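(* (Bousfield–Kan formulas) Let $\mathscr D$ be a derivator and let $A$ be a small category. There is a simplicial resolution morphism (a morphism of derivators) $$s\colon\mathscr D^A\to\mathscr D^{\Delta^{\mathrm{op}}}$$ such that for every $X\in\mathscr D^A$ (i) there is a canonical isomorphism $\operatorname{colim}_{\Delta^{\mathrm{op}}}sX\xrightarrow{\sim}\operatorname{colim}_A X$, and (ii) for every $[n]\in\Delta^{\mathrm{op}}$ there are canonical isomorphisms $$(sX)_n\xrightarrow{\sim}\coprod_{(a_0\to\cdots\to a_n)\in (NA)_n}X_{a_0}.$$
   Context: Derivators. $\mathrm{Cat}$ is the 2-category of small categories, $\mathrm{CAT}$ that of not necessarily small categories, $\mathbb 1$ the terminal category. A prederivator is a strict 2-functor $\mathscr D\colon\mathrm{Cat}^{\mathrm{op}}\to\mathrm{CAT}$ (1-cells reversed); write $u^*=\mathscr D(u)$. It is a derivator if: (Der1) $\mathscr D(\coprod_i A_i)\to\prod_i\mathscr D(A_i)$ is an equivalence; (Der2) a morphism $f$ of $\mathscr D(A)$ is invertible iff $f_a:=a^*f$ is invertible for all objects $a\colon\mathbb 1\to A$; (Der3) every $u^*$ has a left adjoint $u_!$ and a right adjoint $u_*$; (Der4) for $u\colon A\to B$ and $b\in B$ the canonical maps $\operatorname{colim}_{(u/b)}p^*X\to (u_!X)_b$ and $(u_*X)_b\to\lim_{(b/u)}q^*X$ are isomorphisms, where $p\colon(u/b)\to A$, $q\colon (b/u)\to A$ are the projections and $\operatorname{colim}_A=\pi_!$, $\lim_A=\pi_*$ for $\pi\colon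 A\to\mathbb 1$. Morphisms of derivators are pseudo-natural transformations; natural transformations between them are modifications. For $A\in\mathrm{Cat}$, $\mathscr D^A$ is the derivator $B\mapsto\mathscr D(A\times B)$; a functor $u\colon A\to B$ induces morphisms of derivators $u^*\colon\mathscr D^B\to\mathscr D^A$ and $u_!,u_*\colon\mathscr D^A\to\mathscr D^B$. "$X\in\mathscr D^A$" means $X\in\mathscr D^A(B)$ for some $B\in\mathrm{Cat}$ (objects with parameters), and $X_a=a^*X$. $\Delta$ is the simplex category of finite ordinals $[n]=(0<1<\cdots<n)$, $n\ge 0$, and $(NA)_n$ is the set of $n$-simplices of the nerve of $A$, i.e. strings $a_0\to\cdots\to a_n$ of composable morphisms in $A$. For $Y\in\mathscr D^{\Delta^{\mathrm{op}}}$, $Y_n$ is the value at $[n]$. *)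

theory Defs
  imports "HOL-Library.FuncSet"
begin

unbundle cardinal_syntax

section \<open>Categories, functors, natural transformations\<close>

text \<open>
  Strictness of a prederivator refers to equality of functors and of natural transformations.
  All structure maps are therefore required to be \<open>undefined\<close> outside their carriers,
  so that equality of records is equality of the mathematical objects.
  \<open>Comp C g f\<close> is the composite of \<open>f\<close> followed by \<open>g\<close>.
\<close>

record ('o, 'm) cat =
  Obj :: "'o set"
  Arr :: "'m set"
  Dom :: "'m \<Rightarrow> 'o"
  Cod :: "'m \<Rightarrow> 'o"
  Ident :: "'o \<Rightarrow> 'm"
  Comp :: "'m \<Rightarrow> 'm \<Rightarrow> 'm"

definition mk_cat ::
  "'o set \<Rightarrow> 'm set \<Rightarrow> ('m \<Rightarrow> 'o) \<Rightarrow> ('m \<Rightarrow> 'o) \<Rightarrow> ('o \<Rightarrow> 'm) \<Rightarrow> ('m \<Rightarrow> 'm \<Rightarrow> 'm) \<Rightarrow> ('o, 'm) cat" where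
  "mk_cat X M d c i k = \<lparr>Obj = X, Arr = M, Dom = restrict d M, Cod = restrict c M, Ident = restrict i X,
     Comp = (\<lambda>g f. if f \<in> M \<and> g \<in> M \<and> c f = d g then k g f else undefined)\<rparr>"

definition Hom :: "('o, 'm) cat \<Rightarrow> 'o \<Rightarrow> 'o \<Rightarrow> 'm set" where
  "Hom C x y = {f \<in> Arr C. Dom C f = x \<and> Cod C f = y}"

definition composable :: "('o, 'm) cat \<Rightarrow> 'm \<Rightarrow> 'm \<Rightarrow> bool" where
  "composable C g f \<longleftrightarrow> f \<in> Arr C \<and> g \<in> Arr C \<and> Cod C f = Dom C g"

definition is_category :: "('o, 'm) cat \<Rightarrow> bool" where
  "is_category C \<longleftrightarrow>
     Dom C \<in> Arr C \<rightarrow>\<^sub>E Obj C \<and> Cod C \<in> Arr C \<rightarrow>\<^sub>E Obj C \<and> Ident C \<in> Obj C \<rightarrow>\<^sub>E Arr C \<and>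
     (\<forall>x\<in>Obj C. Ident C x \<in> Hom C x x) \<and>
     (\<forall>g f. composable C g f \<longrightarrow> Comp C g f \<in> Hom C (Dom C f) (Cod C g)) \<and>
     (\<forall>g f. \<not> composable C g f \<longrightarrow> Comp C g f = undefined) \<and>
     (\<forall>f\<in>Arr C. Comp C f (Ident C (Dom C f)) = f \<and> Comp C (Ident C (Cod C f)) f = f) \<and>
     (\<forall>h g f. composable C g f \<and> composable C h g \<longrightarrow>
        Comp C h (Comp C g f) = Comp C (Comp C h g) f)"

definition is_iso :: "('o, 'm) cat \<Rightarrow> 'm \<Rightarrow> bool" where
  "is_iso C f \<longleftrightarrow> f \<in> Arr C \<and>
     (\<exists>g \<in> Hom C (Cod C f) (Dom C f).
        Comp C g f = Ident C (Dom C f) \<and> Comp C f g = Ident C (Cod C f))"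

definition is_coproduct ::
  "('o, 'm) cat \<Rightarrow> 'i set \<Rightarrow> ('i \<Rightarrow> 'o) \<Rightarrow> 'o \<Rightarrow> ('i \<Rightarrow> 'm) \<Rightarrow> bool" where
  "is_coproduct C I X P j \<longleftrightarrow>
     (\<forall>i\<in>I. X i \<in> Obj C) \<and> P \<in> Obj C \<and> (\<forall>i\<in>I. j i \<in> Hom C (X i) P) \<and>
     (\<forall>Y\<in>Obj C. \<forall>t. (\<forall>i\<in>I. t i \<in> Hom C (X i) Y) \<longrightarrow>
        (\<exists>!h. h \<in> Hom C P Y \<and> (\<forall>i\<in>I. Comp C h (j i) = t i)))"

record ('o, 'm, 'p, 'n) func =
  Src :: "('o, 'm) cat"
  Tgt :: "('p, 'n) cat"
  FO :: "'o \<Rightarrow> 'p"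
  FA :: "'m \<Rightarrow> 'n"

definition mk_func ::
  "('o, 'm) cat \<Rightarrow> ('p, 'n) cat \<Rightarrow> ('o \<Rightarrow> 'p) \<Rightarrow> ('m \<Rightarrow> 'n) \<Rightarrow> ('o, 'm, 'p, 'n) func" where
  "mk_func C D a b = \<lparr>Src = C, Tgt = D, FO = restrict a (Obj C), FA = restrict b (Arr C)\<rparr>"

definition is_functor :: "('o, 'm, 'p, 'n) func \<Rightarrow> bool" where
  "is_functor F \<longleftrightarrow> is_category (Src F) \<and> is_category (Tgt F) \<and>
     FO F \<in> Obj (Src F) \<rightarrow>\<^sub>E Obj (Tgt F) \<and> FA F \<in> Arr (Src F) \<rightarrow>\<^sub>E Arr (Tgt F) \<and>
     (\<forall>f\<in>Arr (Src F). FA F f \<in> Hom (Tgt F) (FO F (Dom (Src F) f)) (FO F (Cod (Src F) f))) \<and>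
     (\<forall>x\<in>Obj (Src F). FA F (Ident (Src F) x) = Ident (Tgt F) (FO F x)) \<and>
     (\<forall>g f. composable (Src F) g f \<longrightarrow>
        FA F (Comp (Src F) g f) = Comp (Tgt F) (FA F g) (FA F f))"

definition functor_from_to ::
  "('o, 'm) cat \<Rightarrow> ('p, 'n) cat \<Rightarrow> ('o, 'm, 'p, 'n) func \<Rightarrow> bool" where
  "functor_from_to C D F \<longleftrightarrow> is_functor F \<and> Src F = C \<and> Tgt F = D"

definition id_func :: "('o, 'm) cat \<Rightarrow> ('o, 'm, 'o, 'm) func" where
  "id_func C = mk_func C C (\<lambda>x. x) (\<lambda>f. f)"

definition comp_func ::
  "('p, 'n, 'q, 'k) func \<Rightarrow> ('o, 'm, 'p, 'n) func \<Rightarrow> ('o, 'm, 'q, 'k) func" (infixr "\<circ>\<^sub>F" 70) where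
  "G \<circ>\<^sub>F F = mk_func (Src F) (Tgt G) (\<lambda>x. FO G (FO F x)) (\<lambda>f. FA G (FA F f))"

record ('o, 'm, 'p, 'n) ntrans =
  NSrc :: "('o, 'm, 'p, 'n) func"
  NTgt :: "('o, 'm, 'p, 'n) func"
  At :: "'o \<Rightarrow> 'n"

definition mk_nt ::
  "('o, 'm, 'p, 'n) func \<Rightarrow> ('o, 'm, 'p, 'n) func \<Rightarrow> ('o \<Rightarrow> 'n) \<Rightarrow> ('o, 'm, 'p, 'n) ntrans" where
  "mk_nt F G t = \<lparr>NSrc = F, NTgt = G, At = restrict t (Obj (Src F))\<rparr>"

definition is_ntrans :: "('o, 'm, 'p, 'n) ntrans \<Rightarrow> bool" where
  "is_ntrans \<tau> \<longleftrightarrow>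
     (let F = NSrc \<tau>; G = NTgt \<tau>; C = Src F; D = Tgt F in
        is_functor F \<and> is_functor G \<and> Src G = C \<and> Tgt G = D \<and>
        At \<tau> \<in> Obj C \<rightarrow>\<^sub>E Arr D \<and>
        (\<forall>x\<in>Obj C. At \<tau> x \<in> Hom D (FO F x) (FO G x)) \<and>
        (\<forall>f\<in>Arr C. Comp D (At \<tau> (Cod C f)) (FA F f) = Comp D (FA G f) (At \<tau> (Dom C f))))"

definition ntrans_from_to ::
  "('o, 'm, 'p, 'n) func \<Rightarrow> ('o, 'm, 'p, 'n) func \<Rightarrow> ('o, 'm, 'p, 'n) ntrans \<Rightarrow> bool" where
  "ntrans_from_to F G \<tau> \<longleftrightarrow> is_ntrans \<tau> \<and> NSrc \<tau> = F \<and> NTgt \<tau> = G"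

definition nat_iso_from_to ::
  "('o, 'm, 'p, 'n) func \<Rightarrow> ('o, 'm, 'p, 'n) func \<Rightarrow> ('o, 'm, 'p, 'n) ntrans \<Rightarrow> bool" where
  "nat_iso_from_to F G \<tau> \<longleftrightarrow>
     ntrans_from_to F G \<tau> \<and> (\<forall>x\<in>Obj (Src F). is_iso (Tgt F) (At \<tau> x))"

definition id_nt :: "('o, 'm, 'p, 'n) func \<Rightarrow> ('o, 'm, 'p, 'n) ntrans" where
  "id_nt F = mk_nt F F (\<lambda>x. Ident (Tgt F) (FO F x))"

definition vcomp ::
  "('o, 'm, 'p, 'n) ntrans \<Rightarrow> ('o, 'm, 'p, 'n) ntrans \<Rightarrow> ('o, 'm, 'p, 'n) ntrans" where
  "vcomp \<tau> \<sigma> = mk_nt (NSrc \<sigma>) (NTgt \<tau>) (\<lambda>x. Comp (Tgt (NSrc \<sigma>)) (At \<tau> x) (At \<sigma> x))"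

definition hcomp ::
  "('p, 'n, 'q, 'k) ntrans \<Rightarrow> ('o, 'm, 'p, 'n) ntrans \<Rightarrow> ('o, 'm, 'q, 'k) ntrans" where
  "hcomp \<tau> \<sigma> = mk_nt (NSrc \<tau> \<circ>\<^sub>F NSrc \<sigma>) (NTgt \<tau> \<circ>\<^sub>F NTgt \<sigma>)
     (\<lambda>x. Comp (Tgt (NSrc \<tau>)) (At \<tau> (FO (NTgt \<sigma>) x)) (FA (NSrc \<tau>) (At \<sigma> x)))"

definition is_equivalence :: "('o, 'm, 'p, 'n) func \<Rightarrow> bool" where
  "is_equivalence F \<longleftrightarrow> is_functor F \<and>
     (\<exists>G \<eta> \<epsilon>. functor_from_to (Tgt F) (Src F) G \<and>
        nat_iso_from_to (id_func (Src F)) (G \<circ>\<^sub>F F) \<eta> \<and>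
        nat_iso_from_to (F \<circ>\<^sub>F G) (id_func (Tgt F)) \<epsilon>)"

text \<open>\<open>L\<close> is left adjoint to \<open>R\<close>, with unit \<open>\<eta>\<close> and counit \<open>\<epsilon>\<close>.\<close>

definition is_adjunction ::
  "('o, 'm, 'p, 'n) func \<Rightarrow> ('p, 'n, 'o, 'm) func \<Rightarrow>
   ('o, 'm, 'o, 'm) ntrans \<Rightarrow> ('p, 'n, 'p, 'n) ntrans \<Rightarrow> bool" where
  "is_adjunction L R \<eta> \<epsilon> \<longleftrightarrow>
     is_functor L \<and> functor_from_to (Tgt L) (Src L) R \<and>
     ntrans_from_to (id_func (Src L)) (R \<circ>\<^sub>F L) \<eta> \<and>
     ntrans_from_to (L \<circ>\<^sub>F R) (id_func (Tgt L)) \<epsilon> \<and>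
     (\<forall>x\<in>Obj (Src L). Comp (Tgt L) (At \<epsilon> (FO L x)) (FA L (At \<eta> x)) = Ident (Tgt L) (FO L x)) \<and>
     (\<forall>y\<in>Obj (Tgt L). Comp (Src L) (FA R (At \<epsilon> y)) (At \<eta> (FO R y)) = Ident (Src L) (FO R y))"

definition prod_cat_family :: "'i set \<Rightarrow> ('i \<Rightarrow> ('o, 'm) cat) \<Rightarrow> ('i \<Rightarrow> 'o, 'i \<Rightarrow> 'm) cat" where
  "prod_cat_family I C = mk_cat (\<Pi>\<^sub>E i\<in>I. Obj (C i)) (\<Pi>\<^sub>E i\<in>I. Arr (C i))
     (\<lambda>f. \<lambda>i\<in>I. Dom (C i) (f i)) (\<lambda>f. \<lambda>i\<in>I. Cod (C i) (f i))
     (\<lambda>x. \<lambda>i\<in>I. Ident (C i) (x i)) (\<lambda>g f. \<lambda>i\<in>I. Comp (C i) (g i) (f i))"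


section \<open>The 2-category of small categories\<close>

text \<open>
  A prederivator must accept all small categories as arguments of a single type, so these are
  taken with objects and arrows in one type \<open>'a univ\<close>, equipped with pairing and with codes for
  finite strings of numbers. \<open>Small\<close> means of cardinality less than a fixed uncountable regular
  cardinal \<open>\<kappa>\<close>; when \<open>\<kappa>\<close> is inaccessible, this is smallness relative to a Grothendieck universe.
  Since the field of \<open>\<kappa>\<close> lies in \<open>'a univ\<close>, every category of size less than \<open>\<kappa>\<close>
  has an isomorphic copy among those considered here.
\<close>

datatype 'a univ = Atom 'a | Nats (nats: "nat list") | Pair (pfst: "'a univ") (psnd: "'a univ")

type_synonym 'a scat = "('a univ, 'a univ) cat"
type_synonym 'a sfunc = "('a univ, 'a univ, 'a univ, 'a univ) func"
type_synonym 'a sntrans = "('a univ, 'a univ, 'a univ, 'a univ) ntrans"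

definition size_bound :: "'a univ rel \<Rightarrow> bool" where
  "size_bound \<kappa> \<longleftrightarrow> Card_order \<kappa> \<and> regularCard \<kappa> \<and> natLeq <o \<kappa>"

definition small_category :: "'a univ rel \<Rightarrow> 'a scat \<Rightarrow> bool" where
  "small_category \<kappa> A \<longleftrightarrow> is_category A \<and> |Obj A| <o \<kappa> \<and> |Arr A| <o \<kappa>"

definition small_functor :: "'a univ rel \<Rightarrow> 'a sfunc \<Rightarrow> bool" where
  "small_functor \<kappa> u \<longleftrightarrow> is_functor u \<and> small_category \<kappa> (Src u) \<and> small_category \<kappa> (Tgt u)"

definition small_ntrans :: "'a univ rel \<Rightarrow> 'a sntrans \<Rightarrow> bool" where
  "small_ntrans \<kappa> \<alpha> \<longleftrightarrow> is_ntrans \<alpha> \<and> small_functor \<kappa> (NSrc \<alpha>) \<and> small_functor \<kappa> (NTgt \<alpha>)"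

definition op_cat :: "('o, 'm) cat \<Rightarrow> ('o, 'm) cat" where
  "op_cat C = \<lparr>Obj = Obj C, Arr = Arr C, Dom = Cod C, Cod = Dom C, Ident = Ident C,
     Comp = (\<lambda>g f. Comp C f g)\<rparr>"

definition one_cat :: "'a scat" where
  "one_cat = mk_cat {Nats []} {Nats []} (\<lambda>_. Nats []) (\<lambda>_. Nats []) (\<lambda>_. Nats []) (\<lambda>_ _. Nats [])"

definition to_one :: "'a scat \<Rightarrow> 'a sfunc" where
  "to_one A = mk_func A one_cat (\<lambda>_. Nats []) (\<lambda>_. Nats [])"

definition point :: "'a scat \<Rightarrow> 'a univ \<Rightarrow> 'a sfunc" where
  "point A a = mk_func one_cat A (\<lambda>_. a) (\<lambda>_. Ident A a)"

definition prod_cat :: "'a scat \<Rightarrow> 'a scat \<Rightarrow> 'a scat" where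
  "prod_cat A B = mk_cat {Pair a b | a b. a \<in> Obj A \<and> b \<in> Obj B} {Pair f g | f g. f \<in> Arr A \<and> g \<in> Arr B}
     (\<lambda>f. Pair (Dom A (pfst f)) (Dom B (psnd f))) (\<lambda>f. Pair (Cod A (pfst f)) (Cod B (psnd f)))
     (\<lambda>x. Pair (Ident A (pfst x)) (Ident B (psnd x)))
     (\<lambda>g f. Pair (Comp A (pfst g) (pfst f)) (Comp B (psnd g) (psnd f)))"

definition prod_func :: "'a sfunc \<Rightarrow> 'a sfunc \<Rightarrow> 'a sfunc" where
  "prod_func u w = mk_func (prod_cat (Src u) (Src w)) (prod_cat (Tgt u) (Tgt w))
     (\<lambda>x. Pair (FO u (pfst x)) (FO w (psnd x))) (\<lambda>f. Pair (FA u (pfst f)) (FA w (psnd f)))"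

definition prod_nt :: "'a sntrans \<Rightarrow> 'a sntrans \<Rightarrow> 'a sntrans" where
  "prod_nt \<alpha> \<beta> = mk_nt (prod_func (NSrc \<alpha>) (NSrc \<beta>)) (prod_func (NTgt \<alpha>) (NTgt \<beta>))
     (\<lambda>x. Pair (At \<alpha> (pfst x)) (At \<beta> (psnd x)))"

definition coprod_cat :: "'a univ set \<Rightarrow> ('a univ \<Rightarrow> 'a scat) \<Rightarrow> 'a scat" where
  "coprod_cat I A = mk_cat {Pair i x | i x. i \<in> I \<and> x \<in> Obj (A i)} {Pair i f | i f. i \<in> I \<and> f \<in> Arr (A i)}
     (\<lambda>f. Pair (pfst f) (Dom (A (pfst f)) (psnd f))) (\<lambda>f. Pair (pfst f) (Cod (A (pfst f)) (psnd f)))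
     (\<lambda>x. Pair (pfst x) (Ident (A (pfst x)) (psnd x)))
     (\<lambda>g f. Pair (pfst f) (Comp (A (pfst f)) (psnd g) (psnd f)))"

definition coprod_incl :: "'a univ set \<Rightarrow> ('a univ \<Rightarrow> 'a scat) \<Rightarrow> 'a univ \<Rightarrow> 'a sfunc" where
  "coprod_incl I A i = mk_func (A i) (coprod_cat I A) (\<lambda>x. Pair i x) (\<lambda>f. Pair i f)"

text \<open>
  The comma categories \<open>(u/b)\<close> and \<open>(b/u)\<close>: an object is \<open>Pair a f\<close> with \<open>f\<close> an arrow
  \<open>u a \<rightarrow> b\<close>, respectively \<open>b \<rightarrow> u a\<close>; an arrow is \<open>Pair (Pair x y) h\<close> where \<open>x\<close> and \<open>y\<close> are its
  domain and codomain and \<open>h\<close> is the underlying arrow of the source of \<open>u\<close>.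
\<close>

definition over_objs :: "'a sfunc \<Rightarrow> 'a univ \<Rightarrow> 'a univ set" where
  "over_objs u b = {Pair a f | a f. a \<in> Obj (Src u) \<and> f \<in> Hom (Tgt u) (FO u a) b}"

definition under_objs :: "'a univ \<Rightarrow> 'a sfunc \<Rightarrow> 'a univ set" where
  "under_objs b u = {Pair a f | a f. a \<in> Obj (Src u) \<and> f \<in> Hom (Tgt u) b (FO u a)}"

definition over_cat :: "'a sfunc \<Rightarrow> 'a univ \<Rightarrow> 'a scat" where
  "over_cat u b = mk_cat (over_objs u b)
     {Pair (Pair x y) h | x y h. x \<in> over_objs u b \<and> y \<in> over_objs u b \<and>
        h \<in> Hom (Src u) (pfst x) (pfst y) \<and> Comp (Tgt u) (psnd y) (FA u h) = psnd x}
     (\<lambda>k. pfst (pfst k)) (\<lambda>k. psnd (pfst k)) (\<lambda>x. Pair (Pair x x) (Ident (Src u) (pfst x)))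
     (\<lambda>l k. Pair (Pair (pfst (pfst k)) (psnd (pfst l))) (Comp (Src u) (psnd l) (psnd k)))"

definition under_cat :: "'a univ \<Rightarrow> 'a sfunc \<Rightarrow> 'a scat" where
  "under_cat b u = mk_cat (under_objs b u)
     {Pair (Pair x y) h | x y h. x \<in> under_objs b u \<and> y \<in> under_objs b u \<and>
        h \<in> Hom (Src u) (pfst x) (pfst y) \<and> Comp (Tgt u) (FA u h) (psnd x) = psnd y}
     (\<lambda>k. pfst (pfst k)) (\<lambda>k. psnd (pfst k)) (\<lambda>x. Pair (Pair x x) (Ident (Src u) (pfst x)))
     (\<lambda>l k. Pair (Pair (pfst (pfst k)) (psnd (pfst l))) (Comp (Src u) (psnd l) (psnd k)))"

definition over_proj :: "'a sfunc \<Rightarrow> 'a univ \<Rightarrow> 'a sfunc" where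
  "over_proj u b = mk_func (over_cat u b) (Src u) pfst psnd"

definition under_proj :: "'a univ \<Rightarrow> 'a sfunc \<Rightarrow> 'a sfunc" where
  "under_proj b u = mk_func (under_cat b u) (Src u) pfst psnd"

definition over_cell :: "'a sfunc \<Rightarrow> 'a univ \<Rightarrow> 'a sntrans" where
  "over_cell u b =
     mk_nt (u \<circ>\<^sub>F over_proj u b) (point (Tgt u) b \<circ>\<^sub>F to_one (over_cat u b)) psnd"

definition under_cell :: "'a univ \<Rightarrow> 'a sfunc \<Rightarrow> 'a sntrans" where
  "under_cell b u =
     mk_nt (point (Tgt u) b \<circ>\<^sub>F to_one (under_cat b u)) (u \<circ>\<^sub>F under_proj b u) psnd"

text \<open>
  The simplex category: \<open>[n]\<close> is \<open>Nats [n]\<close>, and a monotone map \<open>\<phi> : [m] \<rightarrow> [n]\<close> is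
  \<open>Nats [n, \<phi> 0, ..., \<phi> m]\<close>.
\<close>

definition simplex_cat :: "'a scat" where
  "simplex_cat = mk_cat {Nats [n] | n. True}
     {Nats (n # vs) | n vs. vs \<noteq> [] \<and> sorted vs \<and> set vs \<subseteq> {..n}}
     (\<lambda>f. Nats [length (tl (nats f)) - 1])
     (\<lambda>f. Nats [hd (nats f)])
     (\<lambda>x. Nats (hd (nats x) # [0..<Suc (hd (nats x))]))
     (\<lambda>g f. Nats (hd (nats g) # map (\<lambda>i. tl (nats g) ! i) (tl (nats f))))"

abbreviation simplex_op :: "'a scat" where
  "simplex_op \<equiv> op_cat simplex_cat"

text \<open>An \<open>n\<close>-simplex \<open>a\<^sub>0 \<rightarrow> ... \<rightarrow> a\<^sub>n\<close> of the nerve is \<open>a\<^sub>0\<close> together with the list of its \<open>n\<close> arrows.\<close>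

fun is_string :: "('o, 'm) cat \<Rightarrow> 'o \<Rightarrow> 'm list \<Rightarrow> bool" where
  "is_string A a [] \<longleftrightarrow> a \<in> Obj A"
| "is_string A a (f # fs) \<longleftrightarrow> f \<in> Arr A \<and> Dom A f = a \<and> is_string A (Cod A f) fs"

definition nerve :: "('o, 'm) cat \<Rightarrow> nat \<Rightarrow> ('o \<times> 'm list) set" where
  "nerve A n = {(a, fs). length fs = n \<and> is_string A a fs}"


section \<open>Prederivators and derivators\<close>

text \<open>\<open>D1 D u\<close> is \<open>u\<^sup>*\<close>, from the value of \<open>D\<close> at the target of \<open>u\<close> to the value at its source.\<close>

record ('a, 'o, 'm) prederiv =
  D0 :: "'a scat \<Rightarrow> ('o, 'm) cat"
  D1 :: "'a sfunc \<Rightarrow> ('o, 'm, 'o, 'm) func"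
  D2 :: "'a sntrans \<Rightarrow> ('o, 'm, 'o, 'm) ntrans"

definition prederivator :: "'a univ rel \<Rightarrow> ('a, 'o, 'm) prederiv \<Rightarrow> bool" where
  "prederivator \<kappa> D \<longleftrightarrow>
     (\<forall>A. small_category \<kappa> A \<longrightarrow> is_category (D0 D A)) \<and>
     (\<forall>u. small_functor \<kappa> u \<longrightarrow> functor_from_to (D0 D (Tgt u)) (D0 D (Src u)) (D1 D u)) \<and>
     (\<forall>A. small_category \<kappa> A \<longrightarrow> D1 D (id_func A) = id_func (D0 D A)) \<and>
     (\<forall>u v. small_functor \<kappa> u \<and> small_functor \<kappa> v \<and> Tgt u = Src v \<longrightarrow>
        D1 D (v \<circ>\<^sub>F u) = D1 D u \<circ>\<^sub>F D1 D v) \<and>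
     (\<forall>\<alpha>. small_ntrans \<kappa> \<alpha> \<longrightarrow> ntrans_from_to (D1 D (NSrc \<alpha>)) (D1 D (NTgt \<alpha>)) (D2 D \<alpha>)) \<and>
     (\<forall>u. small_functor \<kappa> u \<longrightarrow> D2 D (id_nt u) = id_nt (D1 D u)) \<and>
     (\<forall>\<alpha> \<beta>. small_ntrans \<kappa> \<alpha> \<and> small_ntrans \<kappa> \<beta> \<and> NTgt \<alpha> = NSrc \<beta> \<longrightarrow>
        D2 D (vcomp \<beta> \<alpha>) = vcomp (D2 D \<beta>) (D2 D \<alpha>)) \<and>
     (\<forall>\<alpha> \<beta>. small_ntrans \<kappa> \<alpha> \<and> small_ntrans \<kappa> \<beta> \<and> Tgt (NSrc \<alpha>) = Src (NSrc \<beta>) \<longrightarrow>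
        D2 D (hcomp \<beta> \<alpha>) = hcomp (D2 D \<alpha>) (D2 D \<beta>))"

definition left_adj ::
  "('a, 'o, 'm) prederiv \<Rightarrow> 'a sfunc \<Rightarrow>
   ('o, 'm, 'o, 'm) func \<times> ('o, 'm, 'o, 'm) ntrans \<times> ('o, 'm, 'o, 'm) ntrans" where
  "left_adj D u = (SOME (L, \<eta>, \<epsilon>). is_adjunction L (D1 D u) \<eta> \<epsilon>)"

definition right_adj ::
  "('a, 'o, 'm) prederiv \<Rightarrow> 'a sfunc \<Rightarrow>
   ('o, 'm, 'o, 'm) func \<times> ('o, 'm, 'o, 'm) ntrans \<times> ('o, 'm, 'o, 'm) ntrans" where
  "right_adj D u = (SOME (R, \<eta>, \<epsilon>). is_adjunction (D1 D u) R \<eta> \<epsilon>)"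

definition lan :: "('a, 'o, 'm) prederiv \<Rightarrow> 'a sfunc \<Rightarrow> ('o, 'm, 'o, 'm) func" where
  "lan D u = fst (left_adj D u)"

definition lan_unit :: "('a, 'o, 'm) prederiv \<Rightarrow> 'a sfunc \<Rightarrow> ('o, 'm, 'o, 'm) ntrans" where
  "lan_unit D u = fst (snd (left_adj D u))"

definition lan_counit :: "('a, 'o, 'm) prederiv \<Rightarrow> 'a sfunc \<Rightarrow> ('o, 'm, 'o, 'm) ntrans" where
  "lan_counit D u = snd (snd (left_adj D u))"

definition ran :: "('a, 'o, 'm) prederiv \<Rightarrow> 'a sfunc \<Rightarrow> ('o, 'm, 'o, 'm) func" where
  "ran D u = fst (right_adj D u)"

definition ran_unit :: "('a, 'o, 'm) prederiv \<Rightarrow> 'a sfunc \<Rightarrow> ('o, 'm, 'o, 'm) ntrans" where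
  "ran_unit D u = fst (snd (right_adj D u))"

definition ran_counit :: "('a, 'o, 'm) prederiv \<Rightarrow> 'a sfunc \<Rightarrow> ('o, 'm, 'o, 'm) ntrans" where
  "ran_counit D u = snd (snd (right_adj D u))"

text \<open>
  Canonical maps (mates), for a square of functors \<open>p : E \<rightarrow> A\<close>, \<open>u : A \<rightarrow> B\<close>, \<open>q : E \<rightarrow> C\<close>, \<open>v : C \<rightarrow> B\<close>.
  Given a 2-cell \<open>\<alpha> : u p \<Rightarrow> v q\<close>, \<open>mate_left\<close> is the component at \<open>X\<close> of \<open>q\<^sub>! p\<^sup>* \<Rightarrow> v\<^sup>* u\<^sub>!\<close>, namely
    \<open>q\<^sub>! p\<^sup>* X \<rightarrow> q\<^sub>! p\<^sup>* u\<^sup>* u\<^sub>! X \<rightarrow> q\<^sub>! q\<^sup>* v\<^sup>* u\<^sub>! X \<rightarrow> v\<^sup>* u\<^sub>! X\<close>.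
  Given a 2-cell \<open>\<alpha> : v q \<Rightarrow> u p\<close>, \<open>mate_right\<close> is the component at \<open>X\<close> of \<open>v\<^sup>* u\<^sub>* \<Rightarrow> q\<^sub>* p\<^sup>*\<close>, namely
    \<open>v\<^sup>* u\<^sub>* X \<rightarrow> q\<^sub>* q\<^sup>* v\<^sup>* u\<^sub>* X \<rightarrow> q\<^sub>* p\<^sup>* u\<^sup>* u\<^sub>* X \<rightarrow> q\<^sub>* p\<^sup>* X\<close>.
\<close>

definition mate_left ::
  "('a, 'o, 'm) prederiv \<Rightarrow> 'a sfunc \<Rightarrow> 'a sfunc \<Rightarrow> 'a sfunc \<Rightarrow> 'a sfunc \<Rightarrow> 'a sntrans \<Rightarrow> 'o \<Rightarrow> 'm" where
  "mate_left D p u q v \<alpha> X =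
     (let Y = FO (lan D u) X; E = D0 D (Src q); C = D0 D (Tgt q) in
        Comp C (At (lan_counit D q) (FO (D1 D v) Y))
          (FA (lan D q) (Comp E (At (D2 D \<alpha>) Y) (FA (D1 D p) (At (lan_unit D u) X)))))"

definition mate_right ::
  "('a, 'o, 'm) prederiv \<Rightarrow> 'a sfunc \<Rightarrow> 'a sfunc \<Rightarrow> 'a sfunc \<Rightarrow> 'a sfunc \<Rightarrow> 'a sntrans \<Rightarrow> 'o \<Rightarrow> 'm" where
  "mate_right D p u q v \<alpha> X =
     (let Y = FO (ran D u) X; E = D0 D (Src q); C = D0 D (Tgt q) in
        Comp C (FA (ran D q) (Comp E (FA (D1 D p) (At (ran_counit D u) X)) (At (D2 D \<alpha>) Y)))
          (At (ran_unit D q) (FO (D1 D v) Y)))"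

definition Der1 :: "'a univ rel \<Rightarrow> ('a, 'o, 'm) prederiv \<Rightarrow> bool" where
  "Der1 \<kappa> D \<longleftrightarrow>
     (\<forall>I A. |I| <o \<kappa> \<and> (\<forall>i\<in>I. small_category \<kappa> (A i)) \<longrightarrow>
        is_equivalence (mk_func (D0 D (coprod_cat I A)) (prod_cat_family I (\<lambda>i. D0 D (A i)))
          (\<lambda>X. \<lambda>i\<in>I. FO (D1 D (coprod_incl I A i)) X)
          (\<lambda>f. \<lambda>i\<in>I. FA (D1 D (coprod_incl I A i)) f)))"

definition Der2 :: "'a univ rel \<Rightarrow> ('a, 'o, 'm) prederiv \<Rightarrow> bool" where
  "Der2 \<kappa> D \<longleftrightarrow>
     (\<forall>A. small_category \<kappa> A \<longrightarrow>
        (\<forall>f\<in>Arr (D0 D A). is_iso (D0 D A) f \<longleftrightarrow>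
           (\<forall>a\<in>Obj A. is_iso (D0 D one_cat) (FA (D1 D (point A a)) f))))"

definition Der3 :: "'a univ rel \<Rightarrow> ('a, 'o, 'm) prederiv \<Rightarrow> bool" where
  "Der3 \<kappa> D \<longleftrightarrow>
     (\<forall>u. small_functor \<kappa> u \<longrightarrow>
        (\<exists>L \<eta> \<epsilon>. is_adjunction L (D1 D u) \<eta> \<epsilon>) \<and> (\<exists>R \<eta> \<epsilon>. is_adjunction (D1 D u) R \<eta> \<epsilon>))"

definition Der4 :: "'a univ rel \<Rightarrow> ('a, 'o, 'm) prederiv \<Rightarrow> bool" where
  "Der4 \<kappa> D \<longleftrightarrow>
     (\<forall>u. small_functor \<kappa> u \<longrightarrow>
        (\<forall>b\<in>Obj (Tgt u). \<forall>X\<in>Obj (D0 D (Src u)).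
           is_iso (D0 D one_cat) (mate_left D (over_proj u b) u (to_one (over_cat u b))
             (point (Tgt u) b) (over_cell u b) X) \<and>
           is_iso (D0 D one_cat) (mate_right D (under_proj b u) u (to_one (under_cat b u))
             (point (Tgt u) b) (under_cell b u) X)))"

definition derivator :: "'a univ rel \<Rightarrow> ('a, 'o, 'm) prederiv \<Rightarrow> bool" where
  "derivator \<kappa> D \<longleftrightarrow> prederivator \<kappa> D \<and> Der1 \<kappa> D \<and> Der2 \<kappa> D \<and> Der3 \<kappa> D \<and> Der4 \<kappa> D"

definition shift :: "('a, 'o, 'm) prederiv \<Rightarrow> 'a scat \<Rightarrow> ('a, 'o, 'm) prederiv" where
  "shift D A = \<lparr>D0 = (\<lambda>B. D0 D (prod_cat A B)),
     D1 = (\<lambda>u. D1 D (prod_func (id_func A) u)),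
     D2 = (\<lambda>\<alpha>. D2 D (prod_nt (id_nt (id_func A)) \<alpha>))\<rparr>"


section \<open>Morphisms of derivators and modifications\<close>

text \<open>
  The structure cell of \<open>F\<close> at \<open>u : A \<rightarrow> B\<close> is taken in the direction \<open>F\<^sub>A u\<^sup>* \<Rightarrow> u\<^sup>* F\<^sub>B\<close>.
\<close>

record ('a, 'o, 'm, 'p, 'n) dmor =
  M0 :: "'a scat \<Rightarrow> ('o, 'm, 'p, 'n) func"
  M1 :: "'a sfunc \<Rightarrow> ('o, 'm, 'p, 'n) ntrans"

definition deriv_morphism ::
  "'a univ rel \<Rightarrow> ('a, 'o, 'm) prederiv \<Rightarrow> ('a, 'p, 'n) prederiv \<Rightarrow> ('a, 'o, 'm, 'p, 'n) dmor \<Rightarrow> bool" where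
  "deriv_morphism \<kappa> D E F \<longleftrightarrow>
     (\<forall>A. small_category \<kappa> A \<longrightarrow> functor_from_to (D0 D A) (D0 E A) (M0 F A)) \<and>
     (\<forall>u. small_functor \<kappa> u \<longrightarrow>
        nat_iso_from_to (M0 F (Src u) \<circ>\<^sub>F D1 D u) (D1 E u \<circ>\<^sub>F M0 F (Tgt u)) (M1 F u)) \<and>
     (\<forall>A. small_category \<kappa> A \<longrightarrow>
        (\<forall>X\<in>Obj (D0 D A). At (M1 F (id_func A)) X = Ident (D0 E A) (FO (M0 F A) X))) \<and>
     (\<forall>u v. small_functor \<kappa> u \<and> small_functor \<kappa> v \<and> Tgt u = Src v \<longrightarrow>
        (\<forall>X\<in>Obj (D0 D (Tgt v)).
           At (M1 F (v \<circ>\<^sub>F u)) X =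
           Comp (D0 E (Src u)) (FA (D1 E u) (At (M1 F v) X)) (At (M1 F u) (FO (D1 D v) X)))) \<and>
     (\<forall>\<alpha> u v. small_ntrans \<kappa> \<alpha> \<and> NSrc \<alpha> = u \<and> NTgt \<alpha> = v \<longrightarrow>
        (\<forall>X\<in>Obj (D0 D (Tgt u)).
           Comp (D0 E (Src u)) (At (D2 E \<alpha>) (FO (M0 F (Tgt u)) X)) (At (M1 F u) X) =
           Comp (D0 E (Src u)) (At (M1 F v) X) (FA (M0 F (Src u)) (At (D2 D \<alpha>) X))))"

definition comp_dmor ::
  "('a, 'p, 'n, 'q, 'k) dmor \<Rightarrow> ('a, 'o, 'm, 'p, 'n) dmor \<Rightarrow> ('a, 'o, 'm, 'q, 'k) dmor" (infixr "\<circ>\<^sub>D" 70) where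
  "G \<circ>\<^sub>D F = \<lparr>M0 = (\<lambda>A. M0 G A \<circ>\<^sub>F M0 F A),
     M1 = (\<lambda>u. vcomp (hcomp (M1 G u) (id_nt (M0 F (Tgt u)))) (hcomp (id_nt (M0 G (Src u))) (M1 F u)))\<rparr>"

definition modification ::
  "'a univ rel \<Rightarrow> ('a, 'o, 'm) prederiv \<Rightarrow> ('a, 'p, 'n) prederiv \<Rightarrow> ('a, 'o, 'm, 'p, 'n) dmor \<Rightarrow>
   ('a, 'o, 'm, 'p, 'n) dmor \<Rightarrow> ('a scat \<Rightarrow> ('o, 'm, 'p, 'n) ntrans) \<Rightarrow> bool" where
  "modification \<kappa> D E F G \<Phi> \<longleftrightarrow>
     deriv_morphism \<kappa> D E F \<and> deriv_morphism \<kappa> D E G \<and>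
     (\<forall>A. small_category \<kappa> A \<longrightarrow> ntrans_from_to (M0 F A) (M0 G A) (\<Phi> A)) \<and>
     (\<forall>u. small_functor \<kappa> u \<longrightarrow>
        (\<forall>X\<in>Obj (D0 D (Tgt u)).
           Comp (D0 E (Src u)) (FA (D1 E u) (At (\<Phi> (Tgt u)) X)) (At (M1 F u) X) =
           Comp (D0 E (Src u)) (At (M1 G u) X) (At (\<Phi> (Src u)) (FO (D1 D u) X))))"

definition iso_modification ::
  "'a univ rel \<Rightarrow> ('a, 'o, 'm) prederiv \<Rightarrow> ('a, 'p, 'n) prederiv \<Rightarrow> ('a, 'o, 'm, 'p, 'n) dmor \<Rightarrow>
   ('a, 'o, 'm, 'p, 'n) dmor \<Rightarrow> ('a scat \<Rightarrow> ('o, 'm, 'p, 'n) ntrans) \<Rightarrow> bool" where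
  "iso_modification \<kappa> D E F G \<Phi> \<longleftrightarrow> modification \<kappa> D E F G \<Phi> \<and>
     (\<forall>A. small_category \<kappa> A \<longrightarrow> nat_iso_from_to (M0 F A) (M0 G A) (\<Phi> A))"

text \<open>
  \<open>(P, j)\<close> is a coproduct of the family \<open>F\<close> of morphisms \<open>D \<rightarrow> E\<close>: for every \<open>X\<close> in \<open>D(B)\<close>, \<open>P X\<close> is
  the coproduct of the \<open>F\<^sub>i X\<close> in the category \<open>E(B)\<close>, with coprojections that are natural in \<open>X\<close> and \<open>B\<close>.
\<close>

definition coproduct_morphism ::
  "'a univ rel \<Rightarrow> ('a, 'o, 'm) prederiv \<Rightarrow> ('a, 'p, 'n) prederiv \<Rightarrow> 'i set \<Rightarrow>
   ('i \<Rightarrow> ('a, 'o, 'm, 'p, 'n) dmor) \<Rightarrow> ('a, 'o, 'm, 'p, 'n) dmor \<Rightarrow>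
   ('i \<Rightarrow> 'a scat \<Rightarrow> ('o, 'm, 'p, 'n) ntrans) \<Rightarrow> bool" where
  "coproduct_morphism \<kappa> D E I F P j \<longleftrightarrow>
     deriv_morphism \<kappa> D E P \<and>
     (\<forall>i\<in>I. modification \<kappa> D E (F i) P (j i)) \<and>
     (\<forall>B. small_category \<kappa> B \<longrightarrow>
        (\<forall>X\<in>Obj (D0 D B).
           is_coproduct (D0 E B) I (\<lambda>i. FO (M0 (F i) B) X) (FO (M0 P B) X) (\<lambda>i. At (j i B) X)))"

definition pull_mor :: "('a, 'o, 'm) prederiv \<Rightarrow> 'a sfunc \<Rightarrow> ('a, 'o, 'm, 'o, 'm) dmor" where
  "pull_mor D u = \<lparr>M0 = (\<lambda>B. D1 D (prod_func u (id_func B))),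
     M1 = (\<lambda>w. id_nt (D1 D (prod_func u w)))\<rparr>"

text \<open>
  The morphism \<open>u\<^sub>!\<close> from \<open>D\<^sup>A\<close> to \<open>D\<^sup>B\<close>, for \<open>u : A \<rightarrow> B\<close>: its value at \<open>C\<close> is \<open>(u \<times> C)\<^sub>!\<close>, and its structure
  cells are the mates of the commutative squares \<open>(u \<times> C') (A \<times> w) = (B \<times> w) (u \<times> C)\<close>, for \<open>w : C \<rightarrow> C'\<close>.
\<close>

definition lan_mor :: "('a, 'o, 'm) prederiv \<Rightarrow> 'a sfunc \<Rightarrow> ('a, 'o, 'm, 'o, 'm) dmor" where
  "lan_mor D u = \<lparr>M0 = (\<lambda>C. lan D (prod_func u (id_func C))),
     M1 = (\<lambda>w.
       let p = prod_func (id_func (Src u)) w; v = prod_func (id_func (Tgt u)) w;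
           q = prod_func u (id_func (Src w)); r = prod_func u (id_func (Tgt w))
       in mk_nt (lan D q \<circ>\<^sub>F D1 D p) (D1 D v \<circ>\<^sub>F lan D r)
            (\<lambda>X. mate_left D p r q v (id_nt (prod_func u w)) X))\<rparr>"

text \<open>
  \<open>colim_mor\<close> and \<open>eval_mor\<close> take values in \<open>D\<^sup>1\<close>, the shift of \<open>D\<close> by the terminal category, whose usual identification
  with \<open>D\<close> is not made.
\<close>

definition colim_mor :: "('a, 'o, 'm) prederiv \<Rightarrow> 'a scat \<Rightarrow> ('a, 'o, 'm, 'o, 'm) dmor" where
  "colim_mor D A = lan_mor D (to_one A)"

definition eval_mor :: "('a, 'o, 'm) prederiv \<Rightarrow> 'a scat \<Rightarrow> 'a univ \<Rightarrow> ('a, 'o, 'm, 'o, 'm) dmor" where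
  "eval_mor D A a = pull_mor D (point A a)"

end

theory Submission
  imports Defs "HOL-Library.Nat_Bijection"
begin

text \<open>
  Let \<open>E\<close> be the opposite of the category of simplices of \<open>A\<close>. The projection \<open>p : E \<rightarrow> \<Delta>\<^sup>o\<^sup>p\<close> is a
  discrete opfibration with fibres the sets \<open>(NA)\<^sub>n\<close>, and \<open>\<pi> : E \<rightarrow> A\<close> sends a string to its first
  vertex. Put \<open>s = p\<^sub>! \<pi>\<^sup>*\<close>. Left Kan extension along a discrete opfibration is computed fibrewise, so
  \<open>(sX)\<^sub>n\<close> is a coproduct over \<open>(NA)\<^sub>n\<close> by Der1. For the colimit, \<open>colim sX\<close> is the colimit of
  \<open>\<pi>\<^sup>* X\<close> over \<open>E\<close>, and \<open>\<pi>\<close> is cofinal: each comma category \<open>(a/\<pi>)\<close> is contracted by the zigzag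
  \<open>\<sigma> \<Leftarrow> (a \<rightarrow> \<sigma>) \<Rightarrow> a\<close> given by prepending \<open>a\<close> to a string \<open>\<sigma>\<close>.
\<close>


section \<open>Categories and functors\<close>

text \<open>The adjoints given by Der3 are arbitrary choices, so Kan extensions agree only up to
  isomorphism, and these isomorphisms must respect parameters. Objects are therefore compared
  through universal arrows: two maps out of a Kan extension are equal once they agree after
  composition with the unit. This test yields naturality, coherence of structure cells and
  invertible comparisons. A second obstacle is that Der4 speaks of comma squares. For a strictly
  commuting square the comma categories are compared by a retraction up to 2-cells, which carries
  one colimit cone to the other. Two squares are treated so: change of parameters, which makes Kan
  extension a morphism of derivators, and inclusion of a fibre. Cofinality is proved on the side of
  right adjoints: restriction along \<open>\<pi>\<close> is bijective on maps into objects pulled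
  back from the point, because the unit from such an object into its right Kan extension is
  invertible. Der2 and Der4 reduce this to a limit over a comma category. Since parameters are
  present throughout, the zigzag must be built for \<open>A \<times> C\<close> and must move the
  parameter as well as the string.\<close>

lemma cat_ident_hom: "is_category C \<Longrightarrow> x \<in> Obj C \<Longrightarrow> Ident C x \<in> Hom C x x"
  by (simp add: is_category_def)

lemma cat_comp_hom:
  "is_category C \<Longrightarrow> g \<in> Hom C y z \<Longrightarrow> f \<in> Hom C x y \<Longrightarrow> Comp C g f \<in> Hom C x z"
  by (auto simp: is_category_def composable_def Hom_def)

lemma cat_assoc:
  "is_category C \<Longrightarrow> h \<in> Hom C z w \<Longrightarrow> g \<in> Hom C y z \<Longrightarrow> f \<in> Hom C x y \<Longrightarrow>
   Comp C (Comp C h g) f = Comp C h (Comp C g f)"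
  by (auto simp: is_category_def composable_def Hom_def)

lemma cat_id_left: "is_category C \<Longrightarrow> f \<in> Hom C x y \<Longrightarrow> Comp C (Ident C y) f = f"
  by (auto simp: is_category_def Hom_def)

lemma cat_id_right: "is_category C \<Longrightarrow> f \<in> Hom C x y \<Longrightarrow> Comp C f (Ident C x) = f"
  by (auto simp: is_category_def Hom_def)

lemma hom_obj: "is_category C \<Longrightarrow> f \<in> Hom C x y \<Longrightarrow> x \<in> Obj C \<and> y \<in> Obj C"
  by (auto simp: is_category_def Hom_def)

lemma homD: "f \<in> Hom C x y \<Longrightarrow> f \<in> Arr C \<and> Dom C f = x \<and> Cod C f = y"
  by (simp add: Hom_def)

lemma arr_hom: "f \<in> Arr C \<Longrightarrow> f \<in> Hom C (Dom C f) (Cod C f)"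
  by (simp add: Hom_def)

lemma hom_composable: "g \<in> Hom C y z \<Longrightarrow> f \<in> Hom C x y \<Longrightarrow> composable C g f"
  by (simp add: Hom_def composable_def)

lemma composableE:
  assumes "composable C g f"
  obtains x y z where "f \<in> Hom C x y" "g \<in> Hom C y z"
  using assms by (auto simp: Hom_def composable_def)

lemma is_isoI:
  "f \<in> Hom C x y \<Longrightarrow> g \<in> Hom C y x \<Longrightarrow> Comp C g f = Ident C x \<Longrightarrow> Comp C f g = Ident C y \<Longrightarrow> is_iso C f"
  by (auto simp: is_iso_def Hom_def)

lemma is_isoE:
  assumes "is_iso C f" "f \<in> Hom C x y"
  obtains g where "g \<in> Hom C y x" "Comp C g f = Ident C x" "Comp C f g = Ident C y"
  using assms by (auto simp: is_iso_def Hom_def)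

lemma iso_ident: "is_category C \<Longrightarrow> x \<in> Obj C \<Longrightarrow> is_iso C (Ident C x)"
  by (meson cat_id_left cat_ident_hom is_isoI)

lemma iso_comp:
  assumes C: "is_category C" and g: "g \<in> Hom C y z" and f: "f \<in> Hom C x y"
    and ig: "is_iso C g" and jf: "is_iso C f"
  shows "is_iso C (Comp C g f)"
proof -
  obtain g' where g': "g' \<in> Hom C z y" "Comp C g' g = Ident C y" "Comp C g g' = Ident C z"
    using is_isoE[OF ig g] .
  obtain f' where f': "f' \<in> Hom C y x" "Comp C f' f = Ident C x" "Comp C f f' = Ident C y"
    using is_isoE[OF jf f] .
  have gf: "Comp C g f \<in> Hom C x z" using cat_comp_hom[OF C g f] .
  have fg': "Comp C f' g' \<in> Hom C z x" using cat_comp_hom[OF C f'(1) g'(1)] .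
  have "Comp C (Comp C f' g') (Comp C g f) = Comp C f' (Comp C (Comp C g' g) f)"
    using cat_assoc[OF C f'(1) g'(1) gf] cat_assoc[OF C g'(1) g f] by simp
  also have "\<dots> = Ident C x" using g' f' cat_id_left[OF C f] by simp
  finally have 1: "Comp C (Comp C f' g') (Comp C g f) = Ident C x" .
  have "Comp C (Comp C g f) (Comp C f' g') = Comp C g (Comp C (Comp C f f') g')"
    using cat_assoc[OF C g f fg'] cat_assoc[OF C f f'(1) g'(1)] by simp
  also have "\<dots> = Ident C z" using g' f' cat_id_left[OF C g'(1)] by simp
  finally show ?thesis using 1 gf fg' is_isoI by metis
qed

lemma iso_cancel_left:
  assumes C: "is_category C" and g: "g \<in> Hom C y z" and f: "f \<in> Hom C x y"
    and gf: "is_iso C (Comp C g f)" and ig: "is_iso C g"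
  shows "is_iso C f"
proof -
  obtain g' where g': "g' \<in> Hom C z y" "Comp C g' g = Ident C y" "Comp C g g' = Ident C z"
    using is_isoE[OF ig g] .
  have "is_iso C g'" using is_isoI[OF g'(1) g g'(3,2)] .
  then have "is_iso C (Comp C g' (Comp C g f))"
    by (intro iso_comp[OF C g'(1) cat_comp_hom[OF C g f]] gf)
  then show ?thesis using cat_assoc[OF C g'(1) g f] g'(2) cat_id_left[OF C f] by simp
qed

section \<open>Categories built from raw data\<close>

lemma mk_cat_simps [simp]:
  "Obj (mk_cat X M d c i k) = X" "Arr (mk_cat X M d c i k) = M"
  "f \<in> M \<Longrightarrow> Dom (mk_cat X M d c i k) f = d f" "f \<in> M \<Longrightarrow> Cod (mk_cat X M d c i k) f = c f"
  "x \<in> X \<Longrightarrow> Ident (mk_cat X M d c i k) x = i x"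
  by (auto simp: mk_cat_def)

lemma mk_cat_comp [simp]:
  "f \<in> M \<Longrightarrow> g \<in> M \<Longrightarrow> c f = d g \<Longrightarrow> Comp (mk_cat X M d c i k) g f = k g f"
  by (simp add: mk_cat_def)

lemma mk_cat_hom: "Hom (mk_cat X M d c i k) x y = {f \<in> M. d f = x \<and> c f = y}"
  by (auto simp: Hom_def)

lemma is_category_mk_cat:
  assumes "\<And>f. f \<in> M \<Longrightarrow> d f \<in> X \<and> c f \<in> X"
    and "\<And>x. x \<in> X \<Longrightarrow> i x \<in> M \<and> d (i x) = x \<and> c (i x) = x"
    and "\<And>g f. f \<in> M \<Longrightarrow> g \<in> M \<Longrightarrow> c f = d g \<Longrightarrow> k g f \<in> M \<and> d (k g f) = d f \<and> c (k g f) = c g"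
    and "\<And>f. f \<in> M \<Longrightarrow> k f (i (d f)) = f \<and> k (i (c f)) f = f"
    and "\<And>h g f. f \<in> M \<Longrightarrow> g \<in> M \<Longrightarrow> h \<in> M \<Longrightarrow> c f = d g \<Longrightarrow> c g = d h \<Longrightarrow> k h (k g f) = k (k h g) f"
  shows "is_category (mk_cat X M d c i k)"
  using assms unfolding is_category_def composable_def
  by (auto simp: mk_cat_def Hom_def)

section \<open>Functors and strict equality of functors\<close>

lemma functor_cat: "functor_from_to C D F \<Longrightarrow> is_category C" "functor_from_to C D F \<Longrightarrow> is_category D"
  by (auto simp: functor_from_to_def is_functor_def)

lemma functor_ends: "functor_from_to C D F \<Longrightarrow> Src F = C" "functor_from_to C D F \<Longrightarrow> Tgt F = D"
  by (auto simp: functor_from_to_def)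

lemma fun_obj: "functor_from_to C D F \<Longrightarrow> x \<in> Obj C \<Longrightarrow> FO F x \<in> Obj D"
  by (auto simp: functor_from_to_def is_functor_def)

lemma fun_hom: "functor_from_to C D F \<Longrightarrow> f \<in> Hom C x y \<Longrightarrow> FA F f \<in> Hom D (FO F x) (FO F y)"
  by (auto simp: functor_from_to_def is_functor_def Hom_def)

lemma fun_ident: "functor_from_to C D F \<Longrightarrow> x \<in> Obj C \<Longrightarrow> FA F (Ident C x) = Ident D (FO F x)"
  by (auto simp: functor_from_to_def is_functor_def)

lemma fun_comp:
  "functor_from_to C D F \<Longrightarrow> g \<in> Hom C y z \<Longrightarrow> f \<in> Hom C x y \<Longrightarrow>
   FA F (Comp C g f) = Comp D (FA F g) (FA F f)"
  by (auto simp: functor_from_to_def is_functor_def hom_composable)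

lemma fun_iso:
  assumes F: "functor_from_to C D F" and f: "f \<in> Hom C x y" and i: "is_iso C f"
  shows "is_iso D (FA F f)"
proof -
  obtain g where g: "g \<in> Hom C y x" "Comp C g f = Ident C x" "Comp C f g = Ident C y"
    using is_isoE[OF i f] .
  have o: "x \<in> Obj C" "y \<in> Obj C" using hom_obj[OF functor_cat(1)[OF F] f] by auto
  show ?thesis
    using is_isoI[OF fun_hom[OF F f] fun_hom[OF F g(1)]] fun_comp[OF F g(1) f] fun_comp[OF F f g(1)]
      g fun_ident[OF F] o by simp
qed

text \<open>Functors are \<open>undefined\<close> off their carriers, so agreement on objects and
  arrows is equality of records. The strict identities between composites, to which the
  2-functoriality of a prederivator applies, are obtained this way.\<close>

lemma functor_eqI:
  assumes F: "functor_from_to C D F" and G: "functor_from_to C D G"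
    and o: "\<And>x. x \<in> Obj C \<Longrightarrow> FO F x = FO G x"
    and a: "\<And>f x y. f \<in> Hom C x y \<Longrightarrow> FA F f = FA G f"
  shows "F = G"
proof -
  have "FO F \<in> extensional (Obj C)" "FO G \<in> extensional (Obj C)"
    "FA F \<in> extensional (Arr C)" "FA G \<in> extensional (Arr C)"
    using F G by (auto simp: functor_from_to_def is_functor_def PiE_def)
  then have "FO F = FO G" "FA F = FA G"
    using o a by (auto intro!: extensionalityI dest: arr_hom)
  then show ?thesis using F G by (simp add: functor_from_to_def)
qed

lemma mk_func_simps [simp]:
  "Src (mk_func C D a b) = C" "Tgt (mk_func C D a b) = D"
  "x \<in> Obj C \<Longrightarrow> FO (mk_func C D a b) x = a x"
  "f \<in> Arr C \<Longrightarrow> FA (mk_func C D a b) f = b f"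
  "f \<in> Hom C x y \<Longrightarrow> FA (mk_func C D a b) f = b f"
  by (auto simp: mk_func_def Hom_def)

lemma functor_mk_func:
  assumes "is_category C" "is_category D"
    and "\<And>x. x \<in> Obj C \<Longrightarrow> a x \<in> Obj D"
    and "\<And>f x y. f \<in> Hom C x y \<Longrightarrow> x \<in> Obj C \<Longrightarrow> y \<in> Obj C \<Longrightarrow> b f \<in> Hom D (a x) (a y)"
    and "\<And>x. x \<in> Obj C \<Longrightarrow> b (Ident C x) = Ident D (a x)"
    and "\<And>f g x y z. f \<in> Hom C x y \<Longrightarrow> g \<in> Hom C y z \<Longrightarrow> x \<in> Obj C \<Longrightarrow> y \<in> Obj C \<Longrightarrow> z \<in> Obj C \<Longrightarrow>
      b (Comp C g f) = Comp D (b g) (b f)"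
  shows "functor_from_to C D (mk_func C D a b)"
proof -
  have arr: "b f \<in> Hom D (a (Dom C f)) (a (Cod C f))" if "f \<in> Arr C" for f
    using assms(4)[OF arr_hom[OF that]] hom_obj[OF assms(1) arr_hom[OF that]] by blast
  have oa: "Dom C f \<in> Obj C" "Cod C f \<in> Obj C" if "f \<in> Arr C" for f
    using hom_obj[OF assms(1) arr_hom[OF that]] by auto
  have "Comp C g f \<in> Arr C" "b (Comp C g f) = Comp D (b g) (b f)" if "composable C g f" for g f
    using composableE[OF that] assms(6) cat_comp_hom[OF assms(1)] hom_obj[OF assms(1)] homD by metis+
  moreover have "Ident C x \<in> Arr C" if "x \<in> Obj C" for x
    using cat_ident_hom[OF assms(1) that] homD by fast
  moreover have "b f \<in> Arr D" if "f \<in> Arr C" for f using arr[OF that] homD by fast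
  ultimately show ?thesis
    using assms(1-3,5) arr oa
    by (auto simp: functor_from_to_def is_functor_def mk_func_def composable_def)
qed

lemma functor_id: "is_category C \<Longrightarrow> functor_from_to C C (id_func C)"
  unfolding id_func_def by (rule functor_mk_func) auto

lemma id_func_simps [simp]:
  "Src (id_func C) = C" "Tgt (id_func C) = C" "x \<in> Obj C \<Longrightarrow> FO (id_func C) x = x"
  "f \<in> Hom C x y \<Longrightarrow> FA (id_func C) f = f"
  by (auto simp: id_func_def)

lemma comp_func_simps [simp]:
  "Src (G \<circ>\<^sub>F F) = Src F" "Tgt (G \<circ>\<^sub>F F) = Tgt G"
  by (auto simp: comp_func_def)

lemma comp_func_FO [simp]: "x \<in> Obj (Src F) \<Longrightarrow> FO (G \<circ>\<^sub>F F) x = FO G (FO F x)"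
  by (auto simp: comp_func_def)

lemma comp_func_FA [simp]: "f \<in> Hom (Src F) x y \<Longrightarrow> FA (G \<circ>\<^sub>F F) f = FA G (FA F f)"
  by (auto simp: comp_func_def)

lemma functor_comp:
  assumes F: "functor_from_to C D F" and G: "functor_from_to D E G"
  shows "functor_from_to C E (G \<circ>\<^sub>F F)"
  unfolding comp_func_def functor_ends[OF F] functor_ends[OF G]
  by (rule functor_mk_func)
    (use functor_cat[OF F] functor_cat[OF G] fun_obj[OF F] fun_obj[OF G] fun_hom[OF F] fun_hom[OF G]
      in \<open>auto simp: fun_ident[OF F] fun_ident[OF G] fun_comp[OF F] intro: fun_comp[OF G fun_hom[OF F] fun_hom[OF F]]\<close>)

lemma comp_func_assoc:
  assumes F: "functor_from_to C D F" and G: "functor_from_to D E G" and H: "functor_from_to E B H"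
  shows "(H \<circ>\<^sub>F G) \<circ>\<^sub>F F = H \<circ>\<^sub>F (G \<circ>\<^sub>F F)"
proof (rule functor_eqI[OF functor_comp[OF F functor_comp[OF G H]] functor_comp[OF functor_comp[OF F G] H]])
  fix x assume "x \<in> Obj C"
  then show "FO ((H \<circ>\<^sub>F G) \<circ>\<^sub>F F) x = FO (H \<circ>\<^sub>F (G \<circ>\<^sub>F F)) x"
    using fun_obj[OF F] by (simp add: functor_ends[OF F] functor_ends[OF G])
next
  fix f x y assume f: "f \<in> Hom C x y"
  have "f \<in> Hom (Src F) x y" "FA F f \<in> Hom (Src G) (FO F x) (FO F y)" "f \<in> Hom (Src (G \<circ>\<^sub>F F)) x y"
    using f fun_hom[OF F f] by (simp_all add: functor_ends[OF F] functor_ends[OF G])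
  then show "FA ((H \<circ>\<^sub>F G) \<circ>\<^sub>F F) f = FA (H \<circ>\<^sub>F (G \<circ>\<^sub>F F)) f" by simp
qed

lemma comp_id_left: "functor_from_to C D F \<Longrightarrow> id_func D \<circ>\<^sub>F F = F"
  by (rule functor_eqI[OF functor_comp[OF _ functor_id]])
    (auto simp: functor_ends fun_obj dest: functor_cat intro: id_func_simps(4)[OF fun_hom])

lemma comp_id_right: "functor_from_to C D F \<Longrightarrow> F \<circ>\<^sub>F id_func C = F"
  by (rule functor_eqI[OF functor_comp[OF functor_id]])
    (auto simp: functor_ends dest: functor_cat intro: comp_func_FA[THEN trans])

section \<open>Natural transformations and whiskering\<close>

lemma nt_ends: "ntrans_from_to F G \<tau> \<Longrightarrow> NSrc \<tau> = F" "ntrans_from_to F G \<tau> \<Longrightarrow> NTgt \<tau> = G"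
  by (auto simp: ntrans_from_to_def)

lemma nt_functors:
  assumes "ntrans_from_to F G \<tau>"
  shows "functor_from_to (Src F) (Tgt F) F" "functor_from_to (Src F) (Tgt F) G"
  using assms by (auto simp: ntrans_from_to_def is_ntrans_def functor_from_to_def Let_def)

lemma nt_hom: "ntrans_from_to F G \<tau> \<Longrightarrow> x \<in> Obj (Src F) \<Longrightarrow> At \<tau> x \<in> Hom (Tgt F) (FO F x) (FO G x)"
  by (auto simp: ntrans_from_to_def is_ntrans_def Let_def)

lemma nt_nat:
  "ntrans_from_to F G \<tau> \<Longrightarrow> f \<in> Hom (Src F) x y \<Longrightarrow>
   Comp (Tgt F) (At \<tau> y) (FA F f) = Comp (Tgt F) (FA G f) (At \<tau> x)"
  by (auto simp: ntrans_from_to_def is_ntrans_def Let_def Hom_def)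

lemma mk_nt_simps [simp]:
  "NSrc (mk_nt F G t) = F" "NTgt (mk_nt F G t) = G" "x \<in> Obj (Src F) \<Longrightarrow> At (mk_nt F G t) x = t x"
  by (auto simp: mk_nt_def)

lemma nt_mk:
  assumes F: "functor_from_to C D F" and G: "functor_from_to C D G"
    and t: "\<And>x. x \<in> Obj C \<Longrightarrow> t x \<in> Hom D (FO F x) (FO G x)"
    and n: "\<And>f x y. f \<in> Hom C x y \<Longrightarrow> x \<in> Obj C \<Longrightarrow> y \<in> Obj C \<Longrightarrow>
      Comp D (t y) (FA F f) = Comp D (FA G f) (t x)"
  shows "ntrans_from_to F G (mk_nt F G t)"
proof -
  have "Dom C f \<in> Obj C \<and> Cod C f \<in> Obj C" if "f \<in> Arr C" for f
    using hom_obj[OF functor_cat(1)[OF F] arr_hom[OF that]] .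
  then have "Comp D (t (Cod C f)) (FA F f) = Comp D (FA G f) (t (Dom C f))" if "f \<in> Arr C" for f
    using n[OF arr_hom[OF that]] that by blast
  then show ?thesis
    using F G t homD[OF t] hom_obj[OF functor_cat(1)[OF F] arr_hom]
    by (auto simp: ntrans_from_to_def is_ntrans_def Let_def mk_nt_def functor_from_to_def)
qed

lemma id_nt:
  assumes F: "functor_from_to C D F"
  shows "ntrans_from_to F F (id_nt F)"
  unfolding id_nt_def functor_ends(2)[OF F]
  by (rule nt_mk[OF F F])
    (auto simp: cat_ident_hom functor_cat[OF F] fun_obj[OF F]
      cat_id_left[OF functor_cat(2)[OF F] fun_hom[OF F]] cat_id_right[OF functor_cat(2)[OF F] fun_hom[OF F]])

lemma id_nt_simps [simp]:
  "NSrc (id_nt F) = F" "NTgt (id_nt F) = F" "x \<in> Obj (Src F) \<Longrightarrow> At (id_nt F) x = Ident (Tgt F) (FO F x)"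
  by (auto simp: id_nt_def)

text \<open>Horizontal composition with an identity 2-cell, with the identity factor removed from
  each component. The identification with \<open>hcomp\<close> brings it under the axioms of a
  prederivator.\<close>

definition whisker_left ::
  "('p, 'n, 'q, 'k) func \<Rightarrow> ('o, 'm, 'p, 'n) ntrans \<Rightarrow> ('o, 'm, 'q, 'k) ntrans" where
  "whisker_left w \<alpha> = mk_nt (w \<circ>\<^sub>F NSrc \<alpha>) (w \<circ>\<^sub>F NTgt \<alpha>) (\<lambda>x. FA w (At \<alpha> x))"

definition whisker_right ::
  "('p, 'n, 'q, 'k) ntrans \<Rightarrow> ('o, 'm, 'p, 'n) func \<Rightarrow> ('o, 'm, 'q, 'k) ntrans" where
  "whisker_right \<alpha> t = mk_nt (NSrc \<alpha> \<circ>\<^sub>F t) (NTgt \<alpha> \<circ>\<^sub>F t) (\<lambda>x. At \<alpha> (FO t x))"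

lemma whisker_left_eq:
  assumes w: "functor_from_to D E w" and a: "ntrans_from_to F G \<alpha>" and D: "Tgt F = D"
  shows "whisker_left w \<alpha> = hcomp (id_nt w) \<alpha>"
proof -
  have FG: "functor_from_to (Src F) D F" "functor_from_to (Src F) D G"
    using nt_functors[OF a] D by auto
  have "Comp E (At (id_nt w) (FO G x)) (FA w (At \<alpha> x)) = FA w (At \<alpha> x)" if "x \<in> Obj (Src F)" for x
    using fun_obj[OF FG(2) that] cat_id_left[OF functor_cat(2)[OF w] fun_hom[OF w]] nt_hom[OF a that] D
    by (simp add: functor_ends[OF w])
  then show ?thesis
    unfolding whisker_left_def hcomp_def nt_ends[OF a] mk_nt_def
    by (auto simp: functor_ends[OF w] intro!: restrict_ext)
qed

lemma whisker_right_eq: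
  assumes w: "functor_from_to B C t" and a: "ntrans_from_to F G \<alpha>" and D: "Src F = C"
  shows "whisker_right \<alpha> t = hcomp \<alpha> (id_nt t)"
proof -
  have FG: "functor_from_to C (Tgt F) F" "functor_from_to C (Tgt F) G"
    using nt_functors[OF a] D by auto
  have "Comp (Tgt F) (At \<alpha> (FO t x)) (FA F (At (id_nt t) x)) = At \<alpha> (FO t x)" if "x \<in> Obj B" for x
    using fun_obj[OF w that] that D cat_id_right[OF functor_cat(2)[OF FG(1)] nt_hom[OF a]] fun_ident[OF FG(1)]
    by (simp add: functor_ends[OF w])
  then show ?thesis
    unfolding whisker_right_def hcomp_def nt_ends[OF a] mk_nt_def
    by (auto simp: functor_ends[OF w] intro!: restrict_ext)
qed

lemma whisker_left:
  assumes w: "functor_from_to D E w" and a: "ntrans_from_to F G \<alpha>" and D: "Tgt F = D"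
  shows "ntrans_from_to (w \<circ>\<^sub>F F) (w \<circ>\<^sub>F G) (whisker_left w \<alpha>)"
proof -
  have FG: "functor_from_to (Src F) D F" "functor_from_to (Src F) D G"
    using nt_functors[OF a] D by auto
  show ?thesis
    unfolding whisker_left_def nt_ends[OF a]
  proof (rule nt_mk[OF functor_comp[OF FG(1) w] functor_comp[OF FG(2) w]])
    show "FA w (At \<alpha> x) \<in> Hom E (FO (w \<circ>\<^sub>F F) x) (FO (w \<circ>\<^sub>F G) x)" if "x \<in> Obj (Src F)" for x
      using that fun_hom[OF w] nt_hom[OF a that] functor_ends[OF FG(2)] D by simp
    fix f x y assume f: "f \<in> Hom (Src F) x y" and x: "x \<in> Obj (Src F)" and y: "y \<in> Obj (Src F)"
    then show "Comp E (FA w (At \<alpha> y)) (FA (w \<circ>\<^sub>F F) f) = Comp E (FA (w \<circ>\<^sub>F G) f) (FA w (At \<alpha> x))"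
      using nt_nat[OF a f] fun_comp[OF w nt_hom[OF a y, unfolded D] fun_hom[OF FG(1) f]]
        fun_comp[OF w fun_hom[OF FG(2) f] nt_hom[OF a x, unfolded D]] f functor_ends[OF FG(2)] D
      by simp
  qed
qed

lemma whisker_right:
  assumes w: "functor_from_to B C t" and a: "ntrans_from_to F G \<alpha>" and D: "Src F = C"
  shows "ntrans_from_to (F \<circ>\<^sub>F t) (G \<circ>\<^sub>F t) (whisker_right \<alpha> t)"
proof -
  have FG: "functor_from_to C (Tgt F) F" "functor_from_to C (Tgt F) G"
    using nt_functors[OF a] D by auto
  show ?thesis
    unfolding whisker_right_def nt_ends[OF a]
    by (rule nt_mk[OF functor_comp[OF w FG(1)] functor_comp[OF w FG(2)]])
      (use nt_hom[OF a] nt_nat[OF a] fun_obj[OF w] fun_hom[OF w] D in \<open>auto simp: functor_ends[OF w]\<close>)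
qed

section \<open>Small categories and comma categories\<close>

lemma cat_dom: "is_category C \<Longrightarrow> f \<in> Arr C \<Longrightarrow> Dom C f \<in> Obj C"
  and cat_cod: "is_category C \<Longrightarrow> f \<in> Arr C \<Longrightarrow> Cod C f \<in> Obj C"
  by (auto simp: is_category_def)

lemma cat_ident_arr:
  assumes "is_category C" "x \<in> Obj C"
  shows "Ident C x \<in> Arr C" "Dom C (Ident C x) = x" "Cod C (Ident C x) = x"
  using cat_ident_hom[OF assms] by (auto dest: homD)

lemma cat_comp_arr:
  assumes "is_category C" "f \<in> Arr C" "g \<in> Arr C" "Cod C f = Dom C g"
  shows "Comp C g f \<in> Arr C" "Dom C (Comp C g f) = Dom C f" "Cod C (Comp C g f) = Cod C g"
  using cat_comp_hom[OF assms(1) arr_hom[OF assms(3)], of f "Dom C f"] assms arr_hom[OF assms(2)]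
  by (auto simp: Hom_def)

lemma cat_ids:
  assumes "is_category C" "f \<in> Arr C"
  shows "Comp C f (Ident C (Dom C f)) = f" "Comp C (Ident C (Cod C f)) f = f"
  using assms by (auto simp: is_category_def)

lemma cat_assoc_arr:
  assumes "is_category C" "f \<in> Arr C" "g \<in> Arr C" "h \<in> Arr C" "Cod C f = Dom C g" "Cod C g = Dom C h"
  shows "Comp C (Comp C h g) f = Comp C h (Comp C g f)"
  using assms by (auto simp: is_category_def composable_def)

section \<open>Product categories\<close>

lemma prod_obj [simp]: "Pair a b \<in> Obj (prod_cat A B) \<longleftrightarrow> a \<in> Obj A \<and> b \<in> Obj B"
  by (simp add: prod_cat_def)

lemma prod_objE:
  assumes "x \<in> Obj (prod_cat A B)"
  obtains a b where "x = Pair a b" "a \<in> Obj A" "b \<in> Obj B"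
  using assms by (auto simp: prod_cat_def)

lemma prod_hom [simp]:
  "Pair f g \<in> Hom (prod_cat A B) (Pair a b) (Pair a' b') \<longleftrightarrow> f \<in> Hom A a a' \<and> g \<in> Hom B b b'"
  by (auto simp: prod_cat_def Hom_def)

lemma prod_homE:
  assumes "h \<in> Hom (prod_cat A B) x y"
  obtains f g a a' b b' where "h = Pair f g" "x = Pair a b" "y = Pair a' b'" "f \<in> Hom A a a'" "g \<in> Hom B b b'"
  using assms by (auto simp: prod_cat_def Hom_def)

lemma prod_ident [simp]:
  "a \<in> Obj A \<Longrightarrow> b \<in> Obj B \<Longrightarrow> Ident (prod_cat A B) (Pair a b) = Pair (Ident A a) (Ident B b)"
  by (simp add: prod_cat_def)

lemma prod_comp:
  "g \<in> Hom A y z \<Longrightarrow> f \<in> Hom A x y \<Longrightarrow> g' \<in> Hom B y' z' \<Longrightarrow> f' \<in> Hom B x' y' \<Longrightarrow>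
   Comp (prod_cat A B) (Pair g g') (Pair f f') = Pair (Comp A g f) (Comp B g' f')"
  by (auto simp: prod_cat_def Hom_def)

lemma category_prod:
  assumes A: "is_category A" and B: "is_category B" shows "is_category (prod_cat A B)"
  unfolding prod_cat_def
  using A B by (intro is_category_mk_cat) (auto simp: is_category_def Hom_def composable_def)

lemma prod_func_simps [simp]:
  "Src (prod_func u w) = prod_cat (Src u) (Src w)" "Tgt (prod_func u w) = prod_cat (Tgt u) (Tgt w)"
  "a \<in> Obj (Src u) \<Longrightarrow> b \<in> Obj (Src w) \<Longrightarrow> FO (prod_func u w) (Pair a b) = Pair (FO u a) (FO w b)"
  "f \<in> Hom (Src u) a a' \<Longrightarrow> g \<in> Hom (Src w) b b' \<Longrightarrow> FA (prod_func u w) (Pair f g) = Pair (FA u f) (FA w g)"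
proof -
  assume "f \<in> Hom (Src u) a a'" "g \<in> Hom (Src w) b b'"
  then have "Pair f g \<in> Hom (prod_cat (Src u) (Src w)) (Pair a b) (Pair a' b')" by simp
  then show "FA (prod_func u w) (Pair f g) = Pair (FA u f) (FA w g)"
    unfolding prod_func_def by (subst mk_func_simps(5)[where x = "Pair a b" and y = "Pair a' b'"]) auto
qed (auto simp: prod_func_def)

lemma functor_prod:
  assumes u: "functor_from_to A B u" and w: "functor_from_to C D w"
  shows "functor_from_to (prod_cat A C) (prod_cat B D) (prod_func u w)"
  unfolding prod_func_def functor_ends[OF u] functor_ends[OF w]
proof (rule functor_mk_func)
  show "is_category (prod_cat A C)" "is_category (prod_cat B D)"
    using category_prod functor_cat[OF u] functor_cat[OF w] by auto
next
  fix x assume "x \<in> Obj (prod_cat A C)"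
  then show "Pair (FO u (pfst x)) (FO w (psnd x)) \<in> Obj (prod_cat B D)"
    by (auto elim!: prod_objE simp: fun_obj[OF u] fun_obj[OF w])
next
  fix f x y assume "f \<in> Hom (prod_cat A C) x y"
  then show "Pair (FA u (pfst f)) (FA w (psnd f)) \<in> Hom (prod_cat B D) (Pair (FO u (pfst x)) (FO w (psnd x)))
     (Pair (FO u (pfst y)) (FO w (psnd y)))"
    by (auto elim!: prod_homE simp: fun_hom[OF u] fun_hom[OF w])
next
  fix x assume "x \<in> Obj (prod_cat A C)"
  then show "Pair (FA u (pfst (Ident (prod_cat A C) x))) (FA w (psnd (Ident (prod_cat A C) x))) =
    Ident (prod_cat B D) (Pair (FO u (pfst x)) (FO w (psnd x)))"
    by (auto elim!: prod_objE simp: fun_obj[OF u] fun_obj[OF w] fun_ident[OF u] fun_ident[OF w])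
next
  fix f g x y z assume "f \<in> Hom (prod_cat A C) x y" "g \<in> Hom (prod_cat A C) y z"
  then show "Pair (FA u (pfst (Comp (prod_cat A C) g f))) (FA w (psnd (Comp (prod_cat A C) g f))) =
    Comp (prod_cat B D) (Pair (FA u (pfst g)) (FA w (psnd g))) (Pair (FA u (pfst f)) (FA w (psnd f)))"
    by (auto elim!: prod_homE simp: prod_comp fun_comp[OF u] fun_comp[OF w]
      prod_comp[OF fun_hom[OF u] fun_hom[OF u] fun_hom[OF w] fun_hom[OF w]])
qed

lemma prod_func_comp:
  assumes u: "functor_from_to A B u" and w: "functor_from_to C D w"
    and u': "functor_from_to B B' u'" and w': "functor_from_to D D' w'"
  shows "prod_func u' w' \<circ>\<^sub>F prod_func u w = prod_func (u' \<circ>\<^sub>F u) (w' \<circ>\<^sub>F w)"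
proof (rule functor_eqI[OF functor_comp[OF functor_prod[OF u w] functor_prod[OF u' w']]
      functor_prod[OF functor_comp[OF u u'] functor_comp[OF w w']]])
  note ends = functor_ends[OF u] functor_ends[OF w] functor_ends[OF u'] functor_ends[OF w']
  fix x assume "x \<in> Obj (prod_cat A C)"
  then show "FO (prod_func u' w' \<circ>\<^sub>F prod_func u w) x = FO (prod_func (u' \<circ>\<^sub>F u) (w' \<circ>\<^sub>F w)) x"
    by (auto elim!: prod_objE simp: ends fun_obj[OF u] fun_obj[OF w])
next
  note ends = functor_ends[OF u] functor_ends[OF w] functor_ends[OF u'] functor_ends[OF w']
  fix f x y assume "f \<in> Hom (prod_cat A C) x y"
  then obtain h k a a' b b' where *: "f = Pair h k" "h \<in> Hom A a a'" "k \<in> Hom C b b'"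
    "x = Pair a b" "y = Pair a' b'" by (metis prod_homE)
  have "FA (prod_func u' w' \<circ>\<^sub>F prod_func u w) f = FA (prod_func u' w') (FA (prod_func u w) f)"
    by (rule comp_func_FA[where x = "Pair a b" and y = "Pair a' b'"]) (simp add: ends *)
  also have "\<dots> = Pair (FA u' (FA u h)) (FA w' (FA w k))"
    unfolding *(1) using fun_hom[OF u *(2)] fun_hom[OF w *(3)] *(2,3)
    by (simp add: ends prod_func_simps(4)[of h u a a' k w b b']
      prod_func_simps(4)[of "FA u h" u' "FO u a" "FO u a'" "FA w k" w' "FO w b" "FO w b'"])
  also have "\<dots> = FA (prod_func (u' \<circ>\<^sub>F u) (w' \<circ>\<^sub>F w)) f"
    unfolding *(1) using *(2,3)
    by (simp add: ends prod_func_simps(4)[of h "u' \<circ>\<^sub>F u" a a' k "w' \<circ>\<^sub>F w" b b']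
      comp_func_FA[of h u a a'] comp_func_FA[of k w b b'])
  finally show "FA (prod_func u' w' \<circ>\<^sub>F prod_func u w) f = FA (prod_func (u' \<circ>\<^sub>F u) (w' \<circ>\<^sub>F w)) f" .
qed

lemma prod_func_id:
  assumes A: "is_category A" and B: "is_category B"
  shows "prod_func (id_func A) (id_func B) = id_func (prod_cat A B)"
  by (rule functor_eqI[OF functor_prod[OF functor_id[OF A] functor_id[OF B]] functor_id[OF category_prod[OF A B]]])
    (auto elim!: prod_objE prod_homE)

lemma prod_nt:
  assumes a: "ntrans_from_to F G \<alpha>" and b: "ntrans_from_to H K \<beta>"
  shows "ntrans_from_to (prod_func F H) (prod_func G K) (prod_nt \<alpha> \<beta>)"
  unfolding prod_nt_def nt_ends[OF a] nt_ends[OF b]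
proof (rule nt_mk[OF functor_prod[OF nt_functors(1)[OF a] nt_functors(1)[OF b]]
      functor_prod[OF nt_functors(2)[OF a] nt_functors(2)[OF b]]])
  note ends = functor_ends[OF nt_functors(2)[OF a]] functor_ends[OF nt_functors(2)[OF b]]
  fix x assume "x \<in> Obj (prod_cat (Src F) (Src H))"
  then show "Pair (At \<alpha> (pfst x)) (At \<beta> (psnd x)) \<in> Hom (prod_cat (Tgt F) (Tgt H))
    (FO (prod_func F H) x) (FO (prod_func G K) x)"
    by (auto elim!: prod_objE simp: ends nt_hom[OF a] nt_hom[OF b])
next
  note ends = functor_ends[OF nt_functors(2)[OF a]] functor_ends[OF nt_functors(2)[OF b]]
  fix f x y assume "f \<in> Hom (prod_cat (Src F) (Src H)) x y"
    "x \<in> Obj (prod_cat (Src F) (Src H))" "y \<in> Obj (prod_cat (Src F) (Src H))"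
  then obtain h k c c' d d' where *: "f = Pair h k" "h \<in> Hom (Src F) c c'" "k \<in> Hom (Src H) d d'"
    "x = Pair c d" "y = Pair c' d'" "c \<in> Obj (Src F)" "c' \<in> Obj (Src F)" "d \<in> Obj (Src H)" "d' \<in> Obj (Src H)"
    by (auto elim!: prod_homE)
  have f: "FA (prod_func F H) f = Pair (FA F h) (FA H k)" "FA (prod_func G K) f = Pair (FA G h) (FA K k)"
    using * by (simp_all add: prod_func_simps(4)[of h F c c' k H d d'] ends prod_func_simps(4)[of h G c c' k K d d'])
  show "Comp (prod_cat (Tgt F) (Tgt H)) (Pair (At \<alpha> (pfst y)) (At \<beta> (psnd y))) (FA (prod_func F H) f) =
    Comp (prod_cat (Tgt F) (Tgt H)) (FA (prod_func G K) f) (Pair (At \<alpha> (pfst x)) (At \<beta> (psnd x)))"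
    unfolding f
    using * nt_nat[OF a *(2)] nt_nat[OF b *(3)]
      prod_comp[OF nt_hom[OF a *(7)] fun_hom[OF nt_functors(1)[OF a] *(2)] nt_hom[OF b *(9)] fun_hom[OF nt_functors(1)[OF b] *(3)]]
      prod_comp[OF fun_hom[OF nt_functors(2)[OF a] *(2)] nt_hom[OF a *(6)] fun_hom[OF nt_functors(2)[OF b] *(3)] nt_hom[OF b *(8)]]
    by simp
qed

lemma prod_nt_at [simp]:
  "x \<in> Obj (Src (NSrc \<alpha>)) \<Longrightarrow> y \<in> Obj (Src (NSrc \<beta>)) \<Longrightarrow> At (prod_nt \<alpha> \<beta>) (Pair x y) = Pair (At \<alpha> x) (At \<beta> y)"
  "NSrc (prod_nt \<alpha> \<beta>) = prod_func (NSrc \<alpha>) (NSrc \<beta>)" "NTgt (prod_nt \<alpha> \<beta>) = prod_func (NTgt \<alpha>) (NTgt \<beta>)"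
  by (simp_all add: prod_nt_def)

section \<open>The terminal category and points\<close>

lemma one_simps [simp]:
  "Obj one_cat = {Nats []}" "Arr one_cat = {Nats []}" "Ident one_cat (Nats []) = Nats []"
  "Hom one_cat (Nats []) (Nats []) = {Nats []}" "Comp one_cat (Nats []) (Nats []) = Nats []"
  by (auto simp: one_cat_def Hom_def)

lemma one_homE: "f \<in> Hom one_cat x y \<Longrightarrow> f = Nats [] \<and> x = Nats [] \<and> y = Nats []"
  by (auto simp: one_cat_def Hom_def)

lemma category_one: "is_category one_cat"
  unfolding one_cat_def by (rule is_category_mk_cat) auto

lemma to_one_simps [simp]:
  "Src (to_one A) = A" "Tgt (to_one A) = one_cat" "x \<in> Obj A \<Longrightarrow> FO (to_one A) x = Nats []"
  "f \<in> Hom A x y \<Longrightarrow> FA (to_one A) f = Nats []"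
  by (auto simp: to_one_def)

lemma functor_to_one: "is_category A \<Longrightarrow> functor_from_to A one_cat (to_one A)"
  unfolding to_one_def by (rule functor_mk_func) (auto simp: category_one)

lemma to_one_eq:
  assumes F: "functor_from_to A one_cat F" and G: "functor_from_to A one_cat G" shows "F = G"
proof (rule functor_eqI[OF F G])
  show "FO F x = FO G x" if "x \<in> Obj A" for x using fun_obj[OF F that] fun_obj[OF G that] by simp
  show "FA F f = FA G f" if "f \<in> Hom A x y" for f x y
    using one_homE[OF fun_hom[OF F that]] one_homE[OF fun_hom[OF G that]] by simp
qed

lemma point_simps [simp]:
  "Src (point A a) = one_cat" "Tgt (point A a) = A" "FO (point A a) (Nats []) = a"
  "FA (point A a) (Nats []) = Ident A a"
  by (auto simp: point_def)

lemma functor_point: "is_category A \<Longrightarrow> a \<in> Obj A \<Longrightarrow> functor_from_to one_cat A (point A a)"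
  unfolding point_def by (rule functor_mk_func)
    (auto simp: category_one cat_ident_hom cat_id_left[OF _ cat_ident_hom] dest!: one_homE)

text \<open>Under \<open>D\<close> this says that the value at \<open>a\<close> of an object pulled
  back along \<open>F\<close> is, on the nose, its value at \<open>FO F a\<close>.\<close>

lemma functor_comp_point:
  assumes F: "functor_from_to A B F" and a: "a \<in> Obj A"
  shows "F \<circ>\<^sub>F point A a = point B (FO F a)"
  by (rule functor_eqI[OF functor_comp[OF functor_point[OF functor_cat(1)[OF F] a] F]
    functor_point[OF functor_cat(2)[OF F] fun_obj[OF F a]]])
    (auto dest!: one_homE simp: fun_ident[OF F a] comp_func_FA[of _ _ "Nats []" "Nats []"])

section \<open>Coproduct categories\<close>

lemma coprod_obj [simp]: "Pair i x \<in> Obj (coprod_cat I A) \<longleftrightarrow> i \<in> I \<and> x \<in> Obj (A i)"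
  by (auto simp: coprod_cat_def)

lemma coprod_objE:
  assumes "y \<in> Obj (coprod_cat I A)" obtains i x where "y = Pair i x" "i \<in> I" "x \<in> Obj (A i)"
  using assms by (auto simp: coprod_cat_def)

lemma coprod_hom [simp]: "Pair i f \<in> Hom (coprod_cat I A) (Pair j x) (Pair k y) \<longleftrightarrow>
    i \<in> I \<and> j = i \<and> k = i \<and> f \<in> Hom (A i) x y"
  by (auto simp: coprod_cat_def Hom_def)

lemma coprod_homE:
  assumes "h \<in> Hom (coprod_cat I A) y z"
  obtains i f a b where "h = Pair i f" "y = Pair i a" "z = Pair i b" "i \<in> I" "f \<in> Hom (A i) a b"
  using assms by (auto simp: coprod_cat_def Hom_def)

lemma coprod_ident [simp]:
  "i \<in> I \<Longrightarrow> x \<in> Obj (A i) \<Longrightarrow> Ident (coprod_cat I A) (Pair i x) = Pair i (Ident (A i) x)"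
  by (simp add: coprod_cat_def)

lemma coprod_comp:
  "i \<in> I \<Longrightarrow> g \<in> Hom (A i) y z \<Longrightarrow> f \<in> Hom (A i) x y \<Longrightarrow>
   Comp (coprod_cat I A) (Pair i g) (Pair i f) = Pair i (Comp (A i) g f)"
  by (simp add: coprod_cat_def Hom_def)

lemma category_coprod:
  assumes "\<And>i. i \<in> I \<Longrightarrow> is_category (A i)"
  shows "is_category (coprod_cat I A)"
  unfolding coprod_cat_def
  by (intro is_category_mk_cat) (auto simp: assms cat_dom cat_cod cat_ident_arr cat_comp_arr cat_ids cat_assoc_arr)

lemma coprod_incl_simps [simp]:
  "Src (coprod_incl I A i) = A i" "Tgt (coprod_incl I A i) = coprod_cat I A"
  "x \<in> Obj (A i) \<Longrightarrow> FO (coprod_incl I A i) x = Pair i x"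
  "f \<in> Hom (A i) x y \<Longrightarrow> FA (coprod_incl I A i) f = Pair i f"
  by (auto simp: coprod_incl_def)

lemma functor_coprod_incl:
  assumes "\<And>i. i \<in> I \<Longrightarrow> is_category (A i)" and "i \<in> I"
  shows "functor_from_to (A i) (coprod_cat I A) (coprod_incl I A i)"
  unfolding coprod_incl_def
  by (rule functor_mk_func) (use assms category_coprod in \<open>auto simp: coprod_comp\<close>)

lemma op_simps [simp]:
  "Obj (op_cat C) = Obj C" "Arr (op_cat C) = Arr C" "Dom (op_cat C) = Cod C" "Cod (op_cat C) = Dom C"
  "Ident (op_cat C) = Ident C" "Comp (op_cat C) g f = Comp C f g" "Hom (op_cat C) x y = Hom C y x"
  by (auto simp: op_cat_def Hom_def)

lemma category_op:
  assumes C: "is_category C"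
  shows "is_category (op_cat C)"
proof -
  have "composable (op_cat C) g f \<longleftrightarrow> composable C f g" for g f
    by (auto simp: composable_def)
  moreover have "Comp C (Comp C f g) h = Comp C f (Comp C g h)" if "composable C f g" "composable C g h" for f g h
    using C that by (auto simp: is_category_def)
  ultimately show ?thesis using C unfolding is_category_def[of "op_cat C"]
    by (auto simp: is_category_def)
qed

section \<open>Comma categories over an object\<close>

lemma over_cat_obj [simp]:
  "Pair a f \<in> Obj (over_cat u b) \<longleftrightarrow> a \<in> Obj (Src u) \<and> f \<in> Hom (Tgt u) (FO u a) b"
  by (auto simp: over_cat_def over_objs_def)

lemma over_objE:
  assumes "x \<in> Obj (over_cat u b)"
  obtains a f where "x = Pair a f" "a \<in> Obj (Src u)" "f \<in> Hom (Tgt u) (FO u a) b"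
  using assms by (auto simp: over_cat_def over_objs_def)

lemma over_hom [simp]:
  "Pair (Pair x' y') h \<in> Hom (over_cat u b) x y \<longleftrightarrow> x' = x \<and> y' = y \<and> x \<in> Obj (over_cat u b) \<and>
    y \<in> Obj (over_cat u b) \<and> h \<in> Hom (Src u) (pfst x) (pfst y) \<and> Comp (Tgt u) (psnd y) (FA u h) = psnd x"
  by (auto simp: over_cat_def Hom_def)

lemma over_homE:
  assumes "k \<in> Hom (over_cat u b) x y"
  obtains h where "k = Pair (Pair x y) h" "x \<in> Obj (over_cat u b)"
    "y \<in> Obj (over_cat u b)" "h \<in> Hom (Src u) (pfst x) (pfst y)" "Comp (Tgt u) (psnd y) (FA u h) = psnd x"
proof -
  obtain h where h: "k = Pair (Pair x y) h" using assms unfolding over_cat_def Hom_def by auto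
  then show thesis using that[OF h] assms over_hom[of x y h u b x y] by blast
qed

lemma over_ident [simp]:
  "x \<in> Obj (over_cat u b) \<Longrightarrow> Ident (over_cat u b) x = Pair (Pair x x) (Ident (Src u) (pfst x))"
  by (auto simp: over_cat_def over_objs_def)

lemma over_comp:
  "Pair (Pair y z) g \<in> Hom (over_cat u b) y z \<Longrightarrow> Pair (Pair x y) f \<in> Hom (over_cat u b) x y \<Longrightarrow>
   Comp (over_cat u b) (Pair (Pair y z) g) (Pair (Pair x y) f) = Pair (Pair x z) (Comp (Src u) g f)"
  unfolding Hom_def by (simp add: over_cat_def)

lemma category_over:
  assumes u: "functor_from_to A B u"
  shows "is_category (over_cat u b)"
  unfolding over_cat_def
proof (intro is_category_mk_cat)
  note ends [simp] = functor_ends[OF u]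
  note C = functor_cat[OF u]
  let ?M = "{Pair (Pair x y) h | x y h. x \<in> over_objs u b \<and> y \<in> over_objs u b \<and>
        h \<in> Hom (Src u) (pfst x) (pfst y) \<and> Comp (Tgt u) (psnd y) (FA u h) = psnd x}"
  have ob: "pfst x \<in> Obj A" "psnd x \<in> Hom B (FO u (pfst x)) b" if "x \<in> over_objs u b" for x
    using that by (auto simp: over_objs_def)
  show "pfst (pfst f) \<in> over_objs u b \<and> psnd (pfst f) \<in> over_objs u b" if "f \<in> ?M" for f
    using that by auto
  show "Pair (Pair x x) (Ident (Src u) (pfst x)) \<in> ?M \<and>
    pfst (pfst (Pair (Pair x x) (Ident (Src u) (pfst x)))) = x \<and>
    psnd (pfst (Pair (Pair x x) (Ident (Src u) (pfst x)))) = x" if "x \<in> over_objs u b" for x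
    using that ob[OF that] by (auto simp: cat_ident_hom[OF C(1)] fun_ident[OF u] cat_id_right[OF C(2)])
  show "Pair (Pair (pfst (pfst f)) (psnd (pfst g))) (Comp (Src u) (psnd g) (psnd f)) \<in> ?M \<and>
       pfst (pfst (Pair (Pair (pfst (pfst f)) (psnd (pfst g))) (Comp (Src u) (psnd g) (psnd f)))) = pfst (pfst f) \<and>
       psnd (pfst (Pair (Pair (pfst (pfst f)) (psnd (pfst g))) (Comp (Src u) (psnd g) (psnd f)))) = psnd (pfst g)"
    if fg: "f \<in> ?M" "g \<in> ?M" "psnd (pfst f) = pfst (pfst g)" for f g
  proof -
    obtain x y z h k where *: "f = Pair (Pair x y) h" "g = Pair (Pair y z) k"
      "x \<in> over_objs u b" "y \<in> over_objs u b" "z \<in> over_objs u b"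
      "h \<in> Hom A (pfst x) (pfst y)" "k \<in> Hom A (pfst y) (pfst z)"
      "Comp B (psnd y) (FA u h) = psnd x" "Comp B (psnd z) (FA u k) = psnd y"
      using fg by auto
    show ?thesis
      using * cat_comp_hom[OF C(1) *(7,6)] fun_comp[OF u *(7,6)]
        cat_assoc[OF C(2) ob(2)[OF *(5)] fun_hom[OF u *(7)] fun_hom[OF u *(6)]] by auto
  qed
  show "Pair (Pair (pfst (pfst (Pair (Pair (pfst (pfst f)) (pfst (pfst f))) (Ident (Src u) (pfst (pfst (pfst f))))))) (psnd (pfst f)))
        (Comp (Src u) (psnd f) (psnd (Pair (Pair (pfst (pfst f)) (pfst (pfst f))) (Ident (Src u) (pfst (pfst (pfst f))))))) = f \<and>
       Pair (Pair (pfst (pfst f)) (psnd (pfst (Pair (Pair (psnd (pfst f)) (psnd (pfst f))) (Ident (Src u) (pfst (psnd (pfst f))))))))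
        (Comp (Src u) (psnd (Pair (Pair (psnd (pfst f)) (psnd (pfst f))) (Ident (Src u) (pfst (psnd (pfst f)))))) (psnd f)) = f"
    if "f \<in> ?M" for f
    using that by (auto simp: cat_id_left[OF C(1)] cat_id_right[OF C(1)])
qed (auto simp: cat_assoc[OF functor_cat(1)[OF u]] functor_ends[OF u])

lemma over_proj_simps [simp]:
  "Src (over_proj u b) = over_cat u b" "Tgt (over_proj u b) = Src u"
  "x \<in> Obj (over_cat u b) \<Longrightarrow> FO (over_proj u b) x = pfst x"
  "f \<in> Hom (over_cat u b) x y \<Longrightarrow> FA (over_proj u b) f = psnd f"
  by (auto simp: over_proj_def)

lemma functor_over_proj:
  assumes u: "functor_from_to A B u"
  shows "functor_from_to (over_cat u b) A (over_proj u b)"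
  unfolding over_proj_def functor_ends[OF u]
  by (rule functor_mk_func)
    (auto simp: category_over[OF u] functor_cat[OF u] functor_ends[OF u] over_comp elim!: over_objE over_homE)

lemma over_cell:
  assumes u: "functor_from_to A B u" and b: "b \<in> Obj B"
  shows "ntrans_from_to (u \<circ>\<^sub>F over_proj u b) (point B b \<circ>\<^sub>F to_one (over_cat u b)) (over_cell u b)"
  unfolding over_cell_def functor_ends[OF u]
proof (rule nt_mk[OF functor_comp[OF functor_over_proj[OF u] u]
      functor_comp[OF functor_to_one[OF category_over[OF u]] functor_point[OF functor_cat(2)[OF u] b]]])
  fix x assume "x \<in> Obj (over_cat u b)"
  then show "psnd x \<in> Hom B (FO (u \<circ>\<^sub>F over_proj u b) x) (FO (point B b \<circ>\<^sub>F to_one (over_cat u b)) x)"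
    by (auto elim!: over_objE simp: functor_ends[OF u])
next
  fix f x y assume f: "f \<in> Hom (over_cat u b) x y" and x: "x \<in> Obj (over_cat u b)"
  then show "Comp B (psnd y) (FA (u \<circ>\<^sub>F over_proj u b) f) = Comp B (FA (point B b \<circ>\<^sub>F to_one (over_cat u b)) f) (psnd x)"
    using comp_func_FA[of f "over_proj u b" x y u] comp_func_FA[of f "to_one (over_cat u b)" x y "point B b"]
    by (auto elim!: over_homE over_objE simp: functor_ends[OF u] cat_id_left[OF functor_cat(2)[OF u]])
qed

lemma over_cell_at [simp]: "x \<in> Obj (over_cat u b) \<Longrightarrow> At (over_cell u b) x = psnd x"
  by (auto simp: over_cell_def)

text \<open>The universal property of the comma category: \<open>F\<close> together with a 2-cell
  \<open>\<phi>\<close> from \<open>u \<circ>\<^sub>F F\<close> to the constant functor at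
  \<open>b\<close> lifts to a functor into \<open>over_cat u b\<close>. The nested pairs in the
  arrow part are the domain and codomain that a comma arrow carries in its code.\<close>

definition over_lift ::
  "'a sfunc \<Rightarrow> 'a univ \<Rightarrow> 'a sfunc \<Rightarrow> ('a univ \<Rightarrow> 'a univ) \<Rightarrow> 'a sfunc" where
  "over_lift u b F \<phi> = mk_func (Src F) (over_cat u b) (\<lambda>x. Pair (FO F x) (\<phi> x))
     (\<lambda>h. Pair (Pair (Pair (FO F (Dom (Src F) h)) (\<phi> (Dom (Src F) h)))
                     (Pair (FO F (Cod (Src F) h)) (\<phi> (Cod (Src F) h)))) (FA F h))"

lemma over_lift_simps [simp]:
  "Src (over_lift u b F \<phi>) = Src F" "Tgt (over_lift u b F \<phi>) = over_cat u b"
  "x \<in> Obj (Src F) \<Longrightarrow> FO (over_lift u b F \<phi>) x = Pair (FO F x) (\<phi> x)"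
  "h \<in> Hom (Src F) x y \<Longrightarrow> FA (over_lift u b F \<phi>) h = Pair (Pair (Pair (FO F x) (\<phi> x)) (Pair (FO F y) (\<phi> y))) (FA F h)"
  by (auto simp: over_lift_def Hom_def)

lemma functor_over_lift:
  assumes u: "functor_from_to A B u" and F: "functor_from_to K A F"
    and \<phi>: "\<And>x. x \<in> Obj K \<Longrightarrow> \<phi> x \<in> Hom B (FO u (FO F x)) b"
    and n: "\<And>h x y. h \<in> Hom K x y \<Longrightarrow> x \<in> Obj K \<Longrightarrow> y \<in> Obj K \<Longrightarrow> Comp B (\<phi> y) (FA u (FA F h)) = \<phi> x"
  shows "functor_from_to K (over_cat u b) (over_lift u b F \<phi>)"
  unfolding over_lift_def functor_ends[OF F]
proof (rule functor_mk_func)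
  note [simp] = functor_ends[OF u] fun_obj[OF F] fun_hom[OF F]
  have K: "is_category K" using functor_cat[OF F] by simp
  show "is_category K" by fact
  show "is_category (over_cat u b)" by (rule category_over[OF u])
  fix x assume x: "x \<in> Obj K"
  then show "Pair (FO F x) (\<phi> x) \<in> Obj (over_cat u b)" using \<phi> by simp
  show "Pair (Pair (Pair (FO F (Dom K (Ident K x))) (\<phi> (Dom K (Ident K x)))) (Pair (FO F (Cod K (Ident K x))) (\<phi> (Cod K (Ident K x)))))
          (FA F (Ident K x)) = Ident (over_cat u b) (Pair (FO F x) (\<phi> x))"
    using x \<phi> homD[OF cat_ident_hom[OF K x]] fun_ident[OF F x] by simp
next
  note [simp] = functor_ends[OF u] fun_obj[OF F]
  fix f x y assume f: "f \<in> Hom K x y" and x: "x \<in> Obj K" and y: "y \<in> Obj K"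
  then show "Pair (Pair (Pair (FO F (Dom K f)) (\<phi> (Dom K f))) (Pair (FO F (Cod K f)) (\<phi> (Cod K f)))) (FA F f)
       \<in> Hom (over_cat u b) (Pair (FO F x) (\<phi> x)) (Pair (FO F y) (\<phi> y))"
    using homD[OF f] fun_hom[OF F f] \<phi> n[OF f x y] by simp
next
  note [simp] = functor_ends[OF u] fun_obj[OF F]
  have K: "is_category K" using functor_cat[OF F] by simp
  fix f g x y z assume f: "f \<in> Hom K x y" and g: "g \<in> Hom K y z" and o: "x \<in> Obj K" "y \<in> Obj K" "z \<in> Obj K"
  show "Pair (Pair (Pair (FO F (Dom K (Comp K g f))) (\<phi> (Dom K (Comp K g f)))) (Pair (FO F (Cod K (Comp K g f))) (\<phi> (Cod K (Comp K g f)))))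
        (FA F (Comp K g f)) =
       Comp (over_cat u b) (Pair (Pair (Pair (FO F (Dom K g)) (\<phi> (Dom K g))) (Pair (FO F (Cod K g)) (\<phi> (Cod K g)))) (FA F g))
        (Pair (Pair (Pair (FO F (Dom K f)) (\<phi> (Dom K f))) (Pair (FO F (Cod K f)) (\<phi> (Cod K f)))) (FA F f))"
    using homD[OF f] homD[OF g] homD[OF cat_comp_hom[OF K g f]] fun_comp[OF F g f] fun_hom[OF F f] fun_hom[OF F g]
     o \<phi> n[OF f] n[OF g] by (simp add: over_comp)
qed

text \<open>A 2-cell between functors into a comma category, given by its underlying arrows
  \<open>t\<close>. Both kinds of comma categories encode arrows in the same way, so the definition
  serves for both.\<close>

definition over_nt :: "'a sfunc \<Rightarrow> 'a sfunc \<Rightarrow> ('a univ \<Rightarrow> 'a univ) \<Rightarrow> 'a sntrans" where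
  "over_nt S T t = mk_nt S T (\<lambda>x. Pair (Pair (FO S x) (FO T x)) (t x))"

lemma over_nt_at [simp]: "x \<in> Obj (Src S) \<Longrightarrow> At (over_nt S T t) x = Pair (Pair (FO S x) (FO T x)) (t x)"
  "NSrc (over_nt S T t) = S" "NTgt (over_nt S T t) = T"
  by (auto simp: over_nt_def)

lemma over_nt:
  assumes u: "functor_from_to A B u" and S: "functor_from_to K (over_cat u b) S"
    and T: "functor_from_to K (over_cat u b) T"
    and t: "\<And>x. x \<in> Obj K \<Longrightarrow> t x \<in> Hom A (pfst (FO S x)) (pfst (FO T x))"
    and p: "\<And>x. x \<in> Obj K \<Longrightarrow> Comp B (psnd (FO T x)) (FA u (t x)) = psnd (FO S x)"
    and n: "\<And>h x y. h \<in> Hom K x y \<Longrightarrow> x \<in> Obj K \<Longrightarrow> y \<in> Obj K \<Longrightarrow>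
      Comp A (t y) (psnd (FA S h)) = Comp A (psnd (FA T h)) (t x)"
  shows "ntrans_from_to S T (over_nt S T t)"
  unfolding over_nt_def
proof (rule nt_mk[OF S T])
  note ends [simp] = functor_ends[OF u]
  show h: "Pair (Pair (FO S x) (FO T x)) (t x) \<in> Hom (over_cat u b) (FO S x) (FO T x)" if "x \<in> Obj K" for x
    unfolding over_hom ends using t[OF that] p[OF that] fun_obj[OF S that] fun_obj[OF T that] by blast
  fix f x y assume f: "f \<in> Hom K x y" and x: "x \<in> Obj K" and y: "y \<in> Obj K"
  obtain f1 where f1: "FA S f = Pair (Pair (FO S x) (FO S y)) f1" by (rule over_homE[OF fun_hom[OF S f]]) blast
  obtain f2 where f2: "FA T f = Pair (Pair (FO T x) (FO T y)) f2" by (rule over_homE[OF fun_hom[OF T f]]) blast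
  show "Comp (over_cat u b) (Pair (Pair (FO S y) (FO T y)) (t y)) (FA S f) =
       Comp (over_cat u b) (FA T f) (Pair (Pair (FO S x) (FO T x)) (t x))"
    using n[OF f x y] over_comp[OF h[OF y] fun_hom[OF S f, unfolded f1]]
      over_comp[OF fun_hom[OF T f, unfolded f2] h[OF x]]
    by (simp only: f1 f2 univ.sel ends)
qed

section \<open>Pullbacks, universal arrows and mates in a derivator\<close>

lemma natLeq_less_infinite: "natLeq <o r \<Longrightarrow> Card_order r \<Longrightarrow> infinite (Field r)"
  using ordLess_imp_ordLeq[of natLeq r] infinite_iff_natLeq_ordLeq[of "Field r"] card_of_Field_ordIso[of r]
  by (meson ordIso_symmetric ordLeq_ordIso_trans)

lemma card_of_subset_less: "A \<subseteq> B \<Longrightarrow> |B| <o r \<Longrightarrow> |A| <o r"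
  using card_of_mono1 ordLeq_ordLess_trans by blast

lemma card_of_image_less: "|A| <o r \<Longrightarrow> |f ` A| <o r"
  using card_of_image ordLeq_ordLess_trans by blast

text \<open>Uncountability of the bound enters here: it makes the simplex category small and allows
  unions over all lengths of strings.\<close>

lemma countable_less: "natLeq <o r \<Longrightarrow> |f ` (UNIV :: nat set)| <o r"
  by (meson card_of_image card_of_nat ordIso_ordLess_trans ordLeq_ordLess_trans)

text \<open>Regularity of \<open>\<kappa>\<close> is what keeps a union of fewer than
  \<open>\<kappa>\<close> sets, each smaller than \<open>\<kappa>\<close>, below
  \<open>\<kappa>\<close>. Products and the set of all strings are bounded by writing them as such
  unions.\<close>

lemma size_bound_UN:
  assumes k: "size_bound \<kappa>" and I: "|I| <o \<kappa>" and A: "\<And>i. i \<in> I \<Longrightarrow> |A i| <o \<kappa>"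
  shows "|\<Union>i\<in>I. A i| <o \<kappa>"
proof -
  have "Cinfinite \<kappa>" using k natLeq_less_infinite by (auto simp: size_bound_def cinfinite_def)
  then show ?thesis
    using card_of_UNION_ordLess_infinite_Field_regularCard[of \<kappa> I A] k I A by (auto simp: size_bound_def)
qed

lemma size_bound_Times:
  assumes k: "size_bound \<kappa>" and A: "|A| <o \<kappa>" and B: "|B| <o \<kappa>"
  shows "|A \<times> B| <o \<kappa>"
proof -
  have "A \<times> B = (\<Union>a\<in>A. (\<lambda>b. (a, b)) ` B)" by auto
  then show ?thesis by (metis (no_types, lifting) size_bound_UN[OF k A] card_of_image_less[OF B])
qed

lemma size_bound_Pair:
  assumes k: "size_bound \<kappa>" and A: "|A| <o \<kappa>" and B: "|B| <o \<kappa>" and X: "X \<subseteq> {Pair a b |a b. a \<in> A \<and> b \<in> B}"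
  shows "|X| <o \<kappa>"
proof -
  have "X \<subseteq> (\<lambda>(a, b). Pair a b) ` (A \<times> B)" using X by auto
  then show ?thesis using card_of_subset_less card_of_image_less size_bound_Times[OF k A B] by metis
qed

lemma size_bound_finite:
  assumes k: "size_bound \<kappa>" and A: "finite A"
  shows "|A| <o \<kappa>"
  using finite_ordLess_infinite[of "|A|" \<kappa>] A natLeq_less_infinite[of \<kappa>] k card_of_Well_order Field_card_of
  by (metis card_order_on_well_order_on size_bound_def)

lemma small_one: "size_bound \<kappa> \<Longrightarrow> small_category \<kappa> one_cat"
  by (simp add: small_category_def category_one size_bound_finite)

lemma small_prod:
  assumes k: "size_bound \<kappa>" and A: "small_category \<kappa> A" and B: "small_category \<kappa> B"
  shows "small_category \<kappa> (prod_cat A B)"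
  unfolding small_category_def
proof (intro conjI)
  show "is_category (prod_cat A B)" using A B category_prod by (auto simp: small_category_def)
  show "|Obj (prod_cat A B)| <o \<kappa>"
    by (rule size_bound_Pair[OF k, of "Obj A" "Obj B"]) (use A B in \<open>auto simp: small_category_def prod_cat_def\<close>)
  show "|Arr (prod_cat A B)| <o \<kappa>"
    by (rule size_bound_Pair[OF k, of "Arr A" "Arr B"]) (use A B in \<open>auto simp: small_category_def prod_cat_def\<close>)
qed

lemma small_coprod:
  assumes k: "size_bound \<kappa>" and I: "|I| <o \<kappa>" and A: "\<And>i. i \<in> I \<Longrightarrow> small_category \<kappa> (A i)"
  shows "small_category \<kappa> (coprod_cat I A)"
  unfolding small_category_def
proof (intro conjI)
  show "is_category (coprod_cat I A)" using A category_coprod by (auto simp: small_category_def)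
  have "|\<Union>i\<in>I. Obj (A i)| <o \<kappa>" "|\<Union>i\<in>I. Arr (A i)| <o \<kappa>"
    using A by (auto intro!: size_bound_UN[OF k I] simp: small_category_def)
  note * = size_bound_Pair[OF k I this(1)] size_bound_Pair[OF k I this(2)]
  show "|Obj (coprod_cat I A)| <o \<kappa>" by (rule *(1)) (auto simp: coprod_cat_def)
  show "|Arr (coprod_cat I A)| <o \<kappa>" by (rule *(2)) (auto simp: coprod_cat_def)
qed

lemma small_op: "small_category \<kappa> A \<Longrightarrow> small_category \<kappa> (op_cat A)"
  by (auto simp: small_category_def category_op)

lemma small_over:
  assumes k: "size_bound \<kappa>" and A: "small_category \<kappa> A" and B: "small_category \<kappa> B"
    and u: "functor_from_to A B u"
  shows "small_category \<kappa> (over_cat u b)"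
  unfolding small_category_def
proof (intro conjI)
  show "is_category (over_cat u b)" by (rule category_over[OF u])
  show o: "|Obj (over_cat u b)| <o \<kappa>"
    by (rule size_bound_Pair[OF k, of "Obj A" "Arr B"])
      (use A B in \<open>auto simp: small_category_def functor_ends[OF u] elim!: over_objE dest: homD\<close>)
  have "|{Pair x y |x y. x \<in> Obj (over_cat u b) \<and> y \<in> Obj (over_cat u b)}| <o \<kappa>"
    by (rule size_bound_Pair[OF k o o]) blast
  then show "|Arr (over_cat u b)| <o \<kappa>"
    by (rule size_bound_Pair[OF k, of _ "Arr A"])
      (use A in \<open>auto simp: small_category_def over_cat_def functor_ends[OF u] dest: homD\<close>)
qed

text \<open>Naming source and target as arguments lets smallness and typing of composites be derived
  by chaining facts, without rewriting \<open>Src\<close> and \<open>Tgt\<close>.\<close>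

definition small_fun :: "'a univ rel \<Rightarrow> 'a scat \<Rightarrow> 'a scat \<Rightarrow> 'a sfunc \<Rightarrow> bool" where
  "small_fun \<kappa> A B u \<longleftrightarrow> functor_from_to A B u \<and> small_category \<kappa> A \<and> small_category \<kappa> B"

lemma small_funD:
  assumes "small_fun \<kappa> A B u"
  shows "functor_from_to A B u" "small_category \<kappa> A" "small_category \<kappa> B" "Src u = A" "Tgt u = B"
    "is_category A" "is_category B"
  using assms by (auto simp: small_fun_def small_category_def functor_ends)

lemma small_functor_iff: "small_functor \<kappa> u \<longleftrightarrow> small_fun \<kappa> (Src u) (Tgt u) u"
  by (auto simp: small_functor_def small_fun_def functor_from_to_def)

lemma small_fun_comp:
  "small_fun \<kappa> A B u \<Longrightarrow> small_fun \<kappa> B C v \<Longrightarrow> small_fun \<kappa> A C (v \<circ>\<^sub>F u)"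
  by (auto simp: small_fun_def intro: functor_comp)

lemma small_fun_id: "small_category \<kappa> A \<Longrightarrow> small_fun \<kappa> A A (id_func A)"
  by (auto simp: small_fun_def small_category_def intro: functor_id)

lemma small_nt_iff:
  "small_ntrans \<kappa> \<alpha> \<longleftrightarrow> ntrans_from_to (NSrc \<alpha>) (NTgt \<alpha>) \<alpha> \<and> small_category \<kappa> (Src (NSrc \<alpha>)) \<and> small_category \<kappa> (Tgt (NSrc \<alpha>))"
  by (auto simp: small_ntrans_def small_functor_def ntrans_from_to_def is_ntrans_def Let_def)

lemma small_nt:
  "ntrans_from_to F G \<alpha> \<Longrightarrow> small_fun \<kappa> A B F \<Longrightarrow> small_ntrans \<kappa> \<alpha>"
  by (auto simp: small_nt_iff nt_ends dest: small_funD)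

section \<open>Strict 2-functoriality of a derivator\<close>

locale derivator_theory =
  fixes \<kappa> :: "'a univ rel" and D :: "('a, 'o, 'm) prederiv"
  assumes size: "size_bound \<kappa>" and der: "derivator \<kappa> D"
begin

abbreviation ob :: "'a scat \<Rightarrow> 'o set" where "ob A \<equiv> Obj (D0 D A)"
abbreviation hm :: "'a scat \<Rightarrow> 'o \<Rightarrow> 'o \<Rightarrow> 'm set" where "hm A \<equiv> Hom (D0 D A)"
abbreviation dcomp :: "'m \<Rightarrow> 'a scat \<Rightarrow> 'm \<Rightarrow> 'm" ("(_ \<cdot>\<^bsub>_\<^esub> _)" [56, 0, 55] 55) where
  "g \<cdot>\<^bsub>A\<^esub> f \<equiv> Comp (D0 D A) g f"
abbreviation idt :: "'a scat \<Rightarrow> 'o \<Rightarrow> 'm" where "idt A \<equiv> Ident (D0 D A)"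
abbreviation pb :: "'a sfunc \<Rightarrow> 'o \<Rightarrow> 'o" where "pb u \<equiv> FO (D1 D u)"
abbreviation pa :: "'a sfunc \<Rightarrow> 'm \<Rightarrow> 'm" where "pa u \<equiv> FA (D1 D u)"
abbreviation cl :: "'a sntrans \<Rightarrow> 'o \<Rightarrow> 'm" where "cl \<alpha> \<equiv> At (D2 D \<alpha>)"
abbreviation small :: "'a scat \<Rightarrow> bool" where "small \<equiv> small_category \<kappa>"
abbreviation sfun :: "'a scat \<Rightarrow> 'a scat \<Rightarrow> 'a sfunc \<Rightarrow> bool" where "sfun \<equiv> small_fun \<kappa>"

lemma pre: "prederivator \<kappa> D" and Der1: "Der1 \<kappa> D" and Der2: "Der2 \<kappa> D" and Der3: "Der3 \<kappa> D" and Der4: "Der4 \<kappa> D"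
  using der by (auto simp: derivator_def)

lemma dcat: "small A \<Longrightarrow> is_category (D0 D A)"
  using pre by (simp add: prederivator_def)

lemma small_funI: "sfun A B u \<Longrightarrow> small_functor \<kappa> u"
  by (simp add: small_functor_iff small_funD)

lemma star:
  assumes u: "sfun A B u"
  shows "functor_from_to (D0 D B) (D0 D A) (D1 D u)"
proof -
  have "\<forall>u. small_functor \<kappa> u \<longrightarrow> functor_from_to (D0 D (Tgt u)) (D0 D (Src u)) (D1 D u)"
    using pre unfolding prederivator_def by (elim conjE)
  then show ?thesis using small_funI[OF u] small_funD(4,5)[OF u] by metis
qed

lemma pb_ob: "sfun A B u \<Longrightarrow> X \<in> ob B \<Longrightarrow> pb u X \<in> ob A"
  by (rule fun_obj[OF star])

lemma pa_hm: "sfun A B u \<Longrightarrow> f \<in> hm B X Y \<Longrightarrow> pa u f \<in> hm A (pb u X) (pb u Y)"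
  by (rule fun_hom[OF star])

lemma pa_dcomp: "sfun A B u \<Longrightarrow> g \<in> hm B Y Z \<Longrightarrow> f \<in> hm B X Y \<Longrightarrow> pa u (g \<cdot>\<^bsub>B\<^esub> f) = pa u g \<cdot>\<^bsub>A\<^esub> pa u f"
  by (rule fun_comp[OF star])

lemma pa_idt: "sfun A B u \<Longrightarrow> X \<in> ob B \<Longrightarrow> pa u (idt B X) = idt A (pb u X)"
  by (rule fun_ident[OF star])

lemma D1_id: "small A \<Longrightarrow> D1 D (id_func A) = id_func (D0 D A)"
  using pre by (simp add: prederivator_def)

lemma pb_id: "small A \<Longrightarrow> X \<in> ob A \<Longrightarrow> pb (id_func A) X = X"
  by (simp add: D1_id)

lemma pa_id: "small A \<Longrightarrow> f \<in> hm A X Y \<Longrightarrow> pa (id_func A) f = f"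
  by (simp add: D1_id)

lemma D1_comp:
  assumes u: "sfun A B u" and v: "sfun B C v"
  shows "D1 D (v \<circ>\<^sub>F u) = D1 D u \<circ>\<^sub>F D1 D v"
proof -
  have "\<forall>u v. small_functor \<kappa> u \<and> small_functor \<kappa> v \<and> Tgt u = Src v \<longrightarrow> D1 D (v \<circ>\<^sub>F u) = D1 D u \<circ>\<^sub>F D1 D v"
    using pre unfolding prederivator_def by (elim conjE)
  then show ?thesis using small_funI[OF u] small_funI[OF v] small_funD(4,5)[OF u] small_funD(4,5)[OF v] by metis
qed

lemma pb_comp: "sfun A B u \<Longrightarrow> sfun B C v \<Longrightarrow> X \<in> ob C \<Longrightarrow> pb (v \<circ>\<^sub>F u) X = pb u (pb v X)"
  using D1_comp[of A B u C v] functor_ends(1)[OF star] by simp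

lemma pa_comp:
  assumes "sfun A B u" "sfun B C v" "f \<in> hm C X Y"
  shows "pa (v \<circ>\<^sub>F u) f = pa u (pa v f)"
  using D1_comp[OF assms(1,2)] functor_ends(1)[OF star[OF assms(2)]] assms(3)
    comp_func_FA[of f "D1 D v" X Y "D1 D u"] by simp

text \<open>Pullbacks around a strictly commuting square are equal and not merely isomorphic,
  because \<open>D\<close> is a strict 2-functor. Coherence isomorphisms are thereby absent from the
  computations with pullbacks.\<close>

lemma pb_sq:
  assumes "v \<circ>\<^sub>F q = u \<circ>\<^sub>F p" "sfun E A p" "sfun A B u" "sfun E C q" "sfun C B v" "X \<in> ob B"
  shows "pb p (pb u X) = pb q (pb v X)"
  using pb_comp[OF assms(2,3,6)] pb_comp[OF assms(4,5,6)] assms(1) by simp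

lemma pa_sq:
  assumes "v \<circ>\<^sub>F q = u \<circ>\<^sub>F p" "sfun E A p" "sfun A B u" "sfun E C q" "sfun C B v" "f \<in> hm B X Y"
  shows "pa p (pa u f) = pa q (pa v f)"
  using pa_comp[OF assms(2,3,6)] pa_comp[OF assms(4,5,6)] assms(1) by simp

lemma D2_nt:
  assumes a: "ntrans_from_to F G \<alpha>" and F: "sfun A B F"
  shows "ntrans_from_to (D1 D F) (D1 D G) (D2 D \<alpha>)"
proof -
  have "\<forall>\<alpha>. small_ntrans \<kappa> \<alpha> \<longrightarrow> ntrans_from_to (D1 D (NSrc \<alpha>)) (D1 D (NTgt \<alpha>)) (D2 D \<alpha>)"
    using pre unfolding prederivator_def by (elim conjE)
  then show ?thesis using small_nt[OF a F] nt_ends[OF a] by metis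
qed

lemma nt_sfun:
  assumes a: "ntrans_from_to F G \<alpha>" and F: "sfun A B F"
  shows "sfun A B G"
  using F nt_functors[OF a] functor_ends small_funD[OF F] by (auto simp: small_fun_def)

lemma cl_hm:
  assumes a: "ntrans_from_to F G \<alpha>" and F: "sfun A B F" and X: "X \<in> ob B"
  shows "cl \<alpha> X \<in> hm A (pb F X) (pb G X)"
  using nt_hom[OF D2_nt[OF a F], unfolded functor_ends[OF star[OF F]], OF X] .

lemma cl_nat:
  assumes a: "ntrans_from_to F G \<alpha>" and F: "sfun A B F" and f: "f \<in> hm B X Y"
  shows "cl \<alpha> Y \<cdot>\<^bsub>A\<^esub> pa F f = pa G f \<cdot>\<^bsub>A\<^esub> cl \<alpha> X"
  using nt_nat[OF D2_nt[OF a F], unfolded functor_ends[OF star[OF F]], OF f] .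

lemma D2_id:
  assumes u: "sfun A B u"
  shows "D2 D (id_nt u) = id_nt (D1 D u)"
  using pre small_funI[OF u] by (simp add: prederivator_def)

lemma cl_id:
  assumes u: "sfun A B u" and X: "X \<in> ob B"
  shows "cl (id_nt u) X = idt A (pb u X)"
  using functor_ends[OF star[OF u]] X by (simp add: D2_id[OF u])

lemma D2_hcomp:
  assumes "small_ntrans \<kappa> \<alpha>" "small_ntrans \<kappa> \<beta>" "Tgt (NSrc \<alpha>) = Src (NSrc \<beta>)"
  shows "D2 D (hcomp \<beta> \<alpha>) = hcomp (D2 D \<alpha>) (D2 D \<beta>)"
  using pre assms by (simp add: prederivator_def)

text \<open>Since \<open>D\<close> reverses 1-cells, whiskering with \<open>w\<close> after
  \<open>\<alpha>\<close> becomes whiskering with \<open>D1 D w\<close> before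
  \<open>D2 D \<alpha>\<close>, which is evaluation at \<open>pb w X\<close>.\<close>

lemma cl_whisker_left:
  assumes a: "ntrans_from_to F G \<alpha>" and F: "sfun A B F" and w: "sfun B C w" and X: "X \<in> ob C"
  shows "cl (whisker_left w \<alpha>) X = cl \<alpha> (pb w X)"
proof -
  note [simp] = small_funD(4,5)[OF F] small_funD(4,5)[OF w]
  have w': "ntrans_from_to w w (id_nt w)" using id_nt small_funD(1)[OF w] .
  have "D2 D (whisker_left w \<alpha>) = hcomp (D2 D \<alpha>) (id_nt (D1 D w))"
    unfolding whisker_left_eq[OF small_funD(1)[OF w] a small_funD(5)[OF F]]
    using D2_hcomp[OF small_nt[OF a F] small_nt[OF w' w]] D2_id[OF w] nt_ends[OF a] by simp
  also have "\<dots> = whisker_right (D2 D \<alpha>) (D1 D w)"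
    by (rule whisker_right_eq[OF star[OF w] D2_nt[OF a F], symmetric]) (simp add: functor_ends[OF star[OF F]])
  finally show ?thesis using X functor_ends[OF star[OF w]] nt_ends[OF D2_nt[OF a F]]
    by (simp add: whisker_right_def)
qed

text \<open>The other case of the reversal: precomposition with \<open>t\<close> becomes application
  of the functor \<open>D1 D t\<close> to the component.\<close>

lemma cl_whisker_right:
  assumes a: "ntrans_from_to F G \<alpha>" and F: "sfun A B F" and t: "sfun E A t" and X: "X \<in> ob B"
  shows "cl (whisker_right \<alpha> t) X = pa t (cl \<alpha> X)"
proof -
  note [simp] = small_funD(4,5)[OF F] small_funD(4,5)[OF t]
  have t': "ntrans_from_to t t (id_nt t)" using id_nt small_funD(1)[OF t] .
  have "D2 D (whisker_right \<alpha> t) = hcomp (id_nt (D1 D t)) (D2 D \<alpha>)"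
    unfolding whisker_right_eq[OF small_funD(1)[OF t] a small_funD(4)[OF F]]
    using D2_hcomp[OF small_nt[OF t' t] small_nt[OF a F]] D2_id[OF t] nt_ends[OF a] by simp
  also have "\<dots> = whisker_left (D1 D t) (D2 D \<alpha>)"
    by (rule whisker_left_eq[OF star[OF t] D2_nt[OF a F], symmetric]) (simp add: functor_ends[OF star[OF F]])
  finally show ?thesis using X functor_ends[OF star[OF F]] nt_ends[OF D2_nt[OF a F]]
    by (simp add: whisker_left_def)
qed

text \<open>\<open>(P, \<eta>)\<close> is initial among maps from \<open>X\<close> to pullbacks
  along \<open>u\<close>, so \<open>P\<close> is a left Kan extension of the single object
  \<open>X\<close>. The notion is independent of a chosen adjoint, and with \<open>u\<close> the
  functor to \<open>one_cat\<close> it describes a colimit cone.\<close>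

definition univ_arrow :: "'a sfunc \<Rightarrow> 'o \<Rightarrow> 'o \<Rightarrow> 'm \<Rightarrow> bool" where
  "univ_arrow u X P \<eta> \<longleftrightarrow> P \<in> ob (Tgt u) \<and> \<eta> \<in> hm (Src u) X (pb u P) \<and>
     (\<forall>Y\<in>ob (Tgt u). \<forall>g\<in>hm (Src u) X (pb u Y). \<exists>!h. h \<in> hm (Tgt u) P Y \<and> pa u h \<cdot>\<^bsub>Src u\<^esub> \<eta> = g)"

lemma univ_arrowI:
  assumes "sfun A B u" "P \<in> ob B" "\<eta> \<in> hm A X (pb u P)"
    and "\<And>Y g. Y \<in> ob B \<Longrightarrow> g \<in> hm A X (pb u Y) \<Longrightarrow> \<exists>h. h \<in> hm B P Y \<and> pa u h \<cdot>\<^bsub>A\<^esub> \<eta> = g"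
    and "\<And>Y h k. Y \<in> ob B \<Longrightarrow> h \<in> hm B P Y \<Longrightarrow> k \<in> hm B P Y \<Longrightarrow> pa u h \<cdot>\<^bsub>A\<^esub> \<eta> = pa u k \<cdot>\<^bsub>A\<^esub> \<eta> \<Longrightarrow> h = k"
  shows "univ_arrow u X P \<eta>"
  unfolding univ_arrow_def small_funD(4,5)[OF assms(1)] using assms(2-) by blast

lemma univ_arrowD:
  assumes "univ_arrow u X P \<eta>" "sfun A B u"
  shows "P \<in> ob B" "\<eta> \<in> hm A X (pb u P)"
  using assms(1) small_funD(4,5)[OF assms(2)] unfolding univ_arrow_def by auto

lemma univ_arrow_ex:
  assumes "univ_arrow u X P \<eta>" "sfun A B u" "Y \<in> ob B" "g \<in> hm A X (pb u Y)"
  obtains h where "h \<in> hm B P Y" "pa u h \<cdot>\<^bsub>A\<^esub> \<eta> = g"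
  using assms small_funD(4,5)[OF assms(2)] unfolding univ_arrow_def by (simp, blast)

lemma univ_arrow_eq:
  assumes U: "univ_arrow u X P \<eta>" and u: "sfun A B u" and h: "h \<in> hm B P Y" and k: "k \<in> hm B P Y"
    and e: "pa u h \<cdot>\<^bsub>A\<^esub> \<eta> = pa u k \<cdot>\<^bsub>A\<^esub> \<eta>"
  shows "h = k"
proof -
  have "Y \<in> ob B" using hom_obj[OF dcat[OF small_funD(3)[OF u]] h] by simp
  moreover have "pa u k \<cdot>\<^bsub>A\<^esub> \<eta> \<in> hm A X (pb u Y)"
    using cat_comp_hom[OF dcat[OF small_funD(2)[OF u]] pa_hm[OF u k] univ_arrowD(2)[OF U u]] .
  ultimately show ?thesis using U h k e unfolding univ_arrow_def small_funD(4,5)[OF u] by blast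
qed

text \<open>The inverse is the factorization of \<open>\<eta>\<close> through
  \<open>\<theta>\<close>. Both composites fix a universal arrow and are therefore
  identities.\<close>

lemma univ_arrow_iso:
  assumes U: "univ_arrow u X P \<eta>" and V: "univ_arrow u X Q \<theta>" and u: "sfun A B u" and h: "h \<in> hm B P Q"
    and e: "pa u h \<cdot>\<^bsub>A\<^esub> \<eta> = \<theta>"
  shows "is_iso (D0 D B) h"
proof -
  note P = univ_arrowD[OF U u] and Q = univ_arrowD[OF V u]
  note A = dcat[OF small_funD(2)[OF u]] and B = dcat[OF small_funD(3)[OF u]]
  obtain k where k: "k \<in> hm B Q P" "pa u k \<cdot>\<^bsub>A\<^esub> \<theta> = \<eta>" using univ_arrow_ex[OF V u P] .
  have "pa u (k \<cdot>\<^bsub>B\<^esub> h) \<cdot>\<^bsub>A\<^esub> \<eta> = \<eta>"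
    using pa_dcomp[OF u k(1) h] cat_assoc[OF A pa_hm[OF u k(1)] pa_hm[OF u h] P(2)] k(2) e by simp
  also have "\<dots> = pa u (idt B P) \<cdot>\<^bsub>A\<^esub> \<eta>" using pa_idt[OF u P(1)] cat_id_left[OF A P(2)] by simp
  finally have 1: "k \<cdot>\<^bsub>B\<^esub> h = idt B P"
    using univ_arrow_eq[OF U u cat_comp_hom[OF B k(1) h] cat_ident_hom[OF B P(1)]] by simp
  have "pa u (h \<cdot>\<^bsub>B\<^esub> k) \<cdot>\<^bsub>A\<^esub> \<theta> = \<theta>"
    using pa_dcomp[OF u h k(1)] cat_assoc[OF A pa_hm[OF u h] pa_hm[OF u k(1)] Q(2)] k(2) e by simp
  also have "\<dots> = pa u (idt B Q) \<cdot>\<^bsub>A\<^esub> \<theta>" using pa_idt[OF u Q(1)] cat_id_left[OF A Q(2)] by simp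
  finally have 2: "h \<cdot>\<^bsub>B\<^esub> k = idt B Q"
    using univ_arrow_eq[OF V u cat_comp_hom[OF B h k(1)] cat_ident_hom[OF B Q(1)]] by simp
  show ?thesis using is_isoI[OF h k(1) 1 2] .
qed

text \<open>Universality survives replacing \<open>P\<close> by an isomorphic object. This turns an
  invertible mate into a new universal arrow.\<close>

lemma univ_arrow_transport:
  assumes U: "univ_arrow u X P \<eta>" and u: "sfun A B u" and h: "h \<in> hm B P Q" and i: "is_iso (D0 D B) h"
  shows "univ_arrow u X Q (pa u h \<cdot>\<^bsub>A\<^esub> \<eta>)"
proof -
  note P = univ_arrowD[OF U u]
  note A = dcat[OF small_funD(2)[OF u]] and B = dcat[OF small_funD(3)[OF u]]
  obtain h' where h': "h' \<in> hm B Q P" "h' \<cdot>\<^bsub>B\<^esub> h = idt B P" "h \<cdot>\<^bsub>B\<^esub> h' = idt B Q"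
    using is_isoE[OF i h] .
  have e: "pa u k \<cdot>\<^bsub>A\<^esub> (pa u h \<cdot>\<^bsub>A\<^esub> \<eta>) = pa u (k \<cdot>\<^bsub>B\<^esub> h) \<cdot>\<^bsub>A\<^esub> \<eta>" if "k \<in> hm B Q Y" for k Y
    using pa_dcomp[OF u that h] cat_assoc[OF A pa_hm[OF u that] pa_hm[OF u h] P(2)] by simp
  show ?thesis
  proof (rule univ_arrowI[OF u])
    show "Q \<in> ob B" using hom_obj[OF B h] by simp
    show "pa u h \<cdot>\<^bsub>A\<^esub> \<eta> \<in> hm A X (pb u Q)" using cat_comp_hom[OF A pa_hm[OF u h] P(2)] .
    fix Y g assume Y: "Y \<in> ob B" "g \<in> hm A X (pb u Y)"
    obtain k where k: "k \<in> hm B P Y" "pa u k \<cdot>\<^bsub>A\<^esub> \<eta> = g" using univ_arrow_ex[OF U u Y] .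
    have "(k \<cdot>\<^bsub>B\<^esub> h') \<cdot>\<^bsub>B\<^esub> h = k" using cat_assoc[OF B k(1) h'(1) h] h'(2) cat_id_right[OF B k(1)] by simp
    then show "\<exists>h''. h'' \<in> hm B Q Y \<and> pa u h'' \<cdot>\<^bsub>A\<^esub> (pa u h \<cdot>\<^bsub>A\<^esub> \<eta>) = g"
      using e cat_comp_hom[OF B k(1) h'(1)] k(2) by metis
  next
    fix Y k l assume k: "k \<in> hm B Q Y" and l: "l \<in> hm B Q Y" and
      eq: "pa u k \<cdot>\<^bsub>A\<^esub> (pa u h \<cdot>\<^bsub>A\<^esub> \<eta>) = pa u l \<cdot>\<^bsub>A\<^esub> (pa u h \<cdot>\<^bsub>A\<^esub> \<eta>)"
    have "k \<cdot>\<^bsub>B\<^esub> h = l \<cdot>\<^bsub>B\<^esub> h"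
      using univ_arrow_eq[OF U u cat_comp_hom[OF B k h] cat_comp_hom[OF B l h]] eq e[OF k] e[OF l] by simp
    then have "(k \<cdot>\<^bsub>B\<^esub> h) \<cdot>\<^bsub>B\<^esub> h' = (l \<cdot>\<^bsub>B\<^esub> h) \<cdot>\<^bsub>B\<^esub> h'" by simp
    then show "k = l"
      using cat_assoc[OF B k h h'(1)] cat_assoc[OF B l h h'(1)] h'(3) cat_id_right[OF B k] cat_id_right[OF B l] by simp
  qed
qed

section \<open>The chosen adjoints of pullback functors\<close>

abbreviation lo :: "'a sfunc \<Rightarrow> 'o \<Rightarrow> 'o" where "lo u \<equiv> FO (lan D u)"
abbreviation la :: "'a sfunc \<Rightarrow> 'm \<Rightarrow> 'm" where "la u \<equiv> FA (lan D u)"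
abbreviation lu :: "'a sfunc \<Rightarrow> 'o \<Rightarrow> 'm" where "lu u \<equiv> At (lan_unit D u)"
abbreviation ro :: "'a sfunc \<Rightarrow> 'o \<Rightarrow> 'o" where "ro u \<equiv> FO (ran D u)"
abbreviation rc :: "'a sfunc \<Rightarrow> 'o \<Rightarrow> 'm" where "rc u \<equiv> At (ran_counit D u)"

lemma lan_adj:
  assumes u: "sfun A B u"
  shows "is_adjunction (lan D u) (D1 D u) (lan_unit D u) (lan_counit D u)"
proof -
  have "\<exists>x. (\<lambda>(L, \<eta>, \<epsilon>). is_adjunction L (D1 D u) \<eta> \<epsilon>) x"
    using Der3 u small_funD(4,5)[OF u] by (auto simp: Der3_def small_functor_iff)
  \<comment> \<open>\<open>left_adj\<close> is a Hilbert choice; Der3 provides the instance that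
    makes it an adjunction.\<close>
  then have "case left_adj D u of (L, \<eta>, \<epsilon>) \<Rightarrow> is_adjunction L (D1 D u) \<eta> \<epsilon>"
    unfolding left_adj_def by (rule someI_ex)
  then show ?thesis by (cases "left_adj D u") (simp add: lan_def lan_unit_def lan_counit_def)
qed

lemma ran_adj:
  assumes u: "sfun A B u"
  shows "is_adjunction (D1 D u) (ran D u) (ran_unit D u) (ran_counit D u)"
proof -
  have "\<exists>x. (\<lambda>(R, \<eta>, \<epsilon>). is_adjunction (D1 D u) R \<eta> \<epsilon>) x"
    using Der3 u small_funD(4,5)[OF u] by (auto simp: Der3_def small_functor_iff)
  then have "case right_adj D u of (R, \<eta>, \<epsilon>) \<Rightarrow> is_adjunction (D1 D u) R \<eta> \<epsilon>"
    unfolding right_adj_def by (rule someI_ex)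
  then show ?thesis by (cases "right_adj D u") (simp add: ran_def ran_unit_def ran_counit_def)
qed

end

section \<open>Transposition in an adjunction\<close>

context
  fixes L :: "('o, 'm, 'p, 'n) func" and R and \<eta> and \<epsilon> and C D
  assumes adj: "is_adjunction L R \<eta> \<epsilon>" and R: "functor_from_to D C R" and L: "functor_from_to C D L"
begin

lemma adj_unit_hom: "x \<in> Obj C \<Longrightarrow> At \<eta> x \<in> Hom C x (FO R (FO L x))"
  using adj nt_hom[of "id_func C" "R \<circ>\<^sub>F L" \<eta> x] by (simp add: is_adjunction_def functor_ends[OF L])

lemma adj_counit_hom: "y \<in> Obj D \<Longrightarrow> At \<epsilon> y \<in> Hom D (FO L (FO R y)) y"
  using adj nt_hom[of "L \<circ>\<^sub>F R" "id_func D" \<epsilon> y] by (simp add: is_adjunction_def functor_ends[OF L] functor_ends[OF R])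

lemma adj_unit_nat:
  assumes f: "f \<in> Hom C x x'" shows "Comp C (At \<eta> x') f = Comp C (FA R (FA L f)) (At \<eta> x)"
  using adj nt_nat[of "id_func C" "R \<circ>\<^sub>F L" \<eta> f x x'] f comp_func_FA[of f L x x' R]
  by (simp add: is_adjunction_def functor_ends[OF L])

lemma adj_counit_nat:
  assumes f: "f \<in> Hom D y y'" shows "Comp D f (At \<epsilon> y) = Comp D (At \<epsilon> y') (FA L (FA R f))"
  using adj nt_nat[of "L \<circ>\<^sub>F R" "id_func D" \<epsilon> f y y'] f comp_func_FA[of f R y y' L]
  by (simp add: is_adjunction_def functor_ends[OF L] functor_ends[OF R])

lemma adj_triangles:
  "x \<in> Obj C \<Longrightarrow> Comp D (At \<epsilon> (FO L x)) (FA L (At \<eta> x)) = Ident D (FO L x)"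
  "y \<in> Obj D \<Longrightarrow> Comp C (FA R (At \<epsilon> y)) (At \<eta> (FO R y)) = Ident C (FO R y)"
  using adj by (simp_all add: is_adjunction_def functor_ends[OF L])

text \<open>The composite of \<open>L g\<close> with the counit is the transpose of
  \<open>g\<close>. Naturality of the unit and the triangle identity at \<open>y\<close> give
  \<open>g\<close> back, which is existence in the universal property; uniqueness comes from the
  other triangle identity.\<close>

lemma adj_flat:
  assumes x: "x \<in> Obj C" and y: "y \<in> Obj D" and g: "g \<in> Hom C x (FO R y)"
  shows "Comp D (At \<epsilon> y) (FA L g) \<in> Hom D (FO L x) y"
    "Comp C (FA R (Comp D (At \<epsilon> y) (FA L g))) (At \<eta> x) = g"
proof -
  note C = functor_cat(1)[OF L] and D = functor_cat(2)[OF L]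
  note Lg = fun_hom[OF L g] and e = adj_counit_hom[OF y]
  show "Comp D (At \<epsilon> y) (FA L g) \<in> Hom D (FO L x) y" using cat_comp_hom[OF D e Lg] .
  have "Comp C (FA R (Comp D (At \<epsilon> y) (FA L g))) (At \<eta> x) = Comp C (FA R (At \<epsilon> y)) (Comp C (At \<eta> (FO R y)) g)"
    using fun_comp[OF R e Lg] cat_assoc[OF C fun_hom[OF R e] fun_hom[OF R Lg] adj_unit_hom[OF x]] adj_unit_nat[OF g]
    by simp
  also have "\<dots> = g"
    using cat_assoc[OF C fun_hom[OF R e] adj_unit_hom[OF fun_obj[OF R y]] g] adj_triangles(2)[OF y] cat_id_left[OF C g]
    by simp
  finally show "Comp C (FA R (Comp D (At \<epsilon> y) (FA L g))) (At \<eta> x) = g" .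
qed

lemma adj_flat_sharp:
  assumes x: "x \<in> Obj C" and h: "h \<in> Hom D (FO L x) y"
  shows "Comp D (At \<epsilon> y) (FA L (Comp C (FA R h) (At \<eta> x))) = h"
proof -
  note C = functor_cat(1)[OF L] and D = functor_cat(2)[OF L]
  have y: "y \<in> Obj D" using hom_obj[OF D h] by simp
  have "Comp D (At \<epsilon> y) (FA L (Comp C (FA R h) (At \<eta> x))) = Comp D h (Comp D (At \<epsilon> (FO L x)) (FA L (At \<eta> x)))"
    using fun_comp[OF L fun_hom[OF R h] adj_unit_hom[OF x]] adj_counit_nat[OF h]
      cat_assoc[OF D adj_counit_hom[OF y] fun_hom[OF L fun_hom[OF R h]] fun_hom[OF L adj_unit_hom[OF x]]]
      cat_assoc[OF D h adj_counit_hom[OF fun_obj[OF L x]] fun_hom[OF L adj_unit_hom[OF x]]] by simp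
  also have "\<dots> = h" using adj_triangles(1)[OF x] cat_id_right[OF D h] by simp
  finally show ?thesis .
qed

text \<open>The same bijection read from the side of the right adjoint \<open>R\<close>, in the form
  required for right Kan extension, where pullback plays the part of \<open>L\<close>.\<close>

lemma adj_sharp:
  assumes y: "y \<in> Obj D" and x: "x \<in> Obj C" and g: "g \<in> Hom D (FO L x) y"
  shows "Comp C (FA R g) (At \<eta> x) \<in> Hom C x (FO R y)"
    "Comp D (At \<epsilon> y) (FA L (Comp C (FA R g) (At \<eta> x))) = g"
  using adj_flat_sharp[OF x g] cat_comp_hom[OF functor_cat(1)[OF L] fun_hom[OF R g] adj_unit_hom[OF x]] by auto

lemma adj_sharp_flat:
  assumes y: "y \<in> Obj D" and x: "x \<in> Obj C" and h: "h \<in> Hom C x (FO R y)"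
  shows "Comp C (FA R (Comp D (At \<epsilon> y) (FA L h))) (At \<eta> x) = h"
  using adj_flat[OF x y h] by simp

end

context derivator_theory begin

lemma lan_functor:
  assumes u: "sfun A B u" shows "functor_from_to (D0 D A) (D0 D B) (lan D u)"
  using lan_adj[OF u] star[OF u] by (auto simp: is_adjunction_def functor_from_to_def)

lemma ran_functor:
  assumes u: "sfun A B u" shows "functor_from_to (D0 D A) (D0 D B) (ran D u)"
  using ran_adj[OF u] star[OF u] by (auto simp: is_adjunction_def functor_from_to_def)

lemma lan_univ:
  assumes u: "sfun A B u" and X: "X \<in> ob A"
  shows "univ_arrow u X (lo u X) (lu u X)"
proof (rule univ_arrowI[OF u])
  note adj = lan_adj[OF u] star[OF u] lan_functor[OF u]
  show "lo u X \<in> ob B" using fun_obj[OF adj(3) X] .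
  show "lu u X \<in> hm A X (pb u (lo u X))" using adj_unit_hom[OF adj X] .
  show "\<exists>h. h \<in> hm B (lo u X) Y \<and> pa u h \<cdot>\<^bsub>A\<^esub> lu u X = g" if "Y \<in> ob B" "g \<in> hm A X (pb u Y)" for Y g
    using adj_flat[OF adj X that] by (intro exI conjI)
  show "h = k" if "h \<in> hm B (lo u X) Y" "k \<in> hm B (lo u X) Y" "pa u h \<cdot>\<^bsub>A\<^esub> lu u X = pa u k \<cdot>\<^bsub>A\<^esub> lu u X" for Y h k
    using adj_flat_sharp[OF adj X that(1)] adj_flat_sharp[OF adj X that(2)] unfolding that(3) by (rule box_equals[OF refl])
qed

lemma la_char:
  assumes u: "sfun A B u" and f: "f \<in> hm A X Y"
  shows "pa u (la u f) \<cdot>\<^bsub>A\<^esub> lu u X = lu u Y \<cdot>\<^bsub>A\<^esub> f"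
  using adj_unit_nat[OF lan_adj[OF u] star[OF u] lan_functor[OF u] f] by simp

lemma rc_hm:
  assumes u: "sfun A B u" and X: "X \<in> ob A"
  shows "rc u X \<in> hm A (pb u (ro u X)) X"
  using adj_counit_hom[OF ran_adj[OF u] ran_functor[OF u] star[OF u] X] .

lemma ran_ex:
  assumes u: "sfun A B u" and X: "X \<in> ob A" and Y: "Y \<in> ob B" and g: "g \<in> hm A (pb u Y) X"
  obtains h where "h \<in> hm B Y (ro u X)" "rc u X \<cdot>\<^bsub>A\<^esub> pa u h = g"
  using adj_sharp[OF ran_adj[OF u] ran_functor[OF u] star[OF u] X Y g] that by blast

lemma ran_eq:
  assumes u: "sfun A B u" and X: "X \<in> ob A" and h: "h \<in> hm B Y (ro u X)" and k: "k \<in> hm B Y (ro u X)"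
    and e: "rc u X \<cdot>\<^bsub>A\<^esub> pa u h = rc u X \<cdot>\<^bsub>A\<^esub> pa u k"
  shows "h = k"
proof -
  have "Y \<in> ob B" using hom_obj[OF dcat[OF small_funD(3)[OF u]] h] by simp
  note * = adj_sharp_flat[OF ran_adj[OF u] ran_functor[OF u] star[OF u] X this]
  show ?thesis using *[OF h] *[OF k] unfolding e by (rule box_equals[OF refl])
qed

text \<open>The mate is by definition the transpose of the composite of \<open>cl \<alpha>\<close>
  with the restricted unit of \<open>u\<close>. The second equation states this without mentioning
  the counit and determines the mate.\<close>

lemma mate_left_char:
  assumes p: "sfun E A p" and u: "sfun A B u" and q: "sfun E C q" and v: "sfun C B v"
    and a: "ntrans_from_to (u \<circ>\<^sub>F p) (v \<circ>\<^sub>F q) \<alpha>" and X: "X \<in> ob A"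
  shows "mate_left D p u q v \<alpha> X \<in> hm C (lo q (pb p X)) (pb v (lo u X))"
    "pa q (mate_left D p u q v \<alpha> X) \<cdot>\<^bsub>E\<^esub> lu q (pb p X) = cl \<alpha> (lo u X) \<cdot>\<^bsub>E\<^esub> pa p (lu u X)"
proof -
  note U = univ_arrowD[OF lan_univ[OF u X] u]
  note E = dcat[OF small_funD(2)[OF p]]
  have up: "sfun E B (u \<circ>\<^sub>F p)" using small_fun_comp[OF p u] .
  have g: "cl \<alpha> (lo u X) \<cdot>\<^bsub>E\<^esub> pa p (lu u X) \<in> hm E (pb p X) (pb q (pb v (lo u X)))"
    using cat_comp_hom[OF E _ pa_hm[OF p U(2)]] cl_hm[OF a up U(1)] pb_comp[OF p u U(1)] pb_comp[OF q v U(1)] by simp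
  note * = adj_flat[OF lan_adj[OF q] star[OF q] lan_functor[OF q] pb_ob[OF p X] pb_ob[OF v U(1)] g]
  show "mate_left D p u q v \<alpha> X \<in> hm C (lo q (pb p X)) (pb v (lo u X))"
    "pa q (mate_left D p u q v \<alpha> X) \<cdot>\<^bsub>E\<^esub> lu q (pb p X) = cl \<alpha> (lo u X) \<cdot>\<^bsub>E\<^esub> pa p (lu u X)"
    using * by (simp_all add: mate_left_def Let_def small_funD[OF q])
qed

text \<open>Dually, the mate is the transpose under the right adjoint of \<open>q\<close>, so it is
  determined by composing with the counit of \<open>q\<close>.\<close>

lemma mate_right_char:
  assumes p: "sfun E A p" and u: "sfun A B u" and q: "sfun E C q" and v: "sfun C B v"
    and a: "ntrans_from_to (v \<circ>\<^sub>F q) (u \<circ>\<^sub>F p) \<alpha>" and X: "X \<in> ob A"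
  shows "mate_right D p u q v \<alpha> X \<in> hm C (pb v (ro u X)) (ro q (pb p X))"
    "rc q (pb p X) \<cdot>\<^bsub>E\<^esub> pa q (mate_right D p u q v \<alpha> X) = pa p (rc u X) \<cdot>\<^bsub>E\<^esub> cl \<alpha> (ro u X)"
proof -
  have Y: "ro u X \<in> ob B" using fun_obj[OF ran_functor[OF u] X] .
  note E = dcat[OF small_funD(2)[OF p]]
  have vq: "sfun E B (v \<circ>\<^sub>F q)" using small_fun_comp[OF q v] .
  have g: "pa p (rc u X) \<cdot>\<^bsub>E\<^esub> cl \<alpha> (ro u X) \<in> hm E (pb q (pb v (ro u X))) (pb p X)"
    using cat_comp_hom[OF E pa_hm[OF p rc_hm[OF u X]]] cl_hm[OF a vq Y] pb_comp[OF p u Y] pb_comp[OF q v Y] by simp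
  note * = adj_sharp[OF ran_adj[OF q] ran_functor[OF q] star[OF q] pb_ob[OF p X] pb_ob[OF v Y] g]
  show "mate_right D p u q v \<alpha> X \<in> hm C (pb v (ro u X)) (ro q (pb p X))"
    "rc q (pb p X) \<cdot>\<^bsub>E\<^esub> pa q (mate_right D p u q v \<alpha> X) = pa p (rc u X) \<cdot>\<^bsub>E\<^esub> cl \<alpha> (ro u X)"
    using * by (simp_all add: mate_right_def Let_def small_funD[OF q])
qed

end

section \<open>Exact squares\<close>

lemma mk_nt_cong: "F = F' \<Longrightarrow> G = G' \<Longrightarrow> (\<And>x. x \<in> Obj (Src F') \<Longrightarrow> t x = t' x) \<Longrightarrow> mk_nt F G t = mk_nt F' G' t'"
  by (auto simp: mk_nt_def intro: restrict_ext)

context derivator_theory begin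

lemma sfun_comp: "sfun A B u \<Longrightarrow> sfun B C v \<Longrightarrow> sfun A C (v \<circ>\<^sub>F u)"
  by (rule small_fun_comp)

lemma sfun_id: "small A \<Longrightarrow> sfun A A (id_func A)"
  by (rule small_fun_id)

lemma sfun_prod: "sfun A B u \<Longrightarrow> sfun C C' w \<Longrightarrow> sfun (prod_cat A C) (prod_cat B C') (prod_func u w)"
  by (auto simp: small_fun_def small_prod[OF size] functor_prod)

lemma sfun_over_proj: "sfun A B u \<Longrightarrow> sfun (over_cat u b) A (over_proj u b)"
  using small_over[OF size] by (auto simp: small_fun_def functor_over_proj)

lemma small_is_category: "small A \<Longrightarrow> is_category A"
  by (simp add: small_category_def)

lemma sfun_to_one: "small A \<Longrightarrow> sfun A one_cat (to_one A)"
  by (simp only: small_fun_def small_one[OF size] functor_to_one small_is_category simp_thms)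

lemma sfun_point: "small A \<Longrightarrow> a \<in> Obj A \<Longrightarrow> sfun one_cat A (point A a)"
  by (simp only: small_fun_def small_one[OF size] functor_point small_is_category simp_thms)

text \<open>The component of \<open>D2 D \<alpha>\<close> at an object pulled back along
  \<open>w\<close> is a component of \<open>w\<close> whiskered with \<open>\<alpha>\<close>. If the
  latter is an identity 2-cell, \<open>\<alpha>\<close> acts trivially on such objects.\<close>

lemma cl_ident:
  assumes a: "ntrans_from_to F G \<alpha>" and F: "sfun K L F" and w: "sfun L M w" and V: "V \<in> ob M"
    and e: "w \<circ>\<^sub>F F = w \<circ>\<^sub>F G" and i: "\<And>x. x \<in> Obj K \<Longrightarrow> FA w (At \<alpha> x) = Ident M (FO w (FO F x))"
  shows "cl \<alpha> (pb w V) = idt K (pb F (pb w V))"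
proof -
  note wF = small_fun_comp[OF F w]
  have "whisker_left w \<alpha> = id_nt (w \<circ>\<^sub>F F)"
    unfolding whisker_left_def id_nt_def
    by (rule mk_nt_cong) (use i in \<open>simp_all add: nt_ends[OF a] e[symmetric] small_funD[OF F] small_funD[OF w]\<close>)
  then show ?thesis
    using cl_whisker_left[OF a F w V] cl_id[OF wF V] pb_comp[OF F w V] by simp
qed

text \<open>Every 2-cell becomes an identity after the functor to the terminal category, so it acts
  trivially on constant diagrams.\<close>

lemma cl_const:
  assumes a: "ntrans_from_to F G \<alpha>" and F: "sfun K L F" and V: "V \<in> ob one_cat"
  shows "cl \<alpha> (pb (to_one L) V) = idt K (pb (to_one K) V)"
proof -
  note w = sfun_to_one[OF small_funD(3)[OF F]]
  note G = nt_sfun[OF a F]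
  have F1: "to_one L \<circ>\<^sub>F F = to_one K"
    by (rule to_one_eq[OF functor_comp[OF small_funD(1)[OF F] small_funD(1)[OF w]] functor_to_one[OF small_funD(6)[OF F]]])
  have G1: "to_one L \<circ>\<^sub>F G = to_one K"
    by (rule to_one_eq[OF functor_comp[OF small_funD(1)[OF G] small_funD(1)[OF w]] functor_to_one[OF small_funD(6)[OF F]]])
  have "cl \<alpha> (pb (to_one L) V) = idt K (pb F (pb (to_one L) V))"
  proof (rule cl_ident[OF a F w V])
    show "to_one L \<circ>\<^sub>F F = to_one L \<circ>\<^sub>F G" using F1 G1 by simp
    show "FA (to_one L) (At \<alpha> x) = Ident one_cat (FO (to_one L) (FO F x))" if "x \<in> Obj K" for x
      using nt_hom[OF a, unfolded small_funD(4,5)[OF F], OF that] fun_obj[OF small_funD(1)[OF F] that] by simp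
  qed
  then show ?thesis using pb_comp[OF F w V] F1 by simp
qed

lemma pb_to_one:
  assumes F: "sfun K L F" and V: "V \<in> ob one_cat"
  shows "pb F (pb (to_one L) V) = pb (to_one K) V"
proof -
  note w = sfun_to_one[OF small_funD(3)[OF F]]
  have "to_one L \<circ>\<^sub>F F = to_one K"
    by (rule to_one_eq[OF functor_comp[OF small_funD(1)[OF F] small_funD(1)[OF w]] functor_to_one[OF small_funD(6)[OF F]]])
  then show ?thesis using pb_comp[OF F w V] by simp
qed

lemma pa_to_one:
  assumes F: "sfun K L F" and f: "f \<in> hm one_cat V V'"
  shows "pa F (pa (to_one L) f) = pa (to_one K) f"
proof -
  note w = sfun_to_one[OF small_funD(3)[OF F]]
  have "to_one L \<circ>\<^sub>F F = to_one K"
    by (rule to_one_eq[OF functor_comp[OF small_funD(1)[OF F] small_funD(1)[OF w]] functor_to_one[OF small_funD(6)[OF F]]])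
  then show ?thesis using pa_comp[OF F w f] by simp
qed

text \<open>A cone \<open>g\<close> over \<open>K\<close> extends to \<open>K'\<close> as
  \<open>pa \<rho> g\<close> composed with \<open>cl \<alpha> X\<close>. Restricting the extension
  along \<open>j\<close> turns \<open>\<alpha>\<close> into \<open>\<beta>\<close>, and naturality
  of \<open>\<beta>\<close> returns \<open>g\<close> because \<open>\<beta>\<close> is trivial on
  the constant target. Hence cones on \<open>K\<close> and on \<open>K'\<close> correspond, and
  \<open>j\<close> preserves colimits by restriction.\<close>

lemma final_univ_arrow:
  assumes j: "sfun K K' j" and r: "sfun K' K \<rho>"
    and a: "ntrans_from_to (id_func K') (j \<circ>\<^sub>F \<rho>) \<alpha>" and b: "ntrans_from_to (id_func K) (\<rho> \<circ>\<^sub>F j) \<beta>"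
    and ab: "\<And>x. x \<in> Obj K \<Longrightarrow> At \<alpha> (FO j x) = FA j (At \<beta> x)"
    and U: "univ_arrow (to_one K') X P \<theta>" and X: "X \<in> ob K'"
  shows "univ_arrow (to_one K) (pb j X) P (pa j \<theta>)"
proof -
  let ?k = "to_one K" and ?k' = "to_one K'"
  note K = small_funD(2)[OF j] and K' = small_funD(3)[OF j]
  note k = sfun_to_one[OF K] and k' = sfun_to_one[OF K']
  note cK = dcat[OF K] and cK' = dcat[OF K']
  note P = univ_arrowD[OF U k']
  note iK = sfun_id[OF K] and iK' = sfun_id[OF K']
  have whisk: "whisker_right \<alpha> j = whisker_left j \<beta>"
    unfolding whisker_left_def whisker_right_def
  proof (rule mk_nt_cong)
    show "NSrc \<alpha> \<circ>\<^sub>F j = j \<circ>\<^sub>F NSrc \<beta>"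
      using nt_ends[OF a] nt_ends[OF b] comp_id_left[OF small_funD(1)[OF j]] comp_id_right[OF small_funD(1)[OF j]] by simp
    show "NTgt \<alpha> \<circ>\<^sub>F j = j \<circ>\<^sub>F NTgt \<beta>"
      using nt_ends[OF a] nt_ends[OF b] comp_func_assoc[OF small_funD(1)[OF j] small_funD(1)[OF r] small_funD(1)[OF j]] by simp
  qed (use ab nt_ends[OF b] in simp)
  have jX: "pb j X \<in> ob K" using pb_ob[OF j X] .
  have aX: "cl \<alpha> X \<in> hm K' X (pb \<rho> (pb j X))"
    using cl_hm[OF a iK' X] pb_id[OF K' X] pb_comp[OF r j X] by simp
  have jaX: "pa j (cl \<alpha> X) = cl \<beta> (pb j X)"
    using cl_whisker_right[OF a iK' j X] cl_whisker_left[OF b iK j X] whisk by simp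
  show ?thesis
  proof (rule univ_arrowI[OF k P(1)])
    show "pa j \<theta> \<in> hm K (pb j X) (pb ?k P)"
      using pa_hm[OF j P(2)] pb_to_one[OF j P(1)] by simp
  next
    fix V g assume V: "V \<in> ob one_cat" and g: "g \<in> hm K (pb j X) (pb ?k V)"
    have rg: "pa \<rho> g \<in> hm K' (pb \<rho> (pb j X)) (pb ?k' V)"
      using pa_hm[OF r g] pb_to_one[OF r V] by simp
    \<comment> \<open>The right-hand side is the extension of \<open>g\<close> to a cone over
      \<open>K'\<close>.\<close>
    obtain h where h: "h \<in> hm one_cat P V" "pa ?k' h \<cdot>\<^bsub>K'\<^esub> \<theta> = pa \<rho> g \<cdot>\<^bsub>K'\<^esub> cl \<alpha> X"
      using univ_arrow_ex[OF U k' V cat_comp_hom[OF cK' rg aX]] .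
    have kV: "pb ?k V \<in> ob K" using pb_ob[OF k V] .
    have "pa ?k h \<cdot>\<^bsub>K\<^esub> pa j \<theta> = pa j (pa ?k' h \<cdot>\<^bsub>K'\<^esub> \<theta>)"
      using pa_dcomp[OF j pa_hm[OF k' h(1)] P(2)] pa_to_one[OF j h(1)] by simp
    also have "\<dots> = pa j (pa \<rho> g) \<cdot>\<^bsub>K\<^esub> cl \<beta> (pb j X)"
      unfolding h(2) using pa_dcomp[OF j rg aX] jaX by simp
    also have "\<dots> = cl \<beta> (pb ?k V) \<cdot>\<^bsub>K\<^esub> g"
      using cl_nat[OF b iK g] pa_id[OF K g] pa_comp[OF j r g] by simp
    also have "\<dots> = g" using cl_const[OF b iK V] cat_id_left[OF cK g] by simp
    finally show "\<exists>h. h \<in> hm one_cat P V \<and> pa ?k h \<cdot>\<^bsub>K\<^esub> pa j \<theta> = g" using h(1) by blast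
  next
    fix V h h' assume V: "V \<in> ob one_cat" and h: "h \<in> hm one_cat P V" and h': "h' \<in> hm one_cat P V"
      and e: "pa ?k h \<cdot>\<^bsub>K\<^esub> pa j \<theta> = pa ?k h' \<cdot>\<^bsub>K\<^esub> pa j \<theta>"
    let ?f = "pa ?k' h \<cdot>\<^bsub>K'\<^esub> \<theta>" and ?f' = "pa ?k' h' \<cdot>\<^bsub>K'\<^esub> \<theta>"
    note fh = cat_comp_hom[OF cK' pa_hm[OF k' h] P(2)] cat_comp_hom[OF cK' pa_hm[OF k' h'] P(2)]
    have "pa j ?f = pa j ?f'"
      using pa_dcomp[OF j pa_hm[OF k' h] P(2)] pa_to_one[OF j h] pa_dcomp[OF j pa_hm[OF k' h'] P(2)] pa_to_one[OF j h'] e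
      by simp
    then have "pa (j \<circ>\<^sub>F \<rho>) ?f = pa (j \<circ>\<^sub>F \<rho>) ?f'"
      using pa_comp[OF r j fh(1)] pa_comp[OF r j fh(2)] by simp
    \<comment> \<open>Naturality of \<open>\<alpha>\<close> recovers a cone on \<open>K'\<close>
      from its restriction along \<open>j\<close>, since \<open>\<alpha>\<close> is the identity at
      the constant object.\<close>
    then have "cl \<alpha> (pb ?k' V) \<cdot>\<^bsub>K'\<^esub> ?f = cl \<alpha> (pb ?k' V) \<cdot>\<^bsub>K'\<^esub> ?f'"
      using cl_nat[OF a iK' fh(1)] cl_nat[OF a iK' fh(2)] pa_id[OF K' fh(1)] pa_id[OF K' fh(2)] by simp
    then have "?f = ?f'" using cl_const[OF a iK' V] cat_id_left[OF cK' fh(1)] cat_id_left[OF cK' fh(2)] by simp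
    then show "h = h'" using univ_arrow_eq[OF U k' h h'] by blast
  qed
qed

text \<open>Der4 in terms of universal arrows: the value at \<open>b\<close> of the Kan extension is
  a colimit over the comma category, with cone induced by the unit. The mate is invertible, and the
  universal arrow of the comma category is transported along it.\<close>

lemma over_univ_arrow:
  assumes u: "sfun A B u" and b: "b \<in> Obj B" and X: "X \<in> ob A"
  shows "univ_arrow (to_one (over_cat u b)) (pb (over_proj u b) X) (pb (point B b) (lo u X))
    (cl (over_cell u b) (lo u X) \<cdot>\<^bsub>over_cat u b\<^esub> pa (over_proj u b) (lu u X))"
proof -
  note pr = sfun_over_proj[OF u, of b]
  note k = sfun_to_one[OF small_funD(2)[OF pr]]
  note pt = sfun_point[OF small_funD(3)[OF u] b]
  let ?m = "mate_left D (over_proj u b) u (to_one (over_cat u b)) (point B b) (over_cell u b) X"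
  note m = mate_left_char[OF pr u k pt over_cell[OF small_funD(1)[OF u] b] X]
  have "is_iso (D0 D one_cat) ?m"
    using Der4 small_funI[OF u] b X small_funD(4,5)[OF u] unfolding Der4_def by blast
  then show ?thesis
    using univ_arrow_transport[OF lan_univ[OF k pb_ob[OF pr X]] k m(1)] m(2) by simp
qed

text \<open>
  A commutative square is exact as soon as the induced functors between the comma categories
  are final, here witnessed by a homotopy retraction \<open>\<rho>\<close>.
\<close>

lemma strict_exact:
  assumes p: "sfun E A p" and u: "sfun A B u" and q: "sfun E C q" and v: "sfun C B v"
    and sq: "u \<circ>\<^sub>F p = v \<circ>\<^sub>F q" and X: "X \<in> ob A"
    and crit: "\<And>c j. c \<in> Obj C \<Longrightarrow> j = over_lift u (FO v c) (p \<circ>\<^sub>F over_proj q c) (\<lambda>x. FA v (psnd x)) \<Longrightarrow>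
       functor_from_to (over_cat q c) (over_cat u (FO v c)) j \<Longrightarrow>
      \<exists>\<rho> \<alpha> \<beta>. functor_from_to (over_cat u (FO v c)) (over_cat q c) \<rho> \<and>
        ntrans_from_to (id_func (over_cat u (FO v c))) (j \<circ>\<^sub>F \<rho>) \<alpha> \<and>
        ntrans_from_to (id_func (over_cat q c)) (\<rho> \<circ>\<^sub>F j) \<beta> \<and>
        (\<forall>x\<in>Obj (over_cat q c). At \<alpha> (FO j x) = FA j (At \<beta> x))"
  shows "univ_arrow q (pb p X) (pb v (lo u X)) (pa p (lu u X))"
proof -
  let ?Z = "lo u X"
  note UX = univ_arrowD[OF lan_univ[OF u X] u]
  note pX = pb_ob[OF p X]
  note Uq = lan_univ[OF q pX]
  note Q = univ_arrowD[OF Uq q]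
  note C = small_funD(2)[OF v]
  have ph: "pa p (lu u X) \<in> hm E (pb p X) (pb q (pb v ?Z))"
    using pa_hm[OF p UX(2)] pb_sq[OF sq q v p u UX(1)] by simp
  \<comment> \<open>\<open>m\<close> is the comparison map of the square. If it is invertible,
    transporting the universal arrow of \<open>q\<close> along it gives the claim.\<close>
  obtain m where m: "m \<in> hm C (lo q (pb p X)) (pb v ?Z)" "pa q m \<cdot>\<^bsub>E\<^esub> lu q (pb p X) = pa p (lu u X)"
    using univ_arrow_ex[OF Uq q pb_ob[OF v UX(1)] ph] .
  \<comment> \<open>By Der2 invertibility is tested at each object \<open>c\<close>, where both ends
    of \<open>m\<close> are colimits over comma categories.\<close>
  have "is_iso (D0 D one_cat) (pa (point C c) m)" if c: "c \<in> Obj C" for c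
  proof -
    let ?K = "over_cat q c" and ?K' = "over_cat u (FO v c)"
    let ?pr = "over_proj q c" and ?pr' = "over_proj u (FO v c)"
    define j where "j = over_lift u (FO v c) (p \<circ>\<^sub>F ?pr) (\<lambda>x. FA v (psnd x))"
    have vc: "FO v c \<in> Obj B" using fun_obj[OF small_funD(1)[OF v] c] .
    note pr = sfun_over_proj[OF q, of c] and pr' = sfun_over_proj[OF u, of "FO v c"]
    note K = small_funD(2)[OF pr] and K' = small_funD(2)[OF pr']
    note k = sfun_to_one[OF K] and k' = sfun_to_one[OF K']
    note pt = sfun_point[OF C c] and pt' = sfun_point[OF small_funD(3)[OF v] vc]
    note ppr = sfun_comp[OF pr p]
    have j: "functor_from_to ?K ?K' j" unfolding j_def
    proof (rule functor_over_lift[OF small_funD(1)[OF u] small_funD(1)[OF ppr]])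
      fix x assume "x \<in> Obj ?K"
      then obtain e h where x: "x = Pair e h" "e \<in> Obj E" "h \<in> Hom C (FO q e) c" "x \<in> Obj ?K"
        by (auto elim!: over_objE simp: small_funD[OF q])
      have "FO u (FO p e) = FO v (FO q e)"
        using arg_cong[OF sq, of "\<lambda>f. FO f e"] x(2) by (simp add: small_funD[OF p] small_funD[OF q])
      then show "FA v (psnd x) \<in> Hom B (FO u (FO (p \<circ>\<^sub>F ?pr) x)) (FO v c)"
        using fun_hom[OF small_funD(1)[OF v] x(3)] x(1,4) by simp
    next
      fix f x y assume f: "f \<in> Hom ?K x y" and x: "x \<in> Obj ?K" and y: "y \<in> Obj ?K"
      obtain h where h: "f = Pair (Pair x y) h" "h \<in> Hom E (pfst x) (pfst y)" "Comp C (psnd y) (FA q h) = psnd x"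
        using over_homE[OF f] by (auto simp: small_funD[OF q])
      have ps: "psnd y \<in> Hom C (FO q (pfst y)) c" using y by (auto elim!: over_objE simp: small_funD[OF q])
      have "FA u (FA p h) = FA v (FA q h)"
        using arg_cong[OF sq, of "\<lambda>f. FA f h"] comp_func_FA[of h p _ _ u] comp_func_FA[of h q _ _ v] h(2)
        by (auto simp: small_funD[OF p] small_funD[OF q])
      moreover have "FA (p \<circ>\<^sub>F ?pr) f = FA p h"
        using comp_func_FA[of f ?pr x y p] f h(1) by simp
      ultimately show "Comp B (FA v (psnd y)) (FA u (FA (p \<circ>\<^sub>F ?pr) f)) = FA v (psnd x)"
        using fun_comp[OF small_funD(1)[OF v] ps fun_hom[OF small_funD(1)[OF q] h(2)]] h(3) by simp
    qed
    then have sj: "sfun ?K ?K' j" using K K' by (simp add: small_fun_def)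
    obtain \<rho> \<alpha> \<beta> where r: "functor_from_to ?K' ?K \<rho>" and a: "ntrans_from_to (id_func ?K') (j \<circ>\<^sub>F \<rho>) \<alpha>"
      and b: "ntrans_from_to (id_func ?K) (\<rho> \<circ>\<^sub>F j) \<beta>"
      and ab: "\<And>x. x\<in>Obj ?K \<Longrightarrow> At \<alpha> (FO j x) = FA j (At \<beta> x)"
      using crit[OF c j_def j] by blast
    have sr: "sfun ?K' ?K \<rho>" using r K K' by (simp add: small_fun_def)
    have prj: "?pr' \<circ>\<^sub>F j = p \<circ>\<^sub>F ?pr"
    proof (rule functor_eqI[OF functor_comp[OF j small_funD(1)[OF pr']] small_funD(1)[OF ppr]])
      fix x assume x: "x \<in> Obj ?K"
      then show "FO (?pr' \<circ>\<^sub>F j) x = FO (p \<circ>\<^sub>F ?pr) x"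
        using fun_obj[OF j x] by (simp add: functor_ends[OF j]) (simp add: j_def)
    next
      fix f x y assume f: "f \<in> Hom ?K x y"
      then show "FA (?pr' \<circ>\<^sub>F j) f = FA (p \<circ>\<^sub>F ?pr) f"
        using fun_hom[OF j f] comp_func_FA[of f j x y ?pr'] by (simp add: functor_ends[OF j]) (simp add: j_def)
    qed
    have ptv: "v \<circ>\<^sub>F point C c = point B (FO v c)" using functor_comp_point[OF small_funD(1)[OF v] c] .
    have ptZ: "pb (point C c) (pb v ?Z) = pb (point B (FO v c)) ?Z" using pb_comp[OF pt v UX(1)] ptv by simp
    have prX: "pb j (pb ?pr' X) = pb ?pr (pb p X)" using pb_sq[OF prj[symmetric] sj pr' pr p X] .
    let ?cq = "over_cell q c" and ?cu = "over_cell u (FO v c)"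
    note cq = over_cell[OF small_funD(1)[OF q] c] and cu = over_cell[OF small_funD(1)[OF u] vc]
    note qpr = sfun_comp[OF pr q] and upr' = sfun_comp[OF pr' u]
    have vZ: "pb v ?Z \<in> ob C" using pb_ob[OF v UX(1)] .
    \<comment> \<open>\<open>j\<close> sends \<open>(e, h)\<close> to \<open>(p e, v h)\<close>. So
      the tautological 2-cell of \<open>(q/c)\<close>, pushed forward by \<open>v\<close>, is that
      of \<open>(u/v c)\<close> restricted along \<open>j\<close>.\<close>
    have cell: "cl ?cq (pb v ?Z) = pa j (cl ?cu ?Z)"
    proof -
      have "whisker_left v ?cq = whisker_right ?cu j"
        unfolding whisker_left_def whisker_right_def nt_ends[OF cq] nt_ends[OF cu]
      proof (rule mk_nt_cong)
        have "v \<circ>\<^sub>F q \<circ>\<^sub>F ?pr = (u \<circ>\<^sub>F p) \<circ>\<^sub>F ?pr"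
          using comp_func_assoc[OF small_funD(1)[OF pr] small_funD(1)[OF q] small_funD(1)[OF v]] sq by simp
        also have "\<dots> = u \<circ>\<^sub>F p \<circ>\<^sub>F ?pr"
          using comp_func_assoc[OF small_funD(1)[OF pr] small_funD(1)[OF p] small_funD(1)[OF u]] by simp
        also have "\<dots> = (u \<circ>\<^sub>F ?pr') \<circ>\<^sub>F j"
          using comp_func_assoc[OF j small_funD(1)[OF pr'] small_funD(1)[OF u]] prj by simp
        finally show "v \<circ>\<^sub>F q \<circ>\<^sub>F ?pr = (u \<circ>\<^sub>F ?pr') \<circ>\<^sub>F j" .
        have "to_one ?K' \<circ>\<^sub>F j = to_one ?K"
          by (rule to_one_eq[OF functor_comp[OF j small_funD(1)[OF k']] small_funD(1)[OF k]])
        then have "(point B (FO v c) \<circ>\<^sub>F to_one ?K') \<circ>\<^sub>F j = point B (FO v c) \<circ>\<^sub>F to_one ?K"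
          using comp_func_assoc[OF j small_funD(1)[OF k'] small_funD(1)[OF pt']] by simp
        then show "v \<circ>\<^sub>F point C c \<circ>\<^sub>F to_one ?K = (point B (FO v c) \<circ>\<^sub>F to_one ?K') \<circ>\<^sub>F j"
          using comp_func_assoc[OF small_funD(1)[OF k] small_funD(1)[OF pt] small_funD(1)[OF v]] ptv by simp
        fix x assume "x \<in> Obj (Src ((u \<circ>\<^sub>F ?pr') \<circ>\<^sub>F j))"
        then have x: "x \<in> Obj ?K" by (simp add: functor_ends[OF j])
        then show "FA v (At ?cq x) = At ?cu (FO j x)"
          using fun_obj[OF j x] by simp (simp add: j_def)
      qed
      then show ?thesis
        using cl_whisker_left[OF cq qpr v UX(1)] cl_whisker_right[OF cu upr' sj UX(1)] by simp
    qed
    note V = over_univ_arrow[OF q c pX]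
    note V' = over_univ_arrow[OF u vc X]
    have cuh: "cl ?cu ?Z \<in> hm ?K' (pb ?pr' (pb u ?Z)) (pb (to_one ?K') (pb (point B (FO v c)) ?Z))"
      using cl_hm[OF cu upr' UX(1)] pb_comp[OF pr' u UX(1)] pb_comp[OF k' pt' UX(1)] by simp
    \<comment> \<open>Finality of \<open>j\<close> turns the colimit cone over
      \<open>(u/v c)\<close> into a colimit cone over \<open>(q/c)\<close> with the same
      vertex.\<close>
    have W: "univ_arrow (to_one ?K) (pb ?pr (pb p X)) (pb (point C c) (pb v ?Z)) (pa j (cl ?cu ?Z \<cdot>\<^bsub>?K'\<^esub> pa ?pr' (lu u X)))"
      using final_univ_arrow[OF sj sr a b ab V' pb_ob[OF pr' X]] prX ptZ by simp
    have cqh: "cl ?cq (lo q (pb p X)) \<in> hm ?K (pb ?pr (pb q (lo q (pb p X)))) (pb (to_one ?K) (pb (point C c) (lo q (pb p X))))"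
      using cl_hm[OF cq qpr Q(1)] pb_comp[OF pr q Q(1)] pb_comp[OF k pt Q(1)] by simp
    have cqh': "cl ?cq (pb v ?Z) \<in> hm ?K (pb ?pr (pb q (pb v ?Z))) (pb (to_one ?K) (pb (point C c) (pb v ?Z)))"
      using cl_hm[OF cq qpr vZ] pb_comp[OF pr q vZ] pb_comp[OF k pt vZ] by simp
    note cK = dcat[OF K]
    \<comment> \<open>The value of \<open>m\<close> at \<open>c\<close> carries the colimit cone
      coming from \<open>q\<close> to the one coming from \<open>u\<close>, so it is an isomorphism
      between two colimits of the same diagram.\<close>
    have "pa (to_one ?K) (pa (point C c) m) \<cdot>\<^bsub>?K\<^esub> (cl ?cq (lo q (pb p X)) \<cdot>\<^bsub>?K\<^esub> pa ?pr (lu q (pb p X))) =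
      (pa (to_one ?K) (pa (point C c) m) \<cdot>\<^bsub>?K\<^esub> cl ?cq (lo q (pb p X))) \<cdot>\<^bsub>?K\<^esub> pa ?pr (lu q (pb p X))"
      using cat_assoc[OF cK pa_hm[OF k pa_hm[OF pt m(1)]] cqh pa_hm[OF pr Q(2)]] by simp
    also have "\<dots> = (cl ?cq (pb v ?Z) \<cdot>\<^bsub>?K\<^esub> pa ?pr (pa q m)) \<cdot>\<^bsub>?K\<^esub> pa ?pr (lu q (pb p X))"
      using cl_nat[OF cq qpr m(1)] pa_comp[OF pr q m(1)] pa_comp[OF k pt m(1)] by simp
    also have "\<dots> = cl ?cq (pb v ?Z) \<cdot>\<^bsub>?K\<^esub> pa ?pr (pa q m \<cdot>\<^bsub>E\<^esub> lu q (pb p X))"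
      using cat_assoc[OF cK cqh' pa_hm[OF pr pa_hm[OF q m(1)]] pa_hm[OF pr Q(2)]] pa_dcomp[OF pr pa_hm[OF q m(1)] Q(2)]
      by simp
    also have "\<dots> = pa j (cl ?cu ?Z) \<cdot>\<^bsub>?K\<^esub> pa j (pa ?pr' (lu u X))"
      unfolding m(2) cell using pa_sq[OF prj[symmetric] sj pr' pr p UX(2)] by simp
    also have "\<dots> = pa j (cl ?cu ?Z \<cdot>\<^bsub>?K'\<^esub> pa ?pr' (lu u X))"
      using pa_dcomp[OF sj cuh pa_hm[OF pr' UX(2)]] by simp
    finally show ?thesis
      using univ_arrow_iso[OF V W k pa_hm[OF pt m(1)]] by blast
  qed
  then have "is_iso (D0 D C) m"
    using Der2 C homD[OF m(1)] unfolding Der2_def by blast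
  then show ?thesis using univ_arrow_transport[OF Uq q m(1)] m(2) by simp
qed

text \<open>The comma category at \<open>(b, c)\<close> is the product of \<open>(u/b)\<close> with
  the slice of \<open>C\<close> over \<open>c\<close>, and this slice has the terminal object
  \<open>(c, id)\<close>; on the other side the slice is that of \<open>C'\<close> over
  \<open>w c\<close>. Collapsing the slice factor to its terminal object gives the retraction
  required by \<open>strict_exact\<close>. The outcome is that left Kan extension along
  \<open>u\<close> commutes with change of parameters.\<close>

lemma product_exact:
  assumes u: "sfun A B u" and w: "sfun C C' w" and X: "X \<in> ob (prod_cat A C')"
  shows "univ_arrow (prod_func u (id_func C)) (pb (prod_func (id_func A) w) X)
    (pb (prod_func (id_func B) w) (lo (prod_func u (id_func C')) X))
    (pa (prod_func (id_func A) w) (lu (prod_func u (id_func C')) X))"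
proof -
  note sA = small_funD(2)[OF u] and sB = small_funD(3)[OF u] and sC = small_funD(2)[OF w] and sC' = small_funD(3)[OF w]
  note fu = small_funD(1)[OF u] and fw = small_funD(1)[OF w]
  note cA = small_funD(6)[OF u] and cB = small_funD(7)[OF u] and cC = small_funD(6)[OF w] and cC' = small_funD(7)[OF w]
  note fA = functor_id[OF cA] and fB = functor_id[OF cB] and fC = functor_id[OF cC] and fC' = functor_id[OF cC']
  let ?p = "prod_func (id_func A) w" and ?v = "prod_func (id_func B) w"
  let ?q = "prod_func u (id_func C)" and ?r = "prod_func u (id_func C')"
  have p: "sfun (prod_cat A C) (prod_cat A C') ?p" using sfun_prod[OF sfun_id[OF sA] w] .
  have v: "sfun (prod_cat B C) (prod_cat B C') ?v" using sfun_prod[OF sfun_id[OF sB] w] .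
  have q: "sfun (prod_cat A C) (prod_cat B C) ?q" using sfun_prod[OF u sfun_id[OF sC]] .
  have r: "sfun (prod_cat A C') (prod_cat B C') ?r" using sfun_prod[OF u sfun_id[OF sC']] .
  have sq: "?r \<circ>\<^sub>F ?p = ?v \<circ>\<^sub>F ?q"
    using prod_func_comp[OF fA fw fu fC'] prod_func_comp[OF fu fC fB fw]
      comp_id_left[OF fu] comp_id_left[OF fw] comp_id_right[OF fu] comp_id_right[OF fw] by simp
  note [simp] = small_funD(4,5)[OF u] small_funD(4,5)[OF w]
  show ?thesis
  proof (rule strict_exact[OF p r q v sq X])
    fix c0 j assume "c0 \<in> Obj (prod_cat B C)"
    then obtain b c where c0: "c0 = Pair b c" and b: "b \<in> Obj B" and c: "c \<in> Obj C" by (rule prod_objE)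
    define c1 where "c1 = FO ?v c0"
    have c1: "c1 = Pair b (FO w c)" using b c by (simp add: c1_def c0)
    let ?K = "over_cat ?q c0" and ?K' = "over_cat ?r (FO ?v c0)"
    assume j: "j = over_lift ?r (FO ?v c0) (?p \<circ>\<^sub>F over_proj ?q c0) (\<lambda>x. FA ?v (psnd x))" and fj: "functor_from_to ?K ?K' j"
    note fr = small_funD(1)[OF r] and fq = small_funD(1)[OF q] and fp = small_funD(1)[OF p]
    have K'E: "\<exists>a x f g. k = Pair (Pair a x) (Pair f g) \<and> a \<in> Obj A \<and> x \<in> Obj C' \<and> f \<in> Hom B (FO u a) b \<and> g \<in> Hom C' x (FO w c)"
      if "k \<in> Obj ?K'" for k
      using that unfolding c1_def[symmetric] c1 by (auto elim!: over_objE prod_objE prod_homE)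
    have KE: "\<exists>a x f g. k = Pair (Pair a x) (Pair f g) \<and> a \<in> Obj A \<and> x \<in> Obj C \<and> f \<in> Hom B (FO u a) b \<and> g \<in> Hom C x c"
      if "k \<in> Obj ?K" for k
      using that unfolding c0 by (auto elim!: over_objE prod_objE prod_homE)
    note [simp del] = over_cat_obj
    \<comment> \<open>The underlying functor of the retraction keeps the \<open>A\<close> coordinate
      and replaces the parameter by the constant \<open>c\<close>.\<close>
    define F where "F = prod_func (id_func A) (point C c \<circ>\<^sub>F to_one C') \<circ>\<^sub>F over_proj ?r (FO ?v c0)"
    have fF: "functor_from_to ?K' (prod_cat A C) F"
      unfolding F_def using functor_comp[OF functor_over_proj[OF fr]
          functor_prod[OF fA functor_comp[OF functor_to_one[OF cC'] functor_point[OF cC c]]]] .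
    have FO: "FO F (Pair (Pair a x) (Pair f g)) = Pair a c" if "Pair (Pair a x) (Pair f g) \<in> Obj ?K'" for a x f g
    proof -
      have "FO F (Pair (Pair a x) (Pair f g)) = FO (prod_func (id_func A) (point C c \<circ>\<^sub>F to_one C')) (Pair a x)"
        using that unfolding F_def by simp
      then show ?thesis using K'E[OF that] by simp
    qed
    have K'hom: "\<exists>a x f g a' x' f' g' h k. x0 = Pair (Pair a x) (Pair f g) \<and> y0 = Pair (Pair a' x') (Pair f' g') \<and>
        k0 = Pair (Pair x0 y0) (Pair h k) \<and> h \<in> Hom A a a' \<and> k \<in> Hom C' x x' \<and> Comp B f' (FA u h) = f \<and> Comp C' g' k = g \<and>
        f' \<in> Hom B (FO u a') b \<and> g' \<in> Hom C' x' (FO w c) \<and> f \<in> Hom B (FO u a) b \<and> g \<in> Hom C' x (FO w c)"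
      if k0: "k0 \<in> Hom ?K' x0 y0" for k0 x0 y0
    proof -
      obtain hk where *: "k0 = Pair (Pair x0 y0) hk" "x0 \<in> Obj ?K'" "y0 \<in> Obj ?K'" "hk \<in> Hom (prod_cat A C') (pfst x0) (pfst y0)"
        "Comp (prod_cat B C') (psnd y0) (FA ?r hk) = psnd x0"
        using over_homE[OF k0] by simp metis
      obtain a x f g where x0: "x0 = Pair (Pair a x) (Pair f g)" "f \<in> Hom B (FO u a) b" "g \<in> Hom C' x (FO w c)"
        using K'E[OF *(2)] by blast
      obtain a' x' f' g' where y0: "y0 = Pair (Pair a' x') (Pair f' g')" "f' \<in> Hom B (FO u a') b" "g' \<in> Hom C' x' (FO w c)"
        using K'E[OF *(3)] by blast
      obtain h k where hk: "hk = Pair h k" "h \<in> Hom A a a'" "k \<in> Hom C' x x'"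
        using *(4) unfolding x0 y0 by (auto elim!: prod_homE)
      have "Comp B f' (FA u h) = f \<and> Comp C' g' k = g"
        using *(5) prod_comp[OF y0(2) fun_hom[OF fu hk(2)] y0(3) hk(3)] prod_func_simps(4)[of h u a a' k "id_func C'" x x'] hk
        unfolding x0 y0 by simp
      then show ?thesis using x0 y0 hk * by blast
    qed
    have FA: "FA F k0 = Pair (pfst (psnd k0)) (Ident C c)" if k0: "k0 \<in> Hom ?K' x0 y0" for k0 x0 y0
    proof -
      obtain a x f g a' x' f' g' h k where *: "k0 = Pair (Pair x0 y0) (Pair h k)" "h \<in> Hom A a a'" "k \<in> Hom C' x x'"
        using K'hom[OF k0] by blast
      have "FA F k0 = FA (prod_func (id_func A) (point C c \<circ>\<^sub>F to_one C')) (Pair h k)"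
        unfolding F_def using comp_func_FA[of k0 "over_proj ?r (FO ?v c0)" x0 y0] k0 *(1) by simp
      then show ?thesis using prod_func_simps(4)[of h "id_func A" a a' k "point C c \<circ>\<^sub>F to_one C'" x x'] *
          comp_func_FA[of k "to_one C'" x x' "point C c"] by simp
    qed
    define \<rho> where "\<rho> = over_lift ?q c0 F (\<lambda>x. Pair (pfst (psnd x)) (Ident C c))"
    have Ic: "Ident C c \<in> Hom C c c" using cat_ident_hom[OF cC c] .
    have f\<rho>: "functor_from_to ?K' ?K \<rho>" unfolding \<rho>_def
    proof (rule functor_over_lift[OF fq fF])
      fix x0 assume x0: "x0 \<in> Obj ?K'"
      then obtain a x f g where *: "x0 = Pair (Pair a x) (Pair f g)" "f \<in> Hom B (FO u a) b" "a \<in> Obj A"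
        using K'E by metis
      show "Pair (pfst (psnd x0)) (Ident C c) \<in> Hom (prod_cat B C) (FO ?q (FO F x0)) c0"
        using FO x0 * c Ic by (simp add: c0)
    next
      fix k0 x0 y0 assume k0: "k0 \<in> Hom ?K' x0 y0"
      then obtain a x f g a' x' f' g' h k where *: "x0 = Pair (Pair a x) (Pair f g)" "y0 = Pair (Pair a' x') (Pair f' g')"
        "k0 = Pair (Pair x0 y0) (Pair h k)" "h \<in> Hom A a a'" "Comp B f' (FA u h) = f" "f' \<in> Hom B (FO u a') b"
        using K'hom[OF k0] by blast
      have "FA ?q (FA F k0) = Pair (FA u h) (Ident C c)"
        using FA[OF k0] *(3,4) prod_func_simps(4)[of h u a a' "Ident C c" "id_func C" c c] Ic by simp
      then show "Comp (prod_cat B C) (Pair (pfst (psnd y0)) (Ident C c)) (FA ?q (FA F k0)) = Pair (pfst (psnd x0)) (Ident C c)"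
        using prod_comp[OF *(6) fun_hom[OF fu *(4)] Ic Ic] *(1,2,5) cat_id_left[OF cC Ic] by simp
    qed
    have jO: "FO j (Pair (Pair a x) (Pair f g)) = Pair (Pair a (FO w x)) (Pair f (FA w g))"
      if "Pair (Pair a x) (Pair f g) \<in> Obj ?K" for a x f g
      using that KE[OF that] unfolding j by (auto simp: prod_func_simps(4)[of f "id_func B" _ _ g w])
    have \<rho>O: "FO \<rho> (Pair (Pair a x) (Pair f g)) = Pair (Pair a c) (Pair f (Ident C c))"
      if "Pair (Pair a x) (Pair f g) \<in> Obj ?K'" for a x f g
      using that FO[OF that] unfolding \<rho>_def by (simp add: functor_ends[OF fF])
    have fw1: "FA w (Ident C c) = Ident C' (FO w c)" using fun_ident[OF fw c] .
    have jA: "FA j k0 = Pair (Pair (FO j x0) (FO j y0)) (FA ?p (psnd k0))" if k0: "k0 \<in> Hom ?K x0 y0" for k0 x0 y0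
    proof -
      have o: "x0 \<in> Obj ?K" "y0 \<in> Obj ?K" using hom_obj[OF functor_cat(1)[OF fj] k0] by auto
      show ?thesis using k0 o comp_func_FA[of k0 "over_proj ?q c0" x0 y0 ?p] unfolding j by simp
    qed
    have \<rho>A: "FA \<rho> k0 = Pair (Pair (FO \<rho> x0) (FO \<rho> y0)) (Pair (pfst (psnd k0)) (Ident C c))" if k0: "k0 \<in> Hom ?K' x0 y0" for k0 x0 y0
    proof -
      have o: "x0 \<in> Obj ?K'" "y0 \<in> Obj ?K'" using hom_obj[OF functor_cat(1)[OF f\<rho>] k0] by auto
      show ?thesis using k0 o FA[OF k0] unfolding \<rho>_def by (simp add: functor_ends[OF fF])
    qed
    \<comment> \<open>Identity on the \<open>A\<close> coordinate, and on the parameter the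
      structure arrow into the terminal object of the slice. One formula gives both 2-cells.\<close>
    let ?t = "\<lambda>x. Pair (Ident A (pfst (pfst x))) (psnd (psnd x))"
    let ?\<alpha> = "over_nt (id_func ?K') (j \<circ>\<^sub>F \<rho>) ?t" and ?\<beta> = "over_nt (id_func ?K) (\<rho> \<circ>\<^sub>F j) ?t"
    have jr: "FO j (FO \<rho> (Pair (Pair a x) (Pair f g))) = Pair (Pair a (FO w c)) (Pair f (Ident C' (FO w c)))"
      if "Pair (Pair a x) (Pair f g) \<in> Obj ?K'" for a x f g
      using fun_obj[OF f\<rho> that] \<rho>O[OF that] jO[of a c f "Ident C c"] fw1 by simp
    have rj: "FO \<rho> (FO j (Pair (Pair a x) (Pair f g))) = Pair (Pair a c) (Pair f (Ident C c))"
      if "Pair (Pair a x) (Pair f g) \<in> Obj ?K" for a x f g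
      using fun_obj[OF fj that] jO[OF that] \<rho>O[of a "FO w x" f "FA w g"] by simp
    have a: "ntrans_from_to (id_func ?K') (j \<circ>\<^sub>F \<rho>) ?\<alpha>"
    proof (rule over_nt[OF fr functor_id[OF functor_cat(2)[OF fj]] functor_comp[OF f\<rho> fj]])
      fix x0 assume x0: "x0 \<in> Obj ?K'"
      then obtain a x f g where *: "x0 = Pair (Pair a x) (Pair f g)" "f \<in> Hom B (FO u a) b" "a \<in> Obj A" "g \<in> Hom C' x (FO w c)"
        using K'E by metis
      have Fx: "FO (j \<circ>\<^sub>F \<rho>) x0 = Pair (Pair a (FO w c)) (Pair f (Ident C' (FO w c)))"
        using jr x0 *(1) by (simp add: functor_ends[OF f\<rho>])
      show "?t x0 \<in> Hom (prod_cat A C') (pfst (FO (id_func ?K') x0)) (pfst (FO (j \<circ>\<^sub>F \<rho>) x0))"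
        unfolding Fx using x0 * cat_ident_hom[OF cA *(3)] by simp
      have "FA ?r (?t x0) = Pair (Ident B (FO u a)) g"
        using prod_func_simps(4)[of "Ident A a" u a a g "id_func C'" x "FO w c"] * cat_ident_hom[OF cA *(3)] fun_ident[OF fu *(3)] by simp
      then show "Comp (prod_cat B C') (psnd (FO (j \<circ>\<^sub>F \<rho>) x0)) (FA ?r (?t x0)) = psnd (FO (id_func ?K') x0)"
        unfolding Fx using x0 prod_comp[OF *(2) cat_ident_hom[OF cB fun_obj[OF fu *(3)]] cat_ident_hom[OF cC' fun_obj[OF fw c]] *(4)]
          cat_id_left[OF cC' *(4)] cat_id_right[OF cB *(2)] *(1) by simp
    next
      fix k0 x0 y0 assume k0: "k0 \<in> Hom ?K' x0 y0"
      then obtain a x f g a' x' f' g' h k where *: "x0 = Pair (Pair a x) (Pair f g)" "y0 = Pair (Pair a' x') (Pair f' g')"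
        "k0 = Pair (Pair x0 y0) (Pair h k)" "h \<in> Hom A a a'" "k \<in> Hom C' x x'" "Comp C' g' k = g" "g' \<in> Hom C' x' (FO w c)" "g \<in> Hom C' x (FO w c)"
        using K'hom[OF k0] by blast
      have "psnd (FA (j \<circ>\<^sub>F \<rho>) k0) = FA ?p (Pair h (Ident C c))"
        using comp_func_FA[of k0 \<rho> x0 y0 j] k0 jA[OF fun_hom[OF f\<rho> k0]] \<rho>A[OF k0] *(3) by (simp add: functor_ends[OF f\<rho>])
      also have "\<dots> = Pair h (Ident C' (FO w c))"
        using prod_func_simps(4)[of h "id_func A" a a' "Ident C c" w c c] *(4) Ic fw1 by simp
      finally have 1: "psnd (FA (j \<circ>\<^sub>F \<rho>) k0) = Pair h (Ident C' (FO w c))" .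
      have aa: "a \<in> Obj A" "a' \<in> Obj A" using hom_obj[OF cA *(4)] by auto
      show "Comp (prod_cat A C') (?t y0) (psnd (FA (id_func ?K') k0)) = Comp (prod_cat A C') (psnd (FA (j \<circ>\<^sub>F \<rho>) k0)) (?t x0)"
        unfolding 1 id_func_simps(4)[OF k0] using *(1,2,3,6) prod_comp[OF cat_ident_hom[OF cA aa(2)] *(4) *(7,5)]
          prod_comp[OF *(4) cat_ident_hom[OF cA aa(1)] cat_ident_hom[OF cC' fun_obj[OF fw c]] *(8)]
          cat_id_left[OF cC' *(8)] cat_id_left[OF cA *(4)] cat_id_right[OF cA *(4)] by simp
    qed
    have b: "ntrans_from_to (id_func ?K) (\<rho> \<circ>\<^sub>F j) ?\<beta>"
    proof (rule over_nt[OF fq functor_id[OF functor_cat(1)[OF fj]] functor_comp[OF fj f\<rho>]])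
      fix x0 assume x0: "x0 \<in> Obj ?K"
      then obtain a x f g where *: "x0 = Pair (Pair a x) (Pair f g)" "f \<in> Hom B (FO u a) b" "a \<in> Obj A" "g \<in> Hom C x c"
        using KE by metis
      have Fx: "FO (\<rho> \<circ>\<^sub>F j) x0 = Pair (Pair a c) (Pair f (Ident C c))"
        using rj x0 *(1) by (simp add: functor_ends[OF fj])
      show "?t x0 \<in> Hom (prod_cat A C) (pfst (FO (id_func ?K) x0)) (pfst (FO (\<rho> \<circ>\<^sub>F j) x0))"
        unfolding Fx using x0 * cat_ident_hom[OF cA *(3)] by simp
      have "FA ?q (?t x0) = Pair (Ident B (FO u a)) g"
        using prod_func_simps(4)[of "Ident A a" u a a g "id_func C" x c] * cat_ident_hom[OF cA *(3)] fun_ident[OF fu *(3)] by simp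
      then show "Comp (prod_cat B C) (psnd (FO (\<rho> \<circ>\<^sub>F j) x0)) (FA ?q (?t x0)) = psnd (FO (id_func ?K) x0)"
        unfolding Fx using x0 prod_comp[OF *(2) cat_ident_hom[OF cB fun_obj[OF fu *(3)]] Ic *(4)]
          cat_id_left[OF cC *(4)] cat_id_right[OF cB *(2)] *(1) by simp
    next
      fix k0 x0 y0 assume k0: "k0 \<in> Hom ?K x0 y0"
      obtain hk where h1: "k0 = Pair (Pair x0 y0) hk" "x0 \<in> Obj ?K" "y0 \<in> Obj ?K" "hk \<in> Hom (prod_cat A C) (pfst x0) (pfst y0)"
        "Comp (prod_cat B C) (psnd y0) (FA ?q hk) = psnd x0"
        using over_homE[OF k0] by simp metis
      obtain a x f g where x0: "x0 = Pair (Pair a x) (Pair f g)" "f \<in> Hom B (FO u a) b" "g \<in> Hom C x c"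
        using KE[OF h1(2)] by blast
      obtain a' x' f' g' where y0: "y0 = Pair (Pair a' x') (Pair f' g')" "f' \<in> Hom B (FO u a') b" "g' \<in> Hom C x' c"
        using KE[OF h1(3)] by blast
      obtain h k where hk: "hk = Pair h k" "h \<in> Hom A a a'" "k \<in> Hom C x x'"
        using h1(4) unfolding x0 y0 by (auto elim!: prod_homE)
      have gk: "Comp C g' k = g"
        using h1(5) prod_comp[OF y0(2) fun_hom[OF fu hk(2)] y0(3) hk(3)] prod_func_simps(4)[of h u a a' k "id_func C" x x'] hk
        unfolding x0 y0 by simp
      have 1: "psnd (FA (\<rho> \<circ>\<^sub>F j) k0) = Pair h (Ident C c)"
        using comp_func_FA[of k0 j x0 y0 \<rho>] k0 \<rho>A[OF fun_hom[OF fj k0]] jA[OF k0] h1(1) hk(1)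
          prod_func_simps(4)[of h "id_func A" a a' k w x x'] hk(2,3) by (simp add: functor_ends[OF fj])
      have aa: "a \<in> Obj A" "a' \<in> Obj A" using hom_obj[OF cA hk(2)] by auto
      show "Comp (prod_cat A C) (?t y0) (psnd (FA (id_func ?K) k0)) = Comp (prod_cat A C) (psnd (FA (\<rho> \<circ>\<^sub>F j) k0)) (?t x0)"
        unfolding 1 id_func_simps(4)[OF k0] using h1(1) hk(1) x0 y0 gk prod_comp[OF cat_ident_hom[OF cA aa(2)] hk(2) y0(3) hk(3)]
          prod_comp[OF hk(2) cat_ident_hom[OF cA aa(1)] Ic x0(3)]
          cat_id_left[OF cC x0(3)] cat_id_left[OF cA hk(2)] cat_id_right[OF cA hk(2)] by simp
    qed
    \<comment> \<open>Both sides have the underlying arrow \<open>(id, w g)\<close>, where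
      \<open>g\<close> is the parameter component of \<open>x0\<close>.\<close>
    have "At ?\<alpha> (FO j x0) = FA j (At ?\<beta> x0)" if x0: "x0 \<in> Obj ?K" for x0
    proof -
      obtain a x f g where *: "x0 = Pair (Pair a x) (Pair f g)" "f \<in> Hom B (FO u a) b" "a \<in> Obj A" "g \<in> Hom C x c"
        using KE[OF x0] by metis
      have bh: "At ?\<beta> x0 \<in> Hom ?K x0 (FO \<rho> (FO j x0))"
        using nt_hom[OF b, unfolded id_func_simps, OF x0] x0 by (simp add: functor_ends[OF fj])
      have bx: "At ?\<beta> x0 = Pair (Pair x0 (FO \<rho> (FO j x0))) (Pair (Ident A a) g)"
        using x0 *(1) by (simp add: functor_ends[OF fj])
      have "FA j (At ?\<beta> x0) = Pair (Pair (FO j x0) (FO j (FO \<rho> (FO j x0)))) (Pair (Ident A a) (FA w g))"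
        using jA[OF bh] bx prod_func_simps(4)[of "Ident A a" "id_func A" a a g w x c] cat_ident_hom[OF cA *(3)] *(4) by simp
      moreover have "At ?\<alpha> (FO j x0) = Pair (Pair (FO j x0) (FO j (FO \<rho> (FO j x0)))) (Pair (Ident A a) (FA w g))"
        using fun_obj[OF fj x0] jO[of a x f g] x0 *(1) by (simp add: functor_ends[OF f\<rho>])
      ultimately show ?thesis by simp
    qed
    then show "\<exists>\<rho> \<alpha> \<beta>. functor_from_to ?K' ?K \<rho> \<and> ntrans_from_to (id_func ?K') (j \<circ>\<^sub>F \<rho>) \<alpha> \<and>
        ntrans_from_to (id_func ?K) (\<rho> \<circ>\<^sub>F j) \<beta> \<and> (\<forall>x\<in>Obj ?K. At \<alpha> (FO j x) = FA j (At \<beta> x))"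
      using f\<rho> a b by blast
  qed
qed

end

section \<open>Morphisms of derivators\<close>

lemma deriv_morphismI:
  assumes "\<And>A. small_category \<kappa> A \<Longrightarrow> functor_from_to (D0 D A) (D0 E A) (M0 F A)"
    and "\<And>u A B. small_fun \<kappa> A B u \<Longrightarrow> nat_iso_from_to (M0 F A \<circ>\<^sub>F D1 D u) (D1 E u \<circ>\<^sub>F M0 F B) (M1 F u)"
    and "\<And>A X. small_category \<kappa> A \<Longrightarrow> X \<in> Obj (D0 D A) \<Longrightarrow>
      At (M1 F (id_func A)) X = Ident (D0 E A) (FO (M0 F A) X)"
    and "\<And>u v A B C X. small_fun \<kappa> A B u \<Longrightarrow> small_fun \<kappa> B C v \<Longrightarrow> X \<in> Obj (D0 D C) \<Longrightarrow>
      At (M1 F (v \<circ>\<^sub>F u)) X = Comp (D0 E A) (FA (D1 E u) (At (M1 F v) X)) (At (M1 F u) (FO (D1 D v) X))"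
    and "\<And>\<alpha> u v A B X. ntrans_from_to u v \<alpha> \<Longrightarrow> small_fun \<kappa> A B u \<Longrightarrow> small_fun \<kappa> A B v \<Longrightarrow> X \<in> Obj (D0 D B) \<Longrightarrow>
      Comp (D0 E A) (At (D2 E \<alpha>) (FO (M0 F B) X)) (At (M1 F u) X) =
           Comp (D0 E A) (At (M1 F v) X) (FA (M0 F A) (At (D2 D \<alpha>) X))"
  shows "deriv_morphism \<kappa> D E F"
  unfolding deriv_morphism_def
proof (intro conjI allI impI ballI)
  show "functor_from_to (D0 D A) (D0 E A) (M0 F A)" if "small_category \<kappa> A" for A using assms(1) that .
  show "nat_iso_from_to (M0 F (Src u) \<circ>\<^sub>F D1 D u) (D1 E u \<circ>\<^sub>F M0 F (Tgt u)) (M1 F u)" if "small_functor \<kappa> u" for u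
    using assms(2) that by (simp add: small_functor_iff)
  show "At (M1 F (id_func A)) X = Ident (D0 E A) (FO (M0 F A) X)"
    if "small_category \<kappa> A" "X \<in> Obj (D0 D A)" for A X using assms(3) that .
  show "At (M1 F (v \<circ>\<^sub>F u)) X = Comp (D0 E (Src u)) (FA (D1 E u) (At (M1 F v) X)) (At (M1 F u) (FO (D1 D v) X))"
    if "small_functor \<kappa> u \<and> small_functor \<kappa> v \<and> Tgt u = Src v" "X \<in> Obj (D0 D (Tgt v))" for u v X
  proof (rule assms(4)[of "Src u" "Src v" u "Tgt v"])
    show "small_fun \<kappa> (Src u) (Src v) u" using that(1) small_functor_iff[of \<kappa> u] by metis
    show "small_fun \<kappa> (Src v) (Tgt v) v" using that(1) by (simp only: small_functor_iff)
  qed (use that in simp)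
  show "Comp (D0 E (Src u)) (At (D2 E \<alpha>) (FO (M0 F (Tgt u)) X)) (At (M1 F u) X) =
           Comp (D0 E (Src u)) (At (M1 F v) X) (FA (M0 F (Src u)) (At (D2 D \<alpha>) X))"
    if "small_ntrans \<kappa> \<alpha> \<and> NSrc \<alpha> = u \<and> NTgt \<alpha> = v" "X \<in> Obj (D0 D (Tgt u))" for \<alpha> u v X
  proof (rule assms(5)[of u v \<alpha>])
    show n: "ntrans_from_to u v \<alpha>" using that by (auto simp: small_nt_iff)
    show "small_fun \<kappa> (Src u) (Tgt u) u" "small_fun \<kappa> (Src u) (Tgt u) v"
      using that nt_functors[OF n] by (auto simp: small_nt_iff small_fun_def)
  qed (use that in simp)
qed

lemma deriv_morphismD:
  assumes "deriv_morphism \<kappa> D E F"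
  shows "\<And>A. small_category \<kappa> A \<Longrightarrow> functor_from_to (D0 D A) (D0 E A) (M0 F A)"
    and "\<And>u A B. small_fun \<kappa> A B u \<Longrightarrow> nat_iso_from_to (M0 F A \<circ>\<^sub>F D1 D u) (D1 E u \<circ>\<^sub>F M0 F B) (M1 F u)"
    and "\<And>A X. small_category \<kappa> A \<Longrightarrow> X \<in> Obj (D0 D A) \<Longrightarrow>
      At (M1 F (id_func A)) X = Ident (D0 E A) (FO (M0 F A) X)"
    and "\<And>u v A B C X. small_fun \<kappa> A B u \<Longrightarrow> small_fun \<kappa> B C v \<Longrightarrow> X \<in> Obj (D0 D C) \<Longrightarrow>
      At (M1 F (v \<circ>\<^sub>F u)) X = Comp (D0 E A) (FA (D1 E u) (At (M1 F v) X)) (At (M1 F u) (FO (D1 D v) X))"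
    and "\<And>\<alpha> u v A B X. ntrans_from_to u v \<alpha> \<Longrightarrow> small_fun \<kappa> A B u \<Longrightarrow> X \<in> Obj (D0 D B) \<Longrightarrow>
      Comp (D0 E A) (At (D2 E \<alpha>) (FO (M0 F B) X)) (At (M1 F u) X) =
           Comp (D0 E A) (At (M1 F v) X) (FA (M0 F A) (At (D2 D \<alpha>) X))"
proof -
  note d = assms[unfolded deriv_morphism_def]
  show "functor_from_to (D0 D A) (D0 E A) (M0 F A)" if "small_category \<kappa> A" for A using d that by blast
  show "nat_iso_from_to (M0 F A \<circ>\<^sub>F D1 D u) (D1 E u \<circ>\<^sub>F M0 F B) (M1 F u)" if "small_fun \<kappa> A B u" for u A B
    using d that small_funD(4,5)[OF that] small_functor_iff by metis
  show "At (M1 F (id_func A)) X = Ident (D0 E A) (FO (M0 F A) X)"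
    if "small_category \<kappa> A" "X \<in> Obj (D0 D A)" for A X using d that by blast
  show "At (M1 F (v \<circ>\<^sub>F u)) X = Comp (D0 E A) (FA (D1 E u) (At (M1 F v) X)) (At (M1 F u) (FO (D1 D v) X))"
    if "small_fun \<kappa> A B u" "small_fun \<kappa> B C v" "X \<in> Obj (D0 D C)" for u v A B C X
  proof -
    have "small_functor \<kappa> u \<and> small_functor \<kappa> v \<and> Tgt u = Src v" "X \<in> Obj (D0 D (Tgt v))"
      using that small_funD(4,5)[OF that(1)] small_funD(4,5)[OF that(2)] by (auto simp: small_functor_iff)
    then show ?thesis using d small_funD(4)[OF that(1)] by blast
  qed
  show "Comp (D0 E A) (At (D2 E \<alpha>) (FO (M0 F B) X)) (At (M1 F u) X) =
           Comp (D0 E A) (At (M1 F v) X) (FA (M0 F A) (At (D2 D \<alpha>) X))"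
    if "ntrans_from_to u v \<alpha>" "small_fun \<kappa> A B u" "X \<in> Obj (D0 D B)" for \<alpha> u v A B X
  proof -
    have "small_ntrans \<kappa> \<alpha> \<and> NSrc \<alpha> = u \<and> NTgt \<alpha> = v" "X \<in> Obj (D0 D (Tgt u))"
      using small_nt[OF that(1,2)] nt_ends[OF that(1)] that(3) small_funD(5)[OF that(2)] by auto
    then show ?thesis using d small_funD(4,5)[OF that(2)] by blast
  qed
qed

lemma vcomp_nt:
  assumes a: "ntrans_from_to F G \<sigma>" and b: "ntrans_from_to G H \<tau>"
  shows "ntrans_from_to F H (vcomp \<tau> \<sigma>)"
proof -
  have e: "Src G = Src F" "Tgt G = Tgt F" using nt_functors(2)[OF a] functor_ends by blast+
  note C = functor_cat(2)[OF nt_functors(1)[OF a]]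
  have b1: "At \<tau> x \<in> Hom (Tgt F) (FO G x) (FO H x)" if "x \<in> Obj (Src F)" for x
    using nt_hom[OF b] that e by simp
  have FH: "functor_from_to (Src F) (Tgt F) H" using nt_functors(2)[OF b] e by simp
  show ?thesis
    unfolding vcomp_def nt_ends[OF a] nt_ends[OF b]
  proof (rule nt_mk[OF nt_functors(1)[OF a] FH])
    fix x assume x: "x \<in> Obj (Src F)"
    then show "Comp (Tgt F) (At \<tau> x) (At \<sigma> x) \<in> Hom (Tgt F) (FO F x) (FO H x)"
      using cat_comp_hom[OF C b1[OF x] nt_hom[OF a x]] by simp
  next
    fix f x y assume f: "f \<in> Hom (Src F) x y" and x: "x \<in> Obj (Src F)" and y: "y \<in> Obj (Src F)"
    show "Comp (Tgt F) (Comp (Tgt F) (At \<tau> y) (At \<sigma> y)) (FA F f) =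
       Comp (Tgt F) (FA H f) (Comp (Tgt F) (At \<tau> x) (At \<sigma> x))"
      using cat_assoc[OF C b1[OF y] nt_hom[OF a y] fun_hom[OF nt_functors(1)[OF a] f]] nt_nat[OF a f]
        cat_assoc[OF C b1[OF y] fun_hom[OF nt_functors(2)[OF a] f] nt_hom[OF a x]]
        nt_nat[OF b, unfolded e, OF f]
        cat_assoc[OF C fun_hom[OF FH f] b1[OF x] nt_hom[OF a x]] by simp
  qed
qed

lemma vcomp_at: "x \<in> Obj (Src (NSrc \<sigma>)) \<Longrightarrow> At (vcomp \<tau> \<sigma>) x = Comp (Tgt (NSrc \<sigma>)) (At \<tau> x) (At \<sigma> x)"
  by (simp add: vcomp_def)

lemma deriv_morphism_cell:
  assumes F: "deriv_morphism \<kappa> D E F" and u: "small_fun \<kappa> A B u"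
  shows "ntrans_from_to (M0 F A \<circ>\<^sub>F D1 D u) (D1 E u \<circ>\<^sub>F M0 F B) (M1 F u)"
  using deriv_morphismD(2)[OF F u] by (simp add: nat_iso_from_to_def)

text \<open>The identity 2-cells in the definition of the composite collapse to whiskerings. What
  remains is the pasting formula: apply \<open>G\<close> to the cell of \<open>F\<close>, then the
  cell of \<open>G\<close>.\<close>

lemma comp_dmor_at:
  assumes F: "deriv_morphism \<kappa> D E F" and G: "deriv_morphism \<kappa> E H G" and u: "small_fun \<kappa> A B u"
    and Eu: "functor_from_to (D0 E B) (D0 E A) (D1 E u)" and Du: "functor_from_to (D0 D B) (D0 D A) (D1 D u)"
    and Hu: "functor_from_to (D0 H B) (D0 H A) (D1 H u)"
  shows "ntrans_from_to (M0 (G \<circ>\<^sub>D F) A \<circ>\<^sub>F D1 D u) (D1 H u \<circ>\<^sub>F M0 (G \<circ>\<^sub>D F) B) (M1 (G \<circ>\<^sub>D F) u)"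
    and "X \<in> Obj (D0 D B) \<Longrightarrow> At (M1 (G \<circ>\<^sub>D F) u) X =
      Comp (D0 H A) (At (M1 G u) (FO (M0 F B) X)) (FA (M0 G A) (At (M1 F u) X))"
proof -
  note e = small_funD(4,5)[OF u]
  note FA' = deriv_morphismD(1)[OF F small_funD(2)[OF u]] and FB = deriv_morphismD(1)[OF F small_funD(3)[OF u]]
  note GA = deriv_morphismD(1)[OF G small_funD(2)[OF u]] and GB = deriv_morphismD(1)[OF G small_funD(3)[OF u]]
  note Fu = deriv_morphism_cell[OF F u] and Gu = deriv_morphism_cell[OF G u]
  have 1: "hcomp (M1 G u) (id_nt (M0 F B)) = whisker_right (M1 G u) (M0 F B)"
    by (rule whisker_right_eq[OF FB Gu, symmetric]) (simp add: functor_ends[OF Eu])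
  have 2: "hcomp (id_nt (M0 G A)) (M1 F u) = whisker_left (M0 G A) (M1 F u)"
    by (rule whisker_left_eq[OF GA Fu, symmetric]) (simp add: functor_ends[OF FA'])
  have 3: "ntrans_from_to ((M0 G A \<circ>\<^sub>F D1 E u) \<circ>\<^sub>F M0 F B) ((D1 H u \<circ>\<^sub>F M0 G B) \<circ>\<^sub>F M0 F B) (whisker_right (M1 G u) (M0 F B))"
    by (rule whisker_right[OF FB Gu]) (simp add: functor_ends[OF Eu])
  have 4: "ntrans_from_to (M0 G A \<circ>\<^sub>F M0 F A \<circ>\<^sub>F D1 D u) (M0 G A \<circ>\<^sub>F D1 E u \<circ>\<^sub>F M0 F B) (whisker_left (M0 G A) (M1 F u))"
    by (rule whisker_left[OF GA Fu]) (simp add: functor_ends[OF FA'])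
  have m: "M1 (G \<circ>\<^sub>D F) u = vcomp (whisker_right (M1 G u) (M0 F B)) (whisker_left (M0 G A) (M1 F u))"
    by (simp add: comp_dmor_def e 1 2)
  show "ntrans_from_to (M0 (G \<circ>\<^sub>D F) A \<circ>\<^sub>F D1 D u) (D1 H u \<circ>\<^sub>F M0 (G \<circ>\<^sub>D F) B) (M1 (G \<circ>\<^sub>D F) u)"
    unfolding m using vcomp_nt[OF 4] 3
    by (simp add: comp_dmor_def comp_func_assoc[OF FB Eu GA] comp_func_assoc[OF Du FA' GA] comp_func_assoc[OF FB GB Hu])
  show "At (M1 (G \<circ>\<^sub>D F) u) X = Comp (D0 H A) (At (M1 G u) (FO (M0 F B) X)) (FA (M0 G A) (At (M1 F u) X))"
    if "X \<in> Obj (D0 D B)"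
    unfolding m using that fun_obj[OF FB that]
    by (simp add: vcomp_at nt_ends[OF 4] functor_ends[OF Du] functor_ends[OF GA] whisker_right_def whisker_left_def
        nt_ends[OF Gu] nt_ends[OF Fu] functor_ends[OF FB])
qed

context derivator_theory begin

section \<open>Left Kan extension as a morphism of derivators\<close>

lemma shift_simps [simp]:
  "D0 (shift D A) C = D0 D (prod_cat A C)" "D1 (shift D A) w = D1 D (prod_func (id_func A) w)"
  "D2 (shift D A) \<alpha> = D2 D (prod_nt (id_nt (id_func A)) \<alpha>)"
  by (simp_all add: shift_def)

lemma sfun_idl: "small A \<Longrightarrow> sfun C C' w \<Longrightarrow> sfun (prod_cat A C) (prod_cat A C') (prod_func (id_func A) w)"
  by (intro sfun_prod sfun_id)

lemma sfun_idr: "sfun A B u \<Longrightarrow> small C \<Longrightarrow> sfun (prod_cat A C) (prod_cat B C) (prod_func u (id_func C))"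
  by (intro sfun_prod sfun_id)

lemma prod_split:
  assumes u: "sfun A B u" and w: "sfun C C' w"
  shows "prod_func u (id_func C') \<circ>\<^sub>F prod_func (id_func A) w = prod_func u w"
    "prod_func (id_func B) w \<circ>\<^sub>F prod_func u (id_func C) = prod_func u w"
  using prod_func_comp[OF functor_id small_funD(1)[OF w] small_funD(1)[OF u] functor_id]
    prod_func_comp[OF small_funD(1)[OF u] functor_id functor_id small_funD(1)[OF w]]
    small_funD(6,7)[OF u] small_funD(6,7)[OF w]
    comp_id_left[OF small_funD(1)[OF u]] comp_id_right[OF small_funD(1)[OF u]]
    comp_id_left[OF small_funD(1)[OF w]] comp_id_right[OF small_funD(1)[OF w]] by simp_all

lemma prod_swap:
  assumes u: "sfun A B u" and w: "sfun C C' w"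
  shows "prod_func u (id_func C') \<circ>\<^sub>F prod_func (id_func A) w = prod_func (id_func B) w \<circ>\<^sub>F prod_func u (id_func C)"
  using prod_split[OF u w] by simp

lemma prod_idl_comp:
  assumes A: "small A" and w: "sfun C C' w" and w': "sfun C' C'' w'"
  shows "prod_func (id_func A) (w' \<circ>\<^sub>F w) = prod_func (id_func A) w' \<circ>\<^sub>F prod_func (id_func A) w"
  using prod_func_comp[OF functor_id small_funD(1)[OF w] functor_id small_funD(1)[OF w']]
    comp_id_left[OF functor_id[OF small_is_category[OF A]]] small_is_category[OF A] by metis

lemma prod_idr_comp:
  assumes C: "small C" and w: "sfun A B w" and w': "sfun B B' w'"
  shows "prod_func (w' \<circ>\<^sub>F w) (id_func C) = prod_func w' (id_func C) \<circ>\<^sub>F prod_func w (id_func C)"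
  using prod_func_comp[OF small_funD(1)[OF w] functor_id small_funD(1)[OF w'] functor_id]
    comp_id_left[OF functor_id[OF small_is_category[OF C]]] small_is_category[OF C] by metis

lemma prod_idl_nt:
  assumes A: "small A" and a: "ntrans_from_to w w' \<alpha>"
  shows "ntrans_from_to (prod_func (id_func A) w) (prod_func (id_func A) w') (prod_nt (id_nt (id_func A)) \<alpha>)"
  using prod_nt[OF id_nt[OF functor_id[OF small_is_category[OF A]]] a] .

lemma star_shift: "small A \<Longrightarrow> sfun C C' w \<Longrightarrow> functor_from_to (D0 (shift D A) C') (D0 (shift D A) C) (D1 (shift D A) w)"
  using star[OF sfun_idl] by simp

text \<open>The square with diagonal \<open>prod_func u w\<close> commutes strictly, so its 2-cell
  is an identity and the structure cell is the unique map taking a unit to a restricted unit. It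
  compares two universal arrows, hence it is invertible by \<open>product_exact\<close>.\<close>

lemma lan_cell:
  fixes u w
  defines "m \<equiv> \<lambda>X. At (M1 (lan_mor D u) w) X"
  assumes u: "sfun A B u" and w: "sfun C C' w" and X: "X \<in> ob (prod_cat A C')"
  shows "m X \<in> hm (prod_cat B C) (lo (prod_func u (id_func C)) (pb (prod_func (id_func A) w) X))
           (pb (prod_func (id_func B) w) (lo (prod_func u (id_func C')) X))"
    and "pa (prod_func u (id_func C)) (m X) \<cdot>\<^bsub>prod_cat A C\<^esub> lu (prod_func u (id_func C)) (pb (prod_func (id_func A) w) X)
       = pa (prod_func (id_func A) w) (lu (prod_func u (id_func C')) X)"
    and "is_iso (D0 D (prod_cat B C)) (m X)"
proof -
  note sA = small_funD(2)[OF u] and sB = small_funD(3)[OF u] and sC = small_funD(2)[OF w] and sC' = small_funD(3)[OF w]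
  let ?p = "prod_func (id_func A) w" and ?v = "prod_func (id_func B) w"
  let ?q = "prod_func u (id_func C)" and ?r = "prod_func u (id_func C')"
  note p = sfun_idl[OF sA w] and v = sfun_idl[OF sB w] and q = sfun_idr[OF u sC] and r = sfun_idr[OF u sC']
  note uw = sfun_prod[OF u w]
  note U = univ_arrowD[OF lan_univ[OF r X] r]
  have "ntrans_from_to (?r \<circ>\<^sub>F ?p) (?v \<circ>\<^sub>F ?q) (id_nt (prod_func u w))"
    using id_nt[OF small_funD(1)[OF uw]] prod_split[OF u w] by simp
  note mt = mate_left_char[OF p r q v this X]
  have m: "m X = mate_left D ?p ?r ?q ?v (id_nt (prod_func u w)) X"
    using X functor_ends[OF star[OF p]] unfolding m_def lan_mor_def by (simp add: Let_def small_funD[OF u] small_funD[OF w])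
  show 1: "m X \<in> hm (prod_cat B C) (lo ?q (pb ?p X)) (pb ?v (lo ?r X))" using mt(1) m by simp
  have id: "cl (id_nt (prod_func u w)) (lo ?r X) = idt (prod_cat A C) (pb ?p (pb ?r (lo ?r X)))"
    using cl_id[OF uw U(1)] pb_comp[OF p r U(1)] prod_split(1)[OF u w] by simp
  show 2: "pa ?q (m X) \<cdot>\<^bsub>prod_cat A C\<^esub> lu ?q (pb ?p X) = pa ?p (lu ?r X)"
    using mt(2) m id cat_id_left[OF dcat[OF small_funD(2)[OF p]] pa_hm[OF p U(2)]] by simp
  show "is_iso (D0 D (prod_cat B C)) (m X)"
    using univ_arrow_iso[OF lan_univ[OF q pb_ob[OF p X]] product_exact[OF u w X] q 1 2] .
qed

lemma lan_mor_M0 [simp]: "M0 (lan_mor D u) C = lan D (prod_func u (id_func C))"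
  by (simp add: lan_mor_def)

lemma lan_mor_M1_ends:
  assumes u: "sfun A B u" and w: "sfun C C' w"
  shows "ntrans_from_to (lan D (prod_func u (id_func C)) \<circ>\<^sub>F D1 D (prod_func (id_func A) w))
     (D1 D (prod_func (id_func B) w) \<circ>\<^sub>F lan D (prod_func u (id_func C'))) (M1 (lan_mor D u) w)"
proof -
  note sA = small_funD(2)[OF u] and sB = small_funD(3)[OF u] and sC = small_funD(2)[OF w] and sC' = small_funD(3)[OF w]
  let ?p = "prod_func (id_func A) w" and ?v = "prod_func (id_func B) w"
  let ?q = "prod_func u (id_func C)" and ?r = "prod_func u (id_func C')"
  let ?E = "prod_cat A C" and ?F = "prod_cat B C"
  note p = sfun_idl[OF sA w] and v = sfun_idl[OF sB w] and q = sfun_idr[OF u sC] and r = sfun_idr[OF u sC']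
  note lc = lan_cell[OF u w]
  let ?m = "\<lambda>X. At (M1 (lan_mor D u) w) X"
  note fs = functor_comp[OF star[OF p] lan_functor[OF q]] and ft = functor_comp[OF lan_functor[OF r] star[OF v]]
  note E = dcat[OF small_funD(2)[OF q]] and F = dcat[OF small_funD(3)[OF q]]
  have "ntrans_from_to (lan D ?q \<circ>\<^sub>F D1 D ?p) (D1 D ?v \<circ>\<^sub>F lan D ?r) (mk_nt (lan D ?q \<circ>\<^sub>F D1 D ?p) (D1 D ?v \<circ>\<^sub>F lan D ?r) ?m)"
  proof (rule nt_mk[OF fs ft])
    show "?m X \<in> Hom (D0 D ?F) (FO (lan D ?q \<circ>\<^sub>F D1 D ?p) X) (FO (D1 D ?v \<circ>\<^sub>F lan D ?r) X)" if X: "X \<in> ob (prod_cat A C')" for X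
      using lc(1)[OF X] X functor_ends[OF star[OF p]] functor_ends[OF lan_functor[OF r]] by simp
    fix f X Y assume f: "f \<in> hm (prod_cat A C') X Y" and X: "X \<in> ob (prod_cat A C')" and Y: "Y \<in> ob (prod_cat A C')"
    note pX = pb_ob[OF p X] and pY = pb_ob[OF p Y] and pf = pa_hm[OF p f]
    note lX = univ_arrowD[OF lan_univ[OF r X] r] and lY = univ_arrowD[OF lan_univ[OF r Y] r]
    note kX = univ_arrowD[OF lan_univ[OF q pX] q] and kY = univ_arrowD[OF lan_univ[OF q pY] q]
    note qpf = fun_hom[OF lan_functor[OF q] pf] and rf = fun_hom[OF lan_functor[OF r] f]
    note vrf = pa_hm[OF v rf]
    \<comment> \<open>Both maps start at a Kan extension along \<open>?q\<close>, so it suffices to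
      compare them after pulling back and composing with the unit.\<close>
    have "?m Y \<cdot>\<^bsub>?F\<^esub> la ?q (pa ?p f) = pa ?v (la ?r f) \<cdot>\<^bsub>?F\<^esub> ?m X"
    proof (rule univ_arrow_eq[OF lan_univ[OF q pX] q cat_comp_hom[OF F lc(1)[OF Y] qpf] cat_comp_hom[OF F vrf lc(1)[OF X]]])
      have "pa ?q (?m Y \<cdot>\<^bsub>?F\<^esub> la ?q (pa ?p f)) \<cdot>\<^bsub>?E\<^esub> lu ?q (pb ?p X) = pa ?q (?m Y) \<cdot>\<^bsub>?E\<^esub> (lu ?q (pb ?p Y) \<cdot>\<^bsub>?E\<^esub> pa ?p f)"
        using pa_dcomp[OF q lc(1)[OF Y] qpf] cat_assoc[OF E pa_hm[OF q lc(1)[OF Y]] pa_hm[OF q qpf] kX(2)] la_char[OF q pf] by simp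
      also have "\<dots> = pa ?p (lu ?r Y \<cdot>\<^bsub>prod_cat A C'\<^esub> f)"
        using cat_assoc[OF E pa_hm[OF q lc(1)[OF Y]] kY(2) pf] lc(2)[OF Y] pa_dcomp[OF p lY(2) f] by simp
      also have "\<dots> = pa ?p (pa ?r (la ?r f)) \<cdot>\<^bsub>?E\<^esub> pa ?p (lu ?r X)"
        using la_char[OF r f] pa_dcomp[OF p pa_hm[OF r rf] lX(2)] by simp
      also have "\<dots> = pa ?q (pa ?v (la ?r f)) \<cdot>\<^bsub>?E\<^esub> (pa ?q (?m X) \<cdot>\<^bsub>?E\<^esub> lu ?q (pb ?p X))"
        using pa_sq[OF prod_swap[OF u w, symmetric] p r q v rf] lc(2)[OF X] by simp
      also have "\<dots> = pa ?q (pa ?v (la ?r f) \<cdot>\<^bsub>?F\<^esub> ?m X) \<cdot>\<^bsub>?E\<^esub> lu ?q (pb ?p X)"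
        using cat_assoc[OF E pa_hm[OF q vrf] pa_hm[OF q lc(1)[OF X]] kX(2)] pa_dcomp[OF q vrf lc(1)[OF X]] by simp
      finally show "pa ?q (?m Y \<cdot>\<^bsub>?F\<^esub> la ?q (pa ?p f)) \<cdot>\<^bsub>?E\<^esub> lu ?q (pb ?p X) =
        pa ?q (pa ?v (la ?r f) \<cdot>\<^bsub>?F\<^esub> ?m X) \<cdot>\<^bsub>?E\<^esub> lu ?q (pb ?p X)" .
    qed
    then show "Comp (D0 D ?F) (?m Y) (FA (lan D ?q \<circ>\<^sub>F D1 D ?p) f) = Comp (D0 D ?F) (FA (D1 D ?v \<circ>\<^sub>F lan D ?r) f) (?m X)"
      using comp_func_FA[of f "D1 D ?p" X Y "lan D ?q"] comp_func_FA[of f "lan D ?r" X Y "D1 D ?v"] f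
        functor_ends[OF star[OF p]] functor_ends[OF lan_functor[OF r]] by simp
  qed
  moreover have "mk_nt (lan D ?q \<circ>\<^sub>F D1 D ?p) (D1 D ?v \<circ>\<^sub>F lan D ?r) ?m = M1 (lan_mor D u) w"
    unfolding lan_mor_def by (auto simp: Let_def small_funD[OF u] small_funD[OF w] intro!: mk_nt_cong)
  ultimately show ?thesis by simp
qed

text \<open>Every coherence law is an equality of maps out of a Kan extension along
  \<open>prod_func u (id_func C)\<close>. Tested on the unit, each reduces to the defining equation
  of the structure cells and to strictness of \<open>D\<close>.\<close>

lemma lan_mor_morphism:
  assumes u: "sfun A B u"
  shows "deriv_morphism \<kappa> (shift D A) (shift D B) (lan_mor D u)"
proof (rule deriv_morphismI)
  note sA = small_funD(2)[OF u] and sB = small_funD(3)[OF u]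
  show "functor_from_to (D0 (shift D A) C) (D0 (shift D B) C) (M0 (lan_mor D u) C)" if "small C" for C
    using lan_functor[OF sfun_idr[OF u that]] by simp
next
  note sA = small_funD(2)[OF u] and sB = small_funD(3)[OF u]
  fix w C C' assume w: "sfun C C' w"
  note sC = small_funD(2)[OF w] and sC' = small_funD(3)[OF w]
  show "nat_iso_from_to (M0 (lan_mor D u) C \<circ>\<^sub>F D1 (shift D A) w) (D1 (shift D B) w \<circ>\<^sub>F M0 (lan_mor D u) C') (M1 (lan_mor D u) w)"
    using lan_mor_M1_ends[OF u w] lan_cell(3)[OF u w] functor_ends[OF star[OF sfun_idl[OF sA w]]] functor_ends[OF lan_functor[OF sfun_idr[OF u sC]]]
    by (simp add: nat_iso_from_to_def)
next
  note sA = small_funD(2)[OF u] and sB = small_funD(3)[OF u]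
  fix C X assume C: "small C" and "X \<in> Obj (D0 (shift D A) C)"
  then have X: "X \<in> ob (prod_cat A C)" by simp
  note i = prod_func_id[OF small_is_category small_is_category]
  note q = sfun_idr[OF u C]
  note iA = small_funD(2)[OF q] and iB = small_funD(3)[OF q]
  note U = univ_arrowD[OF lan_univ[OF q X] q]
  \<comment> \<open>For an identity functor the cell satisfies the equation that characterizes the
    identity of the Kan extension.\<close>
  note lc = lan_cell[OF u sfun_id[OF C] X, unfolded i[OF sA C] i[OF sB C] pb_id[OF iA X] pb_id[OF iB U(1)] pa_id[OF iA U(2)]]
  show "At (M1 (lan_mor D u) (id_func C)) X = Ident (D0 (shift D B) C) (FO (M0 (lan_mor D u) C) X)"
    using univ_arrow_eq[OF lan_univ[OF q X] q lc(1) cat_ident_hom[OF dcat[OF iB] U(1)]] lc(2)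
      pa_idt[OF q U(1)] cat_id_left[OF dcat[OF iA] U(2)] by simp
next
  note sA = small_funD(2)[OF u] and sB = small_funD(3)[OF u]
  fix w w' C C' C'' X assume w: "sfun C C' w" and w': "sfun C' C'' w'" and "X \<in> Obj (D0 (shift D A) C'')"
  then have X: "X \<in> ob (prod_cat A C'')" by simp
  note sC = small_funD(2)[OF w] and sC' = small_funD(3)[OF w]  and sC'' = small_funD(3)[OF w']
  let ?m = "\<lambda>w. At (M1 (lan_mor D u) w)"
  let ?p = "\<lambda>w. prod_func (id_func A) w" and ?v = "\<lambda>w. prod_func (id_func B) w"
  let ?q = "prod_func u (id_func C)" and ?r = "prod_func u (id_func C')" and ?t = "prod_func u (id_func C'')"
  note ww = sfun_comp[OF w w']
  note q = sfun_idr[OF u sC] and r = sfun_idr[OF u sC'] and t = sfun_idr[OF u sC'']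
  note p = sfun_idl[OF sA w] and p' = sfun_idl[OF sA w'] and v = sfun_idl[OF sB w] and v' = sfun_idl[OF sB w']
  note pc = prod_idl_comp[OF sA w w'] and vc = prod_idl_comp[OF sB w w']
  note UX = univ_arrowD[OF lan_univ[OF t X] t]
  note pX = pb_ob[OF p' X]
  note Up = univ_arrowD[OF lan_univ[OF r pX] r]
  note ppX = pb_ob[OF p pX]
  note Upp = univ_arrowD[OF lan_univ[OF q ppX] q]
  note l0 = lan_cell[OF u ww X, unfolded pc vc pb_comp[OF p p' X] pb_comp[OF v v' UX(1)] pa_comp[OF p p' UX(2)]]
  note l1 = lan_cell[OF u w' X] and l2 = lan_cell[OF u w pX]
  let ?E = "prod_cat A C" and ?F = "prod_cat B C"
  note E = dcat[OF small_funD(2)[OF q]] and F = dcat[OF small_funD(3)[OF q]]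
  note vm = pa_hm[OF v l1(1)]
  \<comment> \<open>On the unit over \<open>C\<close>, both sides give the unit over
    \<open>C''\<close> restricted along the composite of \<open>w\<close> and
    \<open>w'\<close>.\<close>
  have "?m (w' \<circ>\<^sub>F w) X = pa (?v w) (?m w' X) \<cdot>\<^bsub>?F\<^esub> ?m w (pb (?p w') X)"
  proof (rule univ_arrow_eq[OF lan_univ[OF q ppX] q l0(1) cat_comp_hom[OF F vm l2(1)]])
    have "pa ?q (pa (?v w) (?m w' X) \<cdot>\<^bsub>?F\<^esub> ?m w (pb (?p w') X)) \<cdot>\<^bsub>?E\<^esub> lu ?q (pb (?p w) (pb (?p w') X))
      = pa ?q (pa (?v w) (?m w' X)) \<cdot>\<^bsub>?E\<^esub> pa (?p w) (lu ?r (pb (?p w') X))"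
      using pa_dcomp[OF q vm l2(1)] cat_assoc[OF E pa_hm[OF q vm] pa_hm[OF q l2(1)] Upp(2)] l2(2) by simp
    also have "\<dots> = pa (?p w) (pa ?r (?m w' X) \<cdot>\<^bsub>prod_cat A C'\<^esub> lu ?r (pb (?p w') X))"
      using pa_sq[OF prod_swap[OF u w] q v p r l1(1)] pa_dcomp[OF p pa_hm[OF r l1(1)] Up(2)] by simp
    also have "\<dots> = pa ?q (?m (w' \<circ>\<^sub>F w) X) \<cdot>\<^bsub>?E\<^esub> lu ?q (pb (?p w) (pb (?p w') X))"
      using l1(2) l0(2) by simp
    finally show "pa ?q (?m (w' \<circ>\<^sub>F w) X) \<cdot>\<^bsub>?E\<^esub> lu ?q (pb (?p w) (pb (?p w') X)) =
      pa ?q (pa (?v w) (?m w' X) \<cdot>\<^bsub>?F\<^esub> ?m w (pb (?p w') X)) \<cdot>\<^bsub>?E\<^esub> lu ?q (pb (?p w) (pb (?p w') X))" by simp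
  qed
  then show "At (M1 (lan_mor D u) (w' \<circ>\<^sub>F w)) X = Comp (D0 (shift D B) C) (FA (D1 (shift D B) w) (At (M1 (lan_mor D u) w') X))
    (At (M1 (lan_mor D u) w) (FO (D1 (shift D A) w') X))" by simp
next
  note sA = small_funD(2)[OF u] and sB = small_funD(3)[OF u]
  fix \<alpha> w w' C C' X assume \<alpha>: "ntrans_from_to w w' \<alpha>" and w: "sfun C C' w" and w': "sfun C C' w'"
    and "X \<in> Obj (D0 (shift D A) C')"
  then have X: "X \<in> ob (prod_cat A C')" by simp
  note sC = small_funD(2)[OF w] and sC' = small_funD(3)[OF w]
  let ?m = "\<lambda>w. At (M1 (lan_mor D u) w)"
  let ?p = "\<lambda>w. prod_func (id_func A) w" and ?v = "\<lambda>w. prod_func (id_func B) w"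
  let ?q = "prod_func u (id_func C)" and ?r = "prod_func u (id_func C')"
  let ?a = "prod_nt (id_nt (id_func A)) \<alpha>" and ?b = "prod_nt (id_nt (id_func B)) \<alpha>"
  note q = sfun_idr[OF u sC] and r = sfun_idr[OF u sC']
  note p = sfun_idl[OF sA w] and p' = sfun_idl[OF sA w'] and v = sfun_idl[OF sB w] and v' = sfun_idl[OF sB w']
  note a = prod_idl_nt[OF sA \<alpha>] and b = prod_idl_nt[OF sB \<alpha>]
  note UX = univ_arrowD[OF lan_univ[OF r X] r]
  note pX = pb_ob[OF p X] and pX' = pb_ob[OF p' X]
  note Up = univ_arrowD[OF lan_univ[OF q pX] q] and Up' = univ_arrowD[OF lan_univ[OF q pX'] q]
  note l1 = lan_cell[OF u w X] and l2 = lan_cell[OF u w' X]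
  let ?E = "prod_cat A C" and ?F = "prod_cat B C"
  note E = dcat[OF small_funD(2)[OF q]] and F = dcat[OF small_funD(3)[OF q]]
  \<comment> \<open>Interchange: \<open>u\<close> and \<open>\<alpha>\<close> act on different
    factors of the product. Under \<open>D\<close> this becomes the equation \<open>ab\<close>
    between the two actions of \<open>\<alpha>\<close>.\<close>
  have "whisker_right ?b ?q = whisker_left ?r ?a"
    unfolding whisker_right_def whisker_left_def nt_ends[OF a] nt_ends[OF b]
  proof (rule mk_nt_cong[OF prod_swap[OF u w, symmetric] prod_swap[OF u w', symmetric]])
    fix x assume "x \<in> Obj (Src (?r \<circ>\<^sub>F ?p w))"
    then obtain a c where *: "x = Pair a c" "a \<in> Obj A" "c \<in> Obj C"
      by (auto simp: small_funD[OF w] elim!: prod_objE)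
    have \<alpha>c: "At \<alpha> c \<in> Hom C' (FO w c) (FO w' c)"
      using nt_hom[OF \<alpha>] *(3) small_funD(4,5)[OF w] by simp
    have ia: "Ident A a \<in> Hom A a a" using cat_ident_hom[OF small_is_category[OF sA] *(2)] .
    show "At ?b (FO ?q x) = FA ?r (At ?a x)"
      using * fun_obj[OF small_funD(1)[OF u] *(2)] prod_func_simps(4)[of "Ident A a" u a a "At \<alpha> c" "id_func C'" "FO w c" "FO w' c"]
        ia \<alpha>c fun_ident[OF small_funD(1)[OF u] *(2)]
      by (simp add: small_funD[OF u] nt_ends[OF \<alpha>] small_funD[OF w])
  qed
  then have ab: "pa ?q (cl ?b (lo ?r X)) = cl ?a (pb ?r (lo ?r X))"
    using cl_whisker_right[OF b v q UX(1)] cl_whisker_left[OF a p r UX(1)] by simp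
  note ca = cl_hm[OF a p X] and cb = cl_hm[OF b v UX(1)]
  note cra = cl_hm[OF a p pb_ob[OF r UX(1)]]
  note qca = fun_hom[OF lan_functor[OF q] ca]
  have "cl ?b (lo ?r X) \<cdot>\<^bsub>?F\<^esub> ?m w X = ?m w' X \<cdot>\<^bsub>?F\<^esub> la ?q (cl ?a X)"
  proof (rule univ_arrow_eq[OF lan_univ[OF q pX] q cat_comp_hom[OF F cb l1(1)] cat_comp_hom[OF F l2(1) qca]])
    have "pa ?q (cl ?b (lo ?r X) \<cdot>\<^bsub>?F\<^esub> ?m w X) \<cdot>\<^bsub>?E\<^esub> lu ?q (pb (?p w) X) = cl ?a (pb ?r (lo ?r X)) \<cdot>\<^bsub>?E\<^esub> pa (?p w) (lu ?r X)"
      using pa_dcomp[OF q cb l1(1)] cat_assoc[OF E pa_hm[OF q cb] pa_hm[OF q l1(1)] Up(2)] l1(2) ab by simp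
    also have "\<dots> = pa (?p w') (lu ?r X) \<cdot>\<^bsub>?E\<^esub> cl ?a X" using cl_nat[OF a p UX(2)] .
    also have "\<dots> = pa ?q (?m w' X) \<cdot>\<^bsub>?E\<^esub> (lu ?q (pb (?p w') X) \<cdot>\<^bsub>?E\<^esub> cl ?a X)"
      using l2(2) cat_assoc[OF E pa_hm[OF q l2(1)] Up'(2) ca] by simp
    also have "\<dots> = pa ?q (?m w' X \<cdot>\<^bsub>?F\<^esub> la ?q (cl ?a X)) \<cdot>\<^bsub>?E\<^esub> lu ?q (pb (?p w) X)"
      using la_char[OF q ca] cat_assoc[OF E pa_hm[OF q l2(1)] pa_hm[OF q qca] Up(2)] pa_dcomp[OF q l2(1) qca] by simp
    finally show "pa ?q (cl ?b (lo ?r X) \<cdot>\<^bsub>?F\<^esub> ?m w X) \<cdot>\<^bsub>?E\<^esub> lu ?q (pb (?p w) X) =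
      pa ?q (?m w' X \<cdot>\<^bsub>?F\<^esub> la ?q (cl ?a X)) \<cdot>\<^bsub>?E\<^esub> lu ?q (pb (?p w) X)" .
  qed
  then show "Comp (D0 (shift D B) C) (At (D2 (shift D B) \<alpha>) (FO (M0 (lan_mor D u) C') X)) (At (M1 (lan_mor D u) w) X) =
       Comp (D0 (shift D B) C) (At (M1 (lan_mor D u) w') X) (FA (M0 (lan_mor D u) C) (At (D2 (shift D A) \<alpha>) X))" by simp
qed

section \<open>Restriction and composition of morphisms of derivators\<close>

lemma pull_mor_simps:
  assumes u: "sfun A B u"
  shows "M0 (pull_mor D u) C = D1 D (prod_func u (id_func C))"
    "sfun C C' w \<Longrightarrow> X \<in> ob (prod_cat B C') \<Longrightarrow> At (M1 (pull_mor D u) w) X = idt (prod_cat A C) (pb (prod_func u w) X)"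
  using functor_ends[OF star[OF sfun_prod[OF u]]] by (simp_all add: pull_mor_def)

text \<open>Both composites in a structure square equal pullback along \<open>prod_func u w\<close>,
  so identities serve as cells. Compatibility with a 2-cell of parameters is interchange in the
  product.\<close>

lemma pull_mor_morphism:
  assumes u: "sfun A B u"
  shows "deriv_morphism \<kappa> (shift D B) (shift D A) (pull_mor D u)"
proof (rule deriv_morphismI)
  note sA = small_funD(2)[OF u] and sB = small_funD(3)[OF u]
  show "functor_from_to (D0 (shift D B) C) (D0 (shift D A) C) (M0 (pull_mor D u) C)" if "small C" for C
    using star[OF sfun_idr[OF u that]] by (simp add: pull_mor_simps[OF u])
next
  note sA = small_funD(2)[OF u] and sB = small_funD(3)[OF u]
  fix w C C' assume w: "sfun C C' w"
  note sC = small_funD(2)[OF w] and sC' = small_funD(3)[OF w]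
  note uw = sfun_prod[OF u w]
  have 1: "D1 D (prod_func u (id_func C)) \<circ>\<^sub>F D1 D (prod_func (id_func B) w) = D1 D (prod_func u w)"
    using D1_comp[OF sfun_idr[OF u sC] sfun_idl[OF sB w]] prod_split(2)[OF u w] by simp
  have 2: "D1 D (prod_func (id_func A) w) \<circ>\<^sub>F D1 D (prod_func u (id_func C')) = D1 D (prod_func u w)"
    using D1_comp[OF sfun_idl[OF sA w] sfun_idr[OF u sC']] prod_split(1)[OF u w] by simp
  show "nat_iso_from_to (M0 (pull_mor D u) C \<circ>\<^sub>F D1 (shift D B) w) (D1 (shift D A) w \<circ>\<^sub>F M0 (pull_mor D u) C') (M1 (pull_mor D u) w)"
    using id_nt[OF star[OF uw]] iso_ident[OF dcat[OF small_funD(2)[OF uw]] pb_ob[OF uw]] functor_ends[OF star[OF uw]]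
    by (simp add: nat_iso_from_to_def pull_mor_def 1 2)
next
  note sA = small_funD(2)[OF u] and sB = small_funD(3)[OF u]
  fix C X assume C: "small C" and "X \<in> Obj (D0 (shift D B) C)"
  then show "At (M1 (pull_mor D u) (id_func C)) X = Ident (D0 (shift D A) C) (FO (M0 (pull_mor D u) C) X)"
    by (simp add: pull_mor_simps(1)[OF u] pull_mor_simps(2)[OF u sfun_id[OF C]])
next
  note sA = small_funD(2)[OF u] and sB = small_funD(3)[OF u]
  fix w w' C C' C'' X assume w: "sfun C C' w" and w': "sfun C' C'' w'" and "X \<in> Obj (D0 (shift D B) C'')"
  then have X: "X \<in> ob (prod_cat B C'')" by simp
  note sC = small_funD(2)[OF w]
  note w2 = sfun_idl[OF sA w] and uw' = sfun_prod[OF u w'] and uw = sfun_prod[OF u w] and w2' = sfun_idl[OF sB w']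
  have e1: "pb (prod_func u (w' \<circ>\<^sub>F w)) X = pb (prod_func (id_func A) w) (pb (prod_func u w') X)"
    using pb_comp[OF w2 uw' X] prod_func_comp[OF functor_id small_funD(1)[OF w] small_funD(1)[OF u] small_funD(1)[OF w']]
      comp_id_right[OF small_funD(1)[OF u]] small_funD(6)[OF u] by simp
  have e2: "pb (prod_func u (w' \<circ>\<^sub>F w)) X = pb (prod_func u w) (pb (prod_func (id_func B) w') X)"
    using pb_comp[OF uw w2' X] prod_func_comp[OF small_funD(1)[OF u] small_funD(1)[OF w] functor_id small_funD(1)[OF w']]
      comp_id_left[OF small_funD(1)[OF u]] small_funD(7)[OF u] by simp
  have o: "pb (prod_func u (w' \<circ>\<^sub>F w)) X \<in> ob (prod_cat A C)" using pb_ob[OF w2 pb_ob[OF uw' X]] e1 by simp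
  have i: "idt (prod_cat A C) (pb (prod_func u (w' \<circ>\<^sub>F w)) X) \<cdot>\<^bsub>prod_cat A C\<^esub> idt (prod_cat A C) (pb (prod_func u (w' \<circ>\<^sub>F w)) X)
    = idt (prod_cat A C) (pb (prod_func u (w' \<circ>\<^sub>F w)) X)"
    using dcat[OF small_funD(2)[OF uw]] o cat_ident_hom cat_id_left by metis
  show "At (M1 (pull_mor D u) (w' \<circ>\<^sub>F w)) X = Comp (D0 (shift D A) C) (FA (D1 (shift D A) w) (At (M1 (pull_mor D u) w') X))
    (At (M1 (pull_mor D u) w) (FO (D1 (shift D B) w') X))"
    using i pull_mor_simps(2)[OF u sfun_comp[OF w w'] X] pull_mor_simps(2)[OF u w' X] pull_mor_simps(2)[OF u w pb_ob[OF w2' X]]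
      pa_idt[OF w2 pb_ob[OF uw' X]] e1 e2 by simp
next
  note sA = small_funD(2)[OF u] and sB = small_funD(3)[OF u]
  fix \<alpha> w w' C C' X assume \<alpha>: "ntrans_from_to w w' \<alpha>" and w: "sfun C C' w" and w': "sfun C C' w'"
    and "X \<in> Obj (D0 (shift D B) C')"
  then have X: "X \<in> ob (prod_cat B C')" by simp
  note sC = small_funD(2)[OF w] and sC' = small_funD(3)[OF w]
  let ?q = "prod_func u (id_func C)" and ?r = "prod_func u (id_func C')"
  let ?a = "prod_nt (id_nt (id_func A)) \<alpha>" and ?b = "prod_nt (id_nt (id_func B)) \<alpha>"
  note q = sfun_idr[OF u sC] and r = sfun_idr[OF u sC']
  note p = sfun_idl[OF sA w] and p' = sfun_idl[OF sA w'] and v = sfun_idl[OF sB w] and v' = sfun_idl[OF sB w']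
  note a = prod_idl_nt[OF sA \<alpha>] and b = prod_idl_nt[OF sB \<alpha>]
  have "whisker_right ?b ?q = whisker_left ?r ?a"
    unfolding whisker_right_def whisker_left_def nt_ends[OF a] nt_ends[OF b]
  proof (rule mk_nt_cong[OF prod_swap[OF u w, symmetric] prod_swap[OF u w', symmetric]])
    fix x assume "x \<in> Obj (Src (?r \<circ>\<^sub>F prod_func (id_func A) w))"
    then obtain a c where *: "x = Pair a c" "a \<in> Obj A" "c \<in> Obj C"
      by (auto simp: small_funD[OF w] elim!: prod_objE)
    have \<alpha>c: "At \<alpha> c \<in> Hom C' (FO w c) (FO w' c)"
      using nt_hom[OF \<alpha>] *(3) small_funD(4,5)[OF w] by simp
    have ia: "Ident A a \<in> Hom A a a" using cat_ident_hom[OF small_is_category[OF sA] *(2)] .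
    show "At ?b (FO ?q x) = FA ?r (At ?a x)"
      using * fun_obj[OF small_funD(1)[OF u] *(2)] prod_func_simps(4)[of "Ident A a" u a a "At \<alpha> c" "id_func C'" "FO w c" "FO w' c"]
        ia \<alpha>c fun_ident[OF small_funD(1)[OF u] *(2)]
      by (simp add: small_funD[OF u] nt_ends[OF \<alpha>] small_funD[OF w])
  qed
  then have ab: "pa ?q (cl ?b X) = cl ?a (pb ?r X)"
    using cl_whisker_right[OF b v q X] cl_whisker_left[OF a p r X] by simp
  have e: "pb (prod_func u w) X = pb (prod_func (id_func A) w) (pb ?r X)" "pb (prod_func u w') X = pb (prod_func (id_func A) w') (pb ?r X)"
    using pb_comp[OF p r X] pb_comp[OF p' r X] prod_split(1)[OF u w] prod_split(1)[OF u w'] by simp_all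
  note E = dcat[OF small_funD(2)[OF q]]
  note ca = cl_hm[OF a p pb_ob[OF r X]]
  show "Comp (D0 (shift D A) C) (At (D2 (shift D A) \<alpha>) (FO (M0 (pull_mor D u) C') X)) (At (M1 (pull_mor D u) w) X) =
       Comp (D0 (shift D A) C) (At (M1 (pull_mor D u) w') X) (FA (M0 (pull_mor D u) C) (At (D2 (shift D B) \<alpha>) X))"
    using cat_id_left[OF E ca] cat_id_right[OF E ca] ab pull_mor_simps(2)[OF u w X] pull_mor_simps(2)[OF u w' X] e
    by (simp add: pull_mor_simps(1)[OF u])
qed

text \<open>Pasting of invertible squares. Coherence of the composite follows from the coherence of
  \<open>F\<close>, mapped by \<open>G\<close>, and from that of \<open>G\<close>, joined by
  naturality of the cells of \<open>G\<close>.\<close>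

lemma comp_dmor_morphism:
  assumes sA: "small A" and sB: "small B" and sB': "small B'"
    and F: "deriv_morphism \<kappa> (shift D A) (shift D B) F" and G: "deriv_morphism \<kappa> (shift D B) (shift D B') G"
  shows "deriv_morphism \<kappa> (shift D A) (shift D B') (G \<circ>\<^sub>D F)"
proof (rule deriv_morphismI)
  show "functor_from_to (D0 (shift D A) C) (D0 (shift D B') C) (M0 (G \<circ>\<^sub>D F) C)" if "small C" for C
    using functor_comp[OF deriv_morphismD(1)[OF F that] deriv_morphismD(1)[OF G that]] by (simp add: comp_dmor_def)
next
  fix w C C' assume w: "sfun C C' w"
  note sC = small_funD(2)[OF w] and sC' = small_funD(3)[OF w]
  note at = comp_dmor_at[OF F G w star_shift[OF sB w] star_shift[OF sA w] star_shift[OF sB' w]]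
  note FC = deriv_morphismD(1)[OF F sC] and FC' = deriv_morphismD(1)[OF F sC'] and GC = deriv_morphismD(1)[OF G sC]
  have "is_iso (D0 D (prod_cat B' C)) (At (M1 (G \<circ>\<^sub>D F) w) X)" if X: "X \<in> ob (prod_cat A C')" for X
  proof -
    have FX: "FO (M0 F C') X \<in> ob (prod_cat B C')" using fun_obj[OF FC'] X by simp
    have 1: "At (M1 F w) X \<in> hm (prod_cat B C) (FO (M0 F C) (pb (prod_func (id_func A) w) X)) (pb (prod_func (id_func B) w) (FO (M0 F C') X))"
      and 2: "is_iso (D0 D (prod_cat B C)) (At (M1 F w) X)"
      using deriv_morphismD(2)[OF F w] X nt_hom[OF deriv_morphism_cell[OF F w]]
        functor_ends[OF star_shift[OF sA w]] functor_ends[OF FC] functor_ends[OF FC']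
      by (simp_all add: nat_iso_from_to_def)
    have 3: "At (M1 G w) (FO (M0 F C') X) \<in> hm (prod_cat B' C) (FO (M0 G C) (pb (prod_func (id_func B) w) (FO (M0 F C') X)))
        (pb (prod_func (id_func B') w) (FO (M0 G C') (FO (M0 F C') X)))"
      and 4: "is_iso (D0 D (prod_cat B' C)) (At (M1 G w) (FO (M0 F C') X))"
      using deriv_morphismD(2)[OF G w] FX nt_hom[OF deriv_morphism_cell[OF G w]]
        functor_ends[OF star_shift[OF sB w]] functor_ends[OF GC] functor_ends[OF deriv_morphismD(1)[OF G sC']]
      by (simp_all add: nat_iso_from_to_def)
    show ?thesis
      using iso_comp[OF functor_cat(2)[OF GC, unfolded shift_simps] 3 _ 4] fun_hom[OF GC, unfolded shift_simps, OF 1]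
        fun_iso[OF GC, unfolded shift_simps, OF 1 2] at(2) X
      by simp
  qed
  then show "nat_iso_from_to (M0 (G \<circ>\<^sub>D F) C \<circ>\<^sub>F D1 (shift D A) w) (D1 (shift D B') w \<circ>\<^sub>F M0 (G \<circ>\<^sub>D F) C') (M1 (G \<circ>\<^sub>D F) w)"
    using at(1) functor_ends[OF star_shift[OF sA w]] functor_ends[OF GC]
    by (simp add: nat_iso_from_to_def) (simp add: comp_dmor_def)
next
  fix C X assume C: "small C" and X: "X \<in> Obj (D0 (shift D A) C)"
  note i = sfun_id[OF C]
  note at = comp_dmor_at[OF F G i star_shift[OF sB i] star_shift[OF sA i] star_shift[OF sB' i]]
  note FC = deriv_morphismD(1)[OF F C] and GC = deriv_morphismD(1)[OF G C]
  note FX = fun_obj[OF FC X]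
  note GFX = fun_obj[OF GC FX]
  show "At (M1 (G \<circ>\<^sub>D F) (id_func C)) X = Ident (D0 (shift D B') C) (FO (M0 (G \<circ>\<^sub>D F) C) X)"
    using at(2)[OF X] deriv_morphismD(3)[OF F C X] deriv_morphismD(3)[OF G C FX] fun_ident[OF GC FX]
      cat_id_left[OF functor_cat(2)[OF GC] cat_ident_hom[OF functor_cat(2)[OF GC] GFX]]
    by (simp add: comp_dmor_def functor_ends[OF FC] X[simplified])
next
  fix w w' C C' C'' X assume w: "sfun C C' w" and w': "sfun C' C'' w'" and X: "X \<in> Obj (D0 (shift D A) C'')"
  note sC = small_funD(2)[OF w] and sC' = small_funD(3)[OF w]  and sC'' = small_funD(3)[OF w']
  note ww = sfun_comp[OF w w']
  note at = comp_dmor_at[OF F G w star_shift[OF sB w] star_shift[OF sA w] star_shift[OF sB' w]]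
  note at' = comp_dmor_at[OF F G w' star_shift[OF sB w'] star_shift[OF sA w'] star_shift[OF sB' w']]
  note at'' = comp_dmor_at[OF F G ww star_shift[OF sB ww] star_shift[OF sA ww] star_shift[OF sB' ww]]
  note FC = deriv_morphismD(1)[OF F sC] and GC = deriv_morphismD(1)[OF G sC]
  note FC' = deriv_morphismD(1)[OF F sC'] and GC' = deriv_morphismD(1)[OF G sC']
  note FC'' = deriv_morphismD(1)[OF F sC''] and GC'' = deriv_morphismD(1)[OF G sC'']
  note FX = fun_obj[OF FC'' X]
  note wX = fun_obj[OF star_shift[OF sA w'] X]
  note wFX = fun_obj[OF star_shift[OF sB w'] FX]
  note FwX = fun_obj[OF FC' wX]
  let ?H = "D0 D (prod_cat B' C)"
  note H = functor_cat(2)[OF GC, unfolded shift_simps]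
  note endsA = functor_ends[OF star_shift[OF sA w]] functor_ends[OF star_shift[OF sA w']] functor_ends[OF star_shift[OF sB w]] functor_ends[OF star_shift[OF sB w']]
     functor_ends[OF FC] functor_ends[OF FC'] functor_ends[OF FC''] functor_ends[OF GC] functor_ends[OF GC'] functor_ends[OF GC'']
  have Fw': "At (M1 F w') X \<in> Hom (D0 (shift D B) C') (FO (M0 F C') (FO (D1 (shift D A) w') X)) (FO (D1 (shift D B) w') (FO (M0 F C'') X))"
    using nt_hom[OF deriv_morphism_cell[OF F w']] X endsA by simp
  have Fw: "At (M1 F w) (FO (D1 (shift D A) w') X) \<in> Hom (D0 (shift D B) C) (FO (M0 F C) (FO (D1 (shift D A) w) (FO (D1 (shift D A) w') X)))
      (FO (D1 (shift D B) w) (FO (M0 F C') (FO (D1 (shift D A) w') X)))"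
    using nt_hom[OF deriv_morphism_cell[OF F w]] wX endsA by simp
  have Gw': "At (M1 G w') (FO (M0 F C'') X) \<in> Hom (D0 (shift D B') C') (FO (M0 G C') (FO (D1 (shift D B) w') (FO (M0 F C'') X)))
      (FO (D1 (shift D B') w') (FO (M0 G C'') (FO (M0 F C'') X)))"
    using nt_hom[OF deriv_morphism_cell[OF G w']] FX endsA by simp
  have Gw: "At (M1 G w) Y \<in> Hom (D0 (shift D B') C) (FO (M0 G C) (FO (D1 (shift D B) w) Y)) (FO (D1 (shift D B') w) (FO (M0 G C') Y))"
    if "Y \<in> Obj (D0 (shift D B) C')" for Y
    using nt_hom[OF deriv_morphism_cell[OF G w]] that endsA by simp
  let ?a = "FA (D1 (shift D B') w) (At (M1 G w') (FO (M0 F C'') X))"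
    and ?b = "At (M1 G w) (FO (D1 (shift D B) w') (FO (M0 F C'') X))"
    and ?c = "FA (M0 G C) (FA (D1 (shift D B) w) (At (M1 F w') X))"
    and ?d = "FA (M0 G C) (At (M1 F w) (FO (D1 (shift D A) w') X))"
    and ?b' = "At (M1 G w) (FO (M0 F C') (FO (D1 (shift D A) w') X))"
    and ?c' = "FA (D1 (shift D B') w) (FA (M0 G C') (At (M1 F w') X))"
  note a = fun_hom[OF star_shift[OF sB' w] Gw'] and b = Gw[OF wFX] and b' = Gw[OF FwX]
  note c0 = fun_hom[OF star_shift[OF sB w] Fw']
  note c = fun_hom[OF GC c0] and c' = fun_hom[OF star_shift[OF sB' w] fun_hom[OF GC' Fw']]
  note d = fun_hom[OF GC Fw]
  note H = functor_cat(2)[OF GC]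
  let ?H = "D0 (shift D B') C"
  \<comment> \<open>Naturality of the cell of \<open>G\<close> at the cell of \<open>F\<close>
    exchanges the two middle factors; this is what makes the two pastings agree.\<close>
  have sq: "Comp ?H ?b ?c = Comp ?H ?c' ?b'"
    using nt_nat[OF deriv_morphism_cell[OF G w], unfolded comp_func_simps endsA, OF Fw']
      comp_func_FA[of "At (M1 F w') X" "D1 (shift D B) w" _ _ "M0 G C", unfolded endsA, OF Fw']
      comp_func_FA[of "At (M1 F w') X" "M0 G C'" _ _ "D1 (shift D B') w", unfolded endsA, OF Fw'] by simp
  have l: "At (M1 (G \<circ>\<^sub>D F) (w' \<circ>\<^sub>F w)) X = Comp ?H (Comp ?H ?a ?b) (Comp ?H ?c ?d)"
    using at''(2)[OF X] deriv_morphismD(4)[OF F w w' X] deriv_morphismD(4)[OF G w w' FX] fun_comp[OF GC c0 Fw] by simp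
  have "\<dots> = Comp ?H ?a (Comp ?H (Comp ?H ?b ?c) ?d)"
    using cat_assoc[OF H a b cat_comp_hom[OF H c d]] cat_assoc[OF H b c d] by simp
  also have "\<dots> = Comp ?H (Comp ?H ?a ?c') (Comp ?H ?b' ?d)"
    unfolding sq using cat_assoc[OF H c' b' d] cat_assoc[OF H a c' cat_comp_hom[OF H b' d]] by simp
  also have "Comp ?H ?a ?c' = FA (D1 (shift D B') w) (At (M1 (G \<circ>\<^sub>D F) w') X)"
    using fun_comp[OF star_shift[OF sB' w] Gw' fun_hom[OF GC' Fw']] at'(2)[OF X] by simp
  also have "Comp ?H ?b' ?d = At (M1 (G \<circ>\<^sub>D F) w) (FO (D1 (shift D A) w') X)"
    using at(2)[OF wX] by simp
  finally show "At (M1 (G \<circ>\<^sub>D F) (w' \<circ>\<^sub>F w)) X = Comp ?H (FA (D1 (shift D B') w) (At (M1 (G \<circ>\<^sub>D F) w') X))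
    (At (M1 (G \<circ>\<^sub>D F) w) (FO (D1 (shift D A) w') X))" using l by simp
next
  fix \<alpha> w w' C C' X assume \<alpha>: "ntrans_from_to w w' \<alpha>" and w: "sfun C C' w" and w': "sfun C C' w'"
    and X: "X \<in> Obj (D0 (shift D A) C')"
  note sC = small_funD(2)[OF w] and sC' = small_funD(3)[OF w]
  note at = comp_dmor_at[OF F G w star_shift[OF sB w] star_shift[OF sA w] star_shift[OF sB' w]]
  note at' = comp_dmor_at[OF F G w' star_shift[OF sB w'] star_shift[OF sA w'] star_shift[OF sB' w']]
  note FC = deriv_morphismD(1)[OF F sC] and GC = deriv_morphismD(1)[OF G sC]
  note FC' = deriv_morphismD(1)[OF F sC'] and GC' = deriv_morphismD(1)[OF G sC']
  note FX = fun_obj[OF FC' X]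
  note GFX = fun_obj[OF GC' FX]
  note ends = functor_ends[OF star_shift[OF sA w]] functor_ends[OF star_shift[OF sB w]]
     functor_ends[OF star_shift[OF sA w']] functor_ends[OF star_shift[OF sB w']]
     functor_ends[OF FC] functor_ends[OF FC'] functor_ends[OF GC] functor_ends[OF GC']
  have Fw: "At (M1 F w) X \<in> Hom (D0 (shift D B) C) (FO (M0 F C) (FO (D1 (shift D A) w) X)) (FO (D1 (shift D B) w) (FO (M0 F C') X))"
    using nt_hom[OF deriv_morphism_cell[OF F w]] X ends by simp
  have Fw': "At (M1 F w') X \<in> Hom (D0 (shift D B) C) (FO (M0 F C) (FO (D1 (shift D A) w') X)) (FO (D1 (shift D B) w') (FO (M0 F C') X))"
    using nt_hom[OF deriv_morphism_cell[OF F w']] X ends by simp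
  have Gw: "At (M1 G w) (FO (M0 F C') X) \<in> Hom (D0 (shift D B') C) (FO (M0 G C) (FO (D1 (shift D B) w) (FO (M0 F C') X)))
      (FO (D1 (shift D B') w) (FO (M0 G C') (FO (M0 F C') X)))"
    using nt_hom[OF deriv_morphism_cell[OF G w]] FX ends by simp
  have Gw': "At (M1 G w') (FO (M0 F C') X) \<in> Hom (D0 (shift D B') C) (FO (M0 G C) (FO (D1 (shift D B) w') (FO (M0 F C') X)))
      (FO (D1 (shift D B') w') (FO (M0 G C') (FO (M0 F C') X)))"
    using nt_hom[OF deriv_morphism_cell[OF G w']] FX ends by simp
  have aX: "At (D2 (shift D A) \<alpha>) X \<in> Hom (D0 (shift D A) C) (FO (D1 (shift D A) w) X) (FO (D1 (shift D A) w') X)"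
    using cl_hm[OF prod_idl_nt[OF sA \<alpha>] sfun_idl[OF sA w]] X by simp
  have aFX: "At (D2 (shift D B) \<alpha>) (FO (M0 F C') X) \<in>
      Hom (D0 (shift D B) C) (FO (D1 (shift D B) w) (FO (M0 F C') X)) (FO (D1 (shift D B) w') (FO (M0 F C') X))"
    using cl_hm[OF prod_idl_nt[OF sB \<alpha>] sfun_idl[OF sB w]] FX by simp
  have aGFX: "At (D2 (shift D B') \<alpha>) (FO (M0 G C') (FO (M0 F C') X)) \<in>
      Hom (D0 (shift D B') C) (FO (D1 (shift D B') w) (FO (M0 G C') (FO (M0 F C') X))) (FO (D1 (shift D B') w') (FO (M0 G C') (FO (M0 F C') X)))"
    using cl_hm[OF prod_idl_nt[OF sB' \<alpha>] sfun_idl[OF sB' w]] GFX by simp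
  note H = functor_cat(2)[OF GC]
  let ?H = "D0 (shift D B') C"
  have gf: "FO (M0 (G \<circ>\<^sub>D F) C') X = FO (M0 G C') (FO (M0 F C') X)"
    "FA (M0 (G \<circ>\<^sub>D F) C) (At (D2 (shift D A) \<alpha>) X) = FA (M0 G C) (FA (M0 F C) (At (D2 (shift D A) \<alpha>) X))"
    using X comp_func_FA[of "At (D2 (shift D A) \<alpha>) X" "M0 F C" _ _ "M0 G C", unfolded ends, OF aX] ends
    by (simp_all add: comp_dmor_def)
  have "Comp ?H (At (D2 (shift D B') \<alpha>) (FO (M0 (G \<circ>\<^sub>D F) C') X)) (At (M1 (G \<circ>\<^sub>D F) w) X) =
    Comp ?H (Comp ?H (At (M1 G w') (FO (M0 F C') X)) (FA (M0 G C) (At (D2 (shift D B) \<alpha>) (FO (M0 F C') X)))) (FA (M0 G C) (At (M1 F w) X))"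
    unfolding gf at(2)[OF X]
    using cat_assoc[OF H aGFX Gw fun_hom[OF GC Fw]] deriv_morphismD(5)[OF G \<alpha> w FX] by simp
  also have "\<dots> = Comp ?H (At (M1 G w') (FO (M0 F C') X)) (FA (M0 G C) (Comp (D0 (shift D B) C) (At (D2 (shift D B) \<alpha>) (FO (M0 F C') X)) (At (M1 F w) X)))"
    using cat_assoc[OF H Gw' fun_hom[OF GC aFX] fun_hom[OF GC Fw]] fun_comp[OF GC aFX Fw] by simp
  also have "\<dots> = Comp ?H (At (M1 (G \<circ>\<^sub>D F) w') X) (FA (M0 (G \<circ>\<^sub>D F) C) (At (D2 (shift D A) \<alpha>) X))"
    unfolding deriv_morphismD(5)[OF F \<alpha> w X] gf(2) at'(2)[OF X]
    using fun_comp[OF GC Fw' fun_hom[OF FC aX]] cat_assoc[OF H Gw' fun_hom[OF GC Fw'] fun_hom[OF GC fun_hom[OF FC aX]]] by simp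
  finally show "Comp ?H (At (D2 (shift D B') \<alpha>) (FO (M0 (G \<circ>\<^sub>D F) C') X)) (At (M1 (G \<circ>\<^sub>D F) w) X) =
      Comp ?H (At (M1 (G \<circ>\<^sub>D F) w') X) (FA (M0 (G \<circ>\<^sub>D F) C) (At (D2 (shift D A) \<alpha>) X))" .
qed

end

section \<open>Kan extensions with parameters\<close>

context derivator_theory begin

lemma dmor_hom:
  assumes A: "small A" and F: "deriv_morphism \<kappa> (shift D A) (shift D B) F" and w: "sfun C C' w" and X: "X \<in> ob (prod_cat A C')"
  shows "At (M1 F w) X \<in> hm (prod_cat B C) (FO (M0 F C) (pb (prod_func (id_func A) w) X)) (pb (prod_func (id_func B) w) (FO (M0 F C') X))"
  using nt_hom[OF deriv_morphism_cell[OF F w]] X functor_ends[OF star_shift[OF A w]]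
    functor_ends[OF deriv_morphismD(1)[OF F small_funD(2)[OF w]]] functor_ends[OF deriv_morphismD(1)[OF F small_funD(3)[OF w]]]
  by simp

lemma dmor_ob:
  assumes "deriv_morphism \<kappa> (shift D A) (shift D B) F" "small C" "X \<in> ob (prod_cat A C)"
  shows "FO (M0 F C) X \<in> ob (prod_cat B C)"
  using fun_obj[OF deriv_morphismD(1)[OF assms(1,2)]] assms(3) by simp

lemma dmor_hm:
  assumes "deriv_morphism \<kappa> (shift D A) (shift D B) F" "small C" "f \<in> hm (prod_cat A C) X Y"
  shows "FA (M0 F C) f \<in> hm (prod_cat B C) (FO (M0 F C) X) (FO (M0 F C) Y)"
  using fun_hom[OF deriv_morphismD(1)[OF assms(1,2)]] assms(3) by simp

text \<open>\<open>F\<close> is the composite \<open>u\<^sub>! \<pi>\<^sup>*\<close>, expressed by universal arrows \<open>\<eta> : \<pi>\<^sup>* X \<rightarrow> u\<^sup>* F X\<close> compatible with parameters.\<close>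

definition kan :: "'a sfunc \<Rightarrow> 'a sfunc \<Rightarrow> ('a, 'o, 'm, 'o, 'm) dmor \<Rightarrow> ('a scat \<Rightarrow> 'o \<Rightarrow> 'm) \<Rightarrow> bool" where
  "kan \<pi> u F \<eta> \<longleftrightarrow>
     (\<forall>C X. small C \<and> X \<in> ob (prod_cat (Tgt \<pi>) C) \<longrightarrow>
        univ_arrow (prod_func u (id_func C)) (pb (prod_func \<pi> (id_func C)) X) (FO (M0 F C) X) (\<eta> C X)) \<and>
     (\<forall>C X Y f. small C \<and> f \<in> hm (prod_cat (Tgt \<pi>) C) X Y \<longrightarrow>
        pa (prod_func u (id_func C)) (FA (M0 F C) f) \<cdot>\<^bsub>prod_cat (Src \<pi>) C\<^esub> \<eta> C X =
        \<eta> C Y \<cdot>\<^bsub>prod_cat (Src \<pi>) C\<^esub> pa (prod_func \<pi> (id_func C)) f) \<and>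
     (\<forall>C C' w X. sfun C C' w \<and> X \<in> ob (prod_cat (Tgt \<pi>) C') \<longrightarrow>
        pa (prod_func u (id_func C)) (At (M1 F w) X) \<cdot>\<^bsub>prod_cat (Src \<pi>) C\<^esub> \<eta> C (pb (prod_func (id_func (Tgt \<pi>)) w) X) =
        pa (prod_func (id_func (Src \<pi>)) w) (\<eta> C' X))"

lemma kanI:
  assumes \<pi>: "sfun E A \<pi>"
    and "\<And>C X. small C \<Longrightarrow> X \<in> ob (prod_cat A C) \<Longrightarrow>
        univ_arrow (prod_func u (id_func C)) (pb (prod_func \<pi> (id_func C)) X) (FO (M0 F C) X) (\<eta> C X)"
    and "\<And>C X Y f. small C \<Longrightarrow> X \<in> ob (prod_cat A C) \<Longrightarrow> Y \<in> ob (prod_cat A C) \<Longrightarrow> f \<in> hm (prod_cat A C) X Y \<Longrightarrow>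
        pa (prod_func u (id_func C)) (FA (M0 F C) f) \<cdot>\<^bsub>prod_cat E C\<^esub> \<eta> C X =
        \<eta> C Y \<cdot>\<^bsub>prod_cat E C\<^esub> pa (prod_func \<pi> (id_func C)) f"
    and "\<And>C C' w X. sfun C C' w \<Longrightarrow> X \<in> ob (prod_cat A C') \<Longrightarrow>
        pa (prod_func u (id_func C)) (At (M1 F w) X) \<cdot>\<^bsub>prod_cat E C\<^esub> \<eta> C (pb (prod_func (id_func A) w) X) =
        pa (prod_func (id_func E) w) (\<eta> C' X)"
  shows "kan \<pi> u F \<eta>"
  unfolding kan_def small_funD(4,5)[OF \<pi>]
  using assms(2-4) hom_obj[OF dcat[OF small_prod[OF size small_funD(3)[OF \<pi>]]]] by blast

lemma kanD:
  assumes "kan \<pi> u F \<eta>" and \<pi>: "sfun E A \<pi>"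
  shows "small C \<Longrightarrow> X \<in> ob (prod_cat A C) \<Longrightarrow>
        univ_arrow (prod_func u (id_func C)) (pb (prod_func \<pi> (id_func C)) X) (FO (M0 F C) X) (\<eta> C X)"
    and "small C \<Longrightarrow> f \<in> hm (prod_cat A C) X Y \<Longrightarrow>
        pa (prod_func u (id_func C)) (FA (M0 F C) f) \<cdot>\<^bsub>prod_cat E C\<^esub> \<eta> C X =
        \<eta> C Y \<cdot>\<^bsub>prod_cat E C\<^esub> pa (prod_func \<pi> (id_func C)) f"
    and "sfun C C' w \<Longrightarrow> X \<in> ob (prod_cat A C') \<Longrightarrow>
        pa (prod_func u (id_func C)) (At (M1 F w) X) \<cdot>\<^bsub>prod_cat E C\<^esub> \<eta> C (pb (prod_func (id_func A) w) X) =
        pa (prod_func (id_func E) w) (\<eta> C' X)"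
  using assms(1) unfolding kan_def small_funD(4,5)[OF \<pi>] by blast+

text \<open>For each object, \<open>\<eta>\<close> and \<open>\<theta>\<close> are universal arrows
  from the same source, so there is one comparison compatible with them and it is invertible. Its
  naturality and its compatibility with parameters are equalities tested on \<open>\<eta>\<close>,
  where the clauses of \<open>kan\<close> for \<open>F\<close> and \<open>G\<close> give the same
  map.\<close>

lemma kan_iso_modification:
  assumes \<pi>: "sfun E A \<pi>" and u: "sfun E B u" and F: "deriv_morphism \<kappa> (shift D A) (shift D B) F"
    and G: "deriv_morphism \<kappa> (shift D A) (shift D B) G" and kF: "kan \<pi> u F \<eta>" and kG: "kan \<pi> u G \<theta>"
  shows "\<exists>\<Phi>. iso_modification \<kappa> (shift D A) (shift D B) F G \<Phi>"
proof -
  note sE = small_funD(2)[OF \<pi>] and sA = small_funD(3)[OF \<pi>] and sB = small_funD(3)[OF u]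
  let ?u = "\<lambda>C. prod_func u (id_func C)" and ?\<pi> = "\<lambda>C. prod_func \<pi> (id_func C)"
  let ?P = "\<lambda>C X h. h \<in> hm (prod_cat B C) (FO (M0 F C) X) (FO (M0 G C) X) \<and> pa (?u C) h \<cdot>\<^bsub>prod_cat E C\<^esub> \<eta> C X = \<theta> C X"
  \<comment> \<open>Uniqueness in the universal property makes the choice immaterial: the predicate
    determines \<open>h\<close>.\<close>
  define \<phi> where "\<phi> C X = (SOME h. ?P C X h)" for C X
  have ph: "?P C X (\<phi> C X)" if C: "small C" and X: "X \<in> ob (prod_cat A C)" for C X
  proof -
    note V = univ_arrowD[OF kanD(1)[OF kG \<pi> C X] sfun_idr[OF u C]]
    obtain h where "?P C X h" using univ_arrow_ex[OF kanD(1)[OF kF \<pi> C X] sfun_idr[OF u C] V] by blast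
    then show ?thesis unfolding \<phi>_def by (rule someI)
  qed
  note ph1 = ph[THEN conjunct1] and ph2 = ph[THEN conjunct2]
  define \<Phi> where "\<Phi> C = mk_nt (M0 F C) (M0 G C) (\<phi> C)" for C
  have at: "At (\<Phi> C) X = \<phi> C X" if "small C" "X \<in> ob (prod_cat A C)" for C X
    using that functor_ends[OF deriv_morphismD(1)[OF F that(1)]] by (simp add: \<Phi>_def)
  have nt: "ntrans_from_to (M0 F C) (M0 G C) (\<Phi> C)" if C: "small C" for C
    unfolding \<Phi>_def
  proof (rule nt_mk[OF deriv_morphismD(1)[OF F C] deriv_morphismD(1)[OF G C]])
    fix X assume "X \<in> Obj (D0 (shift D A) C)"
    then show "\<phi> C X \<in> Hom (D0 (shift D B) C) (FO (M0 F C) X) (FO (M0 G C) X)" using ph1[OF C] by simp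
  next
    fix f X Y assume "f \<in> Hom (D0 (shift D A) C) X Y" "X \<in> Obj (D0 (shift D A) C)" "Y \<in> Obj (D0 (shift D A) C)"
    then have f: "f \<in> hm (prod_cat A C) X Y" and X: "X \<in> ob (prod_cat A C)" and Y: "Y \<in> ob (prod_cat A C)" by simp_all
    note v = sfun_idr[OF u C]
    note U = kanD(1)[OF kF \<pi> C X]
    note e = univ_arrowD(2)[OF U v] and eY = univ_arrowD(2)[OF kanD(1)[OF kF \<pi> C Y] v]
    note Ff = dmor_hm[OF F C f] and Gf = dmor_hm[OF G C f] and pf = pa_hm[OF sfun_idr[OF \<pi> C] f]
    note EC = dcat[OF small_funD(2)[OF v]] and BC = dcat[OF small_funD(3)[OF v]]
    have "\<phi> C Y \<cdot>\<^bsub>prod_cat B C\<^esub> FA (M0 F C) f = FA (M0 G C) f \<cdot>\<^bsub>prod_cat B C\<^esub> \<phi> C X"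
    proof (rule univ_arrow_eq[OF U v cat_comp_hom[OF BC ph1[OF C Y] Ff] cat_comp_hom[OF BC Gf ph1[OF C X]]])
      have "pa (?u C) (\<phi> C Y \<cdot>\<^bsub>prod_cat B C\<^esub> FA (M0 F C) f) \<cdot>\<^bsub>prod_cat E C\<^esub> \<eta> C X =
        pa (?u C) (\<phi> C Y) \<cdot>\<^bsub>prod_cat E C\<^esub> \<eta> C Y \<cdot>\<^bsub>prod_cat E C\<^esub> pa (?\<pi> C) f"
        using pa_dcomp[OF v ph1[OF C Y] Ff] cat_assoc[OF EC pa_hm[OF v ph1[OF C Y]] pa_hm[OF v Ff] e] kanD(2)[OF kF \<pi> C f] by simp
      also have "\<dots> = \<theta> C Y \<cdot>\<^bsub>prod_cat E C\<^esub> pa (?\<pi> C) f"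
        using cat_assoc[OF EC pa_hm[OF v ph1[OF C Y]] eY pf] ph2[OF C Y] by simp
      also have "\<dots> = pa (?u C) (FA (M0 G C) f) \<cdot>\<^bsub>prod_cat E C\<^esub> \<theta> C X" using kanD(2)[OF kG \<pi> C f] by simp
      also have "\<dots> = pa (?u C) (FA (M0 G C) f \<cdot>\<^bsub>prod_cat B C\<^esub> \<phi> C X) \<cdot>\<^bsub>prod_cat E C\<^esub> \<eta> C X"
        using pa_dcomp[OF v Gf ph1[OF C X]] cat_assoc[OF EC pa_hm[OF v Gf] pa_hm[OF v ph1[OF C X]] e] ph2[OF C X] by simp
      finally show "pa (?u C) (\<phi> C Y \<cdot>\<^bsub>prod_cat B C\<^esub> FA (M0 F C) f) \<cdot>\<^bsub>prod_cat E C\<^esub> \<eta> C X =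
        pa (?u C) (FA (M0 G C) f \<cdot>\<^bsub>prod_cat B C\<^esub> \<phi> C X) \<cdot>\<^bsub>prod_cat E C\<^esub> \<eta> C X" .
    qed
    then show "Comp (D0 (shift D B) C) (\<phi> C Y) (FA (M0 F C) f) = Comp (D0 (shift D B) C) (FA (M0 G C) f) (\<phi> C X)" by simp
  qed
  have iso: "is_iso (D0 D (prod_cat B C)) (\<phi> C X)" if C: "small C" and X: "X \<in> ob (prod_cat A C)" for C X
    using univ_arrow_iso[OF kanD(1)[OF kF \<pi> C X] kanD(1)[OF kG \<pi> C X] sfun_idr[OF u C] ph1[OF C X] ph2[OF C X]] .
  \<comment> \<open>After composition with \<open>\<eta>\<close> both sides become the restriction
    of \<open>\<theta> C' X\<close> along \<open>w\<close>.\<close>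
  have cell: "pa (prod_func (id_func B) w) (\<phi> C' X) \<cdot>\<^bsub>prod_cat B C\<^esub> At (M1 F w) X =
    At (M1 G w) X \<cdot>\<^bsub>prod_cat B C\<^esub> \<phi> C (pb (prod_func (id_func A) w) X)"
    if w: "sfun C C' w" and X: "X \<in> ob (prod_cat A C')" for w C C' X
  proof -
    note sC = small_funD(2)[OF w] and sC' = small_funD(3)[OF w]
    let ?p = "prod_func (id_func A) w" and ?v = "prod_func (id_func B) w" and ?e = "prod_func (id_func E) w"
    note p = sfun_idl[OF sA w] and v = sfun_idl[OF sB w] and e = sfun_idl[OF sE w]
    note q = sfun_idr[OF u sC] and r = sfun_idr[OF u sC']
    note pX = pb_ob[OF p X]
    note U = kanD(1)[OF kF \<pi> sC pX]
    note h = univ_arrowD(2)[OF U q] and h' = univ_arrowD(2)[OF kanD(1)[OF kF \<pi> sC' X] r]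
    note Fw = dmor_hom[OF sA F w X] and Gw = dmor_hom[OF sA G w X]
    note f1 = ph1[OF sC' X] and f2 = ph1[OF sC pX]
    note vf = pa_hm[OF v f1]
    note EC = dcat[OF small_funD(2)[OF q]] and BC = dcat[OF small_funD(3)[OF q]]
    show ?thesis
    proof (rule univ_arrow_eq[OF U q cat_comp_hom[OF BC vf Fw] cat_comp_hom[OF BC Gw f2]])
      have "pa (?u C) (pa ?v (\<phi> C' X) \<cdot>\<^bsub>prod_cat B C\<^esub> At (M1 F w) X) \<cdot>\<^bsub>prod_cat E C\<^esub> \<eta> C (pb ?p X) =
        pa (?u C) (pa ?v (\<phi> C' X)) \<cdot>\<^bsub>prod_cat E C\<^esub> pa ?e (\<eta> C' X)"
        using pa_dcomp[OF q vf Fw] cat_assoc[OF EC pa_hm[OF q vf] pa_hm[OF q Fw] h] kanD(3)[OF kF \<pi> w X] by simp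
      also have "\<dots> = pa ?e (pa (?u C') (\<phi> C' X) \<cdot>\<^bsub>prod_cat E C'\<^esub> \<eta> C' X)"
        using pa_sq[OF prod_swap[OF u w] q v e r f1] pa_dcomp[OF e pa_hm[OF r f1] h'] by simp
      also have "\<dots> = pa (?u C) (At (M1 G w) X) \<cdot>\<^bsub>prod_cat E C\<^esub> \<theta> C (pb ?p X)"
        using ph2[OF sC' X] kanD(3)[OF kG \<pi> w X] by simp
      also have "\<dots> = pa (?u C) (At (M1 G w) X \<cdot>\<^bsub>prod_cat B C\<^esub> \<phi> C (pb ?p X)) \<cdot>\<^bsub>prod_cat E C\<^esub> \<eta> C (pb ?p X)"
        using pa_dcomp[OF q Gw f2] cat_assoc[OF EC pa_hm[OF q Gw] pa_hm[OF q f2] h] ph2[OF sC pX] by simp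
      finally show "pa (?u C) (pa ?v (\<phi> C' X) \<cdot>\<^bsub>prod_cat B C\<^esub> At (M1 F w) X) \<cdot>\<^bsub>prod_cat E C\<^esub> \<eta> C (pb ?p X) =
        pa (?u C) (At (M1 G w) X \<cdot>\<^bsub>prod_cat B C\<^esub> \<phi> C (pb ?p X)) \<cdot>\<^bsub>prod_cat E C\<^esub> \<eta> C (pb ?p X)" .
    qed
  qed
  have "iso_modification \<kappa> (shift D A) (shift D B) F G \<Phi>"
    unfolding iso_modification_def modification_def nat_iso_from_to_def
  proof (intro conjI allI impI ballI F G nt)
    fix w X assume "small_functor \<kappa> w" and X: "X \<in> Obj (D0 (shift D A) (Tgt w))"
    then have w: "sfun (Src w) (Tgt w) w" by (simp add: small_functor_iff)
    show "Comp (D0 (shift D B) (Src w)) (FA (D1 (shift D B) w) (At (\<Phi> (Tgt w)) X)) (At (M1 F w) X) =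
          Comp (D0 (shift D B) (Src w)) (At (M1 G w) X) (At (\<Phi> (Src w)) (FO (D1 (shift D A) w) X))"
      using cell[OF w] X at[OF small_funD(3)[OF w]] at[OF small_funD(2)[OF w] pb_ob[OF sfun_idl[OF sA w]]] by simp
  next
    fix C X assume "small C" "X \<in> Obj (Src (M0 F C))"
    then show "is_iso (Tgt (M0 F C)) (At (\<Phi> C) X)"
      using functor_ends[OF deriv_morphismD(1)[OF F]] at iso by simp
  qed
  then show ?thesis by blast
qed

text \<open>Left Kan extensions compose. A map into a pullback along the composite factors through
  \<open>\<eta>\<close>, and the factor in turn through \<open>\<theta>\<close>.\<close>

lemma univ_arrow_comp:
  assumes U: "univ_arrow p X P \<eta>" and V: "univ_arrow t P Q \<theta>" and p: "sfun E B p" and t: "sfun B B' t"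
  shows "univ_arrow (t \<circ>\<^sub>F p) X Q (pa p \<theta> \<cdot>\<^bsub>E\<^esub> \<eta>)"
proof -
  note u = univ_arrowD[OF U p] and v = univ_arrowD[OF V t]
  note E = dcat[OF small_funD(2)[OF p]] and B = dcat[OF small_funD(3)[OF p]]
  have e: "pa (t \<circ>\<^sub>F p) h \<cdot>\<^bsub>E\<^esub> (pa p \<theta> \<cdot>\<^bsub>E\<^esub> \<eta>) = pa p (pa t h \<cdot>\<^bsub>B\<^esub> \<theta>) \<cdot>\<^bsub>E\<^esub> \<eta>" if h: "h \<in> hm B' Q Y" for h Y
    using pa_comp[OF p t h] pa_dcomp[OF p pa_hm[OF t h] v(2)] cat_assoc[OF E pa_hm[OF p pa_hm[OF t h]] pa_hm[OF p v(2)] u(2)] by simp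
  show ?thesis
  proof (rule univ_arrowI[OF sfun_comp[OF p t] v(1)])
    show "pa p \<theta> \<cdot>\<^bsub>E\<^esub> \<eta> \<in> hm E X (pb (t \<circ>\<^sub>F p) Q)"
      using cat_comp_hom[OF E pa_hm[OF p v(2)] u(2)] pb_comp[OF p t v(1)] by simp
    fix Y g assume Y: "Y \<in> ob B'" and g: "g \<in> hm E X (pb (t \<circ>\<^sub>F p) Y)"
    obtain k where k: "k \<in> hm B P (pb t Y)" "pa p k \<cdot>\<^bsub>E\<^esub> \<eta> = g"
      using univ_arrow_ex[OF U p pb_ob[OF t Y]] g pb_comp[OF p t Y] by auto
    obtain h where h: "h \<in> hm B' Q Y" "pa t h \<cdot>\<^bsub>B\<^esub> \<theta> = k" using univ_arrow_ex[OF V t Y k(1)] .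
    show "\<exists>h. h \<in> hm B' Q Y \<and> pa (t \<circ>\<^sub>F p) h \<cdot>\<^bsub>E\<^esub> (pa p \<theta> \<cdot>\<^bsub>E\<^esub> \<eta>) = g"
      using h k e by blast
  next
    fix Y h k assume Y: "Y \<in> ob B'" and h: "h \<in> hm B' Q Y" and k: "k \<in> hm B' Q Y" and
      eq: "pa (t \<circ>\<^sub>F p) h \<cdot>\<^bsub>E\<^esub> (pa p \<theta> \<cdot>\<^bsub>E\<^esub> \<eta>) = pa (t \<circ>\<^sub>F p) k \<cdot>\<^bsub>E\<^esub> (pa p \<theta> \<cdot>\<^bsub>E\<^esub> \<eta>)"
    have "pa t h \<cdot>\<^bsub>B\<^esub> \<theta> = pa t k \<cdot>\<^bsub>B\<^esub> \<theta>"
      using univ_arrow_eq[OF U p cat_comp_hom[OF B pa_hm[OF t h] v(2)] cat_comp_hom[OF B pa_hm[OF t k] v(2)]] eq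
      unfolding e[OF h] e[OF k] by simp
    then show "h = k" using univ_arrow_eq[OF V t h k] by simp
  qed
qed

text \<open>The cells of restriction are identities, so the composite has the cell of the Kan
  extension at the restricted object.\<close>

lemma lan_pull_M1:
  assumes \<pi>: "sfun E A \<pi>" and p: "sfun E B p" and w: "sfun C C' w" and X: "X \<in> ob (prod_cat A C')"
  shows "At (M1 (lan_mor D p \<circ>\<^sub>D pull_mor D \<pi>) w) X = At (M1 (lan_mor D p) w) (pb (prod_func \<pi> (id_func C')) X)"
proof -
  note sE = small_funD(2)[OF \<pi>] and sA = small_funD(3)[OF \<pi>] and sB = small_funD(3)[OF p]
  note sC = small_funD(2)[OF w] and sC' = small_funD(3)[OF w]
  note a = comp_dmor_at(2)[OF pull_mor_morphism[OF \<pi>] lan_mor_morphism[OF p] w star_shift[OF sE w] star_shift[OF sA w] star_shift[OF sB w]]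
  note q = sfun_idr[OF p sC] and \<pi>' = sfun_idr[OF \<pi> sC']
  note l = lan_cell(1)[OF p w pb_ob[OF \<pi>' X]]
  note \<pi>w = sfun_prod[OF \<pi> w]
  have e: "pb (prod_func \<pi> w) X = pb (prod_func (id_func E) w) (pb (prod_func \<pi> (id_func C')) X)"
    using pb_comp[OF sfun_idl[OF sE w] \<pi>' X] prod_split(1)[OF \<pi> w] by simp
  show ?thesis
    using a X cat_id_right[OF dcat[OF small_funD(3)[OF q]] l] fun_ident[OF lan_functor[OF q] pb_ob[OF \<pi>w X]] e
    by (simp add: pull_mor_simps(1)[OF \<pi>] pull_mor_simps(2)[OF \<pi> w X])
qed

text \<open>The universal arrows are the chosen units themselves, and the three clauses are their
  universality, their naturality and the defining equation of the structure cells.\<close>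

lemma kan_lan_pull:
  assumes \<pi>: "sfun E A \<pi>" and p: "sfun E B p"
  shows "kan \<pi> p (lan_mor D p \<circ>\<^sub>D pull_mor D \<pi>) (\<lambda>C X. lu (prod_func p (id_func C)) (pb (prod_func \<pi> (id_func C)) X))"
proof (rule kanI[OF \<pi>])
  fix C X assume C: "small C" and X: "X \<in> ob (prod_cat A C)"
  show "univ_arrow (prod_func p (id_func C)) (pb (prod_func \<pi> (id_func C)) X) (FO (M0 (lan_mor D p \<circ>\<^sub>D pull_mor D \<pi>) C) X)
        (lu (prod_func p (id_func C)) (pb (prod_func \<pi> (id_func C)) X))"
    using lan_univ[OF sfun_idr[OF p C] pb_ob[OF sfun_idr[OF \<pi> C] X]] X
    by (simp add: comp_dmor_def pull_mor_simps(1)[OF \<pi>] functor_ends[OF star[OF sfun_idr[OF \<pi> C]]])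
next
  fix C X Y f assume C: "small C" and f: "f \<in> hm (prod_cat A C) X Y"
  show "pa (prod_func p (id_func C)) (FA (M0 (lan_mor D p \<circ>\<^sub>D pull_mor D \<pi>) C) f) \<cdot>\<^bsub>prod_cat E C\<^esub>
       lu (prod_func p (id_func C)) (pb (prod_func \<pi> (id_func C)) X) =
       lu (prod_func p (id_func C)) (pb (prod_func \<pi> (id_func C)) Y) \<cdot>\<^bsub>prod_cat E C\<^esub> pa (prod_func \<pi> (id_func C)) f"
    using la_char[OF sfun_idr[OF p C] pa_hm[OF sfun_idr[OF \<pi> C] f]] f
      comp_func_FA[of f "D1 D (prod_func \<pi> (id_func C))" X Y "lan D (prod_func p (id_func C))"]
    by (simp add: comp_dmor_def pull_mor_simps(1)[OF \<pi>] functor_ends[OF star[OF sfun_idr[OF \<pi> C]]])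
next
  fix C C' w X assume w: "sfun C C' w" and X: "X \<in> ob (prod_cat A C')"
  note sE = small_funD(2)[OF \<pi>] and sA = small_funD(3)[OF \<pi>]
  note sC = small_funD(2)[OF w] and sC' = small_funD(3)[OF w]
  note \<pi>' = sfun_idr[OF \<pi> sC']
  have e: "pb (prod_func \<pi> (id_func C)) (pb (prod_func (id_func A) w) X) = pb (prod_func (id_func E) w) (pb (prod_func \<pi> (id_func C')) X)"
    using pb_sq[OF prod_swap[OF \<pi> w] sfun_idr[OF \<pi> sC] sfun_idl[OF sA w] sfun_idl[OF sE w] \<pi>' X] .
  show "pa (prod_func p (id_func C)) (At (M1 (lan_mor D p \<circ>\<^sub>D pull_mor D \<pi>) w) X) \<cdot>\<^bsub>prod_cat E C\<^esub>
       lu (prod_func p (id_func C)) (pb (prod_func \<pi> (id_func C)) (pb (prod_func (id_func A) w) X)) =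
       pa (prod_func (id_func E) w) (lu (prod_func p (id_func C')) (pb (prod_func \<pi> (id_func C')) X))"
    unfolding lan_pull_M1[OF \<pi> p w X] e using lan_cell(2)[OF p w pb_ob[OF \<pi>' X]] .
qed

text \<open>Extending further along \<open>t\<close> pastes the unit of \<open>t\<close> onto
  \<open>\<eta>\<close>. With \<open>t\<close> the functor to the point, this exhibits the colimit
  of the resolution as a Kan extension along the composite.\<close>

lemma kan_compose_lan:
  assumes \<pi>: "sfun E A \<pi>" and p: "sfun E B p" and s: "deriv_morphism \<kappa> (shift D A) (shift D B) s"
    and k: "kan \<pi> p s \<eta>" and t: "sfun B B' t"
  shows "kan \<pi> (t \<circ>\<^sub>F p) (lan_mor D t \<circ>\<^sub>D s)
    (\<lambda>C X. pa (prod_func p (id_func C)) (lu (prod_func t (id_func C)) (FO (M0 s C) X)) \<cdot>\<^bsub>prod_cat E C\<^esub> \<eta> C X)"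
proof (rule kanI[OF \<pi>])
  fix C X assume C: "small C" and X: "X \<in> ob (prod_cat A C)"
  note pC = sfun_idr[OF p C] and tC = sfun_idr[OF t C]
  show "univ_arrow (prod_func (t \<circ>\<^sub>F p) (id_func C)) (pb (prod_func \<pi> (id_func C)) X) (FO (M0 (lan_mor D t \<circ>\<^sub>D s) C) X)
      (pa (prod_func p (id_func C)) (lu (prod_func t (id_func C)) (FO (M0 s C) X)) \<cdot>\<^bsub>prod_cat E C\<^esub> \<eta> C X)"
    using univ_arrow_comp[OF kanD(1)[OF k \<pi> C X] lan_univ[OF tC dmor_ob[OF s C X]] pC tC] prod_idr_comp[OF C p t] X
    by (simp add: comp_dmor_def functor_ends[OF deriv_morphismD(1)[OF s C]])
next
  fix C X Y f assume C: "small C" and X: "X \<in> ob (prod_cat A C)" and Y: "Y \<in> ob (prod_cat A C)" and f: "f \<in> hm (prod_cat A C) X Y"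
  note pC = sfun_idr[OF p C] and tC = sfun_idr[OF t C] and \<pi>C = sfun_idr[OF \<pi> C]
  let ?p = "prod_func p (id_func C)" and ?t = "prod_func t (id_func C)" and ?\<pi> = "prod_func \<pi> (id_func C)"
  note hX = univ_arrowD(2)[OF kanD(1)[OF k \<pi> C X] pC] and hY = univ_arrowD(2)[OF kanD(1)[OF k \<pi> C Y] pC]
  note lX = univ_arrowD(2)[OF lan_univ[OF tC dmor_ob[OF s C X]] tC] and lY = univ_arrowD(2)[OF lan_univ[OF tC dmor_ob[OF s C Y]] tC]
  note sf = dmor_hm[OF s C f]
  note tsf = fun_hom[OF lan_functor[OF tC] sf]
  note E = dcat[OF small_funD(2)[OF pC]]
  have M: "FA (M0 (lan_mor D t \<circ>\<^sub>D s) C) f = la ?t (FA (M0 s C) f)"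
    using comp_func_FA[of f "M0 s C" X Y] f by (simp add: comp_dmor_def functor_ends[OF deriv_morphismD(1)[OF s C]])
  have "pa (prod_func (t \<circ>\<^sub>F p) (id_func C)) (la ?t (FA (M0 s C) f)) \<cdot>\<^bsub>prod_cat E C\<^esub> (pa ?p (lu ?t (FO (M0 s C) X)) \<cdot>\<^bsub>prod_cat E C\<^esub> \<eta> C X)
    = pa ?p (pa ?t (la ?t (FA (M0 s C) f)) \<cdot>\<^bsub>prod_cat B C\<^esub> lu ?t (FO (M0 s C) X)) \<cdot>\<^bsub>prod_cat E C\<^esub> \<eta> C X"
    using prod_idr_comp[OF C p t] pa_comp[OF pC tC tsf] cat_assoc[OF E pa_hm[OF pC pa_hm[OF tC tsf]] pa_hm[OF pC lX] hX]
      pa_dcomp[OF pC pa_hm[OF tC tsf] lX] by simp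
  also have "\<dots> = pa ?p (lu ?t (FO (M0 s C) Y)) \<cdot>\<^bsub>prod_cat E C\<^esub> (pa ?p (FA (M0 s C) f) \<cdot>\<^bsub>prod_cat E C\<^esub> \<eta> C X)"
    using la_char[OF tC sf] pa_dcomp[OF pC lY sf] cat_assoc[OF E pa_hm[OF pC lY] pa_hm[OF pC sf] hX] by simp
  also have "\<dots> = (pa ?p (lu ?t (FO (M0 s C) Y)) \<cdot>\<^bsub>prod_cat E C\<^esub> \<eta> C Y) \<cdot>\<^bsub>prod_cat E C\<^esub> pa ?\<pi> f"
    using kanD(2)[OF k \<pi> C f] cat_assoc[OF E pa_hm[OF pC lY] hY pa_hm[OF \<pi>C f]] by simp
  finally show "pa (prod_func (t \<circ>\<^sub>F p) (id_func C)) (FA (M0 (lan_mor D t \<circ>\<^sub>D s) C) f) \<cdot>\<^bsub>prod_cat E C\<^esub>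
      (pa ?p (lu ?t (FO (M0 s C) X)) \<cdot>\<^bsub>prod_cat E C\<^esub> \<eta> C X) =
    (pa ?p (lu ?t (FO (M0 s C) Y)) \<cdot>\<^bsub>prod_cat E C\<^esub> \<eta> C Y) \<cdot>\<^bsub>prod_cat E C\<^esub> pa ?\<pi> f" unfolding M .
next
  fix C C' w X assume w: "sfun C C' w" and X: "X \<in> ob (prod_cat A C')"
  note sE = small_funD(2)[OF \<pi>] and sA = small_funD(3)[OF \<pi>] and sB = small_funD(3)[OF p] and sB' = small_funD(3)[OF t]
  note C = small_funD(2)[OF w] and C' = small_funD(3)[OF w]
  note pC = sfun_idr[OF p C] and tC = sfun_idr[OF t C] and pC' = sfun_idr[OF p C'] and tC' = sfun_idr[OF t C']
  let ?p = "prod_func p (id_func C)" and ?t = "prod_func t (id_func C)" and ?p' = "prod_func p (id_func C')" and ?t' = "prod_func t (id_func C')"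
  let ?w = "prod_func (id_func A) w" and ?wE = "prod_func (id_func E) w" and ?wB = "prod_func (id_func B) w" and ?wB' = "prod_func (id_func B') w"
  note wA = sfun_idl[OF sA w] and wE = sfun_idl[OF sE w] and wB = sfun_idl[OF sB w] and wB' = sfun_idl[OF sB' w]
  note wX = pb_ob[OF wA X]
  note at = comp_dmor_at(2)[OF s lan_mor_morphism[OF t] w star_shift[OF sB w] star_shift[OF sA w] star_shift[OF sB' w], of X, simplified, OF X]
  note sX = dmor_ob[OF s C' X]
  note swX = dmor_ob[OF s C wX]
  note wsX = pb_ob[OF wB sX]
  note sw = dmor_hom[OF sA s w X]
  note tsw = fun_hom[OF lan_functor[OF tC] sw]
  note tm = lan_cell[OF t w sX]
  note h = univ_arrowD(2)[OF kanD(1)[OF k \<pi> C wX] pC] and h' = univ_arrowD(2)[OF kanD(1)[OF k \<pi> C' X] pC']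
  note l = univ_arrowD(2)[OF lan_univ[OF tC swX] tC] and l' = univ_arrowD(2)[OF lan_univ[OF tC' sX] tC']
    and lw = univ_arrowD(2)[OF lan_univ[OF tC wsX] tC]
  note E = dcat[OF small_funD(2)[OF pC]] and B = dcat[OF small_funD(2)[OF tC]] and B' = dcat[OF small_funD(3)[OF tC]]
  let ?m = "At (M1 (lan_mor D t) w) (FO (M0 s C') X)" and ?n = "la ?t (At (M1 s w) X)"
  note mn = cat_comp_hom[OF B' tm(1) tsw]
  have "pa ?t (?m \<cdot>\<^bsub>prod_cat B' C\<^esub> ?n) \<cdot>\<^bsub>prod_cat B C\<^esub> lu ?t (FO (M0 s C) (pb ?w X)) = pa ?wB (lu ?t' (FO (M0 s C') X)) \<cdot>\<^bsub>prod_cat B C\<^esub> At (M1 s w) X"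
    using pa_dcomp[OF tC tm(1) tsw] cat_assoc[OF B pa_hm[OF tC tm(1)] pa_hm[OF tC tsw] l] la_char[OF tC sw]
      cat_assoc[OF B pa_hm[OF tC tm(1)] lw sw] tm(2) by simp
  moreover have "pa (prod_func (t \<circ>\<^sub>F p) (id_func C)) (?m \<cdot>\<^bsub>prod_cat B' C\<^esub> ?n) \<cdot>\<^bsub>prod_cat E C\<^esub> (pa ?p (lu ?t (FO (M0 s C) (pb ?w X))) \<cdot>\<^bsub>prod_cat E C\<^esub> \<eta> C (pb ?w X))
    = pa ?p (pa ?t (?m \<cdot>\<^bsub>prod_cat B' C\<^esub> ?n) \<cdot>\<^bsub>prod_cat B C\<^esub> lu ?t (FO (M0 s C) (pb ?w X))) \<cdot>\<^bsub>prod_cat E C\<^esub> \<eta> C (pb ?w X)"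
    using prod_idr_comp[OF C p t] pa_comp[OF pC tC mn] cat_assoc[OF E pa_hm[OF pC pa_hm[OF tC mn]] pa_hm[OF pC l] h]
      pa_dcomp[OF pC pa_hm[OF tC mn] l] by simp
  ultimately have "pa (prod_func (t \<circ>\<^sub>F p) (id_func C)) (?m \<cdot>\<^bsub>prod_cat B' C\<^esub> ?n) \<cdot>\<^bsub>prod_cat E C\<^esub> (pa ?p (lu ?t (FO (M0 s C) (pb ?w X))) \<cdot>\<^bsub>prod_cat E C\<^esub> \<eta> C (pb ?w X))
    = pa ?p (pa ?wB (lu ?t' (FO (M0 s C') X)) \<cdot>\<^bsub>prod_cat B C\<^esub> At (M1 s w) X) \<cdot>\<^bsub>prod_cat E C\<^esub> \<eta> C (pb ?w X)" by simp
  \<comment> \<open>From here the \<open>kan\<close> clause of \<open>s\<close> moves the cell of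
    \<open>s\<close> onto \<open>\<eta>\<close>, and strictness of the square of \<open>p\<close>
    and \<open>w\<close> does the same for the unit of \<open>t\<close>.\<close>
  also have "\<dots> = pa ?p (pa ?wB (lu ?t' (FO (M0 s C') X))) \<cdot>\<^bsub>prod_cat E C\<^esub> (pa ?p (At (M1 s w) X) \<cdot>\<^bsub>prod_cat E C\<^esub> \<eta> C (pb ?w X))"
  proof -
    have lh: "pa ?wB (lu ?t' (FO (M0 s C') X)) \<in> hm (prod_cat B C) (pb ?wB (FO (M0 s C') X)) (pb ?wB (pb ?t' (lo ?t' (FO (M0 s C') X))))"
      using pa_hm[OF wB l'] .
    show ?thesis using pa_dcomp[OF pC lh sw] cat_assoc[OF E pa_hm[OF pC lh] pa_hm[OF pC sw] h] by simp
  qed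
  also have "\<dots> = pa ?wE (pa ?p' (lu ?t' (FO (M0 s C') X))) \<cdot>\<^bsub>prod_cat E C\<^esub> pa ?wE (\<eta> C' X)"
    using kanD(3)[OF k \<pi> w X] pa_sq[OF prod_swap[OF p w] pC wB wE pC' l'] by simp
  also have "\<dots> = pa ?wE (pa ?p' (lu ?t' (FO (M0 s C') X)) \<cdot>\<^bsub>prod_cat E C'\<^esub> \<eta> C' X)"
    using pa_dcomp[OF wE pa_hm[OF pC' l'] h'] by simp
  finally show "pa (prod_func (t \<circ>\<^sub>F p) (id_func C)) (At (M1 (lan_mor D t \<circ>\<^sub>D s) w) X) \<cdot>\<^bsub>prod_cat E C\<^esub>
      (pa ?p (lu ?t (FO (M0 s C) (pb ?w X))) \<cdot>\<^bsub>prod_cat E C\<^esub> \<eta> C (pb ?w X)) =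
      pa ?wE (pa ?p' (lu ?t' (FO (M0 s C') X)) \<cdot>\<^bsub>prod_cat E C'\<^esub> \<eta> C' X)" unfolding at .
qed

text \<open>This is cofinality in the form in which it is used. The hypothesis \<open>ff\<close>
  makes restriction along \<open>\<pi>\<close> bijective on maps into pullbacks along
  \<open>t\<close>; therefore the unit of \<open>t\<close>, restricted along \<open>\<pi>\<close>,
  is universal for the composite, and Kan extension along \<open>t\<close> is presented as one along
  \<open>t \<circ>\<^sub>F \<pi>\<close>.\<close>

lemma kan_lan_restrict:
  assumes \<pi>: "sfun E A \<pi>" and t: "sfun A B t"
    and ff: "\<And>C X Y g. small C \<Longrightarrow> X \<in> ob (prod_cat A C) \<Longrightarrow> Y \<in> ob (prod_cat B C) \<Longrightarrow>
      g \<in> hm (prod_cat E C) (pb (prod_func \<pi> (id_func C)) X) (pb (prod_func \<pi> (id_func C)) (pb (prod_func t (id_func C)) Y)) \<Longrightarrow>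
      \<exists>!h. h \<in> hm (prod_cat A C) X (pb (prod_func t (id_func C)) Y) \<and> pa (prod_func \<pi> (id_func C)) h = g"
  shows "kan \<pi> (t \<circ>\<^sub>F \<pi>) (lan_mor D t) (\<lambda>C X. pa (prod_func \<pi> (id_func C)) (lu (prod_func t (id_func C)) X))"
proof (rule kanI[OF \<pi>])
  fix C X assume C: "small C" and X: "X \<in> ob (prod_cat A C)"
  note \<pi>C = sfun_idr[OF \<pi> C] and tC = sfun_idr[OF t C]
  let ?\<pi> = "prod_func \<pi> (id_func C)" and ?t = "prod_func t (id_func C)"
  note e = prod_idr_comp[OF C \<pi> t]
  note U = univ_arrowD[OF lan_univ[OF tC X] tC]
  have c: "pa (?t \<circ>\<^sub>F ?\<pi>) h \<cdot>\<^bsub>prod_cat E C\<^esub> pa ?\<pi> (lu ?t X) = pa ?\<pi> (pa ?t h \<cdot>\<^bsub>prod_cat A C\<^esub> lu ?t X)" if "h \<in> hm (prod_cat B C) (lo ?t X) Y" for h Y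
    using pa_comp[OF \<pi>C tC that] pa_dcomp[OF \<pi>C pa_hm[OF tC that] U(2)] by simp
  note A = dcat[OF small_funD(2)[OF tC]]
  show "univ_arrow (prod_func (t \<circ>\<^sub>F \<pi>) (id_func C)) (pb ?\<pi> X) (FO (M0 (lan_mor D t) C) X) (pa ?\<pi> (lu ?t X))"
    unfolding e lan_mor_M0
  proof (rule univ_arrowI[OF sfun_comp[OF \<pi>C tC] U(1)])
    show "pa ?\<pi> (lu ?t X) \<in> hm (prod_cat E C) (pb ?\<pi> X) (pb (?t \<circ>\<^sub>F ?\<pi>) (lo ?t X))"
      using pa_hm[OF \<pi>C U(2)] pb_comp[OF \<pi>C tC U(1)] by simp
    fix Y g assume Y: "Y \<in> ob (prod_cat B C)" and g: "g \<in> hm (prod_cat E C) (pb ?\<pi> X) (pb (?t \<circ>\<^sub>F ?\<pi>) Y)"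
    obtain h where h: "h \<in> hm (prod_cat A C) X (pb ?t Y)" "pa ?\<pi> h = g"
      using ff[OF C X Y g[unfolded pb_comp[OF \<pi>C tC Y]]] by blast
    obtain k where k: "k \<in> hm (prod_cat B C) (lo ?t X) Y" "pa ?t k \<cdot>\<^bsub>prod_cat A C\<^esub> lu ?t X = h"
      using univ_arrow_ex[OF lan_univ[OF tC X] tC Y h(1)] .
    show "\<exists>h. h \<in> hm (prod_cat B C) (lo ?t X) Y \<and> pa (?t \<circ>\<^sub>F ?\<pi>) h \<cdot>\<^bsub>prod_cat E C\<^esub> pa ?\<pi> (lu ?t X) = g"
      using k h c by blast
  next
    fix Y h k assume Y: "Y \<in> ob (prod_cat B C)" and h: "h \<in> hm (prod_cat B C) (lo ?t X) Y" and k: "k \<in> hm (prod_cat B C) (lo ?t X) Y"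
      and eq: "pa (?t \<circ>\<^sub>F ?\<pi>) h \<cdot>\<^bsub>prod_cat E C\<^esub> pa ?\<pi> (lu ?t X) = pa (?t \<circ>\<^sub>F ?\<pi>) k \<cdot>\<^bsub>prod_cat E C\<^esub> pa ?\<pi> (lu ?t X)"
    let ?h = "pa ?t h \<cdot>\<^bsub>prod_cat A C\<^esub> lu ?t X" and ?k = "pa ?t k \<cdot>\<^bsub>prod_cat A C\<^esub> lu ?t X"
    have hk: "?h \<in> hm (prod_cat A C) X (pb ?t Y)" "?k \<in> hm (prod_cat A C) X (pb ?t Y)"
      using cat_comp_hom[OF A pa_hm[OF tC h] U(2)] cat_comp_hom[OF A pa_hm[OF tC k] U(2)] by auto
    have "pa ?\<pi> ?h = pa ?\<pi> ?k" using eq c[OF h] c[OF k] by simp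
    \<comment> \<open>Injectivity of restriction along \<open>\<pi>\<close> reduces uniqueness to
      that for the unit of \<open>t\<close>.\<close>
    then have "?h = ?k" using ff[OF C X Y pa_hm[OF \<pi>C hk(1)]] hk by metis
    then show "h = k" using univ_arrow_eq[OF lan_univ[OF tC X] tC h k] by simp
  qed
next
  fix C X Y f assume C: "small C" and X: "X \<in> ob (prod_cat A C)" and Y: "Y \<in> ob (prod_cat A C)" and f: "f \<in> hm (prod_cat A C) X Y"
  note \<pi>C = sfun_idr[OF \<pi> C] and tC = sfun_idr[OF t C]
  let ?\<pi> = "prod_func \<pi> (id_func C)" and ?t = "prod_func t (id_func C)"
  note UX = univ_arrowD[OF lan_univ[OF tC X] tC] and UY = univ_arrowD[OF lan_univ[OF tC Y] tC]
  note tf = fun_hom[OF lan_functor[OF tC] f]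
  show "pa (prod_func (t \<circ>\<^sub>F \<pi>) (id_func C)) (FA (M0 (lan_mor D t) C) f) \<cdot>\<^bsub>prod_cat E C\<^esub> pa ?\<pi> (lu ?t X) =
    pa ?\<pi> (lu ?t Y) \<cdot>\<^bsub>prod_cat E C\<^esub> pa ?\<pi> f"
    using la_char[OF tC f] pa_dcomp[OF \<pi>C pa_hm[OF tC tf] UX(2)] pa_dcomp[OF \<pi>C UY(2) f] pa_comp[OF \<pi>C tC tf]
    by (simp add: prod_idr_comp[OF C \<pi> t])
next
  fix C C' w X assume w: "sfun C C' w" and X: "X \<in> ob (prod_cat A C')"
  note sE = small_funD(2)[OF \<pi>] and sA = small_funD(3)[OF \<pi>] and sB = small_funD(3)[OF t]
  note C = small_funD(2)[OF w] and C' = small_funD(3)[OF w]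
  note \<pi>C = sfun_idr[OF \<pi> C] and tC = sfun_idr[OF t C] and \<pi>C' = sfun_idr[OF \<pi> C'] and tC' = sfun_idr[OF t C']
  let ?\<pi> = "prod_func \<pi> (id_func C)" and ?t = "prod_func t (id_func C)" and ?\<pi>' = "prod_func \<pi> (id_func C')" and ?t' = "prod_func t (id_func C')"
  let ?w = "prod_func (id_func A) w" and ?wE = "prod_func (id_func E) w"
  note wA = sfun_idl[OF sA w] and wE = sfun_idl[OF sE w]
  note wX = pb_ob[OF wA X]
  note tm = lan_cell[OF t w X]
  note l = univ_arrowD(2)[OF lan_univ[OF tC wX] tC] and l' = univ_arrowD(2)[OF lan_univ[OF tC' X] tC']
  show "pa (prod_func (t \<circ>\<^sub>F \<pi>) (id_func C)) (At (M1 (lan_mor D t) w) X) \<cdot>\<^bsub>prod_cat E C\<^esub> pa ?\<pi> (lu ?t (pb ?w X)) = pa ?wE (pa ?\<pi>' (lu ?t' X))"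
    unfolding prod_idr_comp[OF C \<pi> t] pa_comp[OF \<pi>C tC tm(1)]
    using pa_dcomp[OF \<pi>C pa_hm[OF tC tm(1)] l] tm(2) pa_sq[OF prod_swap[OF \<pi> w] \<pi>C wA wE \<pi>C' l'] by simp
qed

end

section \<open>Categories of elements and the nerve\<close>

text \<open>A set-valued functor on \<open>B\<close>, presented by the set \<open>S\<close> of all
  its elements, the projection \<open>pr\<close> to the base and the covariant action of arrows. The
  projection of its category of elements is a discrete opfibration.\<close>

definition discrete_action :: "'a scat \<Rightarrow> 'a univ set \<Rightarrow> ('a univ \<Rightarrow> 'a univ) \<Rightarrow> ('a univ \<Rightarrow> 'a univ \<Rightarrow> 'a univ) \<Rightarrow> bool" where
  "discrete_action B S pr act \<longleftrightarrow> is_category B \<and> (\<forall>x\<in>S. pr x \<in> Obj B) \<and>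
     (\<forall>x\<in>S. \<forall>f b. f \<in> Hom B (pr x) b \<longrightarrow> act f x \<in> S \<and> pr (act f x) = b) \<and>
     (\<forall>x\<in>S. act (Ident B (pr x)) x = x) \<and>
     (\<forall>x\<in>S. \<forall>g f b c. f \<in> Hom B (pr x) b \<longrightarrow> g \<in> Hom B b c \<longrightarrow> act (Comp B g f) x = act g (act f x))"

text \<open>
  An arrow of the category of elements is \<open>Pair x f\<close> with \<open>x\<close> its domain and \<open>f\<close> its image in \<open>B\<close>; its
  codomain is then \<open>act f x\<close>.
\<close>

definition elements :: "'a scat \<Rightarrow> 'a univ set \<Rightarrow> ('a univ \<Rightarrow> 'a univ) \<Rightarrow> ('a univ \<Rightarrow> 'a univ \<Rightarrow> 'a univ) \<Rightarrow> 'a scat" where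
  "elements B S pr act = mk_cat S {Pair x f | x f. x \<in> S \<and> f \<in> Arr B \<and> Dom B f = pr x}
     pfst (\<lambda>k. act (psnd k) (pfst k)) (\<lambda>x. Pair x (Ident B (pr x))) (\<lambda>l k. Pair (pfst k) (Comp B (psnd l) (psnd k)))"

definition elements_proj :: "'a scat \<Rightarrow> 'a univ set \<Rightarrow> ('a univ \<Rightarrow> 'a univ) \<Rightarrow> ('a univ \<Rightarrow> 'a univ \<Rightarrow> 'a univ) \<Rightarrow> 'a sfunc" where
  "elements_proj B S pr act = mk_func (elements B S pr act) B pr psnd"

context
  fixes B :: "'a scat" and S pr act
  assumes da: "discrete_action B S pr act"
begin

lemma da_cat: "is_category B"
  and da_ob: "x \<in> S \<Longrightarrow> pr x \<in> Obj B"
  and da_act: "x \<in> S \<Longrightarrow> f \<in> Hom B (pr x) b \<Longrightarrow> act f x \<in> S" "x \<in> S \<Longrightarrow> f \<in> Hom B (pr x) b \<Longrightarrow> pr (act f x) = b"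
  and da_id: "x \<in> S \<Longrightarrow> act (Ident B (pr x)) x = x"
  and da_comp: "x \<in> S \<Longrightarrow> f \<in> Hom B (pr x) b \<Longrightarrow> g \<in> Hom B b c \<Longrightarrow> act (Comp B g f) x = act g (act f x)"
  using da unfolding discrete_action_def by (simp, simp, simp, simp, simp, blast)

lemma elements_obj [simp]: "Obj (elements B S pr act) = S"
  by (simp add: elements_def)

lemma elements_hom [simp]:
  "Pair x f \<in> Hom (elements B S pr act) x' y \<longleftrightarrow> x' = x \<and> x \<in> S \<and> f \<in> Hom B (pr x) (pr y) \<and> y = act f x"
proof -
  have "pr (act f x) = Cod B f" if "x \<in> S" "f \<in> Arr B" "Dom B f = pr x"
    using da_act(2)[OF that(1), of f "Cod B f"] that by (simp add: Hom_def)
  then show ?thesis by (auto simp: elements_def Hom_def)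
qed

lemma elements_homE:
  assumes "k \<in> Hom (elements B S pr act) x y"
  obtains f where "k = Pair x f" "x \<in> S" "f \<in> Hom B (pr x) (pr y)" "y = act f x"
proof -
  obtain f where "k = Pair x f" using assms by (auto simp: elements_def Hom_def)
  then show thesis using that[of f] assms by (metis elements_hom)
qed

lemma elements_ident [simp]: "x \<in> S \<Longrightarrow> Ident (elements B S pr act) x = Pair x (Ident B (pr x))"
  by (simp add: elements_def)

lemma elements_comp:
  "x \<in> S \<Longrightarrow> f \<in> Hom B (pr x) b \<Longrightarrow> g \<in> Hom B b c \<Longrightarrow>
   Comp (elements B S pr act) (Pair (act f x) g) (Pair x f) = Pair x (Comp B g f)"
  using da_act[of x f b] by (simp add: elements_def Hom_def)

lemma category_elements: "is_category (elements B S pr act)"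
  unfolding elements_def
proof (rule is_category_mk_cat)
  let ?M = "{Pair x f | x f. x \<in> S \<and> f \<in> Arr B \<and> Dom B f = pr x}"
  have M: "\<exists>x h. f = Pair x h \<and> x \<in> S \<and> h \<in> Hom B (pr x) (Cod B h)" if "f \<in> ?M" for f
    using that by (auto simp: Hom_def)
  show "pfst f \<in> S \<and> act (psnd f) (pfst f) \<in> S" if "f \<in> ?M" for f
    using M[OF that] da_act(1) by auto
  show "Pair x (Ident B (pr x)) \<in> ?M \<and> pfst (Pair x (Ident B (pr x))) = x \<and>
      act (psnd (Pair x (Ident B (pr x)))) (pfst (Pair x (Ident B (pr x)))) = x" if "x \<in> S" for x
    using that cat_ident_arr[OF da_cat da_ob] da_id by auto
  show "Pair (pfst f) (Comp B (psnd g) (psnd f)) \<in> ?M \<and>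
       pfst (Pair (pfst f) (Comp B (psnd g) (psnd f))) = pfst f \<and>
       act (psnd (Pair (pfst f) (Comp B (psnd g) (psnd f)))) (pfst (Pair (pfst f) (Comp B (psnd g) (psnd f)))) = act (psnd g) (pfst g)"
    if f: "f \<in> ?M" and g: "g \<in> ?M" and e: "act (psnd f) (pfst f) = pfst g" for f g
  proof -
    obtain x h where f': "f = Pair x h" "x \<in> S" "h \<in> Hom B (pr x) (Cod B h)" using M[OF f] by blast
    obtain y k where g': "g = Pair y k" "y \<in> S" "k \<in> Hom B (pr y) (Cod B k)" using M[OF g] by blast
    have k: "k \<in> Hom B (Cod B h) (Cod B k)" using g'(3) e f' g'(1) da_act(2)[OF f'(2,3)] by simp
    show ?thesis
      using f' g' e da_comp[OF f'(2,3) k] homD[OF cat_comp_hom[OF da_cat k f'(3)]] by simp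
  qed
  show "Pair (pfst (Pair (pfst f) (Ident B (pr (pfst f))))) (Comp B (psnd f) (psnd (Pair (pfst f) (Ident B (pr (pfst f)))))) = f \<and>
       Pair (pfst f) (Comp B (psnd (Pair (act (psnd f) (pfst f)) (Ident B (pr (act (psnd f) (pfst f)))))) (psnd f)) = f"
    if f: "f \<in> ?M" for f
  proof -
    obtain x h where f': "f = Pair x h" "x \<in> S" "h \<in> Hom B (pr x) (Cod B h)" using M[OF f] by blast
    show ?thesis using f' cat_id_left[OF da_cat f'(3)] cat_id_right[OF da_cat f'(3)] da_act(2)[OF f'(2,3)] by simp
  qed
  show "Pair (pfst (Pair (pfst f) (Comp B (psnd g) (psnd f)))) (Comp B (psnd h) (psnd (Pair (pfst f) (Comp B (psnd g) (psnd f))))) =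
       Pair (pfst f) (Comp B (psnd (Pair (pfst g) (Comp B (psnd h) (psnd g)))) (psnd f))"
    if f: "f \<in> ?M" and g: "g \<in> ?M" and h: "h \<in> ?M" and e: "act (psnd f) (pfst f) = pfst g" "act (psnd g) (pfst g) = pfst h" for f g h
  proof -
    obtain x k where f': "f = Pair x k" "x \<in> S" "k \<in> Hom B (pr x) (Cod B k)" using M[OF f] by blast
    obtain y l where g': "g = Pair y l" "y \<in> S" "l \<in> Hom B (pr y) (Cod B l)" using M[OF g] by blast
    obtain z m where h': "h = Pair z m" "z \<in> S" "m \<in> Hom B (pr z) (Cod B m)" using M[OF h] by blast
    have l: "l \<in> Hom B (Cod B k) (Cod B l)" using g' f' e da_act(2)[OF f'(2,3)] by simp
    have m: "m \<in> Hom B (Cod B l) (Cod B m)" using g' h' e da_act(2)[OF g'(2,3)] by simp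
    show ?thesis using f'(1) g'(1) h'(1) cat_assoc[OF da_cat m l f'(3)] by simp
  qed
qed

lemma elements_proj_simps [simp]:
  "Src (elements_proj B S pr act) = elements B S pr act" "Tgt (elements_proj B S pr act) = B"
  "x \<in> S \<Longrightarrow> FO (elements_proj B S pr act) x = pr x"
  "f \<in> Hom (elements B S pr act) x y \<Longrightarrow> FA (elements_proj B S pr act) f = psnd f"
  by (auto simp: elements_proj_def)

lemma functor_elements_proj: "functor_from_to (elements B S pr act) B (elements_proj B S pr act)"
  unfolding elements_proj_def
  by (rule functor_mk_func[OF category_elements da_cat])
    (auto simp: da_ob elements_comp elim!: elements_homE)

lemma small_elements:
  assumes k: "size_bound \<kappa>" and S: "|S| <o \<kappa>" and B: "small_category \<kappa> B"
  shows "small_category \<kappa> (elements B S pr act)"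
  unfolding small_category_def
proof (intro conjI category_elements)
  show "|Obj (elements B S pr act)| <o \<kappa>" using S by simp
  show "|Arr (elements B S pr act)| <o \<kappa>"
    by (rule size_bound_Pair[OF k S, of "Arr B"]) (use B in \<open>auto simp: small_category_def elements_def\<close>)
qed

end

section \<open>The simplex category\<close>

lemma simplex_obj: "x \<in> Obj simplex_cat \<longleftrightarrow> (\<exists>n. x = Nats [n])"
  by (auto simp: simplex_cat_def)

lemma simplex_hom: "Nats (n' # vs) \<in> Hom simplex_cat (Nats [m]) (Nats [n]) \<longleftrightarrow>
    n' = n \<and> length vs = Suc m \<and> sorted vs \<and> set vs \<subseteq> {..n}"
  by (cases vs) (auto simp: simplex_cat_def Hom_def)

lemma simplex_homE:
  assumes "f \<in> Hom simplex_cat x y"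
  obtains m n vs where "f = Nats (n # vs)" "x = Nats [m]" "y = Nats [n]" "length vs = Suc m" "sorted vs" "set vs \<subseteq> {..n}"
proof -
  obtain n vs where f: "f = Nats (n # vs)" "x = Nats [length vs - 1]" "y = Nats [n]" "vs \<noteq> []" "sorted vs" "set vs \<subseteq> {..n}"
    using assms by (auto simp: simplex_cat_def Hom_def)
  then show thesis using that[of n vs "length vs - 1"] by simp
qed

lemma simplex_ident: "Ident simplex_cat (Nats [n]) = Nats (n # [0..<Suc n])"
  by (simp add: simplex_cat_def)

lemma simplex_comp:
  assumes "Nats (n # vs) \<in> Hom simplex_cat x y" "Nats (k # ws) \<in> Hom simplex_cat y z"
  shows "Comp simplex_cat (Nats (k # ws)) (Nats (n # vs)) = Nats (k # map (\<lambda>i. ws ! i) vs)"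
  using assms by (auto simp: simplex_cat_def Hom_def)

lemma simplex_comp_valid:
  assumes "length vs = Suc m" "sorted vs" "set vs \<subseteq> {..n}" "length ws = Suc n" "sorted ws" "set ws \<subseteq> {..k}"
  shows "sorted (map (\<lambda>i. ws ! i) vs)" "set (map (\<lambda>i. ws ! i) vs) \<subseteq> {..k}"
proof -
  have *: "vs ! i < length ws" if "i < length vs" for i
  proof -
    have "vs ! i \<in> {..n}" using nth_mem[OF that] assms(3) by blast
    then show ?thesis using assms(4) by simp
  qed
  show "sorted (map (\<lambda>i. ws ! i) vs)"
    using assms(2,5) * by (auto simp: sorted_iff_nth_mono)
  show "set (map (\<lambda>i. ws ! i) vs) \<subseteq> {..k}"
  proof
    fix x assume "x \<in> set (map (\<lambda>i. ws ! i) vs)"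
    then obtain i where "i < length vs" "x = ws ! (vs ! i)" by (auto simp: in_set_conv_nth)
    then show "x \<in> {..k}" using nth_mem[OF *[of i]] assms(6) by blast
  qed
qed

lemma category_simplex: "is_category (simplex_cat :: 'a scat)"
  unfolding simplex_cat_def
proof (rule is_category_mk_cat)
  let ?M = "{Nats (n # vs) | n vs. vs \<noteq> [] \<and> sorted vs \<and> set vs \<subseteq> {..n}} :: 'a univ set"
  let ?k = "\<lambda>g f. Nats (hd (nats g) # map (\<lambda>i. tl (nats g) ! i) (tl (nats f))) :: 'a univ"
  show "Nats [length (tl (nats f)) - 1] \<in> {Nats [n] | n. True} \<and> Nats [hd (nats f)] \<in> {Nats [n] | n. True}" for f by auto
  show "Nats (hd (nats x) # [0..<Suc (hd (nats x))]) \<in> ?M \<and>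
       Nats [length (tl (nats (Nats (hd (nats x) # [0..<Suc (hd (nats x))])))) - 1] = x \<and>
       Nats [hd (nats (Nats (hd (nats x) # [0..<Suc (hd (nats x))])))] = x"
    if "x \<in> {Nats [n] | n. True}" for x :: "'a univ"
  proof -
    obtain n where x: "x = Nats [n]" using \<open>x \<in> {Nats [n] | n. True}\<close> by blast
    have "sorted [0..<Suc n]" "set [0..<Suc n] \<subseteq> {..n}" by (auto simp del: upt_Suc)
    then show ?thesis unfolding x by (auto simp del: upt_Suc)
  qed
  show "?k g f \<in> ?M \<and> (Nats [length (tl (nats (?k g f))) - 1] :: 'a univ) = Nats [length (tl (nats f)) - 1] \<and>
      (Nats [hd (nats (?k g f))] :: 'a univ) = Nats [hd (nats g)]"
    if f: "f \<in> ?M" and g: "g \<in> ?M" and e: "(Nats [hd (nats f)] :: 'a univ) = Nats [length (tl (nats g)) - 1]" for f g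
  proof -
    obtain n vs where f': "f = Nats (n # vs)" "vs \<noteq> []" "sorted vs" "set vs \<subseteq> {..n}" using f by auto
    obtain k ws where g': "g = Nats (k # ws)" "ws \<noteq> []" "sorted ws" "set ws \<subseteq> {..k}" using g by auto
    have n: "length ws = Suc n" using e f' g' by (cases ws) auto
    show ?thesis using simplex_comp_valid[OF _ f'(3,4) n g'(3,4), of "length vs - 1"] f' g' by simp
  qed
  show "?k f (Nats (hd (nats (Nats [length (tl (nats f)) - 1])) # [0..<Suc (hd (nats (Nats [length (tl (nats f)) - 1])))])) = f \<and>
       ?k (Nats (hd (nats (Nats [hd (nats f)])) # [0..<Suc (hd (nats (Nats [hd (nats f)])))])) f = f"
    if f: "f \<in> ?M" for f
  proof -
    obtain n vs where f': "f = Nats (n # vs)" "vs \<noteq> []" "sorted vs" "set vs \<subseteq> {..n}" using f by auto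
    have "map (\<lambda>i. vs ! i) [0..<Suc (length vs - 1)] = vs" using f'(2) map_nth[of vs] by (cases vs) (simp_all del: upt_Suc)
    moreover have "map (\<lambda>i. [0..<Suc n] ! i) vs = vs"
      by (rule map_idI) (use f'(4) in \<open>auto simp del: upt_Suc simp: less_Suc_eq_le\<close>)
    ultimately show ?thesis using f' by (simp del: upt_Suc)
  qed
  show "?k h (?k g f) = ?k (?k h g) f"
    if f: "f \<in> ?M" and g: "g \<in> ?M" and e: "(Nats [hd (nats f)] :: 'a univ) = Nats [length (tl (nats g)) - 1]" for f g h
  proof -
    obtain n vs where f': "f = Nats (n # vs)" "vs \<noteq> []" "sorted vs" "set vs \<subseteq> {..n}" using f by auto
    obtain k ws where g': "g = Nats (k # ws)" "ws \<noteq> []" "sorted ws" "set ws \<subseteq> {..k}" using g by auto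
    have n: "length ws = Suc n" using e f' g' by (cases ws) auto
    show ?thesis using f' g' n by auto
  qed
qed

text \<open>Objects and arrows are codes of finite lists of numbers, and \<open>list_decode\<close>
  enumerates all such lists, so the category is countable.\<close>

lemma small_simplex:
  assumes k: "size_bound \<kappa>" shows "small_category \<kappa> simplex_cat"
proof -
  let ?f = "\<lambda>n. Nats (list_decode n) :: 'a univ"
  have c: "|?f ` (UNIV :: nat set)| <o \<kappa>"
    by (rule countable_less) (use k in \<open>simp add: size_bound_def\<close>)
  have "Nats l \<in> ?f ` UNIV" for l
    using list_encode_inverse[of l] by (metis rangeI)
  then have "Obj simplex_cat \<subseteq> ?f ` UNIV" "Arr simplex_cat \<subseteq> ?f ` UNIV"
    unfolding simplex_cat_def by auto
  then show ?thesis
    using card_of_subset_less[OF _ c] unfolding small_category_def by (intro conjI category_simplex)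
qed

subsection \<open>Strings of arrows\<close>

text \<open>An index past the end of the string yields its last vertex.\<close>

fun vert :: "('o, 'm) cat \<Rightarrow> 'o \<Rightarrow> 'm list \<Rightarrow> nat \<Rightarrow> 'o" where
  "vert A a (f # fs) (Suc i) = vert A (Cod A f) fs i"
| "vert A a fs i = a"

text \<open>The composite of the arrows between the vertices \<open>i \<le> j\<close>; meaningless for \<open>i > j\<close>.\<close>

fun seg :: "('o, 'm) cat \<Rightarrow> 'o \<Rightarrow> 'm list \<Rightarrow> nat \<Rightarrow> nat \<Rightarrow> 'm" where
  "seg A a (f # fs) 0 (Suc j) = Comp A (seg A (Cod A f) fs 0 j) f"
| "seg A a (f # fs) (Suc i) (Suc j) = seg A (Cod A f) fs i j"
| "seg A a fs i j = Ident A a"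

lemma vert_0 [simp]: "vert A a fs 0 = a"
  by (cases fs) auto

lemma seg_0 [simp]: "seg A a fs 0 0 = Ident A a"
  by (cases fs) auto

lemma string_obj: "is_category A \<Longrightarrow> is_string A a fs \<Longrightarrow> a \<in> Obj A"
  by (cases fs) (auto simp: cat_dom)

lemma seg_hom:
  assumes A: "is_category A"
  shows "is_string A a fs \<Longrightarrow> i \<le> j \<Longrightarrow> j \<le> length fs \<Longrightarrow> seg A a fs i j \<in> Hom A (vert A a fs i) (vert A a fs j)"
proof (induction fs arbitrary: a i j)
  case Nil then show ?case using A by (simp add: cat_ident_hom)
next
  case (Cons f fs)
  then have f: "f \<in> Hom A a (Cod A f)" "is_string A (Cod A f) fs" by (auto simp: Hom_def)
  show ?case
  proof (cases j)
    case 0 then show ?thesis using Cons.prems hom_obj[OF A f(1)] by (simp add: cat_ident_hom[OF A])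
  next
    case j: (Suc j')
    show ?thesis
    proof (cases i)
      case 0
      then show ?thesis using j Cons.IH[OF f(2), of 0 j'] Cons.prems cat_comp_hom[OF A _ f(1)] by simp
    next
      case (Suc i') then show ?thesis using j Cons.IH[OF f(2), of i' j'] Cons.prems by simp
    qed
  qed
qed

lemma vert_obj:
  assumes A: "is_category A" and "is_string A a fs" "i \<le> length fs"
  shows "vert A a fs i \<in> Obj A"
  using hom_obj[OF A seg_hom[OF A assms(2) order_refl assms(3)]] by simp

lemma seg_id: "i \<le> length fs \<Longrightarrow> seg A a fs i i = Ident A (vert A a fs i)"
proof (induction fs arbitrary: a i)
  case (Cons f fs) then show ?case by (cases i) auto
qed simp

lemma seg_comp:
  assumes A: "is_category A"
  shows "is_string A a fs \<Longrightarrow> i \<le> j \<Longrightarrow> j \<le> k \<Longrightarrow> k \<le> length fs \<Longrightarrow>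
    Comp A (seg A a fs j k) (seg A a fs i j) = seg A a fs i k"
proof (induction fs arbitrary: a i j k)
  case Nil then show ?case using cat_id_left[OF A cat_ident_hom[OF A]] by simp
next
  case (Cons f fs)
  then have f: "f \<in> Hom A a (Cod A f)" "is_string A (Cod A f) fs" by (auto simp: Hom_def)
  have s: "is_string A a (f # fs)" by fact
  show ?case
  proof (cases i)
    case i: 0
    show ?thesis
    proof (cases j)
      case 0 then show ?thesis using i cat_id_right[OF A seg_hom[OF A s, of 0 k]] Cons.prems by simp
    next
      case (Suc j')
      then obtain k' where k: "k = Suc k'" using Cons.prems by (cases k) auto
      show ?thesis using Suc i k Cons.prems Cons.IH[OF f(2), of 0 j' k']
          cat_assoc[OF A seg_hom[OF A f(2), of j' k'] seg_hom[OF A f(2), of 0 j', unfolded vert_0] f(1)] by simp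
    qed
  next
    case (Suc i')
    then obtain j' k' where "j = Suc j'" "k = Suc k'" using Cons.prems by (cases j; cases k) auto
    then show ?thesis using Suc Cons.IH[OF f(2), of i' j' k'] Cons.prems by simp
  qed
qed

lemma seg_Suc:
  assumes A: "is_category A"
  shows "is_string A a fs \<Longrightarrow> i < length fs \<Longrightarrow> seg A a fs i (Suc i) = fs ! i"
proof (induction fs arbitrary: a i)
  case (Cons f fs)
  then have f: "f \<in> Hom A a (Cod A f)" "is_string A (Cod A f) fs" by (auto simp: Hom_def)
  then show ?case using Cons cat_id_left[OF A f(1)] by (cases i) auto
qed simp

text \<open>The arrows of the simplex obtained by restricting a string along the monotone map with
  values \<open>vs\<close>: consecutive composites, hence one entry fewer than \<open>vs\<close>.
  The first vertex of that simplex is the vertex at \<open>hd vs\<close>.\<close>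

fun segs :: "('o, 'm) cat \<Rightarrow> 'o \<Rightarrow> 'm list \<Rightarrow> nat list \<Rightarrow> 'm list" where
  "segs A a fs (v # w # vs) = seg A a fs v w # segs A a fs (w # vs)"
| "segs A a fs _ = []"

lemma length_segs [simp]: "length (segs A a fs vs) = length vs - 1"
  by (induction A a fs vs rule: segs.induct) auto

lemma nth_segs: "Suc i < length vs \<Longrightarrow> segs A a fs vs ! i = seg A a fs (vs ! i) (vs ! Suc i)"
proof (induction A a fs vs arbitrary: i rule: segs.induct)
  case (1 A a fs v w vs) then show ?case by (cases i) auto
qed auto

context
  fixes A :: "('o, 'm) cat" and a fs
  assumes A: "is_category A" and str: "is_string A a fs"
begin

lemma segs_string:
  "sorted (v # vs) \<Longrightarrow> set (v # vs) \<subseteq> {..length fs} \<Longrightarrow> is_string A (vert A a fs v) (segs A a fs (v # vs))"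
proof (induction vs arbitrary: v)
  case Nil then show ?case using vert_obj[OF A str] by simp
next
  case (Cons w vs)
  then show ?case using homD[OF seg_hom[OF A str, of v w]] by simp
qed

lemma segs_vert:
  "sorted (v # vs) \<Longrightarrow> set (v # vs) \<subseteq> {..length fs} \<Longrightarrow> i < length (v # vs) \<Longrightarrow>
    vert A (vert A a fs v) (segs A a fs (v # vs)) i = vert A a fs ((v # vs) ! i)"
proof (induction vs arbitrary: v i)
  case (Cons w vs)
  show ?case
  proof (cases i)
    case (Suc i')
    then show ?thesis using Cons homD[OF seg_hom[OF A str, of v w]] by simp
  qed simp
qed simp

text \<open>Composites in the restricted string telescope by \<open>seg_comp\<close> to composites
  in the original string.\<close>

lemma segs_seg:
  "sorted (v # vs) \<Longrightarrow> set (v # vs) \<subseteq> {..length fs} \<Longrightarrow> i \<le> j \<Longrightarrow> j < length (v # vs) \<Longrightarrow>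
    seg A (vert A a fs v) (segs A a fs (v # vs)) i j = seg A a fs ((v # vs) ! i) ((v # vs) ! j)"
proof (induction vs arbitrary: v i j)
  case Nil then show ?case by (simp add: seg_id)
next
  case (Cons w vs)
  have vw: "v \<le> w" "w \<le> length fs" using Cons.prems by auto
  have c: "Cod A (seg A a fs v w) = vert A a fs w" using homD[OF seg_hom[OF A str vw]] by simp
  have s: "sorted (w # vs)" "set (w # vs) \<subseteq> {..length fs}" using Cons.prems by auto
  show ?case
  proof (cases j)
    case 0 then show ?thesis using Cons.prems seg_id[of v fs A a] by simp
  next
    case j: (Suc j')
    show ?thesis
    proof (cases i)
      case 0
      have le: "w \<le> (w # vs) ! j'" "(w # vs) ! j' \<le> length fs"
      proof -
        have j': "j' < length (w # vs)" using j Cons.prems(4) by simp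
        show "w \<le> (w # vs) ! j'" using sorted_nth_mono[OF s(1), of 0 j'] j' by simp
        have "(w # vs) ! j' \<in> {..length fs}" using nth_mem[OF j'] s(2) by blast
        then show "(w # vs) ! j' \<le> length fs" by simp
      qed
      show ?thesis using 0 j c Cons.IH[OF s, of 0 j'] Cons.prems(4) seg_comp[OF A str vw(1) le] by simp
    next
      case (Suc i') then show ?thesis using j c Cons.IH[OF s, of i' j'] Cons.prems by simp
    qed
  qed
qed

text \<open>Restricting along \<open>vs\<close> and then along \<open>ws\<close> is restricting
  along the composite map; together with \<open>segs_upt\<close> this is functoriality of the
  nerve.\<close>

lemma segs_segs:
  assumes vs: "sorted (v # vs)" "set (v # vs) \<subseteq> {..length fs}"
  shows "sorted ws \<Longrightarrow> set ws \<subseteq> {..<length (v # vs)} \<Longrightarrow>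
    segs A (vert A a fs v) (segs A a fs (v # vs)) ws = segs A a fs (map (\<lambda>i. (v # vs) ! i) ws)"
proof (induction ws)
  case (Cons i ws)
  then show ?case using segs_seg[OF vs, of i "hd ws"] by (cases ws) auto
qed simp

lemma segs_upt: "segs A a fs [0..<Suc (length fs)] = fs"
proof (rule nth_equalityI)
  show "length (segs A a fs [0..<Suc (length fs)]) = length fs" by (simp del: upt_Suc)
  fix i assume "i < length (segs A a fs [0..<Suc (length fs)])"
  then have "i < length fs" by (simp del: upt_Suc)
  then show "segs A a fs [0..<Suc (length fs)] ! i = fs ! i"
    using nth_segs[of i "[0..<Suc (length fs)]" A a fs] seg_Suc[OF A str] by (simp del: upt_Suc)
qed

end

section \<open>Simplices of the nerve as a category of elements\<close>

fun encl :: "'a univ list \<Rightarrow> 'a univ" where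
  "encl [] = Nats []"
| "encl (f # fs) = Pair f (encl fs)"

text \<open>A code that is not a pair decodes to the empty list, so \<open>decl\<close> is total and
  the action on strings is defined on arbitrary codes.\<close>

fun decl :: "'a univ \<Rightarrow> 'a univ list" where
  "decl (Pair f r) = f # decl r"
| "decl _ = []"

lemma decl_encl [simp]: "decl (encl fs) = fs"
  by (induction fs) auto

lemma encl_inject [simp]: "encl fs = encl gs \<longleftrightarrow> fs = gs"
  by (metis decl_encl)

text \<open>The string \<open>a\<^sub>0 \<rightarrow> ... \<rightarrow> a\<^sub>n\<close> is encoded as \<open>Pair a\<^sub>0 (encl fs)\<close> with \<open>fs\<close> its list of arrows.\<close>

definition strings :: "'a scat \<Rightarrow> 'a univ set" where
  "strings A = {Pair a (encl fs) | a fs. is_string A a fs}"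

definition string_dim :: "'a univ \<Rightarrow> 'a univ" where
  "string_dim x = Nats [length (decl (psnd x))]"

text \<open>The contravariant action of a monotone map on simplices. The tail of the list drops the
  leading entry, which names the codomain, and leaves the values of the map.\<close>

definition string_act :: "'a scat \<Rightarrow> 'a univ \<Rightarrow> 'a univ \<Rightarrow> 'a univ" where
  "string_act A \<phi> x = (let vs = tl (nats \<phi>); fs = decl (psnd x) in
     Pair (vert A (pfst x) fs (hd vs)) (encl (segs A (pfst x) fs vs)))"

abbreviation simplices :: "'a scat \<Rightarrow> 'a scat" where
  "simplices A \<equiv> elements simplex_op (strings A) string_dim (string_act A)"

text \<open>An arrow over a monotone map \<open>\<phi>\<close> goes from a string to its
  restriction, whose first vertex is the vertex at \<open>\<phi> 0\<close>. So the first vertex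
  moves forward, along the composite from \<open>0\<close> to \<open>\<phi> 0\<close>, and the
  functor on the opposite of the category of simplices is covariant.\<close>

definition first_vertex :: "'a scat \<Rightarrow> 'a sfunc" where
  "first_vertex A = mk_func (simplices A) A pfst
     (\<lambda>k. seg A (pfst (pfst k)) (decl (psnd (pfst k))) 0 (hd (tl (nats (psnd k)))))"

lemma string_in [simp]: "Pair a (encl fs) \<in> strings A \<longleftrightarrow> is_string A a fs"
  by (auto simp: strings_def)

lemma string_dim_Pair [simp]: "string_dim (Pair a (encl fs)) = Nats [length fs]"
  by (simp add: string_dim_def)

lemma string_act_Pair [simp]:
  "string_act A (Nats (n # vs)) (Pair a (encl fs)) = Pair (vert A a fs (hd vs)) (encl (segs A a fs vs))"
  by (simp add: string_act_def)

lemma stringE: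
  assumes "x \<in> strings A" obtains a fs where "x = Pair a (encl fs)" "is_string A a fs"
  using assms by (auto simp: strings_def)

text \<open>The action laws on arrows are \<open>segs_upt\<close> and \<open>segs_segs\<close>, and
  on first vertices \<open>segs_vert\<close>; passing to the opposite category makes the
  contravariant nerve a covariant action.\<close>

lemma simplices_action:
  assumes A: "is_category A"
  shows "discrete_action simplex_op (strings A) string_dim (string_act A)"
  unfolding discrete_action_def
proof (intro conjI ballI allI impI)
  show "is_category (simplex_op :: 'a scat)" by (rule category_op[OF category_simplex])
  fix x assume "x \<in> strings A"
  then obtain a fs where x: "x = Pair a (encl fs)" "is_string A a fs" by (rule stringE)
  show "string_dim x \<in> Obj simplex_op" using x by (simp add: simplex_obj)
  show "string_act A (Ident simplex_op (string_dim x)) x = x"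
    unfolding x(1) using segs_upt[OF A x(2)] by (simp add: simplex_ident hd_append del: upt_Suc)
  fix f b assume f: "f \<in> Hom simplex_op (string_dim x) b"
  then obtain m vs where f': "f = Nats (length fs # vs)" "b = Nats [m]" "length vs = Suc m" "sorted vs" "set vs \<subseteq> {..length fs}"
    by (auto simp: x(1) elim!: simplex_homE)
  then obtain v vs' where vs: "vs = v # vs'" by (cases vs) auto
  show "string_act A f x \<in> strings A"
    using segs_string[OF A x(2)] f' by (simp add: x(1) vs)
  show "string_dim (string_act A f x) = b" using f' by (simp add: x(1))
  fix g c assume g: "g \<in> Hom simplex_op b c"
  then obtain k ws where g': "g = Nats (m # ws)" "c = Nats [k]" "length ws = Suc k" "sorted ws" "set ws \<subseteq> {..m}"
    by (auto simp: f'(2) elim!: simplex_homE)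
  then obtain w ws' where ws: "ws = w # ws'" by (cases ws) auto
  have "Comp simplex_cat f g = Nats (length fs # map (\<lambda>i. vs ! i) ws)"
    using f g simplex_comp[of m ws c b "length fs" vs] by (simp add: f'(1) g'(1))
  moreover have "set ws \<subseteq> {..<length vs}" using g'(5) f'(3) by auto
  ultimately show "string_act A (Comp simplex_op g f) x = string_act A g (string_act A f x)"
    using segs_segs[OF A x(2) f'(4,5)[unfolded vs], of ws] segs_vert[OF A x(2) f'(4,5)[unfolded vs], of w] g'(4)
    by (simp add: x(1) f'(1) g'(1) vs ws)
qed

lemma functor_first_vertex:
  assumes A: "is_category A"
  shows "functor_from_to (simplices A) A (first_vertex A)"
  unfolding first_vertex_def
proof (rule functor_mk_func[OF category_elements[OF simplices_action[OF A]] A])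
  note da = simplices_action[OF A]
  note [simp] = elements_obj[OF da]
  fix x assume "x \<in> Obj (simplices A)"
  then obtain a fs where x: "x = Pair a (encl fs)" "is_string A a fs" by (auto elim: stringE)
  then show "pfst x \<in> Obj A" using string_obj[OF A] by simp
  show "seg A (pfst (pfst (Ident (simplices A) x))) (decl (psnd (pfst (Ident (simplices A) x)))) 0
         (hd (tl (nats (psnd (Ident (simplices A) x))))) = Ident A (pfst x)"
    using x by (simp add: elements_ident[OF da] simplex_ident upt_rec del: upt_Suc)
next
  note da = simplices_action[OF A]
  note [simp] = elements_obj[OF da]
  have *: "\<exists>a fs v vs. k = Pair (Pair a (encl fs)) (Nats (length fs # v # vs)) \<and> x = Pair a (encl fs) \<and> is_string A a fs \<and>
     sorted (v # vs) \<and> set (v # vs) \<subseteq> {..length fs} \<and> y = Pair (vert A a fs v) (encl (segs A a fs (v # vs)))"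
    if k: "k \<in> Hom (simplices A) x y" for k x y
  proof -
    obtain f where f: "k = Pair x f" "x \<in> strings A" "f \<in> Hom simplex_op (string_dim x) (string_dim y)" "y = string_act A f x"
      by (rule elements_homE[OF da k])
    obtain a fs where x: "x = Pair a (encl fs)" "is_string A a fs" by (rule stringE[OF f(2)])
    obtain m vs where vs: "f = Nats (length fs # vs)" "length vs = Suc m" "sorted vs" "set vs \<subseteq> {..length fs}"
      using f(3) by (auto simp: x(1) elim!: simplex_homE)
    obtain v vs' where v: "vs = v # vs'" using vs(2) by (cases vs) auto
    show ?thesis
      by (rule exI[of _ a], rule exI[of _ fs], rule exI[of _ v], rule exI[of _ vs'])
        (use f(1,4) x vs v in simp)
  qed
  {
    fix k x y assume k: "k \<in> Hom (simplices A) x y"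
    show "seg A (pfst (pfst k)) (decl (psnd (pfst k))) 0 (hd (tl (nats (psnd k)))) \<in> Hom A (pfst x) (pfst y)"
    proof -
      obtain a fs v vs where k': "k = Pair (Pair a (encl fs)) (Nats (length fs # v # vs))" "x = Pair a (encl fs)" "is_string A a fs"
        "set (v # vs) \<subseteq> {..length fs}" "y = Pair (vert A a fs v) (encl (segs A a fs (v # vs)))"
        using *[OF k] by blast
      then show ?thesis using seg_hom[OF A k'(3), of 0 v] by simp
    qed
  }
  fix k l x y z assume k: "k \<in> Hom (simplices A) x y" and l: "l \<in> Hom (simplices A) y z"
  obtain a fs v vs where k': "k = Pair (Pair a (encl fs)) (Nats (length fs # v # vs))" "x = Pair a (encl fs)" "is_string A a fs"
     "sorted (v # vs)" "set (v # vs) \<subseteq> {..length fs}" "y = Pair (vert A a fs v) (encl (segs A a fs (v # vs)))"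
    using *[OF k] by blast
  obtain w ws where l': "l = Pair y (Nats (length vs # w # ws))" "sorted (w # ws)" "set (w # ws) \<subseteq> {..length vs}"
  proof -
    obtain a' fs' w ws where l': "l = Pair (Pair a' (encl fs')) (Nats (length fs' # w # ws))" "y = Pair a' (encl fs')"
      "sorted (w # ws)" "set (w # ws) \<subseteq> {..length fs'}"
      using *[OF l] by blast
    then have "fs' = segs A a fs (v # vs)" using k'(6) by simp
    then show thesis using that[of w ws] l' by simp
  qed
  have "l = Pair (string_act A (Nats (length fs # v # vs)) x) (Nats (length vs # w # ws))" using l'(1) k' by simp
  moreover have "Nats (length fs # v # vs) \<in> Hom simplex_op (string_dim x) (Nats [length vs])"
    using k' by (simp add: simplex_hom)
  moreover have "Nats (length vs # w # ws) \<in> Hom simplex_op (Nats [length vs]) (Nats [length ws])"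
    using l' by (simp add: simplex_hom)
  ultimately have "Comp (simplices A) l k = Pair x (Comp simplex_cat (Nats (length fs # v # vs)) (Nats (length vs # w # ws)))"
    using elements_comp[OF da, of x "Nats (length fs # v # vs)" "Nats [length vs]" "Nats (length vs # w # ws)" "Nats [length ws]"] k' by simp
  also have "\<dots> = Pair x (Nats (length fs # (v # vs) ! w # map (\<lambda>i. (v # vs) ! i) ws))"
    using k' l' by (subst simplex_comp[where x = "Nats [length ws]" and y = "Nats [length vs]" and z = "Nats [length fs]"]) (auto simp: simplex_hom)
  finally have c: "Comp (simplices A) l k = Pair x (Nats (length fs # (v # vs) ! w # map (\<lambda>i. (v # vs) ! i) ws))" .
  have w: "w < length (v # vs)" using l'(3) by auto
  \<comment> \<open>Monotonicity puts the first value \<open>v\<close> below the first value of the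
    composite map, so the composites from \<open>0\<close> to \<open>v\<close> and from
    \<open>v\<close> onwards can be joined by \<open>seg_comp\<close>.\<close>
  have le: "v \<le> (v # vs) ! w" "(v # vs) ! w \<le> length fs"
  proof -
    show "v \<le> (v # vs) ! w" using sorted_nth_mono[OF k'(4), of 0 w] w by simp
    have "(v # vs) ! w \<in> {..length fs}" using nth_mem[OF w] k'(5) by blast
    then show "(v # vs) ! w \<le> length fs" by simp
  qed
  show "seg A (pfst (pfst (Comp (simplices A) l k))) (decl (psnd (pfst (Comp (simplices A) l k)))) 0
          (hd (tl (nats (psnd (Comp (simplices A) l k))))) =
         Comp A (seg A (pfst (pfst l)) (decl (psnd (pfst l))) 0 (hd (tl (nats (psnd l)))))
          (seg A (pfst (pfst k)) (decl (psnd (pfst k))) 0 (hd (tl (nats (psnd k)))))"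
    unfolding c using segs_seg[OF A k'(3,4,5), of 0 w] w seg_comp[OF A k'(3) _ le, of 0] l' k' by simp
qed

text \<open>Strings of a fixed length are bounded by induction on the length; the union over all
  lengths is small since the bound is uncountable and regular.\<close>

lemma small_strings:
  assumes k: "size_bound \<kappa>" and A: "small_category \<kappa> A"
  shows "|strings A| <o \<kappa>"
proof -
  define L where "L n = {encl fs | fs. length fs = n \<and> set fs \<subseteq> Arr A}" for n
  have L: "|L n| <o \<kappa>" for n
  proof (induction n)
    case 0
    have "L 0 = {Nats []}" by (auto simp: L_def)
    then show ?case using size_bound_finite[OF k, of "{Nats []} :: 'a univ set"] by simp
  next
    case (Suc n)
    have "L (Suc n) \<subseteq> {Pair f r | f r. f \<in> Arr A \<and> r \<in> L n}" by (auto simp: L_def length_Suc_conv)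
    then show ?case using size_bound_Pair[OF k _ Suc] A by (auto simp: small_category_def)
  qed
  have U: "|\<Union>n. L n| <o \<kappa>"
    by (rule size_bound_UN[OF k]) (use L countable_less[of \<kappa> id] k in \<open>auto simp: size_bound_def\<close>)
  have "is_string A a fs \<Longrightarrow> set fs \<subseteq> Arr A" for a fs
    by (induction fs arbitrary: a) auto
  then have "strings A \<subseteq> {Pair a r | a r. a \<in> Obj A \<and> r \<in> (\<Union>n. L n)}"
    using string_obj A by (fastforce simp: strings_def L_def small_category_def)
  then show ?thesis using size_bound_Pair[OF k _ U] A by (auto simp: small_category_def)
qed

section \<open>Fibres and coproducts\<close>

lemma under_cat_obj [simp]:
  "Pair a f \<in> Obj (under_cat b u) \<longleftrightarrow> a \<in> Obj (Src u) \<and> f \<in> Hom (Tgt u) b (FO u a)"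
  by (auto simp: under_cat_def under_objs_def)

lemma under_objE:
  assumes "x \<in> Obj (under_cat b u)"
  obtains a f where "x = Pair a f" "a \<in> Obj (Src u)" "f \<in> Hom (Tgt u) b (FO u a)"
  using assms by (auto simp: under_cat_def under_objs_def)

lemma under_hom [simp]:
  "Pair (Pair x' y') h \<in> Hom (under_cat b u) x y \<longleftrightarrow> x' = x \<and> y' = y \<and> x \<in> Obj (under_cat b u) \<and>
    y \<in> Obj (under_cat b u) \<and> h \<in> Hom (Src u) (pfst x) (pfst y) \<and> Comp (Tgt u) (FA u h) (psnd x) = psnd y"
  by (auto simp: under_cat_def Hom_def)

lemma under_homE:
  assumes "k \<in> Hom (under_cat b u) x y"
  obtains h where "k = Pair (Pair x y) h" "x \<in> Obj (under_cat b u)"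
    "y \<in> Obj (under_cat b u)" "h \<in> Hom (Src u) (pfst x) (pfst y)" "Comp (Tgt u) (FA u h) (psnd x) = psnd y"
proof -
  obtain h where h: "k = Pair (Pair x y) h" using assms unfolding under_cat_def Hom_def by auto
  then show thesis using that[OF h] assms under_hom[of x y h b u x y] by blast
qed

lemma under_ident [simp]:
  "x \<in> Obj (under_cat b u) \<Longrightarrow> Ident (under_cat b u) x = Pair (Pair x x) (Ident (Src u) (pfst x))"
  by (auto simp: under_cat_def under_objs_def)

lemma under_comp:
  "Pair (Pair y z) g \<in> Hom (under_cat b u) y z \<Longrightarrow> Pair (Pair x y) f \<in> Hom (under_cat b u) x y \<Longrightarrow>
   Comp (under_cat b u) (Pair (Pair y z) g) (Pair (Pair x y) f) = Pair (Pair x z) (Comp (Src u) g f)"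
  unfolding Hom_def by (simp add: under_cat_def)

lemma category_under:
  assumes u: "functor_from_to A B u"
  shows "is_category (under_cat b u)"
  unfolding under_cat_def
proof (intro is_category_mk_cat)
  note ends [simp] = functor_ends[OF u]
  note C = functor_cat[OF u]
  let ?M = "{Pair (Pair x y) h | x y h. x \<in> under_objs b u \<and> y \<in> under_objs b u \<and>
        h \<in> Hom (Src u) (pfst x) (pfst y) \<and> Comp (Tgt u) (FA u h) (psnd x) = psnd y}"
  have ob: "pfst x \<in> Obj A" "psnd x \<in> Hom B b (FO u (pfst x))" if "x \<in> under_objs b u" for x
    using that by (auto simp: under_objs_def)
  show "pfst (pfst f) \<in> under_objs b u \<and> psnd (pfst f) \<in> under_objs b u" if "f \<in> ?M" for f
    using that by auto
  show "Pair (Pair x x) (Ident (Src u) (pfst x)) \<in> ?M \<and>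
    pfst (pfst (Pair (Pair x x) (Ident (Src u) (pfst x)))) = x \<and>
    psnd (pfst (Pair (Pair x x) (Ident (Src u) (pfst x)))) = x" if "x \<in> under_objs b u" for x
    using that ob[OF that] by (auto simp: cat_ident_hom[OF C(1)] fun_ident[OF u] cat_id_left[OF C(2)])
  show "Pair (Pair (pfst (pfst f)) (psnd (pfst g))) (Comp (Src u) (psnd g) (psnd f)) \<in> ?M \<and>
       pfst (pfst (Pair (Pair (pfst (pfst f)) (psnd (pfst g))) (Comp (Src u) (psnd g) (psnd f)))) = pfst (pfst f) \<and>
       psnd (pfst (Pair (Pair (pfst (pfst f)) (psnd (pfst g))) (Comp (Src u) (psnd g) (psnd f)))) = psnd (pfst g)"
    if fg: "f \<in> ?M" "g \<in> ?M" "psnd (pfst f) = pfst (pfst g)" for f g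
  proof -
    obtain x y z h k where *: "f = Pair (Pair x y) h" "g = Pair (Pair y z) k"
      "x \<in> under_objs b u" "y \<in> under_objs b u" "z \<in> under_objs b u"
      "h \<in> Hom A (pfst x) (pfst y)" "k \<in> Hom A (pfst y) (pfst z)"
      "Comp B (FA u h) (psnd x) = psnd y" "Comp B (FA u k) (psnd y) = psnd z"
      using fg by auto
    show ?thesis
      using * cat_comp_hom[OF C(1) *(7,6)] fun_comp[OF u *(7,6)]
        cat_assoc[OF C(2) fun_hom[OF u *(7)] fun_hom[OF u *(6)] ob(2)[OF *(3)]] by auto
  qed
  show "Pair (Pair (pfst (pfst (Pair (Pair (pfst (pfst f)) (pfst (pfst f))) (Ident (Src u) (pfst (pfst (pfst f))))))) (psnd (pfst f)))
        (Comp (Src u) (psnd f) (psnd (Pair (Pair (pfst (pfst f)) (pfst (pfst f))) (Ident (Src u) (pfst (pfst (pfst f))))))) = f \<and>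
       Pair (Pair (pfst (pfst f)) (psnd (pfst (Pair (Pair (psnd (pfst f)) (psnd (pfst f))) (Ident (Src u) (pfst (psnd (pfst f))))))))
        (Comp (Src u) (psnd (Pair (Pair (psnd (pfst f)) (psnd (pfst f))) (Ident (Src u) (pfst (psnd (pfst f)))))) (psnd f)) = f"
    if "f \<in> ?M" for f
    using that by (auto simp: cat_id_left[OF C(1)] cat_id_right[OF C(1)])
qed (auto simp: cat_assoc[OF functor_cat(1)[OF u]] functor_ends[OF u])

lemma under_proj_simps [simp]:
  "Src (under_proj b u) = under_cat b u" "Tgt (under_proj b u) = Src u"
  "x \<in> Obj (under_cat b u) \<Longrightarrow> FO (under_proj b u) x = pfst x"
  "f \<in> Hom (under_cat b u) x y \<Longrightarrow> FA (under_proj b u) f = psnd f"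
  by (auto simp: under_proj_def)

lemma functor_under_proj:
  assumes u: "functor_from_to A B u"
  shows "functor_from_to (under_cat b u) A (under_proj b u)"
  unfolding under_proj_def functor_ends[OF u]
  by (rule functor_mk_func)
    (auto simp: category_under[OF u] functor_cat[OF u] functor_ends[OF u] under_comp elim!: under_objE under_homE)

lemma under_cell_at [simp]: "x \<in> Obj (under_cat b u) \<Longrightarrow> At (under_cell b u) x = psnd x"
  by (auto simp: under_cell_def)

lemma under_cell:
  assumes u: "functor_from_to A B u" and b: "b \<in> Obj B"
  shows "ntrans_from_to (point B b \<circ>\<^sub>F to_one (under_cat b u)) (u \<circ>\<^sub>F under_proj b u) (under_cell b u)"
  unfolding under_cell_def functor_ends[OF u]
proof (rule nt_mk[OF functor_comp[OF functor_to_one[OF category_under[OF u]] functor_point[OF functor_cat(2)[OF u] b]]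
      functor_comp[OF functor_under_proj[OF u] u]])
  fix x assume "x \<in> Obj (under_cat b u)"
  then show "psnd x \<in> Hom B (FO (point B b \<circ>\<^sub>F to_one (under_cat b u)) x) (FO (u \<circ>\<^sub>F under_proj b u) x)"
    by (auto elim!: under_objE simp: functor_ends[OF u])
next
  fix f x y assume f: "f \<in> Hom (under_cat b u) x y" and x: "x \<in> Obj (under_cat b u)" and y: "y \<in> Obj (under_cat b u)"
  have "psnd y \<in> Hom B b (FO u (pfst y))" using y by (auto elim!: under_objE simp: functor_ends[OF u])
  then show "Comp B (psnd y) (FA (point B b \<circ>\<^sub>F to_one (under_cat b u)) f) = Comp B (FA (u \<circ>\<^sub>F under_proj b u) f) (psnd x)"
    using f comp_func_FA[of f "under_proj b u" x y u] comp_func_FA[of f "to_one (under_cat b u)" x y "point B b"]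
    by (auto elim!: under_homE simp: functor_ends[OF u] cat_id_right[OF functor_cat(2)[OF u]])
qed

lemma small_under:
  assumes k: "size_bound \<kappa>" and A: "small_category \<kappa> A" and B: "small_category \<kappa> B"
    and u: "functor_from_to A B u"
  shows "small_category \<kappa> (under_cat b u)"
  unfolding small_category_def
proof (intro conjI)
  show "is_category (under_cat b u)" by (rule category_under[OF u])
  show o: "|Obj (under_cat b u)| <o \<kappa>"
    by (rule size_bound_Pair[OF k, of "Obj A" "Arr B"])
      (use A B in \<open>auto simp: small_category_def functor_ends[OF u] elim!: under_objE dest: homD\<close>)
  have "|{Pair x y |x y. x \<in> Obj (under_cat b u) \<and> y \<in> Obj (under_cat b u)}| <o \<kappa>"
    by (rule size_bound_Pair[OF k o o]) blast
  then show "|Arr (under_cat b u)| <o \<kappa>"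
    by (rule size_bound_Pair[OF k, of _ "Arr A"])
      (use A in \<open>auto simp: small_category_def under_cat_def functor_ends[OF u] dest: homD\<close>)
qed

definition under_lift ::
  "'a univ \<Rightarrow> 'a sfunc \<Rightarrow> 'a sfunc \<Rightarrow> ('a univ \<Rightarrow> 'a univ) \<Rightarrow> 'a sfunc" where
  "under_lift b u F \<phi> = mk_func (Src F) (under_cat b u) (\<lambda>x. Pair (FO F x) (\<phi> x))
     (\<lambda>h. Pair (Pair (Pair (FO F (Dom (Src F) h)) (\<phi> (Dom (Src F) h)))
                     (Pair (FO F (Cod (Src F) h)) (\<phi> (Cod (Src F) h)))) (FA F h))"

lemma under_lift_simps [simp]:
  "Src (under_lift b u F \<phi>) = Src F" "Tgt (under_lift b u F \<phi>) = under_cat b u"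
  "x \<in> Obj (Src F) \<Longrightarrow> FO (under_lift b u F \<phi>) x = Pair (FO F x) (\<phi> x)"
  "h \<in> Hom (Src F) x y \<Longrightarrow> FA (under_lift b u F \<phi>) h = Pair (Pair (Pair (FO F x) (\<phi> x)) (Pair (FO F y) (\<phi> y))) (FA F h)"
  by (auto simp: under_lift_def Hom_def)

lemma functor_under_lift:
  assumes u: "functor_from_to A B u" and F: "functor_from_to K A F"
    and \<phi>: "\<And>x. x \<in> Obj K \<Longrightarrow> \<phi> x \<in> Hom B b (FO u (FO F x))"
    and n: "\<And>h x y. h \<in> Hom K x y \<Longrightarrow> x \<in> Obj K \<Longrightarrow> y \<in> Obj K \<Longrightarrow> Comp B (FA u (FA F h)) (\<phi> x) = \<phi> y"
  shows "functor_from_to K (under_cat b u) (under_lift b u F \<phi>)"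
  unfolding under_lift_def functor_ends[OF F]
proof (rule functor_mk_func)
  note [simp] = functor_ends[OF u] fun_obj[OF F] fun_hom[OF F]
  have K: "is_category K" using functor_cat[OF F] by simp
  show "is_category K" by fact
  show "is_category (under_cat b u)" by (rule category_under[OF u])
  fix x assume x: "x \<in> Obj K"
  then show "Pair (FO F x) (\<phi> x) \<in> Obj (under_cat b u)" using \<phi> by simp
  show "Pair (Pair (Pair (FO F (Dom K (Ident K x))) (\<phi> (Dom K (Ident K x)))) (Pair (FO F (Cod K (Ident K x))) (\<phi> (Cod K (Ident K x)))))
          (FA F (Ident K x)) = Ident (under_cat b u) (Pair (FO F x) (\<phi> x))"
    using x \<phi> homD[OF cat_ident_hom[OF K x]] fun_ident[OF F x] by simp
next
  note [simp] = functor_ends[OF u] fun_obj[OF F]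
  fix f x y assume f: "f \<in> Hom K x y" and x: "x \<in> Obj K" and y: "y \<in> Obj K"
  then show "Pair (Pair (Pair (FO F (Dom K f)) (\<phi> (Dom K f))) (Pair (FO F (Cod K f)) (\<phi> (Cod K f)))) (FA F f)
       \<in> Hom (under_cat b u) (Pair (FO F x) (\<phi> x)) (Pair (FO F y) (\<phi> y))"
    using homD[OF f] fun_hom[OF F f] \<phi> n[OF f x y] by simp
next
  note [simp] = functor_ends[OF u] fun_obj[OF F]
  have K: "is_category K" using functor_cat[OF F] by simp
  fix f g x y z assume f: "f \<in> Hom K x y" and g: "g \<in> Hom K y z" and o: "x \<in> Obj K" "y \<in> Obj K" "z \<in> Obj K"
  show "Pair (Pair (Pair (FO F (Dom K (Comp K g f))) (\<phi> (Dom K (Comp K g f)))) (Pair (FO F (Cod K (Comp K g f))) (\<phi> (Cod K (Comp K g f)))))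
        (FA F (Comp K g f)) =
       Comp (under_cat b u) (Pair (Pair (Pair (FO F (Dom K g)) (\<phi> (Dom K g))) (Pair (FO F (Cod K g)) (\<phi> (Cod K g)))) (FA F g))
        (Pair (Pair (Pair (FO F (Dom K f)) (\<phi> (Dom K f))) (Pair (FO F (Cod K f)) (\<phi> (Cod K f)))) (FA F f))"
    using homD[OF f] homD[OF g] homD[OF cat_comp_hom[OF K g f]] fun_comp[OF F g f] fun_hom[OF F f] fun_hom[OF F g]
     o \<phi> n[OF f] n[OF g] by (simp add: under_comp)
qed

lemma under_nt:
  assumes u: "functor_from_to A B u" and S: "functor_from_to K (under_cat b u) S"
    and T: "functor_from_to K (under_cat b u) T"
    and t: "\<And>x. x \<in> Obj K \<Longrightarrow> t x \<in> Hom A (pfst (FO S x)) (pfst (FO T x))"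
    and p: "\<And>x. x \<in> Obj K \<Longrightarrow> Comp B (FA u (t x)) (psnd (FO S x)) = psnd (FO T x)"
    and n: "\<And>h x y. h \<in> Hom K x y \<Longrightarrow> x \<in> Obj K \<Longrightarrow> y \<in> Obj K \<Longrightarrow>
      Comp A (t y) (psnd (FA S h)) = Comp A (psnd (FA T h)) (t x)"
  shows "ntrans_from_to S T (over_nt S T t)"
  unfolding over_nt_def
proof (rule nt_mk[OF S T])
  note ends [simp] = functor_ends[OF u]
  show h: "Pair (Pair (FO S x) (FO T x)) (t x) \<in> Hom (under_cat b u) (FO S x) (FO T x)" if "x \<in> Obj K" for x
    unfolding under_hom ends using t[OF that] p[OF that] fun_obj[OF S that] fun_obj[OF T that] by blast
  fix f x y assume f: "f \<in> Hom K x y" and x: "x \<in> Obj K" and y: "y \<in> Obj K"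
  obtain f1 where f1: "FA S f = Pair (Pair (FO S x) (FO S y)) f1" by (rule under_homE[OF fun_hom[OF S f]]) blast
  obtain f2 where f2: "FA T f = Pair (Pair (FO T x) (FO T y)) f2" by (rule under_homE[OF fun_hom[OF T f]]) blast
  show "Comp (under_cat b u) (Pair (Pair (FO S y) (FO T y)) (t y)) (FA S f) =
       Comp (under_cat b u) (FA T f) (Pair (Pair (FO S x) (FO T x)) (t x))"
    using n[OF f x y] under_comp[OF h[OF y] fun_hom[OF S f, unfolded f1]]
      under_comp[OF fun_hom[OF T f, unfolded f2] h[OF x]]
    by (simp only: f1 f2 univ.sel ends)
qed

text \<open>The preimage of \<open>g\<close> is \<open>FA G g\<close> conjugated by the isomorphisms
  \<open>\<eta>\<close>. Naturality of \<open>\<eta>\<close> shows that its image has the same value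
  under \<open>G\<close> as \<open>g\<close>, and \<open>G\<close> is faithful because
  \<open>\<epsilon>\<close> is invertible. Faithfulness of \<open>F\<close> follows in the same way
  from \<open>\<eta>\<close>.\<close>

lemma equivalence_full_faithful:
  assumes F: "functor_from_to C D F" and e: "is_equivalence F" and x: "x \<in> Obj C" and y: "y \<in> Obj C"
    and g: "g \<in> Hom D (FO F x) (FO F y)"
  shows "\<exists>!f. f \<in> Hom C x y \<and> FA F f = g"
proof -
  obtain G \<eta> \<epsilon> where G: "functor_from_to D C G" and n: "nat_iso_from_to (id_func C) (G \<circ>\<^sub>F F) \<eta>"
    and m: "nat_iso_from_to (F \<circ>\<^sub>F G) (id_func D) \<epsilon>"
    using e unfolding is_equivalence_def functor_ends[OF F] by blast
  note C = functor_cat(1)[OF F] and D = functor_cat(2)[OF F]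
  have n': "ntrans_from_to (id_func C) (G \<circ>\<^sub>F F) \<eta>" and m': "ntrans_from_to (F \<circ>\<^sub>F G) (id_func D) \<epsilon>"
    using n m by (auto simp: nat_iso_from_to_def)
  have nh: "At \<eta> z \<in> Hom C z (FO G (FO F z))" "is_iso C (At \<eta> z)" if "z \<in> Obj C" for z
    using nt_hom[OF n'] n that by (simp_all add: functor_ends[OF F] nat_iso_from_to_def)
  have mh: "At \<epsilon> z \<in> Hom D (FO F (FO G z)) z" "is_iso D (At \<epsilon> z)" if "z \<in> Obj D" for z
    using nt_hom[OF m'] m that by (simp_all add: functor_ends[OF F] functor_ends[OF G] nat_iso_from_to_def)
  have nn: "Comp C (At \<eta> z') f = Comp C (FA G (FA F f)) (At \<eta> z)" if "f \<in> Hom C z z'" for f z z'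
    using nt_nat[OF n'] comp_func_FA[of f F z z' G] that by (simp add: functor_ends[OF F])
  have mn: "Comp D f (At \<epsilon> z) = Comp D (At \<epsilon> z') (FA F (FA G f))" if "f \<in> Hom D z z'" for f z z'
    using nt_nat[OF m'] comp_func_FA[of f G z z' F] that by (simp add: functor_ends[OF F] functor_ends[OF G])
  \<comment> \<open>Naturality determines \<open>f\<close> after precomposition with the invertible
    \<open>At \<epsilon> a\<close>.\<close>
  have Gf: "f = f'" if f: "f \<in> Hom D a b" and f': "f' \<in> Hom D a b" and eq: "FA G f = FA G f'" for f f' a b
  proof -
    have a: "a \<in> Obj D" using hom_obj[OF D f] by simp
    obtain i where i: "i \<in> Hom D a (FO F (FO G a))" "Comp D (At \<epsilon> a) i = Ident D a"
      using is_isoE[OF mh(2)[OF a] mh(1)[OF a]] by metis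
    have "Comp D f (At \<epsilon> a) = Comp D f' (At \<epsilon> a)" using mn[OF f] mn[OF f'] eq by simp
    then have "Comp D (Comp D f (At \<epsilon> a)) i = Comp D (Comp D f' (At \<epsilon> a)) i" by simp
    then show ?thesis
      using cat_assoc[OF D f mh(1)[OF a] i(1)] cat_assoc[OF D f' mh(1)[OF a] i(1)] i(2) cat_id_right[OF D f] cat_id_right[OF D f'] by simp
  qed
  obtain i where i: "i \<in> Hom C (FO G (FO F y)) y" "Comp C i (At \<eta> y) = Ident C y" "Comp C (At \<eta> y) i = Ident C (FO G (FO F y))"
    using is_isoE[OF nh(2)[OF y] nh(1)[OF y]] by metis
  obtain ix where ix: "ix \<in> Hom C (FO G (FO F x)) x" "Comp C (At \<eta> x) ix = Ident C (FO G (FO F x))"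
    using is_isoE[OF nh(2)[OF x] nh(1)[OF x]] by metis
  note Gg = fun_hom[OF G g]
  define f where "f = Comp C i (Comp C (FA G g) (At \<eta> x))"
  have gx: "Comp C (FA G g) (At \<eta> x) \<in> Hom C x (FO G (FO F y))" using cat_comp_hom[OF C Gg nh(1)[OF x]] .
  have f: "f \<in> Hom C x y" unfolding f_def using cat_comp_hom[OF C i(1) gx] .
  have "Comp C (FA G (FA F f)) (At \<eta> x) = Comp C (At \<eta> y) f" using nn[OF f] by simp
  also have "\<dots> = Comp C (FA G g) (At \<eta> x)"
    unfolding f_def using cat_assoc[OF C nh(1)[OF y] i(1) gx] i(3) cat_id_left[OF C gx] by simp
  finally have "Comp C (Comp C (FA G (FA F f)) (At \<eta> x)) ix = Comp C (Comp C (FA G g) (At \<eta> x)) ix" by simp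
  then have "FA G (FA F f) = FA G g"
    using cat_assoc[OF C fun_hom[OF G fun_hom[OF F f]] nh(1)[OF x] ix(1)] cat_assoc[OF C Gg nh(1)[OF x] ix(1)] ix(2)
      cat_id_right[OF C fun_hom[OF G fun_hom[OF F f]]] cat_id_right[OF C Gg] by simp
  then have "FA F f = g" using Gf[OF fun_hom[OF F f] g] by simp
  moreover have "f1 = f2" if f1: "f1 \<in> Hom C x y" and f2: "f2 \<in> Hom C x y" and eq: "FA F f1 = FA F f2" for f1 f2
  proof -
    have "Comp C (At \<eta> y) f1 = Comp C (At \<eta> y) f2" using nn[OF f1] nn[OF f2] eq by simp
    then have "Comp C i (Comp C (At \<eta> y) f1) = Comp C i (Comp C (At \<eta> y) f2)" by simp
    then show ?thesis
      using cat_assoc[OF C i(1) nh(1)[OF y] f1] cat_assoc[OF C i(1) nh(1)[OF y] f2] i(2) cat_id_left[OF C f1] cat_id_left[OF C f2] by simp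
  qed
  ultimately show ?thesis using f by (intro ex1I[of _ f]) auto
qed

lemma prod_cat_family_hom:
  "t \<in> (\<Pi>\<^sub>E i\<in>I. Hom (C i) (X i) (Y i)) \<Longrightarrow> X \<in> (\<Pi>\<^sub>E i\<in>I. Obj (C i)) \<Longrightarrow> Y \<in> (\<Pi>\<^sub>E i\<in>I. Obj (C i)) \<Longrightarrow>
    t \<in> Hom (prod_cat_family I C) X Y"
  unfolding prod_cat_family_def mk_cat_hom
  by (auto simp: PiE_iff Hom_def extensional_def fun_eq_iff)

context derivator_theory begin

lemma sfun_under_proj: "sfun A B u \<Longrightarrow> sfun (under_cat b u) A (under_proj b u)"
  using small_under[OF size] by (auto simp: small_fun_def functor_under_proj)

text \<open>Full faithfulness of the equivalence in Der1: a map between objects over a coproduct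
  category is the same as a family of maps over the summands.\<close>

lemma Der1_ff:
  assumes I: "|I| <o \<kappa>" and A: "\<And>i. i \<in> I \<Longrightarrow> small (A i)" and X: "X \<in> ob (coprod_cat I A)" and Y: "Y \<in> ob (coprod_cat I A)"
    and t: "\<And>i. i \<in> I \<Longrightarrow> t i \<in> hm (A i) (pb (coprod_incl I A i) X) (pb (coprod_incl I A i) Y)"
  shows "\<exists>!h. h \<in> hm (coprod_cat I A) X Y \<and> (\<forall>i\<in>I. pa (coprod_incl I A i) h = t i)"
proof -
  let ?S = "coprod_cat I A" and ?P = "prod_cat_family I (\<lambda>i. D0 D (A i))"
  let ?O = "\<lambda>X. \<lambda>i\<in>I. pb (coprod_incl I A i) X" and ?H = "\<lambda>f. \<lambda>i\<in>I. pa (coprod_incl I A i) f"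
  let ?F = "mk_func (D0 D ?S) ?P ?O ?H"
  have e: "is_equivalence ?F" using Der1 I A unfolding Der1_def by blast
  then have F: "functor_from_to (D0 D ?S) ?P ?F" by (simp add: is_equivalence_def functor_from_to_def)
  have S: "small ?S" using small_coprod[OF size I A] .
  have i: "sfun (A i) ?S (coprod_incl I A i)" if "i \<in> I" for i
    unfolding small_fun_def using S A that functor_coprod_incl[of I A i] small_is_category by blast
  \<comment> \<open>Arrows of the product category are extensional functions, so the given family
    must be cut down to \<open>I\<close>.\<close>
  have "restrict t I \<in> Hom ?P (FO ?F X) (FO ?F Y)"
    using X Y t pb_ob[OF i] by (intro prod_cat_family_hom) auto
  from equivalence_full_faithful[OF F e X Y this]
  have "\<exists>!h. h \<in> hm ?S X Y \<and> FA ?F h = restrict t I" .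
  moreover have "FA ?F h = restrict t I \<longleftrightarrow> (\<forall>i\<in>I. pa (coprod_incl I A i) h = t i)" if "h \<in> hm ?S X Y" for h
  proof -
    have "FA ?F h = ?H h" using that by simp
    then show ?thesis by (auto simp: fun_eq_iff restrict_def split: if_splits)
  qed
  ultimately show ?thesis by (metis (no_types, lifting))
qed

text \<open>Kan extension along the codiagonal is a coproduct: maps \<open>P \<rightarrow> Y\<close>
  are maps from \<open>W\<close> to the pullback of \<open>Y\<close>, and by Der1 these are families
  of maps into \<open>Y\<close>, because each inclusion followed by the codiagonal is the
  identity.\<close>

lemma coproduct_codiagonal:
  assumes I: "|I| <o \<kappa>" and C: "small C" and q: "sfun (coprod_cat I (\<lambda>_. C)) C q"
    and qi: "\<And>i. i \<in> I \<Longrightarrow> q \<circ>\<^sub>F coprod_incl I (\<lambda>_. C) i = id_func C"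
    and W: "W \<in> ob (coprod_cat I (\<lambda>_. C))" and U: "univ_arrow q W P \<theta>"
  shows "is_coproduct (D0 D C) I (\<lambda>i. pb (coprod_incl I (\<lambda>_. C) i) W) P (\<lambda>i. pa (coprod_incl I (\<lambda>_. C) i) \<theta>)"
proof -
  let ?S = "coprod_cat I (\<lambda>_. C)" and ?i = "coprod_incl I (\<lambda>_. C)"
  note P = univ_arrowD[OF U q] and S = small_funD(2)[OF q]
  have i: "sfun C ?S (?i i)" if "i \<in> I" for i
    unfolding small_fun_def using S C that functor_coprod_incl[of I "\<lambda>_. C" i] small_is_category by blast
  have iq: "pb (?i i) (pb q Y) = Y" if "i \<in> I" "Y \<in> ob C" for i Y
    using pb_comp[OF i[OF that(1)] q that(2)] qi[OF that(1)] pb_id[OF C that(2)] by simp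
  have iqa: "pa (?i i) (pa q h) = h" if "i \<in> I" "h \<in> hm C Y Z" for i h Y Z
    using pa_comp[OF i[OF that(1)] q that(2)] qi[OF that(1)] pa_id[OF C that(2)] by simp
  note cS = dcat[OF S]
  show ?thesis unfolding is_coproduct_def
  proof (intro conjI ballI allI impI)
    show "pb (?i i) W \<in> ob C" if "i \<in> I" for i using pb_ob[OF i[OF that] W] .
    show "P \<in> ob C" using P(1) .
    show "pa (?i i) \<theta> \<in> hm C (pb (?i i) W) P" if "i \<in> I" for i using pa_hm[OF i[OF that] P(2)] iq[OF that P(1)] by simp
    fix Y t assume Y: "Y \<in> ob C" and t: "\<forall>i\<in>I. t i \<in> hm C (pb (?i i) W) Y"
    have "\<And>i. i \<in> I \<Longrightarrow> t i \<in> hm C (pb (?i i) W) (pb (?i i) (pb q Y))" using t iq[OF _ Y] by simp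
    from Der1_ff[OF I C W pb_ob[OF q Y] this]
    \<comment> \<open>The family \<open>t\<close> assembles to one map over the coproduct category,
      which then factors through the universal arrow.\<close>
    have ex: "\<exists>!g. g \<in> hm ?S W (pb q Y) \<and> (\<forall>i\<in>I. pa (?i i) g = t i)" .
    then obtain g where g: "g \<in> hm ?S W (pb q Y)" "\<forall>i\<in>I. pa (?i i) g = t i" by blast
    have e: "pa (?i i) (pa q h \<cdot>\<^bsub>?S\<^esub> \<theta>) = h \<cdot>\<^bsub>C\<^esub> pa (?i i) \<theta>" if "i \<in> I" "h \<in> hm C P Y" for i h
      using pa_dcomp[OF i[OF that(1)] pa_hm[OF q that(2)] P(2)] iqa[OF that] by simp
    obtain h where h: "h \<in> hm C P Y" "pa q h \<cdot>\<^bsub>?S\<^esub> \<theta> = g" using univ_arrow_ex[OF U q Y g(1)] .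
    show "\<exists>!h. h \<in> hm C P Y \<and> (\<forall>i\<in>I. h \<cdot>\<^bsub>C\<^esub> pa (?i i) \<theta> = t i)"
    proof (intro ex1I conjI)
      show "h \<in> hm C P Y" using h(1) .
      show "\<forall>i\<in>I. h \<cdot>\<^bsub>C\<^esub> pa (?i i) \<theta> = t i" using h g e by metis
      fix k assume k: "k \<in> hm C P Y \<and> (\<forall>i\<in>I. k \<cdot>\<^bsub>C\<^esub> pa (?i i) \<theta> = t i)"
      have "pa q k \<cdot>\<^bsub>?S\<^esub> \<theta> \<in> hm ?S W (pb q Y)" using cat_comp_hom[OF cS pa_hm[OF q conjunct1[OF k]] P(2)] .
      then have "pa q k \<cdot>\<^bsub>?S\<^esub> \<theta> = g" using ex g k e by metis
      then show "k = h" using univ_arrow_eq[OF U q conjunct1[OF k] h(1)] h(2) by simp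
    qed
  qed
qed

end

subsection \<open>Fibres of a discrete opfibration\<close>

text \<open>The fibre over \<open>b\<close>, with parameters in \<open>C\<close>, as a coproduct of copies of \<open>1 \<times> C\<close>.\<close>

definition fibre_incl :: "'a scat \<Rightarrow> 'a univ set \<Rightarrow> ('a univ \<Rightarrow> 'a univ) \<Rightarrow> ('a univ \<Rightarrow> 'a univ \<Rightarrow> 'a univ) \<Rightarrow>
    'a univ \<Rightarrow> 'a scat \<Rightarrow> 'a sfunc" where
  "fibre_incl B S pr act b C = mk_func (coprod_cat {x \<in> S. pr x = b} (\<lambda>_. prod_cat one_cat C))
     (prod_cat (elements B S pr act) C)
     (\<lambda>x. Pair (pfst x) (psnd (psnd x))) (\<lambda>k. Pair (Pair (pfst k) (Ident B b)) (psnd (psnd k)))"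

definition codiagonal :: "'a univ set \<Rightarrow> 'a scat \<Rightarrow> 'a sfunc" where
  "codiagonal I C = mk_func (coprod_cat I (\<lambda>_. C)) C psnd psnd"

lemma codiagonal_simps [simp]:
  "Src (codiagonal I C) = coprod_cat I (\<lambda>_. C)" "Tgt (codiagonal I C) = C"
  "x \<in> Obj (coprod_cat I (\<lambda>_. C)) \<Longrightarrow> FO (codiagonal I C) x = psnd x"
  "f \<in> Hom (coprod_cat I (\<lambda>_. C)) x y \<Longrightarrow> FA (codiagonal I C) f = psnd f"
  by (auto simp: codiagonal_def)

lemma functor_codiagonal: "is_category C \<Longrightarrow> functor_from_to (coprod_cat I (\<lambda>_. C)) C (codiagonal I C)"
  unfolding codiagonal_def
  by (rule functor_mk_func) (auto simp: category_coprod coprod_comp elim!: coprod_objE coprod_homE)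

lemma codiagonal_incl:
  assumes C: "is_category C" and i: "i \<in> I"
  shows "codiagonal I C \<circ>\<^sub>F coprod_incl I (\<lambda>_. C) i = id_func C"
proof -
  have ci: "functor_from_to C (coprod_cat I (\<lambda>_. C)) (coprod_incl I (\<lambda>_. C) i)"
    using functor_coprod_incl[of I "\<lambda>_. C" i] C i by simp
  have *: "FA (codiagonal I C) (Pair i f) = f" if "f \<in> Hom C x y" for f x y
    using codiagonal_simps(4)[of "Pair i f" I C "Pair i x" "Pair i y"] that i by simp
  show ?thesis
    by (rule functor_eqI[OF functor_comp[OF ci functor_codiagonal[OF C]] functor_id[OF C]])
      (use i in \<open>auto simp: * comp_func_FA[of _ "coprod_incl I (\<lambda>_. C) i"]\<close>)
qed

context
  fixes B :: "'a scat" and S pr act b and C :: "'a scat"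
  assumes da: "discrete_action B S pr act" and b: "b \<in> Obj B" and C: "is_category C"
begin

private abbreviation "El \<equiv> elements B S pr act"
private abbreviation "Fib \<equiv> coprod_cat {x \<in> S. pr x = b} (\<lambda>_. prod_cat one_cat C)"
private abbreviation "inc \<equiv> fibre_incl B S pr act b C"

private lemma category_Fib: "is_category Fib"
  by (intro category_coprod category_prod category_one C)

private lemma category_El: "is_category (prod_cat El C)"
  by (intro category_prod category_elements[OF da] C)

lemma fibre_incl_simps:
  "Src inc = Fib" "Tgt inc = prod_cat El C"
  "x \<in> S \<Longrightarrow> pr x = b \<Longrightarrow> c \<in> Obj C \<Longrightarrow> FO inc (Pair x (Pair (Nats []) c)) = Pair x c"
  "x \<in> S \<Longrightarrow> pr x = b \<Longrightarrow> h \<in> Hom C c c' \<Longrightarrow> FA inc (Pair x (Pair (Nats []) h)) = Pair (Pair x (Ident B b)) h"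
proof -
  show "FA inc (Pair x (Pair (Nats []) h)) = Pair (Pair x (Ident B b)) h" if "x \<in> S" "pr x = b" "h \<in> Hom C c c'"
  proof -
    have "Pair x (Pair (Nats []) h) \<in> Hom Fib (Pair x (Pair (Nats []) c)) (Pair x (Pair (Nats []) c'))"
      using that by simp
    then show ?thesis
      unfolding fibre_incl_def by (subst mk_func_simps(5)[where x = "Pair x (Pair (Nats []) c)" and y = "Pair x (Pair (Nats []) c')"]) simp_all
  qed
qed (simp_all add: fibre_incl_def)

lemma N_objE:
  assumes "x \<in> Obj Fib" obtains i c where "x = Pair i (Pair (Nats []) c)" "i \<in> S" "pr i = b" "c \<in> Obj C"
  using assms by (auto elim!: coprod_objE prod_objE)

lemma N_homE:
  assumes "k \<in> Hom Fib x y"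
  obtains i c c' h where "x = Pair i (Pair (Nats []) c)" "y = Pair i (Pair (Nats []) c')"
    "k = Pair i (Pair (Nats []) h)" "i \<in> S" "pr i = b" "h \<in> Hom C c c'"
  using assms by (auto elim!: coprod_homE prod_homE dest!: one_homE)

lemma functor_fibre_incl: "functor_from_to Fib (prod_cat El C) inc"
  unfolding fibre_incl_def
proof (rule functor_mk_func[OF category_Fib category_El])
  fix x assume "x \<in> Obj Fib"
  then obtain i c where x: "x = Pair i (Pair (Nats []) c)" "i \<in> S" "pr i = b" "c \<in> Obj C" by (rule N_objE)
  then show "Pair (pfst x) (psnd (psnd x)) \<in> Obj (prod_cat El C)" using elements_obj[OF da] by simp
  show "Pair (Pair (pfst (Ident Fib x)) (Ident B b)) (psnd (psnd (Ident Fib x))) = Ident (prod_cat El C) (Pair (pfst x) (psnd (psnd x)))"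
    using x elements_obj[OF da] elements_ident[OF da x(2)] by simp
next
  fix f x y assume "f \<in> Hom Fib x y"
  then obtain i c c' h where "x = Pair i (Pair (Nats []) c)" "y = Pair i (Pair (Nats []) c')"
    "f = Pair i (Pair (Nats []) h)" "i \<in> S" "pr i = b" "h \<in> Hom C c c'" by (rule N_homE)
  then show "Pair (Pair (pfst f) (Ident B b)) (psnd (psnd f)) \<in> Hom (prod_cat El C) (Pair (pfst x) (psnd (psnd x))) (Pair (pfst y) (psnd (psnd y)))"
    using elements_hom[OF da] cat_ident_hom[OF da_cat[OF da] b] da_id[OF da, of i] by simp
next
  fix f g x y z assume f: "f \<in> Hom Fib x y" and g: "g \<in> Hom Fib y z"
  obtain i c c' h where f': "x = Pair i (Pair (Nats []) c)" "y = Pair i (Pair (Nats []) c')"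
    "f = Pair i (Pair (Nats []) h)" "i \<in> S" "pr i = b" "h \<in> Hom C c c'" using f by (rule N_homE)
  obtain c'' k where g': "z = Pair i (Pair (Nats []) c'')" "g = Pair i (Pair (Nats []) k)" "k \<in> Hom C c' c''"
    using g by (rule N_homE) (simp add: f')
  have I: "Ident B b \<in> Hom B b b" using cat_ident_hom[OF da_cat[OF da] b] .
  have e: "Pair i (Ident B b) \<in> Hom El i i" using elements_hom[OF da] I f'(4,5) da_id[OF da f'(4)] by simp
  have "Comp Fib g f = Pair i (Pair (Nats []) (Comp C k h))"
    using f' g' coprod_comp[of i "{x \<in> S. pr x = b}" "Pair (Nats []) k" "\<lambda>_. prod_cat one_cat C" "Pair (Nats []) c'" "Pair (Nats []) c''" "Pair (Nats []) h" "Pair (Nats []) c"]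
      prod_comp[of "Nats []" one_cat "Nats []" "Nats []" "Nats []" "Nats []" k C c' c'' h c] by simp
  moreover have "Comp El (Pair i (Ident B b)) (Pair i (Ident B b)) = Pair i (Ident B b)"
    using cat_id_left[OF category_elements[OF da] e] elements_ident[OF da f'(4)] f'(5) by simp
  ultimately show "Pair (Pair (pfst (Comp Fib g f)) (Ident B b)) (psnd (psnd (Comp Fib g f))) =
       Comp (prod_cat El C) (Pair (Pair (pfst g) (Ident B b)) (psnd (psnd g))) (Pair (Pair (pfst f) (Ident B b)) (psnd (psnd f)))"
    using f' g' prod_comp[OF e e g'(3) f'(6)] by simp
qed

end

context derivator_theory begin

text \<open>An object of the comma category over \<open>(b, c)\<close> consists of an element
  \<open>x\<close>, a parameter \<open>c'\<close> and arrows \<open>f : pr x \<rightarrow> b\<close>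
  and \<open>g : c' \<rightarrow> c\<close>. Pushing \<open>x\<close> forward along \<open>f\<close>
  lands in the fibre over \<open>b\<close>; this is the retraction, and the lift of \<open>f\<close>
  starting at \<open>x\<close> is the 2-cell from the identity. On objects already in the fibre,
  \<open>f\<close> is an identity and nothing moves.\<close>

lemma fibre_exact:
  fixes B C :: "'a scat"
  assumes da: "discrete_action B S pr act" and S: "|S| <o \<kappa>" and B: "small B" and b: "b \<in> Obj B" and C: "small C"
    and X: "X \<in> ob (prod_cat (elements B S pr act) C)"
  defines "p \<equiv> fibre_incl B S pr act b C" and "u \<equiv> prod_func (elements_proj B S pr act) (id_func C)"
    and "q \<equiv> codiagonal {x \<in> S. pr x = b} (prod_cat one_cat C)" and "v \<equiv> prod_func (point B b) (id_func C)"
  shows "univ_arrow q (pb p X) (pb v (lo u X)) (pa p (lu u X))"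
proof -
  let ?E = "elements B S pr act" and ?I = "{x \<in> S. pr x = b}"
  let ?U = "prod_cat one_cat C"
  let ?N = "coprod_cat ?I (\<lambda>_. ?U)"
  have cC: "is_category C" and cB: "is_category B" using C B by (auto simp: small_category_def)
  have sE: "small ?E" using small_elements[OF da size S B] .
  have cE: "is_category ?E" using category_elements[OF da] .
  have s1: "small ?U" using small_prod[OF size small_one[OF size] C] .
  have I: "|?I| <o \<kappa>" using card_of_subset_less[OF _ S] by auto
  have sN: "small ?N" using small_coprod[OF size I s1] .
  have pr: "sfun ?E B (elements_proj B S pr act)" using functor_elements_proj[OF da] sE B by (simp add: small_fun_def)
  have p: "sfun ?N (prod_cat ?E C) p" unfolding p_def small_fun_def
    using functor_fibre_incl[OF da b cC] sN small_prod[OF size sE C] by simp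
  have u: "sfun (prod_cat ?E C) (prod_cat B C) u" unfolding u_def using sfun_idr[OF pr C] .
  have q: "sfun ?N ?U q" unfolding q_def small_fun_def using functor_codiagonal small_is_category[OF s1] sN s1 by blast
  have v: "sfun ?U (prod_cat B C) v" unfolding v_def using sfun_idr[OF sfun_point[OF B b] C] .
  note fp = small_funD(1)[OF p] and fu = small_funD(1)[OF u] and fq = small_funD(1)[OF q] and fv = small_funD(1)[OF v]
  note [simp] = elements_obj[OF da] elements_proj_simps[OF da]
  note p_simps [simp] = fibre_incl_simps[OF da b cC, folded p_def]
  note NE = N_objE[OF da b cC] and NhE = N_homE[OF da b cC]
  have q_simps [simp]: "Src q = ?N" "Tgt q = ?U" "x \<in> Obj ?N \<Longrightarrow> FO q x = psnd x" "f \<in> Hom ?N x y \<Longrightarrow> FA q f = psnd f" for x y f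
    by (simp_all add: q_def)
  have u_ends [simp]: "Src u = prod_cat ?E C" "Tgt u = prod_cat B C" using functor_ends[OF fu] .
  have v_ends [simp]: "Src v = ?U" "Tgt v = prod_cat B C" using functor_ends[OF fv] .
  have uO [simp]: "FO u (Pair x c) = Pair (pr x) c" if "x \<in> S" "c \<in> Obj C" for x c using that by (simp add: u_def)
  have uA [simp]: "FA u (Pair (Pair x f) h) = Pair f h" if "Pair x f \<in> Hom ?E x y" "h \<in> Hom C c c'" for x f y h c c'
    using prod_func_simps(4)[of "Pair x f" "elements_proj B S pr act" x y h "id_func C" c c'] that
      elements_proj_simps(4)[OF da that(1)] unfolding u_def by simp
  have vO [simp]: "FO v (Pair (Nats []) c) = Pair b c" if "c \<in> Obj C" for c using that by (simp add: v_def)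
  have vA [simp]: "FA v (Pair (Nats []) h) = Pair (Ident B b) h" if "h \<in> Hom C c c'" for h c c'
    using prod_func_simps(4)[of "Nats []" "point B b" "Nats []" "Nats []" h "id_func C" c c'] that unfolding v_def by simp
  have Ib: "Ident B b \<in> Hom B b b" using cat_ident_hom[OF cB b] .
  have ehom: "Pair x f \<in> Hom ?E x (act f x)" "pr (act f x) = c" "act f x \<in> S" if "x \<in> S" "f \<in> Hom B (pr x) c" for x f c
    using elements_hom[OF da] da_act[OF da that] that by simp_all
  \<comment> \<open>Around either side, an element of the fibre with parameter \<open>c\<close> goes
    to \<open>(b, c)\<close>.\<close>
  have sq: "u \<circ>\<^sub>F p = v \<circ>\<^sub>F q"
  proof (rule functor_eqI[OF functor_comp[OF fp fu] functor_comp[OF fq fv]])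
    fix x assume x: "x \<in> Obj ?N"
    then obtain i c where "x = Pair i (Pair (Nats []) c)" "i \<in> S" "pr i = b" "c \<in> Obj C" by (rule NE)
    then show "FO (u \<circ>\<^sub>F p) x = FO (v \<circ>\<^sub>F q) x" by simp
  next
    fix k x y assume k: "k \<in> Hom ?N x y"
    then obtain i c c' h where h: "k = Pair i (Pair (Nats []) h)" "i \<in> S" "pr i = b" "h \<in> Hom C c c'" by (rule NhE)
    have "FA (u \<circ>\<^sub>F p) k = FA u (Pair (Pair i (Ident B b)) h)"
      using comp_func_FA[of k p x y u] k h by simp
    also have "\<dots> = Pair (Ident B b) h" using uA[OF ehom(1)[of i "Ident B b" b] h(4)] h Ib by simp
    also have "\<dots> = FA (v \<circ>\<^sub>F q) k" using comp_func_FA[of k q x y v] q_simps(4)[OF k] vA[OF h(4)] k h by simp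
    finally show "FA (u \<circ>\<^sub>F p) k = FA (v \<circ>\<^sub>F q) k" .
  qed
  show ?thesis
  proof (rule strict_exact[OF p u q v sq X])
    fix c0 j assume "c0 \<in> Obj ?U"
    then obtain c where c0: "c0 = Pair (Nats []) c" and c: "c \<in> Obj C" by (auto elim!: prod_objE)
    let ?K = "over_cat q c0" and ?K' = "over_cat u (FO v c0)"
    assume j: "j = over_lift u (FO v c0) (p \<circ>\<^sub>F over_proj q c0) (\<lambda>x. FA v (psnd x))" and fj: "functor_from_to ?K ?K' j"
    have vc0: "FO v c0 = Pair b c" using c by (simp add: c0)
    have K'E: "\<exists>x c' f g. k = Pair (Pair x c') (Pair f g) \<and> x \<in> S \<and> c' \<in> Obj C \<and> f \<in> Hom B (pr x) b \<and> g \<in> Hom C c' c"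
      if k: "k \<in> Obj ?K'" for k
    proof -
      obtain a h where k': "k = Pair a h" "a \<in> Obj (prod_cat ?E C)" "h \<in> Hom (prod_cat B C) (FO u a) (Pair b c)"
        using k unfolding vc0 by (auto elim!: over_objE)
      obtain x c' where a: "a = Pair x c'" "x \<in> S" "c' \<in> Obj C" using k'(2) by (auto elim!: prod_objE)
      then show ?thesis using k'(1,3) by (auto elim!: prod_homE)
    qed
    have KE: "\<exists>i c' g. k = Pair (Pair i (Pair (Nats []) c')) (Pair (Nats []) g) \<and> i \<in> S \<and> pr i = b \<and> c' \<in> Obj C \<and> g \<in> Hom C c' c"
      if k: "k \<in> Obj ?K" for k
    proof -
      obtain a h where k': "k = Pair a h" "a \<in> Obj ?N" "h \<in> Hom ?U (FO q a) c0"
        using k by (auto elim!: over_objE)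
      obtain i c' where a: "a = Pair i (Pair (Nats []) c')" "i \<in> S" "pr i = b" "c' \<in> Obj C" using k'(2) by (rule NE)
      have "h \<in> Hom ?U (Pair (Nats []) c') (Pair (Nats []) c)" using k'(2,3) a c0 by simp
      then obtain g where "h = Pair (Nats []) g" "g \<in> Hom C c' c" by (auto elim!: prod_homE dest!: one_homE)
      then show ?thesis using k'(1) a by blast
    qed
    note [simp del] = over_cat_obj
    have K'hom: "\<exists>x c' f g x' c'' f' g' h k. x0 = Pair (Pair x c') (Pair f g) \<and> y0 = Pair (Pair (act h x) c'') (Pair f' g') \<and>
        k0 = Pair (Pair x0 y0) (Pair (Pair x h) k) \<and> x \<in> S \<and> x' = act h x \<and> h \<in> Hom B (pr x) (pr (act h x)) \<and> k \<in> Hom C c' c'' \<and> Comp B f' h = f \<and> Comp C g' k = g \<and>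
        f' \<in> Hom B (pr (act h x)) b \<and> g' \<in> Hom C c'' c \<and> f \<in> Hom B (pr x) b \<and> g \<in> Hom C c' c"
      if k0: "k0 \<in> Hom ?K' x0 y0" for k0 x0 y0
    proof -
      obtain hk where *: "k0 = Pair (Pair x0 y0) hk" "x0 \<in> Obj ?K'" "y0 \<in> Obj ?K'" "hk \<in> Hom (prod_cat ?E C) (pfst x0) (pfst y0)"
        "Comp (prod_cat B C) (psnd y0) (FA u hk) = psnd x0"
        using over_homE[OF k0] by simp metis
      obtain x c' f g where x0: "x0 = Pair (Pair x c') (Pair f g)" "x \<in> S" "f \<in> Hom B (pr x) b" "g \<in> Hom C c' c"
        using K'E[OF *(2)] by blast
      obtain x' c'' f' g' where y0: "y0 = Pair (Pair x' c'') (Pair f' g')" "f' \<in> Hom B (pr x') b" "g' \<in> Hom C c'' c"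
        using K'E[OF *(3)] by blast
      obtain eh k where hk: "hk = Pair eh k" "eh \<in> Hom ?E x x'" "k \<in> Hom C c' c''"
        using *(4) unfolding x0 y0 by (auto elim!: prod_homE)
      obtain h where h: "eh = Pair x h" "h \<in> Hom B (pr x) (pr x')" "x' = act h x" using elements_homE[OF da hk(2)] by metis
      have "Comp B f' h = f \<and> Comp C g' k = g"
        using *(5) prod_comp[OF y0(2) h(2) y0(3) hk(3)] uA[OF hk(2)[unfolded h(1)] hk(3)] hk(1) h(1)
        unfolding x0 y0 by simp
      then show ?thesis using x0 y0 hk h * by blast
    qed
    \<comment> \<open>The pushforward along \<open>f\<close> names the summand of the coproduct; the
      parameter is kept.\<close>
    define F where "F = mk_func ?K' ?N (\<lambda>x. Pair (act (pfst (psnd x)) (pfst (pfst x))) (Pair (Nats []) (psnd (pfst x))))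
      (\<lambda>k. Pair (act (pfst (psnd (pfst (pfst k)))) (pfst (pfst (pfst (pfst k))))) (Pair (Nats []) (psnd (psnd k))))"
    have cK': "is_category ?K'" using functor_cat(2)[OF fj] .
    have cN: "is_category ?N" using small_is_category[OF sN] .
    have fF: "functor_from_to ?K' ?N F"
      unfolding F_def
    proof (rule functor_mk_func[OF cK' cN])
      fix x assume x: "x \<in> Obj ?K'"
      then obtain y c' f g where x': "x = Pair (Pair y c') (Pair f g)" "y \<in> S" "c' \<in> Obj C" "f \<in> Hom B (pr y) b" "g \<in> Hom C c' c"
        using K'E by metis
      then show "Pair (act (pfst (psnd x)) (pfst (pfst x))) (Pair (Nats []) (psnd (pfst x))) \<in> Obj ?N"
        using ehom[OF x'(2,4)] by simp
      have "Ident ?K' x = Pair (Pair x x) (Pair (Ident ?E y) (Ident C c'))" using x x' by simp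
      then show "Pair (act (pfst (psnd (pfst (pfst (Ident ?K' x))))) (pfst (pfst (pfst (pfst (Ident ?K' x))))))
          (Pair (Nats []) (psnd (psnd (Ident ?K' x)))) =
         Ident ?N (Pair (act (pfst (psnd x)) (pfst (pfst x))) (Pair (Nats []) (psnd (pfst x))))"
        using x' ehom[OF x'(2,4)] by simp
    next
      fix k0 x y assume k0: "k0 \<in> Hom ?K' x y"
      obtain a c' f g c'' f' g' h k where *: "x = Pair (Pair a c') (Pair f g)" "y = Pair (Pair (act h a) c'') (Pair f' g')"
        "k0 = Pair (Pair x y) (Pair (Pair a h) k)" "a \<in> S" "h \<in> Hom B (pr a) (pr (act h a))" "k \<in> Hom C c' c''" "Comp B f' h = f"
        "f' \<in> Hom B (pr (act h a)) b" "f \<in> Hom B (pr a) b"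
        using K'hom[OF k0] by blast
      \<comment> \<open>An arrow of the comma category satisfies \<open>f' h = f\<close>, so
        pushforward gives the same element at both ends. Its image therefore stays within one
        summand.\<close>
      have "act f' (act h a) = act f a" using da_comp[OF da *(4,5,8)] *(7) by simp
      then show "Pair (act (pfst (psnd (pfst (pfst k0)))) (pfst (pfst (pfst (pfst k0))))) (Pair (Nats []) (psnd (psnd k0)))
       \<in> Hom ?N (Pair (act (pfst (psnd x)) (pfst (pfst x))) (Pair (Nats []) (psnd (pfst x))))
           (Pair (act (pfst (psnd y)) (pfst (pfst y))) (Pair (Nats []) (psnd (pfst y))))"
        using * ehom[OF *(4,9)] by simp
    next
      fix k0 l0 x y z assume k0: "k0 \<in> Hom ?K' x y" and l0: "l0 \<in> Hom ?K' y z"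
      obtain a c' f g c'' f' g' h k where *: "x = Pair (Pair a c') (Pair f g)" "y = Pair (Pair (act h a) c'') (Pair f' g')"
        "k0 = Pair (Pair x y) (Pair (Pair a h) k)" "a \<in> S" "h \<in> Hom B (pr a) (pr (act h a))" "k \<in> Hom C c' c''" "Comp B f' h = f"
        "f' \<in> Hom B (pr (act h a)) b" "f \<in> Hom B (pr a) b"
        using K'hom[OF k0] by blast
      obtain a2 c2 f2 g2 c3 f3 g3 h2 k2 where **: "y = Pair (Pair a2 c2) (Pair f2 g2)" "z = Pair (Pair (act h2 a2) c3) (Pair f3 g3)"
        "l0 = Pair (Pair y z) (Pair (Pair a2 h2) k2)" "a2 \<in> S" "h2 \<in> Hom B (pr a2) (pr (act h2 a2))" "k2 \<in> Hom C c2 c3"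
        using K'hom[OF l0] by blast
      have e: "act f' (act h a) = act f a" using da_comp[OF da *(4,5,8)] *(7) by simp
      have e2: "a2 = act h a" "c2 = c''" "f2 = f'" "g2 = g'" using *(2) **(1) by auto
      have c1: "Comp ?K' l0 k0 = Pair (Pair x z) (Comp (prod_cat ?E C) (Pair (Pair a2 h2) k2) (Pair (Pair a h) k))"
        using over_comp[of y z "Pair (Pair a2 h2) k2" u "FO v c0" x "Pair (Pair a h) k"] k0 l0 *(3) **(3) by simp
      have eh: "Pair a2 h2 \<in> Hom ?E (act h a) (act h2 a2)" "Pair a h \<in> Hom ?E a (act h a)"
        using ehom(1)[OF **(4,5)] ehom(1)[OF *(4,5)] e2 by simp_all
      have c2: "Comp (prod_cat ?E C) (Pair (Pair a2 h2) k2) (Pair (Pair a h) k) = Pair (Comp ?E (Pair a2 h2) (Pair a h)) (Comp C k2 k)"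
        using prod_comp[OF eh **(6)[unfolded e2] *(6)] .
      have i: "act f a \<in> ?I" using ehom[OF *(4,9)] by simp
      have c3: "Comp ?N (Pair (act f a) (Pair (Nats []) k2)) (Pair (act f a) (Pair (Nats []) k)) = Pair (act f a) (Pair (Nats []) (Comp C k2 k))"
        using coprod_comp[of "act f a" ?I "Pair (Nats []) k2" "\<lambda>_. ?U" "Pair (Nats []) c''" "Pair (Nats []) c3" "Pair (Nats []) k" "Pair (Nats []) c'"]
          i *(6) **(6) e2 prod_comp[of "Nats []" one_cat "Nats []" "Nats []" "Nats []" "Nats []" k2 C c'' c3 k c'] by simp
      show "Pair (act (pfst (psnd (pfst (pfst (Comp ?K' l0 k0))))) (pfst (pfst (pfst (pfst (Comp ?K' l0 k0)))))) (Pair (Nats []) (psnd (psnd (Comp ?K' l0 k0)))) =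
        Comp ?N (Pair (act (pfst (psnd (pfst (pfst l0)))) (pfst (pfst (pfst (pfst l0))))) (Pair (Nats []) (psnd (psnd l0))))
          (Pair (act (pfst (psnd (pfst (pfst k0)))) (pfst (pfst (pfst (pfst k0))))) (Pair (Nats []) (psnd (psnd k0))))"
        unfolding c1 c2 using c3 *(1,3) **(3) e **(1) e2 by simp
    qed
    have FOs: "FO F (Pair (Pair x c') (Pair f g)) = Pair (act f x) (Pair (Nats []) c')" if "Pair (Pair x c') (Pair f g) \<in> Obj ?K'" for x c' f g
      using that by (simp add: F_def)
    have FAs: "FA F k0 = Pair (act (pfst (psnd x)) (pfst (pfst x))) (Pair (Nats []) (psnd (psnd k0)))" if k0: "k0 \<in> Hom ?K' x y" for k0 x y
      using K'hom[OF k0] k0 by (auto simp: F_def simp del: over_hom)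
    define \<rho> where "\<rho> = over_lift q c0 F (\<lambda>x. Pair (Nats []) (psnd (psnd x)))"
    have f\<rho>: "functor_from_to ?K' ?K \<rho>" unfolding \<rho>_def
    proof (rule functor_over_lift[OF fq fF])
      fix x0 assume x0: "x0 \<in> Obj ?K'"
      then obtain x c' f g where *: "x0 = Pair (Pair x c') (Pair f g)" "c' \<in> Obj C" "g \<in> Hom C c' c"
        using K'E by metis
      show "Pair (Nats []) (psnd (psnd x0)) \<in> Hom ?U (FO q (FO F x0)) c0"
        using FOs x0 * c q_simps(3)[OF fun_obj[OF fF x0]] by (simp add: c0)
    next
      fix k0 x0 y0 assume k0: "k0 \<in> Hom ?K' x0 y0"
      obtain x c' f g c'' f' g' h k where *: "x0 = Pair (Pair x c') (Pair f g)" "y0 = Pair (Pair (act h x) c'') (Pair f' g')"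
        "k0 = Pair (Pair x0 y0) (Pair (Pair x h) k)" "k \<in> Hom C c' c''" "Comp C g' k = g" "g' \<in> Hom C c'' c"
        using K'hom[OF k0] by blast
      have "FA q (FA F k0) = Pair (Nats []) k"
        using FAs[OF k0] q_simps(4)[OF fun_hom[OF fF k0]] *(3) by simp
      then show "Comp ?U (Pair (Nats []) (psnd (psnd y0))) (FA q (FA F k0)) = Pair (Nats []) (psnd (psnd x0))"
        using prod_comp[of "Nats []" one_cat "Nats []" "Nats []" "Nats []" "Nats []" g' C c'' c k c'] *(1,2,4,5,6) by simp
    qed
    have jO: "FO j (Pair (Pair i (Pair (Nats []) c')) (Pair (Nats []) g)) = Pair (Pair i c') (Pair (Ident B b) g)"
      if "Pair (Pair i (Pair (Nats []) c')) (Pair (Nats []) g) \<in> Obj ?K" for i c' g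
      using that KE[OF that] vA unfolding j by auto
    have \<rho>O: "FO \<rho> (Pair (Pair x c') (Pair f g)) = Pair (Pair (act f x) (Pair (Nats []) c')) (Pair (Nats []) g)"
      if "Pair (Pair x c') (Pair f g) \<in> Obj ?K'" for x c' f g
      using that FOs[OF that] unfolding \<rho>_def by (simp add: functor_ends[OF fF])
    have jA: "FA j k0 = Pair (Pair (FO j x0) (FO j y0)) (FA p (psnd k0))" if k0: "k0 \<in> Hom ?K x0 y0" for k0 x0 y0
    proof -
      have o: "x0 \<in> Obj ?K" "y0 \<in> Obj ?K" using hom_obj[OF functor_cat(1)[OF fj] k0] by auto
      show ?thesis using k0 o comp_func_FA[of k0 "over_proj q c0" x0 y0 p] unfolding j by simp
    qed
    have \<rho>A: "FA \<rho> k0 = Pair (Pair (FO \<rho> x0) (FO \<rho> y0)) (FA F k0)" if k0: "k0 \<in> Hom ?K' x0 y0" for k0 x0 y0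
    proof -
      have o: "x0 \<in> Obj ?K'" "y0 \<in> Obj ?K'" using hom_obj[OF functor_cat(1)[OF f\<rho>] k0] by auto
      show ?thesis using k0 o unfolding \<rho>_def by (simp add: functor_ends[OF fF])
    qed
    \<comment> \<open>An element of the fibre is paired with the identity of \<open>b\<close>, whose
      action fixes it.\<close>
    have rj: "FO \<rho> (FO j x0) = x0" if x0: "x0 \<in> Obj ?K" for x0
    proof -
      obtain i c' g where *: "x0 = Pair (Pair i (Pair (Nats []) c')) (Pair (Nats []) g)" "i \<in> S" "pr i = b" using KE[OF x0] by blast
      show ?thesis using \<rho>O[of i c' "Ident B b" g] fun_obj[OF fj x0] jO x0 * da_id[OF da *(2)] by simp
    qed
    have jr: "FO j (FO \<rho> (Pair (Pair x c') (Pair f g))) = Pair (Pair (act f x) c') (Pair (Ident B b) g)"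
      if "Pair (Pair x c') (Pair f g) \<in> Obj ?K'" for x c' f g
      using fun_obj[OF f\<rho> that] \<rho>O[OF that] jO[of "act f x" c' g] by simp
    \<comment> \<open>The lift of \<open>f\<close> from \<open>x\<close> to its pushforward, with
      the identity on the parameter. Since the retraction is strict on the fibre, the other 2-cell
      consists of identities.\<close>
    let ?t = "\<lambda>x. Pair (Pair (pfst (pfst x)) (pfst (psnd x))) (Ident C (psnd (pfst x)))"
    let ?\<alpha> = "over_nt (id_func ?K') (j \<circ>\<^sub>F \<rho>) ?t" and ?\<beta> = "over_nt (id_func ?K) (\<rho> \<circ>\<^sub>F j) (\<lambda>x. Ident ?N (pfst x))"
    have a: "ntrans_from_to (id_func ?K') (j \<circ>\<^sub>F \<rho>) ?\<alpha>"
    proof (rule over_nt[OF fu functor_id[OF cK'] functor_comp[OF f\<rho> fj]])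
      fix x0 assume x0: "x0 \<in> Obj ?K'"
      then obtain x c' f g where *: "x0 = Pair (Pair x c') (Pair f g)" "x \<in> S" "c' \<in> Obj C" "f \<in> Hom B (pr x) b" "g \<in> Hom C c' c"
        using K'E by metis
      have Fx: "FO (j \<circ>\<^sub>F \<rho>) x0 = Pair (Pair (act f x) c') (Pair (Ident B b) g)"
        using jr x0 *(1) by (simp add: functor_ends[OF f\<rho>])
      have Ic: "Ident C c' \<in> Hom C c' c'" using cat_ident_hom[OF cC *(3)] .
      show "?t x0 \<in> Hom (prod_cat ?E C) (pfst (FO (id_func ?K') x0)) (pfst (FO (j \<circ>\<^sub>F \<rho>) x0))"
        unfolding Fx using x0 * ehom(1)[OF *(2,4)] Ic by simp
      have "FA u (?t x0) = Pair f (Ident C c')" using uA[OF ehom(1)[OF *(2,4)] Ic] * by simp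
      then show "Comp (prod_cat B C) (psnd (FO (j \<circ>\<^sub>F \<rho>) x0)) (FA u (?t x0)) = psnd (FO (id_func ?K') x0)"
        unfolding Fx using x0 prod_comp[OF Ib *(4,5) Ic] cat_id_left[OF cB *(4)] cat_id_right[OF cC *(5)] *(1) by simp
    next
      fix k0 x0 y0 assume k0: "k0 \<in> Hom ?K' x0 y0"
      obtain x c' f g c'' f' g' h k where *: "x0 = Pair (Pair x c') (Pair f g)" "y0 = Pair (Pair (act h x) c'') (Pair f' g')"
        "k0 = Pair (Pair x0 y0) (Pair (Pair x h) k)" "x \<in> S" "h \<in> Hom B (pr x) (pr (act h x))" "k \<in> Hom C c' c''" "Comp B f' h = f"
        "f' \<in> Hom B (pr (act h x)) b" "f \<in> Hom B (pr x) b"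
        using K'hom[OF k0] by blast
      have cc: "c' \<in> Obj C" "c'' \<in> Obj C" using hom_obj[OF cC *(6)] by auto
      note i1 = cat_ident_hom[OF cC cc(1)] and i2 = cat_ident_hom[OF cC cc(2)]
      have xf: "act f x \<in> S" "pr (act f x) = b" using ehom[OF *(4,9)] by auto
      have "psnd (FA (j \<circ>\<^sub>F \<rho>) k0) = FA p (Pair (act f x) (Pair (Nats []) k))"
        using comp_func_FA[of k0 \<rho> x0 y0 j] k0 jA[OF fun_hom[OF f\<rho> k0]] \<rho>A[OF k0] FAs[OF k0] *(1,3) by (simp add: functor_ends[OF f\<rho>])
      also have "\<dots> = Pair (Pair (act f x) (Ident B b)) k" using p_simps(4)[OF xf *(6)] .
      finally have 1: "psnd (FA (j \<circ>\<^sub>F \<rho>) k0) = Pair (Pair (act f x) (Ident B b)) k" .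
      have e: "act f' (act h x) = act f x" using da_comp[OF da *(4,5,8)] *(7) by simp
      note h1 = ehom(1)[OF *(4,5)] and h2 = ehom(1)[OF ehom(3)[OF *(4,5)] *(8), unfolded e] and h3 = ehom(1)[OF *(4,9)]
      have h4: "Pair (act f x) (Ident B b) \<in> Hom ?E (act f x) (act f x)"
        using ehom(1)[OF xf(1), of "Ident B b" b] Ib xf da_id[OF da xf(1)] by simp
      have "Comp ?E (Pair (act h x) f') (Pair x h) = Pair x f"
        using elements_comp[OF da *(4,5,8)] *(7) by simp
      moreover have "Comp ?E (Pair (act f x) (Ident B b)) (Pair x f) = Pair x f"
        using elements_comp[OF da *(4,9) Ib] cat_id_left[OF cB *(9)] by simp
      ultimately show "Comp (prod_cat ?E C) (?t y0) (psnd (FA (id_func ?K') k0)) = Comp (prod_cat ?E C) (psnd (FA (j \<circ>\<^sub>F \<rho>) k0)) (?t x0)"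
        unfolding 1 id_func_simps(4)[OF k0] using *(1,2,3) prod_comp[OF h2 h1 i2 *(6)] prod_comp[OF h4 h3 *(6) i1]
          cat_id_left[OF cC *(6)] cat_id_right[OF cC *(6)] by simp
    qed
    have cK: "is_category ?K" using functor_cat(1)[OF fj] .
    have b: "ntrans_from_to (id_func ?K) (\<rho> \<circ>\<^sub>F j) ?\<beta>"
    proof (rule over_nt[OF fq functor_id[OF cK] functor_comp[OF fj f\<rho>]])
      fix x0 assume x0: "x0 \<in> Obj ?K"
      then obtain a h where *: "x0 = Pair a h" "a \<in> Obj ?N" "h \<in> Hom ?U (FO q a) c0" by (auto elim!: over_objE)
      have Fx: "FO (\<rho> \<circ>\<^sub>F j) x0 = x0" using rj x0 by (simp add: functor_ends[OF fj])
      show "Ident ?N (pfst x0) \<in> Hom ?N (pfst (FO (id_func ?K) x0)) (pfst (FO (\<rho> \<circ>\<^sub>F j) x0))"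
        unfolding Fx using x0 *(1) cat_ident_hom[OF cN *(2)] by simp
      show "Comp ?U (psnd (FO (\<rho> \<circ>\<^sub>F j) x0)) (FA q (Ident ?N (pfst x0))) = psnd (FO (id_func ?K) x0)"
        unfolding Fx using x0 *(1) fun_ident[OF fq *(2)] cat_id_right[OF small_is_category[OF s1] *(3)] by (simp del: q_simps(3,4))
    next
      fix k0 x0 y0 assume k0: "k0 \<in> Hom ?K x0 y0"
      obtain hk where h1: "k0 = Pair (Pair x0 y0) hk" "x0 \<in> Obj ?K" "y0 \<in> Obj ?K" "hk \<in> Hom ?N (pfst x0) (pfst y0)"
        using over_homE[OF k0] by simp metis
      obtain i c' g where x0: "x0 = Pair (Pair i (Pair (Nats []) c')) (Pair (Nats []) g)" "i \<in> S" "pr i = b"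
        using KE[OF h1(2)] by blast
      obtain h where h: "hk = Pair i (Pair (Nats []) h)" "\<exists>c'' c3. h \<in> Hom C c'' c3" using h1(4) by (rule NhE) (use x0 in auto)
      obtain c'' c3 where hc: "h \<in> Hom C c'' c3" using h(2) by blast
      have "FA p hk = Pair (Pair i (Ident B b)) h" using p_simps(4)[OF x0(2,3) hc] h(1) by simp
      then have "FA j k0 = Pair (Pair (FO j x0) (FO j y0)) (Pair (Pair i (Ident B b)) h)" using jA[OF k0] h1(1) by simp
      moreover have "FO j x0 = Pair (Pair i c') (Pair (Ident B b) g)" using jO h1(2) x0(1) by simp
      ultimately have "FA F (FA j k0) = hk"
        using FAs[OF fun_hom[OF fj k0]] da_id[OF da x0(2)] x0(3) h(1) by simp
      then have 1: "psnd (FA (\<rho> \<circ>\<^sub>F j) k0) = hk"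
        using comp_func_FA[of k0 j x0 y0 \<rho>] k0 \<rho>A[OF fun_hom[OF fj k0]] by (simp add: functor_ends[OF fj])
      show "Comp ?N (Ident ?N (pfst y0)) (psnd (FA (id_func ?K) k0)) = Comp ?N (psnd (FA (\<rho> \<circ>\<^sub>F j) k0)) (Ident ?N (pfst x0))"
        unfolding 1 id_func_simps(4)[OF k0] using h1(1) cat_id_left[OF cN h1(4)] cat_id_right[OF cN h1(4)] by simp
    qed
    have "At ?\<alpha> (FO j x0) = FA j (At ?\<beta> x0)" if x0: "x0 \<in> Obj ?K" for x0
    proof -
      obtain i c' g where *: "x0 = Pair (Pair i (Pair (Nats []) c')) (Pair (Nats []) g)" "i \<in> S" "pr i = b" "c' \<in> Obj C"
        using KE[OF x0] by metis
      have bx: "At ?\<beta> x0 = Pair (Pair x0 x0) (Ident ?N (pfst x0))"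
        using x0 rj by (simp add: functor_ends[OF fj])
      have bh: "At ?\<beta> x0 \<in> Hom ?K x0 x0"
        using nt_hom[OF b, unfolded id_func_simps, OF x0] x0 rj by (simp add: functor_ends[OF fj])
      have "FA p (Ident ?N (pfst x0)) = Pair (Pair i (Ident B b)) (Ident C c')"
        using fun_ident[OF fp, of "pfst x0"] * elements_ident[OF da *(2)] by simp
      then have "FA j (At ?\<beta> x0) = Pair (Pair (FO j x0) (FO j x0)) (Pair (Pair i (Ident B b)) (Ident C c'))"
        using jA[OF bh] bx by simp
      moreover have "At ?\<alpha> (FO j x0) = Pair (Pair (FO j x0) (FO j x0)) (Pair (Pair i (Ident B b)) (Ident C c'))"
        using fun_obj[OF fj x0] jO[of i c' g] x0 *(1) rj[OF x0] by (simp add: functor_ends[OF f\<rho>])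
      ultimately show ?thesis by simp
    qed
    then show "\<exists>\<rho> \<alpha> \<beta>. functor_from_to ?K' ?K \<rho> \<and> ntrans_from_to (id_func ?K') (j \<circ>\<^sub>F \<rho>) \<alpha> \<and>
        ntrans_from_to (id_func ?K) (\<rho> \<circ>\<^sub>F j) \<beta> \<and> (\<forall>x\<in>Obj ?K. At \<alpha> (FO j x) = FA j (At \<beta> x))"
      using f\<rho> a b by blast
  qed
qed

text \<open>Exactness at the fibre inclusion expresses the value of the Kan extension at
  \<open>b\<close> as a Kan extension along a codiagonal, that is, as a coproduct over the fibre.
  The coprojections are the unit evaluated at the elements of the fibre.\<close>

lemma fibre_coproduct:
  fixes B C :: "'a scat"
  assumes da: "discrete_action B S pr act" and S: "|S| <o \<kappa>" and B: "small B" and b: "b \<in> Obj B" and C: "small C"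
    and X: "X \<in> ob (prod_cat (elements B S pr act) C)"
  defines "u \<equiv> prod_func (elements_proj B S pr act) (id_func C)"
    and "x \<equiv> \<lambda>i. prod_func (point (elements B S pr act) i) (id_func C)"
  shows "is_coproduct (D0 D (prod_cat one_cat C)) {i \<in> S. pr i = b} (\<lambda>i. pb (x i) X)
    (pb (prod_func (point B b) (id_func C)) (lo u X)) (\<lambda>i. pa (x i) (lu u X))"
proof -
  let ?E = "elements B S pr act" and ?I = "{x \<in> S. pr x = b}"
  let ?U = "prod_cat one_cat C"
  let ?N = "coprod_cat ?I (\<lambda>_. ?U)"
  have cC: "is_category C" and cB: "is_category B" using C B by (auto simp: small_category_def)
  have sE: "small ?E" using small_elements[OF da size S B] .
  have s1: "small ?U" using small_prod[OF size small_one[OF size] C] .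
  note c1 = small_is_category[OF s1]
  have I: "|?I| <o \<kappa>" using card_of_subset_less[OF _ S] by auto
  have sN: "small ?N" using small_coprod[OF size I s1] .
  let ?p = "fibre_incl B S pr act b C" and ?q = "codiagonal ?I ?U" and ?i = "coprod_incl ?I (\<lambda>_. ?U)"
  have p: "sfun ?N (prod_cat ?E C) ?p" unfolding small_fun_def
    using functor_fibre_incl[OF da b cC] sN small_prod[OF size sE C] by simp
  have q: "sfun ?N ?U ?q" unfolding small_fun_def using functor_codiagonal c1 sN s1 by blast
  have pr: "sfun ?E B (elements_proj B S pr act)" using functor_elements_proj[OF da] sE B by (simp add: small_fun_def)
  have u: "sfun (prod_cat ?E C) (prod_cat B C) u" unfolding u_def using sfun_idr[OF pr C] .
  note lX = univ_arrowD[OF lan_univ[OF u X] u]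
  have i: "sfun ?U ?N (?i i)" if "i \<in> ?I" for i
    unfolding small_fun_def using functor_coprod_incl[of ?I "\<lambda>_. ?U" i] c1 that sN s1 by blast
  have x: "sfun ?U (prod_cat ?E C) (x i)" if "i \<in> ?I" for i
    unfolding x_def using sfun_idr[OF sfun_point[OF sE] C] that elements_obj[OF da] by simp
  \<comment> \<open>The summand of index \<open>i\<close> is the point \<open>i\<close> with
    parameters, so pulling back to it is evaluation at \<open>i\<close>.\<close>
  have pi: "?p \<circ>\<^sub>F ?i i = x i" if iI: "i \<in> ?I" for i
  proof (rule functor_eqI[OF small_funD(1)[OF sfun_comp[OF i[OF iI] p]] small_funD(1)[OF x[OF iI]]])
    fix y assume "y \<in> Obj ?U"
    then obtain c where "y = Pair (Nats []) c" "c \<in> Obj C" by (auto elim!: prod_objE)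
    then show "FO (?p \<circ>\<^sub>F ?i i) y = FO (x i) y"
      using iI fibre_incl_simps(3)[OF da b cC] by (simp add: x_def)
  next
    fix f y z assume f: "f \<in> Hom ?U y z"
    then obtain h c c' where h: "f = Pair (Nats []) h" "h \<in> Hom C c c'" by (auto elim!: prod_homE dest!: one_homE)
    have "FA (?p \<circ>\<^sub>F ?i i) f = FA ?p (Pair i f)" using comp_func_FA[of f "?i i" y z ?p] f coprod_incl_simps(4)[of f "\<lambda>_. ?U" i y z ?I] by simp
    also have "\<dots> = Pair (Pair i (Ident B b)) h" using fibre_incl_simps(4)[OF da b cC _ _ h(2)] iI h(1) by simp
    also have "\<dots> = FA (x i) f"
      using prod_func_simps(4)[of "Nats []" "point ?E i" "Nats []" "Nats []" h "id_func C" c c'] h iI elements_ident[OF da, of i] by (simp add: x_def)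
    finally show "FA (?p \<circ>\<^sub>F ?i i) f = FA (x i) f" .
  qed
  have e1: "pb (?i i) (pb ?p X) = pb (x i) X" if "i \<in> ?I" for i
    using pb_comp[OF i[OF that] p X] pi[OF that] by simp
  have e2: "pa (?i i) (pa ?p (lu u X)) = pa (x i) (lu u X)" if "i \<in> ?I" for i
    using pa_comp[OF i[OF that] p lX(2)] pi[OF that] by simp
  have qi: "?q \<circ>\<^sub>F ?i i = id_func ?U" if "i \<in> ?I" for i using codiagonal_incl[OF c1 that] .
  have "is_coproduct (D0 D ?U) ?I (\<lambda>i. pb (?i i) (pb ?p X)) (pb (prod_func (point B b) (id_func C)) (lo u X)) (\<lambda>i. pa (?i i) (pa ?p (lu u X)))"
    using coproduct_codiagonal[OF I s1 q qi pb_ob[OF p X] fibre_exact[OF da S B b C X, folded u_def]] .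
  then show ?thesis unfolding is_coproduct_def using e1 e2 by (simp cong: ball_cong)
qed

end

section \<open>Cofinality\<close>

text \<open>Strings are coded inside \<open>'a univ\<close>, whereas the nerve consists of pairs
  with lists; this carries the coproduct from one index set to the other.\<close>

lemma coproduct_reindex:
  assumes e: "bij_betw e J I" and c: "is_coproduct C I X P j"
    and X: "\<And>i. i \<in> J \<Longrightarrow> X' i = X (e i)" and j: "\<And>i. i \<in> J \<Longrightarrow> j' i = j (e i)"
  shows "is_coproduct C J X' P j'"
  unfolding is_coproduct_def
proof (intro conjI ballI allI impI)
  have eI: "e i \<in> I" if "i \<in> J" for i using e that by (auto simp: bij_betw_def)
  show "X' i \<in> Obj C" if "i \<in> J" for i using c eI[OF that] X[OF that] by (simp add: is_coproduct_def)
  show "P \<in> Obj C" using c by (simp add: is_coproduct_def)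
  show "j' i \<in> Hom C (X' i) P" if "i \<in> J" for i using c eI[OF that] X[OF that] j[OF that] by (simp add: is_coproduct_def)
  fix Y t assume Y: "Y \<in> Obj C" and t: "\<forall>i\<in>J. t i \<in> Hom C (X' i) Y"
  let ?e = "inv_into J e"
  have inv: "?e (e i) = i" if "i \<in> J" for i using e that by (simp add: bij_betw_def)
  have J: "?e i \<in> J" "e (?e i) = i" if "i \<in> I" for i
    using e that by (auto simp: bij_betw_def inv_into_into f_inv_into_f)
  have "\<forall>i\<in>I. t (?e i) \<in> Hom C (X i) Y" using t J X by metis
  then have ex: "\<exists>!h. h \<in> Hom C P Y \<and> (\<forall>i\<in>I. Comp C h (j i) = t (?e i))"
  proof -
    have "\<forall>Y\<in>Obj C. \<forall>t. (\<forall>i\<in>I. t i \<in> Hom C (X i) Y) \<longrightarrow> (\<exists>!h. h \<in> Hom C P Y \<and> (\<forall>i\<in>I. Comp C h (j i) = t i))"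
      using c unfolding is_coproduct_def by (elim conjE)
    from bspec[OF this Y, THEN spec, of "\<lambda>i. t (?e i)"] show ?thesis using \<open>\<forall>i\<in>I. t (?e i) \<in> Hom C (X i) Y\<close> by simp
  qed
  have "(\<forall>i\<in>I. Comp C h (j i) = t (?e i)) \<longleftrightarrow> (\<forall>i\<in>J. Comp C h (j' i) = t i)" for h
    using J inv eI j by metis
  then show "\<exists>!h. h \<in> Hom C P Y \<and> (\<forall>i\<in>J. Comp C h (j' i) = t i)" using ex by simp
qed

context derivator_theory begin

lemma id_iso_modification:
  assumes A: "small A" and B: "small B" and F: "deriv_morphism \<kappa> (shift D A) (shift D B) F"
  shows "iso_modification \<kappa> (shift D A) (shift D B) F F (\<lambda>C. id_nt (M0 F C))"
  unfolding iso_modification_def modification_def nat_iso_from_to_def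
proof (intro conjI allI impI ballI F)
  fix C assume C: "small C"
  note FC = deriv_morphismD(1)[OF F C]
  show "ntrans_from_to (M0 F C) (M0 F C) (id_nt (M0 F C))" "ntrans_from_to (M0 F C) (M0 F C) (id_nt (M0 F C))"
    using id_nt[OF FC] by auto
  fix X assume X: "X \<in> Obj (Src (M0 F C))"
  then show "is_iso (Tgt (M0 F C)) (At (id_nt (M0 F C)) X)"
    using iso_ident[OF functor_cat(2)[OF FC] fun_obj[OF FC]] functor_ends[OF FC] by simp
next
  fix w X assume "small_functor \<kappa> w" and X: "X \<in> Obj (D0 (shift D A) (Tgt w))"
  then have w: "sfun (Src w) (Tgt w) w" by (simp add: small_functor_iff)
  note C = small_funD(2)[OF w] and C' = small_funD(3)[OF w]
  note FC = deriv_morphismD(1)[OF F C] and FC' = deriv_morphismD(1)[OF F C']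
  have X': "X \<in> ob (prod_cat A (Tgt w))" using X by simp
  have "pb (prod_func (id_func A) w) X \<in> ob (prod_cat A (Src w))" using pb_ob[OF sfun_idl[OF A w] X'] .
  then show "Comp (D0 (shift D B) (Src w)) (FA (D1 (shift D B) w) (At (id_nt (M0 F (Tgt w))) X)) (At (M1 F w) X) =
    Comp (D0 (shift D B) (Src w)) (At (M1 F w) X) (At (id_nt (M0 F (Src w))) (FO (D1 (shift D A) w) X))"
    using X' functor_ends[OF FC] functor_ends[OF FC'] pa_idt[OF sfun_idl[OF B w] dmor_ob[OF F C' X']]
      cat_id_left[OF functor_cat(2)[OF FC], unfolded shift_simps, OF dmor_hom[OF A F w X']]
      cat_id_right[OF functor_cat(2)[OF FC], unfolded shift_simps, OF dmor_hom[OF A F w X']]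
    by simp
qed

text \<open>Restricting \<open>\<eta>\<close> along \<open>i\<close> gives maps from restriction
  along \<open>\<pi> \<circ>\<^sub>F i\<close> to the corresponding value of \<open>s\<close>. The
  naturality clause and the parameter clause of \<open>kan\<close> become the two laws of a
  modification. With \<open>i\<close> a point of the category of simplices, these are the
  coprojections.\<close>

lemma kan_restrict_modification:
  assumes \<pi>: "sfun E A \<pi>" and p: "sfun E B p" and i: "sfun I E i" and s: "deriv_morphism \<kappa> (shift D A) (shift D B) s"
    and k: "kan \<pi> p s \<eta>"
  defines "F \<equiv> pull_mor D (\<pi> \<circ>\<^sub>F i)" and "G \<equiv> pull_mor D (p \<circ>\<^sub>F i) \<circ>\<^sub>D s"
  shows "modification \<kappa> (shift D A) (shift D I) F G (\<lambda>C. mk_nt (M0 F C) (M0 G C) (\<lambda>X. pa (prod_func i (id_func C)) (\<eta> C X)))"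
proof -
  note sE = small_funD(2)[OF \<pi>] and sA = small_funD(3)[OF \<pi>] and sB = small_funD(3)[OF p] and sI = small_funD(2)[OF i]
  have \<pi>i: "sfun I A (\<pi> \<circ>\<^sub>F i)" using sfun_comp[OF i \<pi>] .
  have pi: "sfun I B (p \<circ>\<^sub>F i)" using sfun_comp[OF i p] .
  have F: "deriv_morphism \<kappa> (shift D A) (shift D I) F" unfolding F_def using pull_mor_morphism[OF \<pi>i] .
  have G: "deriv_morphism \<kappa> (shift D A) (shift D I) G"
    unfolding G_def using comp_dmor_morphism[OF sA sB sI s pull_mor_morphism[OF pi]] .
  let ?i = "\<lambda>C. prod_func i (id_func C)" and ?p = "\<lambda>C. prod_func p (id_func C)" and ?\<pi> = "\<lambda>C. prod_func \<pi> (id_func C)"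
  have FO: "FO (M0 F C) X = pb (?i C) (pb (?\<pi> C) X)" if "small C" "X \<in> ob (prod_cat A C)" for C X
    using pb_comp[OF sfun_idr[OF i that(1)] sfun_idr[OF \<pi> that(1)] that(2)] prod_idr_comp[OF that(1) i \<pi>]
    by (simp add: F_def pull_mor_simps(1)[OF \<pi>i])
  have FA: "FA (M0 F C) f = pa (?i C) (pa (?\<pi> C) f)" if "small C" "f \<in> hm (prod_cat A C) X Y" for C f X Y
    using pa_comp[OF sfun_idr[OF i that(1)] sfun_idr[OF \<pi> that(1)] that(2)] prod_idr_comp[OF that(1) i \<pi>]
    by (simp add: F_def pull_mor_simps(1)[OF \<pi>i])
  have GO: "FO (M0 G C) X = pb (?i C) (pb (?p C) (FO (M0 s C) X))" if "small C" "X \<in> ob (prod_cat A C)" for C X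
    using pb_comp[OF sfun_idr[OF i that(1)] sfun_idr[OF p that(1)] dmor_ob[OF s that]] prod_idr_comp[OF that(1) i p] that(2)
    by (simp add: G_def comp_dmor_def pull_mor_simps(1)[OF pi] functor_ends[OF deriv_morphismD(1)[OF s that(1)]])
  have GA: "FA (M0 G C) f = pa (?i C) (pa (?p C) (FA (M0 s C) f))" if "small C" "f \<in> hm (prod_cat A C) X Y" for C f X Y
    using pa_comp[OF sfun_idr[OF i that(1)] sfun_idr[OF p that(1)] dmor_hm[OF s that]] prod_idr_comp[OF that(1) i p] that(2)
      comp_func_FA[of f "M0 s C" X Y]
    by (simp add: G_def comp_dmor_def pull_mor_simps(1)[OF pi] functor_ends[OF deriv_morphismD(1)[OF s that(1)]])
  let ?j = "\<lambda>C X. pa (?i C) (\<eta> C X)"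
  have h: "\<eta> C X \<in> hm (prod_cat E C) (pb (?\<pi> C) X) (pb (?p C) (FO (M0 s C) X))" if "small C" "X \<in> ob (prod_cat A C)" for C X
    using univ_arrowD(2)[OF kanD(1)[OF k \<pi> that] sfun_idr[OF p that(1)]] .
  show ?thesis
    unfolding modification_def
  proof (intro conjI allI impI ballI F G)
    fix C assume C: "small C"
    note iC = sfun_idr[OF i C] and pC = sfun_idr[OF p C] and \<pi>C = sfun_idr[OF \<pi> C]
    show "ntrans_from_to (M0 F C) (M0 G C) (mk_nt (M0 F C) (M0 G C) (?j C))"
    proof (rule nt_mk[OF deriv_morphismD(1)[OF F C] deriv_morphismD(1)[OF G C]])
      fix X assume "X \<in> Obj (D0 (shift D A) C)"
      then show "?j C X \<in> Hom (D0 (shift D I) C) (FO (M0 F C) X) (FO (M0 G C) X)"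
        using pa_hm[OF iC h[OF C]] FO[OF C] GO[OF C] by simp
    next
      fix f X Y assume "f \<in> Hom (D0 (shift D A) C) X Y" "X \<in> Obj (D0 (shift D A) C)" "Y \<in> Obj (D0 (shift D A) C)"
      then have f: "f \<in> hm (prod_cat A C) X Y" and X: "X \<in> ob (prod_cat A C)" and Y: "Y \<in> ob (prod_cat A C)" by simp_all
      show "Comp (D0 (shift D I) C) (?j C Y) (FA (M0 F C) f) = Comp (D0 (shift D I) C) (FA (M0 G C) f) (?j C X)"
        unfolding FA[OF C f] GA[OF C f]
        using pa_dcomp[OF iC h[OF C Y] pa_hm[OF \<pi>C f]] pa_dcomp[OF iC pa_hm[OF pC dmor_hm[OF s C f]] h[OF C X]] kanD(2)[OF k \<pi> C f]
        by simp
    qed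
  next
    fix w X assume "small_functor \<kappa> w" and "X \<in> Obj (D0 (shift D A) (Tgt w))"
    then have w: "sfun (Src w) (Tgt w) w" and X: "X \<in> ob (prod_cat A (Tgt w))" by (simp_all add: small_functor_iff)
    define C C' where "C = Src w" and "C' = Tgt w"
    note w = w[folded C_def C'_def] and X = X[folded C'_def]
    note C = small_funD(2)[OF w] and C' = small_funD(3)[OF w]
    note iC = sfun_idr[OF i C] and pC = sfun_idr[OF p C] and iC' = sfun_idr[OF i C']
    note wA = sfun_idl[OF sA w] and wB = sfun_idl[OF sB w] and wI = sfun_idl[OF sI w] and wE = sfun_idl[OF sE w]
    note wX = pb_ob[OF wA X]
    note sX = dmor_ob[OF s C' X]
    note sw = dmor_hom[OF sA s w X]
    have piC: "prod_func (p \<circ>\<^sub>F i) (id_func C) = ?p C \<circ>\<^sub>F ?i C" using prod_idr_comp[OF C i p] .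
    note piC' = sfun_idr[OF pi C]
    \<comment> \<open>Restriction has identity cells, so the cell of \<open>G\<close> is the cell of
      \<open>s\<close> pulled back along \<open>p\<close> and \<open>i\<close>.\<close>
    have 1: "At (M1 G w) X = pa (?i C) (pa (?p C) (At (M1 s w) X))"
    proof -
      have "At (M1 G w) X = At (M1 (pull_mor D (p \<circ>\<^sub>F i)) w) (FO (M0 s C') X) \<cdot>\<^bsub>prod_cat I C\<^esub> pa (prod_func (p \<circ>\<^sub>F i) (id_func C)) (At (M1 s w) X)"
        using comp_dmor_at(2)[OF s pull_mor_morphism[OF pi] w star_shift[OF sB w] star_shift[OF sA w] star_shift[OF sI w], of X] X
        by (simp add: G_def pull_mor_simps(1)[OF pi])
      moreover have "pb (prod_func (p \<circ>\<^sub>F i) w) (FO (M0 s C') X) = pb (prod_func (p \<circ>\<^sub>F i) (id_func C)) (pb (prod_func (id_func B) w) (FO (M0 s C') X))"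
        using pb_comp[OF piC' wB sX] prod_split(2)[OF pi w] by simp
      ultimately show ?thesis
        using pull_mor_simps(2)[OF pi w sX] cat_id_left[OF dcat[OF small_funD(2)[OF piC']] pa_hm[OF piC' sw]]
          pa_comp[OF iC pC sw] piC by simp
    qed
    have 2: "At (M1 F w) X = idt (prod_cat I C) (pb (?i C) (pb (?\<pi> C) (pb (prod_func (id_func A) w) X)))"
    proof -
      have "pb (prod_func (\<pi> \<circ>\<^sub>F i) w) X = pb (prod_func (\<pi> \<circ>\<^sub>F i) (id_func C)) (pb (prod_func (id_func A) w) X)"
        using pb_comp[OF sfun_idr[OF \<pi>i C] wA X] prod_split(2)[OF \<pi>i w] by simp
      then show ?thesis using pull_mor_simps(2)[OF \<pi>i w X] pb_comp[OF iC sfun_idr[OF \<pi> C] wX] prod_idr_comp[OF C i \<pi>] by (simp add: F_def)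
    qed
    have 3: "pa (prod_func (id_func I) w) (?j C' X) = pa (?i C) (pa (prod_func (id_func E) w) (\<eta> C' X))"
      using pa_sq[OF prod_swap[OF i w, symmetric] wI iC' iC wE h[OF C' X]] .
    have 4: "pa (prod_func (id_func I) w) (?j C' X) \<in> hm (prod_cat I C) (pb (?i C) (pb (?\<pi> C) (pb (prod_func (id_func A) w) X)))
        (pb (prod_func (id_func I) w) (pb (?i C') (pb (?p C') (FO (M0 s C') X))))"
      using pa_hm[OF wI pa_hm[OF iC' h[OF C' X]]] pb_sq[OF prod_swap[OF i w, symmetric] wI iC' iC wE pb_ob[OF sfun_idr[OF \<pi> C'] X]]
        pb_sq[OF prod_swap[OF \<pi> w, symmetric] wE sfun_idr[OF \<pi> C'] sfun_idr[OF \<pi> C] wA X] by simp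
    have "pa (prod_func (id_func I) w) (?j C' X) \<cdot>\<^bsub>prod_cat I C\<^esub> At (M1 F w) X = At (M1 G w) X \<cdot>\<^bsub>prod_cat I C\<^esub> ?j C (pb (prod_func (id_func A) w) X)"
      unfolding 1 2 using cat_id_right[OF dcat[OF small_funD(2)[OF iC]] 4] 3 kanD(3)[OF k \<pi> w X]
        pa_dcomp[OF iC pa_hm[OF pC sw] h[OF C wX]] by simp
    then show "Comp (D0 (shift D I) (Src w)) (FA (D1 (shift D I) w) (At (mk_nt (M0 F (Tgt w)) (M0 G (Tgt w)) (?j (Tgt w))) X)) (At (M1 F w) X) =
      Comp (D0 (shift D I) (Src w)) (At (M1 G w) X) (At (mk_nt (M0 F (Src w)) (M0 G (Src w)) (?j (Src w))) (FO (D1 (shift D A) w) X))"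
      using X wX functor_ends[OF deriv_morphismD(1)[OF F C]] functor_ends[OF deriv_morphismD(1)[OF F C']]
      by (simp add: C_def[symmetric] C'_def[symmetric])
  qed
qed

text \<open>
  Strict functoriality makes every \<open>g : k\<^sup>* V \<rightarrow> w\<^sup>* Y\<close>, for \<open>k : K \<rightarrow> 1\<close>, natural along the zigzag
  \<open>id \<Leftarrow> T \<Rightarrow> e\<^sub>0 k\<close>, so \<open>g\<close> is determined by its value at \<open>e\<^sub>0\<close>; hence \<open>t\<^sup>* Y\<close> is recovered as a limit over
  the comma category, and Der4 applies.
\<close>

lemma cofinal_ff:
  assumes u: "sfun E A u" and t: "sfun A B t" and Y: "Y \<in> ob B" and X: "X \<in> ob A"
    and zig: "\<And>b K w. b \<in> Obj A \<Longrightarrow> K = under_cat b u \<Longrightarrow> w = t \<circ>\<^sub>F u \<circ>\<^sub>F under_proj b u \<Longrightarrow>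
      \<exists>e T \<sigma> \<tau>. e \<in> Obj K \<and> functor_from_to K K T \<and> ntrans_from_to T (id_func K) \<sigma> \<and>
        ntrans_from_to T (point K e \<circ>\<^sub>F to_one K) \<tau> \<and>
        FO w e = FO t b \<and> FA t (psnd e) = Ident B (FO t b) \<and>
        w \<circ>\<^sub>F T = t \<circ>\<^sub>F point A b \<circ>\<^sub>F to_one K \<and>
        (\<forall>x\<in>Obj K. FA w (At \<sigma> x) = FA t (psnd x)) \<and> (\<forall>x\<in>Obj K. FA w (At \<tau> x) = Ident B (FO w (FO T x)))"
    and g: "g \<in> hm E (pb u X) (pb u (pb t Y))"
  shows "\<exists>!h. h \<in> hm A X (pb t Y) \<and> pa u h = g"
proof -
  let ?Z = "pb t Y" and ?W = "pb u (pb t Y)"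
  note sA = small_funD(2)[OF t]
  note cE = dcat[OF small_funD(2)[OF u]] and cA = dcat[OF sA]
  note fu = small_funD(1)[OF u] and ft = small_funD(1)[OF t]
  have Z: "?Z \<in> ob A" using pb_ob[OF t Y] .
  have W: "?W \<in> ob E" using pb_ob[OF u Z] .
  note rcu = rc_hm[OF u W]
  have R: "ro u ?W \<in> ob A" using fun_obj[OF ran_functor[OF u] W] .
  \<comment> \<open>\<open>\<eta>\<close> is the unit from \<open>?Z\<close> to the right Kan
    extension of its own restriction. If it is invertible, a map between restrictions transposes to
    a map into the right Kan extension and comes from a unique map into \<open>?Z\<close>.\<close>
  obtain \<eta> where \<eta>: "\<eta> \<in> hm A ?Z (ro u ?W)" "rc u ?W \<cdot>\<^bsub>E\<^esub> pa u \<eta> = idt E ?W"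
    using ran_ex[OF u W Z cat_ident_hom[OF cE W]] .
  \<comment> \<open>By Der2 it suffices to invert \<open>\<eta>\<close> at each \<open>b\<close>,
    where Der4 identifies its target with a limit over \<open>K\<close>.\<close>
  have "is_iso (D0 D one_cat) (pa (point A b) \<eta>)" if b: "b \<in> Obj A" for b
  proof -
    define K where "K = under_cat b u"
    let ?pr = "under_proj b u" and ?k = "to_one K" and ?pt = "point A b"
    define w where "w = t \<circ>\<^sub>F u \<circ>\<^sub>F ?pr"
    obtain e T \<sigma> \<tau> where e: "e \<in> Obj K" and T: "functor_from_to K K T" and \<sigma>: "ntrans_from_to T (id_func K) \<sigma>"
      and \<tau>: "ntrans_from_to T (point K e \<circ>\<^sub>F ?k) \<tau>" and we: "FO w e = FO t b" "FA t (psnd e) = Ident B (FO t b)"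
      and wT: "w \<circ>\<^sub>F T = t \<circ>\<^sub>F ?pt \<circ>\<^sub>F ?k" and w\<sigma>: "\<And>x. x \<in> Obj K \<Longrightarrow> FA w (At \<sigma> x) = FA t (psnd x)"
      and w\<tau>: "\<And>x. x \<in> Obj K \<Longrightarrow> FA w (At \<tau> x) = Ident B (FO w (FO T x))"
      using zig[OF b K_def w_def] by blast
    have pr: "sfun K E ?pr" unfolding K_def using sfun_under_proj[OF u] .
    note sK = small_funD(2)[OF pr]
    note cK = dcat[OF sK]
    note k = sfun_to_one[OF sK] and pt = sfun_point[OF sA b] and pe = sfun_point[OF sK e]
    note upr = sfun_comp[OF pr u]
    have w: "sfun K B w" unfolding w_def using sfun_comp[OF upr t] .
    have sT: "sfun K K T" using T sK by (simp add: small_fun_def)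
    note kpt = sfun_comp[OF k pt] and ke = sfun_comp[OF k pe]
    let ?c = "under_cell b u"
    have c: "ntrans_from_to (?pt \<circ>\<^sub>F ?k) (u \<circ>\<^sub>F ?pr) ?c" unfolding K_def using under_cell[OF fu b] .
    define V where "V = ro ?k (pb ?pr ?W)"
    have prW: "pb ?pr ?W \<in> ob K" using pb_ob[OF pr W] .
    have V: "V \<in> ob one_cat" unfolding V_def using fun_obj[OF ran_functor[OF k] prW] .
    let ?m = "mate_right D ?pr u ?k ?pt ?c ?W" and ?r = "rc ?k (pb ?pr ?W)"
    note m = mate_right_char[OF pr u k pt c W, folded V_def]
    have im: "is_iso (D0 D one_cat) ?m"
      using Der4 small_funI[OF u] b W small_funD(4,5)[OF u] unfolding Der4_def K_def by blast
    note r = rc_hm[OF k prW, folded V_def]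
    define \<gamma> where "\<gamma> = cl ?c ?Z"
    have wY: "pb ?pr ?W = pb w Y"
      unfolding w_def using pb_comp[OF upr t Y] pb_comp[OF pr u Z] by simp
    have \<gamma>: "\<gamma> \<in> hm K (pb ?k (pb ?pt ?Z)) (pb ?pr ?W)"
      unfolding \<gamma>_def using cl_hm[OF c kpt Z] pb_comp[OF k pt Z] pb_comp[OF pr u Z] by simp
    note p\<eta> = pa_hm[OF pt \<eta>(1)]
    \<comment> \<open>\<open>n\<close> is \<open>\<eta>\<close> at \<open>b\<close> followed by the
      invertible map of Der4. It goes from the value of \<open>?Z\<close> at \<open>b\<close> to the
      limit \<open>V\<close>.\<close>
    define n where "n = ?m \<cdot>\<^bsub>one_cat\<^esub> pa ?pt \<eta>"
    note c1 = dcat[OF small_one[OF size]]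
    have n: "n \<in> hm one_cat (pb ?pt ?Z) V" unfolding n_def using cat_comp_hom[OF c1 m(1) p\<eta>] .
    \<comment> \<open>The cone that corresponds to \<open>n\<close> is the canonical one, induced by
      the 2-cell of the comma category. The remaining task is to see that this cone is a limit
      cone.\<close>
    have rn: "?r \<cdot>\<^bsub>K\<^esub> pa ?k n = \<gamma>"
    proof -
      have cR: "cl ?c (ro u ?W) \<in> hm K (pb ?k (pb ?pt (ro u ?W))) (pb ?pr (pb u (ro u ?W)))"
        using cl_hm[OF c kpt R] pb_comp[OF k pt R] pb_comp[OF pr u R] by simp
      have "?r \<cdot>\<^bsub>K\<^esub> pa ?k n = (pa ?pr (rc u ?W) \<cdot>\<^bsub>K\<^esub> cl ?c (ro u ?W)) \<cdot>\<^bsub>K\<^esub> pa ?k (pa ?pt \<eta>)"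
        unfolding n_def using pa_dcomp[OF k m(1) p\<eta>] cat_assoc[OF cK r pa_hm[OF k m(1)] pa_hm[OF k p\<eta>]] m(2) by simp
      also have "\<dots> = pa ?pr (rc u ?W) \<cdot>\<^bsub>K\<^esub> (pa ?pr (pa u \<eta>) \<cdot>\<^bsub>K\<^esub> \<gamma>)"
        using cat_assoc[OF cK pa_hm[OF pr rcu] cR pa_hm[OF k p\<eta>]] cl_nat[OF c kpt \<eta>(1)]
          pa_comp[OF k pt \<eta>(1)] pa_comp[OF pr u \<eta>(1)] by (simp add: \<gamma>_def)
      also have "\<dots> = pa ?pr (rc u ?W \<cdot>\<^bsub>E\<^esub> pa u \<eta>) \<cdot>\<^bsub>K\<^esub> \<gamma>"
        using cat_assoc[OF cK pa_hm[OF pr rcu] pa_hm[OF pr pa_hm[OF u \<eta>(1)]] \<gamma>] pa_dcomp[OF pr rcu pa_hm[OF u \<eta>(1)]] by simp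
      also have "\<dots> = \<gamma>" unfolding \<eta>(2) using pa_idt[OF pr W] cat_id_left[OF cK \<gamma>] by simp
      finally show ?thesis .
    qed
    have kpe: "?k \<circ>\<^sub>F point K e = id_func one_cat"
      by (rule to_one_eq[OF functor_comp[OF small_funD(1)[OF pe] small_funD(1)[OF k]] functor_id[OF category_one]])
    have ek: "pb (point K e) (pb ?k U) = U" if "U \<in> ob one_cat" for U
      using pb_comp[OF pe k that] kpe pb_id[OF small_one[OF size] that] by simp
    have eka: "pa (point K e) (pa ?k f) = f" if "f \<in> hm one_cat U U'" for f U U'
      using pa_comp[OF pe k that] kpe pa_id[OF small_one[OF size] that] by simp
    have wpe: "w \<circ>\<^sub>F point K e = t \<circ>\<^sub>F ?pt"
      using functor_comp_point[OF small_funD(1)[OF w] e] functor_comp_point[OF ft b] we(1) by simp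
    have eW: "pb (point K e) (pb ?pr ?W) = pb ?pt ?Z"
      using pb_comp[OF pe w Y] pb_comp[OF pt t Y] wpe wY by simp
    \<comment> \<open>The candidate inverse of \<open>n\<close> is evaluation of the limit cone at
      the object \<open>e\<close>, where the diagram takes the value of \<open>?Z\<close> at
      \<open>b\<close>.\<close>
    define l where "l = pa (point K e) ?r"
    have l: "l \<in> hm one_cat V (pb ?pt ?Z)" unfolding l_def using pa_hm[OF pe r] ek[OF V] eW by simp
    have tc: "ntrans_from_to (t \<circ>\<^sub>F ?pt \<circ>\<^sub>F ?k) (t \<circ>\<^sub>F u \<circ>\<^sub>F ?pr) (whisker_left t ?c)"
      using whisker_left[OF ft c] small_funD(5)[OF pt] by simp
    have tkpt: "sfun K B (t \<circ>\<^sub>F ?pt \<circ>\<^sub>F ?k)" using sfun_comp[OF kpt t] .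
    have g1: "\<gamma> = cl (whisker_left t ?c) Y" unfolding \<gamma>_def using cl_whisker_left[OF c kpt t Y] by simp
    \<comment> \<open>The structure arrow of \<open>e\<close> becomes an identity under
      \<open>t\<close>, so the canonical cone is the identity at \<open>e\<close>.\<close>
    have e\<gamma>: "pa (point K e) \<gamma> = idt one_cat (pb ?pt ?Z)"
    proof -
      have "whisker_right (whisker_left t ?c) (point K e) = id_nt (t \<circ>\<^sub>F ?pt)"
        unfolding whisker_right_def id_nt_def nt_ends[OF tc]
      proof (rule mk_nt_cong)
        show "(t \<circ>\<^sub>F ?pt \<circ>\<^sub>F ?k) \<circ>\<^sub>F point K e = t \<circ>\<^sub>F ?pt"
          using comp_func_assoc[OF small_funD(1)[OF pe] small_funD(1)[OF kpt] ft]
            comp_func_assoc[OF small_funD(1)[OF pe] small_funD(1)[OF k] small_funD(1)[OF pt]] kpe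
            comp_id_right[OF small_funD(1)[OF pt]] by simp
        show "(t \<circ>\<^sub>F u \<circ>\<^sub>F ?pr) \<circ>\<^sub>F point K e = t \<circ>\<^sub>F ?pt" using wpe by (simp add: w_def)
        fix x assume "x \<in> Obj (Src (t \<circ>\<^sub>F ?pt))"
        then have x: "x = Nats []" by simp
        have "At (whisker_left t ?c) e = FA t (psnd e)"
          using e by (simp add: whisker_left_def nt_ends[OF c]) (simp add: K_def)
        then show "At (whisker_left t ?c) (FO (point K e) x) = Ident (Tgt (t \<circ>\<^sub>F ?pt)) (FO (t \<circ>\<^sub>F ?pt) x)"
          using we(2) by (simp add: x small_funD(5)[OF t])
      qed
      then have "pa (point K e) \<gamma> = cl (id_nt (t \<circ>\<^sub>F ?pt)) Y"
        unfolding g1 using cl_whisker_right[OF tc tkpt pe Y] by simp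
      then show ?thesis using cl_id[OF sfun_comp[OF pt t] Y] pb_comp[OF pt t Y] by simp
    qed
    have ln: "l \<cdot>\<^bsub>one_cat\<^esub> n = idt one_cat (pb ?pt ?Z)"
      unfolding l_def using pa_dcomp[OF pe r pa_hm[OF k n]] eka[OF n] rn e\<gamma> by simp
    \<comment> \<open>\<open>\<tau>\<close> becomes an identity after \<open>w\<close>, and it is
      trivial on constants; naturality of the limit cone along \<open>\<tau>\<close> is thus an
      equality.\<close>
    have Tr: "pa T ?r = pa (point K e \<circ>\<^sub>F ?k) ?r"
    proof -
      have wTe: "w \<circ>\<^sub>F T = w \<circ>\<^sub>F (point K e \<circ>\<^sub>F ?k)"
        using wT comp_func_assoc[OF small_funD(1)[OF k] small_funD(1)[OF pe] small_funD(1)[OF w]] wpe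
          comp_func_assoc[OF small_funD(1)[OF k] small_funD(1)[OF pt] ft] by simp
      have 1: "cl \<tau> (pb w Y) = idt K (pb T (pb w Y))" by (rule cl_ident[OF \<tau> sT w Y wTe w\<tau>])
      have Tk: "pb T (pb ?k V) = pb ?k V" "pb (point K e \<circ>\<^sub>F ?k) (pb ?k V) = pb ?k V" using pb_to_one[OF sT V] pb_to_one[OF ke V] by auto
      have h: "pa T ?r \<in> hm K (pb ?k V) (pb T (pb w Y))" using pa_hm[OF sT r] Tk(1) wY by simp
      have h': "pa (point K e \<circ>\<^sub>F ?k) ?r \<in> hm K (pb ?k V) (pb (point K e \<circ>\<^sub>F ?k) (pb w Y))" using pa_hm[OF ke r] Tk(2) wY by simp
      show ?thesis
        using cl_nat[OF \<tau> sT r] cl_const[OF \<tau> sT V] 1 cat_id_left[OF cK h] cat_id_right[OF cK h'] wY by simp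
    qed
    \<comment> \<open>Naturality of the limit cone along \<open>\<sigma>\<close> writes it as its
      restriction along \<open>T\<close> followed by the action of \<open>\<sigma>\<close>. The
      first is the constant extension of \<open>l\<close> by \<open>Tr\<close>, and the second is
      \<open>\<gamma>\<close>, since \<open>\<sigma>\<close> and the structure arrows agree in
      \<open>B\<close>.\<close>
    have \<gamma>r: "\<gamma> \<cdot>\<^bsub>K\<^esub> pa ?k l = ?r"
    proof -
      have "whisker_left w \<sigma> = whisker_left t ?c"
        unfolding whisker_left_def nt_ends[OF \<sigma>] nt_ends[OF c]
      proof (rule mk_nt_cong[OF wT])
        show "w \<circ>\<^sub>F id_func K = t \<circ>\<^sub>F u \<circ>\<^sub>F ?pr" using comp_id_right[OF small_funD(1)[OF w]] by (simp add: w_def)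
        fix x assume "x \<in> Obj (Src (t \<circ>\<^sub>F ?pt \<circ>\<^sub>F ?k))"
        then have "x \<in> Obj K" by simp
        then show "FA w (At \<sigma> x) = FA t (At ?c x)" using w\<sigma> by (simp add: K_def)
      qed
      then have s: "cl \<sigma> (pb ?pr ?W) = \<gamma>" using cl_whisker_left[OF \<sigma> sT w Y] g1 wY by simp
      have "pa (point K e \<circ>\<^sub>F ?k) ?r = pa ?k l" unfolding l_def using pa_comp[OF k pe r] .
      then have "\<gamma> \<cdot>\<^bsub>K\<^esub> pa ?k l = cl \<sigma> (pb ?pr ?W) \<cdot>\<^bsub>K\<^esub> pa T ?r" using s Tr by simp
      also have "\<dots> = ?r" using cl_nat[OF \<sigma> sT r] cl_const[OF \<sigma> sT V] pa_id[OF sK r] cat_id_right[OF cK r] by simp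
      finally show ?thesis .
    qed
    \<comment> \<open>Both sides induce the same cone, so uniqueness for the limit applies.\<close>
    have nl: "n \<cdot>\<^bsub>one_cat\<^esub> l = idt one_cat V"
    proof (rule ran_eq[OF k prW, folded V_def, OF cat_comp_hom[OF c1 n l] cat_ident_hom[OF c1 V]])
      show "?r \<cdot>\<^bsub>K\<^esub> pa ?k (n \<cdot>\<^bsub>one_cat\<^esub> l) = ?r \<cdot>\<^bsub>K\<^esub> pa ?k (idt one_cat V)"
        using pa_dcomp[OF k n l] cat_assoc[OF cK r pa_hm[OF k n] pa_hm[OF k l]] rn \<gamma>r pa_idt[OF k V] cat_id_right[OF cK r] by simp
    qed
    have "is_iso (D0 D one_cat) n" using is_isoI[OF n l ln nl] .
    then show ?thesis unfolding n_def using iso_cancel_left[OF c1 m(1) p\<eta> _ im] by simp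
  qed
  then have "is_iso (D0 D A) \<eta>" using Der2 sA homD[OF \<eta>(1)] unfolding Der2_def by blast
  then obtain \<theta> where \<theta>: "\<theta> \<in> hm A (ro u ?W) ?Z" "\<theta> \<cdot>\<^bsub>A\<^esub> \<eta> = idt A ?Z" "\<eta> \<cdot>\<^bsub>A\<^esub> \<theta> = idt A (ro u ?W)"
    using is_isoE[OF _ \<eta>(1)] by metis
  \<comment> \<open>Composing with \<open>\<eta>\<close> is the transpose of restricting along
    \<open>u\<close>, so inverting \<open>\<eta>\<close> inverts restriction.\<close>
  have ra: "rc u ?W \<cdot>\<^bsub>E\<^esub> pa u (\<eta> \<cdot>\<^bsub>A\<^esub> h) = pa u h" if h: "h \<in> hm A X ?Z" for h
    using pa_dcomp[OF u \<eta>(1) h] cat_assoc[OF cE rcu pa_hm[OF u \<eta>(1)] pa_hm[OF u h]] \<eta>(2) cat_id_left[OF cE pa_hm[OF u h]] by simp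
  obtain f where f: "f \<in> hm A X (ro u ?W)" "rc u ?W \<cdot>\<^bsub>E\<^esub> pa u f = g" using ran_ex[OF u W X g] .
  show ?thesis
  proof (intro ex1I conjI)
    show h: "\<theta> \<cdot>\<^bsub>A\<^esub> f \<in> hm A X ?Z" using cat_comp_hom[OF cA \<theta>(1) f(1)] .
    have "\<eta> \<cdot>\<^bsub>A\<^esub> (\<theta> \<cdot>\<^bsub>A\<^esub> f) = f" using cat_assoc[OF cA \<eta>(1) \<theta>(1) f(1)] \<theta>(3) cat_id_left[OF cA f(1)] by simp
    then show "pa u (\<theta> \<cdot>\<^bsub>A\<^esub> f) = g" using ra[OF h] f(2) by simp
    fix h assume h: "h \<in> hm A X ?Z \<and> pa u h = g"
    then have "\<eta> \<cdot>\<^bsub>A\<^esub> h = f"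
      using ran_eq[OF u W cat_comp_hom[OF cA \<eta>(1)] f(1)] ra f(2) by simp
    then show "h = \<theta> \<cdot>\<^bsub>A\<^esub> f" using cat_assoc[OF cA \<theta>(1) \<eta>(1) conjunct1[OF h]] \<theta>(2) cat_id_left[OF cA conjunct1[OF h]] by simp
  qed
qed

end

section \<open>The first vertex functor\<close>

declare encl.simps(2) [simp del]

text \<open>A monotone map that misses the new initial vertex ignores the prepended arrow.\<close>

lemma segs_Suc: "segs A a (f # fs) (map Suc vs) = segs A (Cod A f) fs vs"
proof (induction vs)
  case (Cons v vs) then show ?case by (cases vs) auto
qed simp

text \<open>\<open>[0] \<star> \<phi>\<close>, the effect of \<open>\<phi>\<close> on strings extended by one arrow at the start.\<close>

definition cone_map :: "'a univ \<Rightarrow> 'a univ" where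
  "cone_map \<phi> = Nats (Suc (hd (nats \<phi>)) # 0 # map Suc (tl (nats \<phi>)))"

lemma cone_map_Nats [simp]: "cone_map (Nats (n # vs)) = Nats (Suc n # 0 # map Suc vs)"
  by (simp add: cone_map_def)

text \<open>Restricting a prepended string along \<open>[0] \<star> \<phi>\<close> gives a prepended
  string again. Its new first arrow is \<open>f\<close> followed by the composite up to the first
  value \<open>v\<close> of \<open>\<phi>\<close>.\<close>

lemma cone_act:
  assumes A: "is_category A" and f: "f \<in> Hom A a a0" and fs: "is_string A a0 fs"
    and vs: "sorted (v # vs)" "set (v # vs) \<subseteq> {..length fs}"
  shows "string_act A (Nats (Suc n # 0 # map Suc (v # vs))) (Pair a (encl (f # fs))) =
    Pair a (encl (Comp A (seg A a0 fs 0 v) f # segs A a0 fs (v # vs)))"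
  using segs_Suc[of A a f fs "v # vs"] homD[OF f] by simp

section \<open>The zigzag in the comma category under \<open>(a, c)\<close>\<close>

context
  fixes A :: "'a scat" and C :: "'a scat" and a c
  assumes A: "is_category A" and C: "is_category C" and a: "a \<in> Obj A" and c: "c \<in> Obj C"
begin

private abbreviation "E \<equiv> simplices A"
private abbreviation "u \<equiv> prod_func (first_vertex A) (id_func C)"
private abbreviation "K \<equiv> under_cat (Pair a c) u"
private abbreviation "t \<equiv> prod_func (to_one A) (id_func C)"

private lemma da: "discrete_action simplex_op (strings A) string_dim (string_act A)"
  by (rule simplices_action[OF A])

private lemma fu: "functor_from_to (prod_cat E C) (prod_cat A C) u"
  by (intro functor_prod functor_first_vertex functor_id A C)

private lemma ft: "functor_from_to (prod_cat A C) (prod_cat one_cat C) t"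
  by (intro functor_prod functor_to_one functor_id A C)

private lemma cE: "is_category E"
  by (rule category_elements[OF da])

private lemma cK: "is_category K"
  by (rule category_under[OF fu])

private lemma first_vertex_simps:
  "Src (first_vertex A) = E" "Tgt (first_vertex A) = A" "x \<in> strings A \<Longrightarrow> FO (first_vertex A) x = pfst x"
  "Pair (Pair b (encl fs)) (Nats (n # vs)) \<in> Hom E x y \<Longrightarrow>
    FA (first_vertex A) (Pair (Pair b (encl fs)) (Nats (n # vs))) = seg A b fs 0 (hd vs)"
  using elements_obj[OF da] mk_func_simps(5)[of _ E] by (auto simp: first_vertex_def)

private lemma uO: "is_string A b fs \<Longrightarrow> c' \<in> Obj C \<Longrightarrow> FO u (Pair (Pair b (encl fs)) c') = Pair b c'"
  using elements_obj[OF da] by (simp add: first_vertex_simps)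

private lemma uA:
  assumes "Pair (Pair b (encl fs)) (Nats (n # vs)) \<in> Hom E x y" "k \<in> Hom C c1 c2"
  shows "FA u (Pair (Pair (Pair b (encl fs)) (Nats (n # vs))) k) = Pair (seg A b fs 0 (hd vs)) k"
  using prod_func_simps(4)[of "Pair (Pair b (encl fs)) (Nats (n # vs))" "first_vertex A" x y k "id_func C" c1 c2] assms
    first_vertex_simps(4)[OF assms(1)] by (simp add: first_vertex_simps)

private lemma E_hom:
  assumes "is_string A b fs" "sorted (v # vs)" "set (v # vs) \<subseteq> {..length fs}"
    "string_act A (Nats (length fs # v # vs)) (Pair b (encl fs)) = y"
  shows "Pair (Pair b (encl fs)) (Nats (length fs # v # vs)) \<in> Hom E (Pair b (encl fs)) y"
proof -
  have f: "Nats (length fs # v # vs) \<in> Hom simplex_op (string_dim (Pair b (encl fs))) (Nats [length vs])"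
    using assms(2,3) by (simp add: simplex_hom)
  have s: "Pair b (encl fs) \<in> strings A" using assms(1) by simp
  have "string_dim y = Nats [length vs]" using da_act(2)[OF da s f] unfolding assms(4) .
  then show ?thesis unfolding elements_hom[OF da] using f s assms(4) by metis
qed

private lemma E_comp:
  assumes f: "Pair x (Nats (n # vs)) \<in> Hom E x y" and g: "Pair y (Nats (m # ws)) \<in> Hom E y z"
  shows "Comp E (Pair y (Nats (m # ws))) (Pair x (Nats (n # vs))) = Pair x (Nats (n # map (\<lambda>i. vs ! i) ws))"
proof -
  have *: "x \<in> strings A" "Nats (n # vs) \<in> Hom simplex_op (string_dim x) (string_dim y)" "y = string_act A (Nats (n # vs)) x"
    "Nats (m # ws) \<in> Hom simplex_op (string_dim y) (string_dim z)"
    using f g unfolding elements_hom[OF da] by blast+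
  have "Comp E (Pair y (Nats (m # ws))) (Pair x (Nats (n # vs))) = Pair x (Comp simplex_op (Nats (m # ws)) (Nats (n # vs)))"
    using elements_comp[OF da *(1,2,4)] *(3) by simp
  then show ?thesis using simplex_comp[of m ws "string_dim z" "string_dim y" n vs "string_dim x"] *(2,4) by simp
qed

private lemma K_objE:
  assumes "x \<in> Obj K"
  obtains a0 fs c' f g where "x = Pair (Pair (Pair a0 (encl fs)) c') (Pair f g)" "is_string A a0 fs" "c' \<in> Obj C"
    "f \<in> Hom A a a0" "g \<in> Hom C c c'"
proof -
  obtain e h where x: "x = Pair e h" "e \<in> Obj (prod_cat E C)" "h \<in> Hom (prod_cat A C) (Pair a c) (FO u e)"
    using assms functor_ends[OF fu] by (auto elim!: under_objE)
  obtain s c' where e: "e = Pair s c'" "s \<in> strings A" "c' \<in> Obj C" using x(2) elements_obj[OF da] by (auto elim!: prod_objE)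
  obtain a0 fs where s: "s = Pair a0 (encl fs)" "is_string A a0 fs" by (rule stringE[OF e(2)])
  have "h \<in> Hom (prod_cat A C) (Pair a c) (Pair a0 c')" using x(3) e s uO by simp
  then obtain f g where "h = Pair f g" "f \<in> Hom A a a0" "g \<in> Hom C c c'" by (auto elim!: prod_homE)
  then show thesis using that x(1) e s by blast
qed

private lemma K_objI:
  "is_string A a0 fs \<Longrightarrow> c' \<in> Obj C \<Longrightarrow> f \<in> Hom A a a0 \<Longrightarrow> g \<in> Hom C c c' \<Longrightarrow>
    Pair (Pair (Pair a0 (encl fs)) c') (Pair f g) \<in> Obj K"
  using functor_ends[OF fu] elements_obj[OF da] uO by simp

private lemma K_homE:
  assumes k: "k \<in> Hom K x y"
  obtains a0 fs c' f g v vs c'' h where "x = Pair (Pair (Pair a0 (encl fs)) c') (Pair f g)"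
    "y = Pair (Pair (Pair (vert A a0 fs v) (encl (segs A a0 fs (v # vs)))) c'') (Pair (Comp A (seg A a0 fs 0 v) f) (Comp C h g))"
    "k = Pair (Pair x y) (Pair (Pair (Pair a0 (encl fs)) (Nats (length fs # v # vs))) h)"
    "is_string A a0 fs" "sorted (v # vs)" "set (v # vs) \<subseteq> {..length fs}" "h \<in> Hom C c' c''" "f \<in> Hom A a a0" "g \<in> Hom C c c'"
proof -
  obtain eh where *: "k = Pair (Pair x y) eh" "x \<in> Obj K" "y \<in> Obj K" "eh \<in> Hom (prod_cat E C) (pfst x) (pfst y)"
    "Comp (prod_cat A C) (FA u eh) (psnd x) = psnd y"
    using under_homE[OF k] functor_ends[OF fu] by metis
  obtain a0 fs c' f g where x: "x = Pair (Pair (Pair a0 (encl fs)) c') (Pair f g)" "is_string A a0 fs" "c' \<in> Obj C"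
    "f \<in> Hom A a a0" "g \<in> Hom C c c'" by (rule K_objE[OF *(2)])
  obtain a1 gs c'' f' g' where y: "y = Pair (Pair (Pair a1 (encl gs)) c'') (Pair f' g')" by (rule K_objE[OF *(3)])
  obtain e h where eh: "eh = Pair e h" "e \<in> Hom E (Pair a0 (encl fs)) (Pair a1 (encl gs))" "h \<in> Hom C c' c''"
    using *(4) x(1) y by (auto elim!: prod_homE)
  obtain \<phi> where p: "e = Pair (Pair a0 (encl fs)) \<phi>" "\<phi> \<in> Hom simplex_op (Nats [length fs]) (Nats [length gs])"
    "Pair a1 (encl gs) = string_act A \<phi> (Pair a0 (encl fs))"
    using elements_homE[OF da eh(2)] by (metis string_dim_Pair)
  obtain ws where ws: "\<phi> = Nats (length fs # ws)" "length ws = Suc (length gs)" "sorted ws" "set ws \<subseteq> {..length fs}"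
    using p(2) by (auto elim!: simplex_homE)
  obtain v vs where v: "ws = v # vs" using ws(2) by (cases ws) auto
  have y': "a1 = vert A a0 fs v" "gs = segs A a0 fs (v # vs)" using p(3) ws v by auto
  have vl: "v \<le> length fs" using ws(4) v by simp
  have "Comp (prod_cat A C) (Pair (seg A a0 fs 0 v) h) (Pair f g) = Pair (Comp A (seg A a0 fs 0 v) f) (Comp C h g)"
    using prod_comp[OF seg_hom[OF A x(2) _ vl, of 0, unfolded vert_0] x(4) eh(3) x(5)] by simp
  moreover have "FA u eh = Pair (seg A a0 fs 0 v) h"
    using uA[OF eh(2)[unfolded p(1) ws(1) v] eh(3)] eh(1) p(1) ws(1) v by simp
  ultimately have "f' = Comp A (seg A a0 fs 0 v) f" "g' = Comp C h g" using *(5) x(1) y by auto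
  then show thesis using that[of a0 fs c' f g v vs c'' h] x y y' *(1) eh p(1) ws v by simp
qed

text \<open>The underlying functor of the middle term of the zigzag: the string is extended by its
  structure arrow \<open>f\<close>, and the parameter is moved back to \<open>c\<close>. The fields
  are read off by projections, \<open>Pair f (encl fs)\<close> being the code of
  \<open>f # fs\<close>.\<close>

private definition "F = mk_func K (prod_cat E C)
  (\<lambda>x. Pair (Pair a (Pair (pfst (psnd x)) (psnd (pfst (pfst x))))) c)
  (\<lambda>k. Pair (Pair (Pair a (Pair (pfst (psnd (pfst (pfst k)))) (psnd (pfst (pfst (pfst (pfst k)))))))
      (cone_map (psnd (pfst (psnd k))))) (Ident C c))"

private lemma FO_F: "Pair (Pair (Pair a0 (encl fs)) c') (Pair f g) \<in> Obj K \<Longrightarrow>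
    FO F (Pair (Pair (Pair a0 (encl fs)) c') (Pair f g)) = Pair (Pair a (encl (f # fs))) c"
  unfolding F_def by (subst mk_func_simps(3), assumption, simp add: encl.simps)

private lemma FA_F: "Pair (Pair (Pair (Pair (Pair a0 (encl fs)) c') (Pair f g)) y) (Pair (Pair s (Nats (n # vs))) h) \<in> Hom K x y' \<Longrightarrow>
    FA F (Pair (Pair (Pair (Pair (Pair a0 (encl fs)) c') (Pair f g)) y) (Pair (Pair s (Nats (n # vs))) h)) =
    Pair (Pair (Pair a (encl (f # fs))) (Nats (Suc n # 0 # map Suc vs))) (Ident C c)"
  unfolding F_def by (subst mk_func_simps(5), assumption, simp add: encl.simps del: under_hom)

text \<open>The prepended vertex \<open>0\<close> is kept by \<open>[0] \<star> \<phi>\<close>, so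
  the restricted string starts at \<open>a\<close> again; this is the arrow part of
  \<open>F\<close>.\<close>

private lemma cone_hom:
  assumes "is_string A a0 fs" "f \<in> Hom A a a0" "sorted (v # vs)" "set (v # vs) \<subseteq> {..length fs}"
  shows "Pair (Pair a (encl (f # fs))) (Nats (Suc (length fs) # 0 # map Suc (v # vs))) \<in>
    Hom E (Pair a (encl (f # fs))) (Pair a (encl (Comp A (seg A a0 fs 0 v) f # segs A a0 fs (v # vs))))"
proof -
  have s: "is_string A a (f # fs)" using assms(1) homD[OF assms(2)] by simp
  have o: "sorted (0 # map Suc (v # vs))" "set (0 # map Suc (v # vs)) \<subseteq> {..length (f # fs)}"
    using assms(3,4) by (auto simp: sorted_map intro: sorted_wrt_mono_rel)
  have "string_act A (Nats (length (f # fs) # 0 # map Suc (v # vs))) (Pair a (encl (f # fs))) =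
    Pair a (encl (Comp A (seg A a0 fs 0 v) f # segs A a0 fs (v # vs)))"
    using cone_act[OF A assms(2,1,3,4), of "length fs"] by simp
  from E_hom[OF s o this] show ?thesis by simp
qed

private lemma Ic: "Ident C c \<in> Hom C c c"
  using cat_ident_hom[OF C c] .

private lemma Ia: "Ident A a \<in> Hom A a a"
  using cat_ident_hom[OF A a] .

private lemma cone_string: "is_string A a0 fs \<Longrightarrow> f \<in> Hom A a a0 \<Longrightarrow> is_string A a (f # fs)"
  using homD[of f A a a0] by simp

private lemma functor_F: "functor_from_to K (prod_cat E C) F"
proof -
  \<comment> \<open>Functoriality is checked through the values of \<open>F\<close>, so that the
    rules for explicit codes apply. Restricting twice to the carriers does not change the
    record.\<close>
  have "functor_from_to K (prod_cat E C) (mk_func K (prod_cat E C) (FO F) (FA F))"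
  proof (rule functor_mk_func[OF cK category_prod[OF cE C]])
    fix x assume x: "x \<in> Obj K"
    then obtain a0 fs c' f g where x': "x = Pair (Pair (Pair a0 (encl fs)) c') (Pair f g)" "is_string A a0 fs" "c' \<in> Obj C"
      "f \<in> Hom A a a0" "g \<in> Hom C c c'" by (rule K_objE)
    have s: "is_string A a (f # fs)" using cone_string[OF x'(2,4)] .
    have FO: "FO F x = Pair (Pair a (encl (f # fs))) c" using FO_F x x'(1) by blast
    show "FO F x \<in> Obj (prod_cat E C)" unfolding FO using s elements_obj[OF da] c by simp
    have s0: "Pair a0 (encl fs) \<in> strings A" "Pair a (encl (f # fs)) \<in> strings A" using x'(2) s by simp_all
    have "Ident K x = Pair (Pair x x) (Pair (Pair (Pair a0 (encl fs)) (Nats (length fs # [0..<Suc (length fs)]))) (Ident C c'))"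
      unfolding under_ident[OF x] functor_ends(1)[OF fu]
      using x'(1,3) s0 elements_obj[OF da] elements_ident[OF da s0(1)] by (simp add: simplex_ident del: upt_Suc)
    then have "FA F (Ident K x) = Pair (Pair (Pair a (encl (f # fs))) (Nats (Suc (length fs) # 0 # map Suc [0..<Suc (length fs)]))) (Ident C c)"
      using FA_F[of a0 fs c' f g x "Pair a0 (encl fs)" "length fs" "[0..<Suc (length fs)]" "Ident C c'" x x] cat_ident_hom[OF cK x] x'(1)
      by (simp del: upt_Suc under_hom)
    \<comment> \<open>The cone on an identity map is an identity map.\<close>
    also have "0 # map Suc [0..<Suc (length fs)] = [0..<Suc (Suc (length fs))]"
      by (simp add: map_Suc_upt upt_conv_Cons del: upt_Suc)
    finally show "FA F (Ident K x) = Ident (prod_cat E C) (FO F x)"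
      unfolding FO using s0 c elements_obj[OF da] elements_ident[OF da s0(2)] by (simp add: simplex_ident del: upt_Suc)
  next
    fix k x y assume k: "k \<in> Hom K x y" and x: "x \<in> Obj K" and y: "y \<in> Obj K"
    obtain a0 fs c' f g v vs c'' h where *: "x = Pair (Pair (Pair a0 (encl fs)) c') (Pair f g)"
      "y = Pair (Pair (Pair (vert A a0 fs v) (encl (segs A a0 fs (v # vs)))) c'') (Pair (Comp A (seg A a0 fs 0 v) f) (Comp C h g))"
      "k = Pair (Pair x y) (Pair (Pair (Pair a0 (encl fs)) (Nats (length fs # v # vs))) h)"
      "is_string A a0 fs" "sorted (v # vs)" "set (v # vs) \<subseteq> {..length fs}" "f \<in> Hom A a a0"
      using k by (rule K_homE)
    have Fx: "FO F x = Pair (Pair a (encl (f # fs))) c" using FO_F x *(1) by blast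
    have Fy: "FO F y = Pair (Pair a (encl (Comp A (seg A a0 fs 0 v) f # segs A a0 fs (v # vs)))) c" using FO_F y *(2) by blast
    have Fk: "FA F k = Pair (Pair (Pair a (encl (f # fs))) (Nats (Suc (length fs) # 0 # map Suc (v # vs)))) (Ident C c)"
      using FA_F[of a0 fs c' f g y "Pair a0 (encl fs)" "length fs" "v # vs" h x y] k unfolding *(1,3) .
    show "FA F k \<in> Hom (prod_cat E C) (FO F x) (FO F y)"
      unfolding Fx Fy Fk prod_hom using cone_hom[OF *(4,7,5,6)] Ic by blast
  next
    fix k l x y z assume k: "k \<in> Hom K x y" and l: "l \<in> Hom K y z" and x: "x \<in> Obj K" and y: "y \<in> Obj K"
    obtain a0 fs c' f g v vs c'' h where *: "x = Pair (Pair (Pair a0 (encl fs)) c') (Pair f g)"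
      "y = Pair (Pair (Pair (vert A a0 fs v) (encl (segs A a0 fs (v # vs)))) c'') (Pair (Comp A (seg A a0 fs 0 v) f) (Comp C h g))"
      "k = Pair (Pair x y) (Pair (Pair (Pair a0 (encl fs)) (Nats (length fs # v # vs))) h)"
      "is_string A a0 fs" "sorted (v # vs)" "set (v # vs) \<subseteq> {..length fs}" "h \<in> Hom C c' c''" "f \<in> Hom A a a0"
      using k by (rule K_homE)
    obtain b1 gs c1 f1 g1 w ws c2 h1 where **: "y = Pair (Pair (Pair b1 (encl gs)) c1) (Pair f1 g1)"
      "z = Pair (Pair (Pair (vert A b1 gs w) (encl (segs A b1 gs (w # ws)))) c2) (Pair (Comp A (seg A b1 gs 0 w) f1) (Comp C h1 g1))"
      "l = Pair (Pair y z) (Pair (Pair (Pair b1 (encl gs)) (Nats (length gs # w # ws))) h1)"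
      "is_string A b1 gs" "sorted (w # ws)" "set (w # ws) \<subseteq> {..length gs}" "h1 \<in> Hom C c1 c2" "f1 \<in> Hom A a b1"
      using l by (rule K_homE)
    have e: "b1 = vert A a0 fs v" "gs = segs A a0 fs (v # vs)" "c1 = c''" "f1 = Comp A (seg A a0 fs 0 v) f" using *(2) **(1) by auto
    have Fk: "FA F k = Pair (Pair (Pair a (encl (f # fs))) (Nats (Suc (length fs) # 0 # map Suc (v # vs)))) (Ident C c)"
      using FA_F[of a0 fs c' f g y "Pair a0 (encl fs)" "length fs" "v # vs" h x y] k unfolding *(1,3) .
    have Fl: "FA F l = Pair (Pair (Pair a (encl (f1 # gs))) (Nats (Suc (length gs) # 0 # map Suc (w # ws)))) (Ident C c)"
      using FA_F[of b1 gs c1 f1 g1 z "Pair b1 (encl gs)" "length gs" "w # ws" h1 y z] l unfolding **(1,3) .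
    have e1: "Pair (Pair a0 (encl fs)) (Nats (length fs # v # vs)) \<in> Hom E (Pair a0 (encl fs)) (Pair b1 (encl gs))"
      by (rule E_hom[OF *(4,5,6)]) (simp add: e)
    have e2: "Pair (Pair b1 (encl gs)) (Nats (length gs # w # ws)) \<in> Hom E (Pair b1 (encl gs)) (Pair (vert A b1 gs w) (encl (segs A b1 gs (w # ws))))"
      by (rule E_hom[OF **(4,5,6)]) simp
    let ?vw = "map (\<lambda>i. (v # vs) ! i) (w # ws)"
    have "Comp K l k = Pair (Pair x z) (Comp (prod_cat E C) (Pair (Pair (Pair b1 (encl gs)) (Nats (length gs # w # ws))) h1)
       (Pair (Pair (Pair a0 (encl fs)) (Nats (length fs # v # vs))) h))"
      using under_comp[OF l[unfolded **(3)] k[unfolded *(3)]] functor_ends[OF fu] unfolding **(3) *(3) by simp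
    also have "\<dots> = Pair (Pair x z) (Pair (Pair (Pair a0 (encl fs)) (Nats (length fs # ?vw))) (Comp C h1 h))"
      using prod_comp[OF e2 e1 **(7)[unfolded e(3)] *(7)] E_comp[OF e1 e2] by simp
    finally have c: "Comp K l k = \<dots>" .
    have lk: "Comp K l k \<in> Hom K x z" using cat_comp_hom[OF cK l k] .
    have Flk: "FA F (Comp K l k) = Pair (Pair (Pair a (encl (f # fs))) (Nats (Suc (length fs) # 0 # map Suc ?vw))) (Ident C c)"
      using FA_F[of a0 fs c' f g z "Pair a0 (encl fs)" "length fs" ?vw "Comp C h1 h" x z] lk unfolding c *(1) .
    have h1: "Pair (Pair a (encl (f # fs))) (Nats (Suc (length fs) # 0 # map Suc (v # vs))) \<in> Hom E (Pair a (encl (f # fs))) (Pair a (encl (f1 # gs)))"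
      using cone_hom[OF *(4,8,5,6)] unfolding e by simp
    note h2 = cone_hom[OF **(4,8,5,6)]
    \<comment> \<open>The construction \<open>[0] \<star> \<phi>\<close> respects composition:
      \<open>0\<close> is fixed, and the shifted values compose as before.\<close>
    have m: "map (\<lambda>i. (0 # map Suc (v # vs)) ! i) (0 # map Suc (w # ws)) = 0 # map Suc ?vw"
      using **(6) by (auto simp: e(2) simp del: nth_Cons_Suc intro!: nth_map[of _ "v # vs" Suc, simplified])
    show "FA F (Comp K l k) = Comp (prod_cat E C) (FA F l) (FA F k)"
      unfolding Flk Fl Fk using prod_comp[OF h2 h1 Ic Ic] E_comp[OF h1 h2] cat_id_left[OF C Ic] m by simp
  qed
  moreover have "mk_func K (prod_cat E C) (FO F) (FA F) = F"
    unfolding F_def mk_func_def by (simp add: restrict_def fun_eq_iff)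
  ultimately show ?thesis by simp
qed

private lemma E_hom':
  assumes "is_string A b fs" "vs \<noteq> []" "sorted vs" "set vs \<subseteq> {..length fs}"
    "string_act A (Nats (length fs # vs)) (Pair b (encl fs)) = y"
  shows "Pair (Pair b (encl fs)) (Nats (length fs # vs)) \<in> Hom E (Pair b (encl fs)) y"
  using assms E_hom[of b fs "hd vs" "tl vs" y] by simp

text \<open>The first vertex of a prepended string is \<open>a\<close> and its parameter is
  \<open>c\<close>, so an identity can serve as structure arrow. This makes the extended strings
  objects of \<open>K\<close>.\<close>

private definition "T = under_lift (Pair a c) u F (\<lambda>_. Pair (Ident A a) (Ident C c))"
text \<open>The constant end of the zigzag: the string of length zero at \<open>a\<close>, with
  identity structure arrows.\<close>

private definition "e = Pair (Pair (Pair a (encl [])) c) (Pair (Ident A a) (Ident C c))"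

private lemma FA_F_hom:
  assumes k: "k \<in> Hom K x y"
  obtains a0 fs c' f g v vs c'' h where "x = Pair (Pair (Pair a0 (encl fs)) c') (Pair f g)"
    "y = Pair (Pair (Pair (vert A a0 fs v) (encl (segs A a0 fs (v # vs)))) c'') (Pair (Comp A (seg A a0 fs 0 v) f) (Comp C h g))"
    "k = Pair (Pair x y) (Pair (Pair (Pair a0 (encl fs)) (Nats (length fs # v # vs))) h)"
    "is_string A a0 fs" "sorted (v # vs)" "set (v # vs) \<subseteq> {..length fs}" "h \<in> Hom C c' c''" "f \<in> Hom A a a0" "g \<in> Hom C c c'"
    "FA F k = Pair (Pair (Pair a (encl (f # fs))) (Nats (Suc (length fs) # 0 # map Suc (v # vs)))) (Ident C c)"
proof -
  obtain a0 fs c' f g v vs c'' h where *: "x = Pair (Pair (Pair a0 (encl fs)) c') (Pair f g)"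
    "y = Pair (Pair (Pair (vert A a0 fs v) (encl (segs A a0 fs (v # vs)))) c'') (Pair (Comp A (seg A a0 fs 0 v) f) (Comp C h g))"
    "k = Pair (Pair x y) (Pair (Pair (Pair a0 (encl fs)) (Nats (length fs # v # vs))) h)"
    "is_string A a0 fs" "sorted (v # vs)" "set (v # vs) \<subseteq> {..length fs}" "h \<in> Hom C c' c''" "f \<in> Hom A a a0" "g \<in> Hom C c c'"
    using k by (rule K_homE)
  have "FA F k = Pair (Pair (Pair a (encl (f # fs))) (Nats (Suc (length fs) # 0 # map Suc (v # vs)))) (Ident C c)"
    using FA_F[of a0 fs c' f g y "Pair a0 (encl fs)" "length fs" "v # vs" h x y] k unfolding *(1,3) .
  then show thesis using that * by blast
qed

private lemma functor_T: "functor_from_to K K T"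
  unfolding T_def
proof (rule functor_under_lift[OF fu functor_F])
  fix x assume x: "x \<in> Obj K"
  then obtain a0 fs c' f g where x': "x = Pair (Pair (Pair a0 (encl fs)) c') (Pair f g)" "is_string A a0 fs" "f \<in> Hom A a a0"
    by (rule K_objE)
  have "FO u (FO F x) = Pair a c" using FO_F x x'(1) uO[OF cone_string[OF x'(2,3)] c] by metis
  then show "Pair (Ident A a) (Ident C c) \<in> Hom (prod_cat A C) (Pair a c) (FO u (FO F x))" using Ia Ic by simp
next
  fix k x y assume k: "k \<in> Hom K x y"
  obtain a0 fs c' f g v vs c'' h where *: "x = Pair (Pair (Pair a0 (encl fs)) c') (Pair f g)"
    "is_string A a0 fs" "sorted (v # vs)" "set (v # vs) \<subseteq> {..length fs}" "f \<in> Hom A a a0"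
    "FA F k = Pair (Pair (Pair a (encl (f # fs))) (Nats (Suc (length fs) # 0 # map Suc (v # vs)))) (Ident C c)"
    using k by (rule FA_F_hom)
  have "FA u (FA F k) = Pair (Ident A a) (Ident C c)"
    unfolding *(6) using uA[OF cone_hom[OF *(2,5,3,4)] Ic] by simp
  then show "Comp (prod_cat A C) (FA u (FA F k)) (Pair (Ident A a) (Ident C c)) = Pair (Ident A a) (Ident C c)"
    using prod_comp[OF Ia Ia Ic Ic] cat_id_left[OF A Ia] cat_id_left[OF C Ic] by simp
qed

private lemma FO_T: "x \<in> Obj K \<Longrightarrow> FO T x = Pair (FO F x) (Pair (Ident A a) (Ident C c))"
  unfolding T_def by (simp add: functor_ends[OF functor_F])

private lemma FA_T: "k \<in> Hom K x y \<Longrightarrow> psnd (FA T k) = FA F k"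
  unfolding T_def by (subst under_lift_simps(4)[where x = x and y = y]) (simp_all add: functor_ends[OF functor_F] del: under_hom)

private lemma e_obj: "e \<in> Obj K"
  unfolding e_def by (rule K_objI) (use a c Ia Ic in simp_all)

private definition "cone_dim x = length (decl (psnd (pfst (pfst x))))"
private definition "cone_point x = Pair a (Pair (pfst (psnd x)) (psnd (pfst (pfst x))))"
text \<open>The coface map \<open>i \<mapsto> i + 1\<close> from \<open>[n]\<close> to
  \<open>[n + 1]\<close>, which drops the prepended vertex, together with the arrow
  \<open>c \<rightarrow> c'\<close> that returns to the original parameter.\<close>

private definition "t\<sigma> x = Pair (Pair (cone_point x) (Nats (Suc (cone_dim x) # map Suc [0..<Suc (cone_dim x)]))) (psnd (psnd x))"
text \<open>The map from \<open>[0]\<close> to \<open>[n + 1]\<close> with value \<open>0\<close>,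
  which keeps just the prepended vertex, and the identity of the parameter \<open>c\<close>.\<close>

private definition "t\<tau> x = Pair (Pair (cone_point x) (Nats [Suc (cone_dim x), 0])) (Ident C c)"

private lemma t\<sigma>_eq: "t\<sigma> (Pair (Pair (Pair a0 (encl fs)) c') (Pair f g)) =
    Pair (Pair (Pair a (encl (f # fs))) (Nats (length (f # fs) # map Suc [0..<Suc (length fs)]))) g"
  by (simp add: t\<sigma>_def cone_point_def cone_dim_def encl.simps del: upt_Suc)

private lemma t\<tau>_eq: "t\<tau> (Pair (Pair (Pair a0 (encl fs)) c') (Pair f g)) =
    Pair (Pair (Pair a (encl (f # fs))) (Nats (length (f # fs) # [0]))) (Ident C c)"
  by (simp add: t\<tau>_def cone_point_def cone_dim_def encl.simps)

text \<open>The first value of the coface map is \<open>1\<close>, and the vertex of index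
  \<open>1\<close> of the prepended string is \<open>a0\<close>; the remaining arrows are those of
  \<open>fs\<close>.\<close>

private lemma t\<sigma>_hom:
  assumes "is_string A a0 fs" "f \<in> Hom A a a0"
  shows "Pair (Pair a (encl (f # fs))) (Nats (length (f # fs) # map Suc [0..<Suc (length fs)])) \<in> Hom E (Pair a (encl (f # fs))) (Pair a0 (encl fs))"
proof (rule E_hom'[OF cone_string[OF assms]])
  show "sorted (map Suc [0..<Suc (length fs)])" by (simp add: map_Suc_upt del: upt_Suc)
  have "hd (map Suc [0..<Suc (length fs)]) = Suc 0" by (simp add: upt_conv_Cons del: upt_Suc)
  then show "string_act A (Nats (length (f # fs) # map Suc [0..<Suc (length fs)])) (Pair a (encl (f # fs))) = Pair a0 (encl fs)"
    using segs_Suc[of A a f fs "[0..<Suc (length fs)]"] segs_upt[OF A assms(1)] homD[OF assms(2)] by (simp del: upt_Suc)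
qed (auto simp del: upt_Suc)

private lemma t\<tau>_hom:
  assumes "is_string A a0 fs" "f \<in> Hom A a a0"
  shows "Pair (Pair a (encl (f # fs))) (Nats (length (f # fs) # [0])) \<in> Hom E (Pair a (encl (f # fs))) (Pair a (encl []))"
  by (rule E_hom'[OF cone_string[OF assms]]) simp_all

text \<open>Dropping the prepended vertex commutes with restriction: both composites are the map
  with values \<open>map Suc (v # vs)\<close>. The structure arrows agree because the composite from
  vertex \<open>0\<close> to vertex \<open>1\<close> is \<open>f\<close>.\<close>

private lemma nt_\<sigma>: "ntrans_from_to T (id_func K) (over_nt T (id_func K) t\<sigma>)"
proof (rule under_nt[OF fu functor_T functor_id[OF cK]])
  fix x assume x: "x \<in> Obj K"
  then obtain a0 fs c' f g where x': "x = Pair (Pair (Pair a0 (encl fs)) c') (Pair f g)" "is_string A a0 fs" "f \<in> Hom A a a0" "g \<in> Hom C c c'"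
    by (rule K_objE)
  have F: "FO F x = Pair (Pair a (encl (f # fs))) c" using FO_F x x'(1) by blast
  note h = t\<sigma>_hom[OF x'(2,3)]
  show "t\<sigma> x \<in> Hom (prod_cat E C) (pfst (FO T x)) (pfst (FO (id_func K) x))"
    unfolding id_func_simps(3)[OF x] FO_T[OF x] F univ.sel using h x'(4) unfolding x'(1) t\<sigma>_eq by (simp only: univ.sel prod_hom)
  have a0: "a0 \<in> Obj A" using string_obj[OF A x'(2)] .
  have hd: "hd (map Suc [0..<Suc (length fs)]) = Suc 0" by (simp add: upt_conv_Cons del: upt_Suc)
  have "FA u (t\<sigma> x) = Pair (Comp A (Ident A a0) f) g"
    using uA[OF h x'(4)] homD[OF x'(3)] unfolding x'(1) t\<sigma>_eq hd by simp
  then show "Comp (prod_cat A C) (FA u (t\<sigma> x)) (psnd (FO T x)) = psnd (FO (id_func K) x)"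
    unfolding id_func_simps(3)[OF x]
    using prod_comp[OF x'(3) Ia x'(4) Ic] cat_id_left[OF A x'(3)] cat_id_right[OF A x'(3)] cat_id_right[OF C x'(4)] FO_T[OF x] x x'(1) by simp
next
  fix k x y assume k: "k \<in> Hom K x y"
  obtain a0 fs c' f g v vs c'' h where *: "x = Pair (Pair (Pair a0 (encl fs)) c') (Pair f g)"
    "y = Pair (Pair (Pair (vert A a0 fs v) (encl (segs A a0 fs (v # vs)))) c'') (Pair (Comp A (seg A a0 fs 0 v) f) (Comp C h g))"
    "k = Pair (Pair x y) (Pair (Pair (Pair a0 (encl fs)) (Nats (length fs # v # vs))) h)"
    "is_string A a0 fs" "sorted (v # vs)" "set (v # vs) \<subseteq> {..length fs}" "h \<in> Hom C c' c''" "f \<in> Hom A a a0" "g \<in> Hom C c c'"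
    "FA F k = Pair (Pair (Pair a (encl (f # fs))) (Nats (Suc (length fs) # 0 # map Suc (v # vs)))) (Ident C c)"
    using k by (rule FA_F_hom)
  let ?gs = "segs A a0 fs (v # vs)" and ?b = "vert A a0 fs v" and ?f = "Comp A (seg A a0 fs 0 v) f" and ?g = "Comp C h g"
  have vl: "v \<le> length fs" using *(6) by simp
  have f: "?f \<in> Hom A a ?b" using cat_comp_hom[OF A seg_hom[OF A *(4) _ vl, of 0, unfolded vert_0] *(8)] by simp
  have g: "?g \<in> Hom C c c''" using cat_comp_hom[OF C *(7,9)] .
  note h1 = cone_hom[OF *(4,8,5,6)] and h2 = t\<sigma>_hom[OF segs_string[OF A *(4,5,6)] f] and h3 = t\<sigma>_hom[OF *(4,8)]
  have h4: "Pair (Pair a0 (encl fs)) (Nats (length fs # v # vs)) \<in> Hom E (Pair a0 (encl fs)) (Pair ?b (encl ?gs))"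
    by (rule E_hom[OF *(4,5,6)]) simp
  have len: "length ?gs = length vs" by simp
  \<comment> \<open>\<open>[0] \<star> \<phi>\<close> after the coface map skips the entry
    \<open>0\<close>.\<close>
  have l1: "map (\<lambda>i. (0 # map Suc (v # vs)) ! i) (map Suc [0..<Suc (length ?gs)]) = map Suc (v # vs)"
  proof -
    have "map (\<lambda>i. (0 # map Suc (v # vs)) ! i) (map Suc [0..<Suc (length ?gs)]) = map (\<lambda>i. map Suc (v # vs) ! i) [0..<length (map Suc (v # vs))]"
      by (simp add: len comp_def del: upt_Suc list.map)
    then show ?thesis using map_nth by metis
  qed
  \<comment> \<open>The coface map after \<open>\<phi>\<close> shifts every value by one.\<close>
  have l2: "map (\<lambda>i. map Suc [0..<Suc (length fs)] ! i) (v # vs) = map Suc (v # vs)"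
    using *(6) by (auto simp del: upt_Suc simp: less_Suc_eq_le)
  have "Comp (prod_cat E C) (t\<sigma> y) (FA F k) = Pair (Pair (Pair a (encl (f # fs))) (Nats (Suc (length fs) # map Suc (v # vs)))) ?g"
    unfolding *(2) t\<sigma>_eq *(10) using prod_comp[OF h2 h1 g Ic] E_comp[OF h1 h2] l1 cat_id_right[OF C g] by simp
  moreover have "Comp (prod_cat E C) (psnd k) (t\<sigma> x) = Pair (Pair (Pair a (encl (f # fs))) (Nats (Suc (length fs) # map Suc (v # vs)))) ?g"
    unfolding *(1,3) t\<sigma>_eq using prod_comp[OF h4 h3 *(7,9)] E_comp[OF h3 h4] l2 by simp
  ultimately show "Comp (prod_cat E C) (t\<sigma> y) (psnd (FA T k)) = Comp (prod_cat E C) (psnd (FA (id_func K) k)) (t\<sigma> x)"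
    unfolding FA_T[OF k] id_func_simps(4)[OF k] by simp
qed

text \<open>Every map \<open>[0] \<star> \<phi>\<close> fixes the vertex \<open>0\<close>, so
  selecting it is compatible with restriction; the arrow parts over \<open>A\<close> and
  \<open>C\<close> are identities.\<close>

private lemma nt_\<tau>: "ntrans_from_to T (point K e \<circ>\<^sub>F to_one K) (over_nt T (point K e \<circ>\<^sub>F to_one K) t\<tau>)"
proof (rule under_nt[OF fu functor_T functor_comp[OF functor_to_one[OF cK] functor_point[OF cK e_obj]]])
  fix x assume x: "x \<in> Obj K"
  then obtain a0 fs c' f g where x': "x = Pair (Pair (Pair a0 (encl fs)) c') (Pair f g)" "is_string A a0 fs" "f \<in> Hom A a a0" "g \<in> Hom C c c'"
    by (rule K_objE)
  have F: "FO F x = Pair (Pair a (encl (f # fs))) c" using FO_F x x'(1) by blast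
  note h = t\<tau>_hom[OF x'(2,3)]
  have p: "FO (point K e \<circ>\<^sub>F to_one K) x = e" using x by simp
  show "t\<tau> x \<in> Hom (prod_cat E C) (pfst (FO T x)) (pfst (FO (point K e \<circ>\<^sub>F to_one K) x))"
    unfolding p FO_T[OF x] F univ.sel using h Ic unfolding x'(1) t\<tau>_eq by (simp only: e_def univ.sel prod_hom)
  have "FA u (t\<tau> x) = Pair (Ident A a) (Ident C c)"
    using uA[OF h Ic] unfolding x'(1) t\<tau>_eq by simp
  then show "Comp (prod_cat A C) (FA u (t\<tau> x)) (psnd (FO T x)) = psnd (FO (point K e \<circ>\<^sub>F to_one K) x)"
    unfolding p FO_T[OF x] using prod_comp[OF Ia Ia Ic Ic] cat_id_left[OF A Ia] cat_id_left[OF C Ic] by (simp add: e_def)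
next
  fix k x y assume k: "k \<in> Hom K x y"
  obtain a0 fs c' f g v vs c'' h where *: "x = Pair (Pair (Pair a0 (encl fs)) c') (Pair f g)"
    "y = Pair (Pair (Pair (vert A a0 fs v) (encl (segs A a0 fs (v # vs)))) c'') (Pair (Comp A (seg A a0 fs 0 v) f) (Comp C h g))"
    "k = Pair (Pair x y) (Pair (Pair (Pair a0 (encl fs)) (Nats (length fs # v # vs))) h)"
    "is_string A a0 fs" "sorted (v # vs)" "set (v # vs) \<subseteq> {..length fs}" "h \<in> Hom C c' c''" "f \<in> Hom A a a0" "g \<in> Hom C c c'"
    "FA F k = Pair (Pair (Pair a (encl (f # fs))) (Nats (Suc (length fs) # 0 # map Suc (v # vs)))) (Ident C c)"
    using k by (rule FA_F_hom)
  let ?gs = "segs A a0 fs (v # vs)" and ?b = "vert A a0 fs v" and ?f = "Comp A (seg A a0 fs 0 v) f" and ?g = "Comp C h g"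
  have vl: "v \<le> length fs" using *(6) by simp
  have f: "?f \<in> Hom A a ?b" using cat_comp_hom[OF A seg_hom[OF A *(4) _ vl, of 0, unfolded vert_0] *(8)] by simp
  note h1 = cone_hom[OF *(4,8,5,6)] and h2 = t\<tau>_hom[OF segs_string[OF A *(4,5,6)] f] and h3 = t\<tau>_hom[OF *(4,8)]
  have tx: "t\<tau> x \<in> Hom (prod_cat E C) (Pair (Pair a (encl (f # fs))) c) (Pair (Pair a (encl [])) c)"
    using h3 Ic unfolding *(1) t\<tau>_eq by (simp only: prod_hom)
  have "Comp (prod_cat E C) (t\<tau> y) (FA F k) = t\<tau> x"
    unfolding *(1,2) t\<tau>_eq *(10) using prod_comp[OF h2 h1 Ic Ic] E_comp[OF h1 h2] cat_id_right[OF C Ic] by simp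
  moreover have "psnd (FA (point K e \<circ>\<^sub>F to_one K) k) = Ident (prod_cat E C) (Pair (Pair a (encl [])) c)"
    using comp_func_FA[of k "to_one K" x y "point K e"] k to_one_simps(4)[OF k] under_ident[OF e_obj] functor_ends(1)[OF fu] by (simp add: e_def)
  ultimately show "Comp (prod_cat E C) (t\<tau> y) (psnd (FA T k)) = Comp (prod_cat E C) (psnd (FA (point K e \<circ>\<^sub>F to_one K) k)) (t\<tau> x)"
    unfolding FA_T[OF k] using cat_id_left[OF category_prod[OF cE C] tx] by simp
qed

private lemma tO: "x \<in> Obj (prod_cat A C) \<Longrightarrow> FO t x = Pair (Nats []) (psnd x)"
  by (auto elim!: prod_objE)

private lemma tA: "k \<in> Hom (prod_cat A C) x y \<Longrightarrow> FA t k = Pair (Nats []) (psnd k)"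
  by (auto elim!: prod_homE simp: prod_func_simps(4)[of _ "to_one A" _ _ _ "id_func C"])

text \<open>The composite with \<open>t\<close> forgets the string and its vertex and remembers the
  parameter. All conditions on the zigzag that involve \<open>w\<close> are thus conditions in
  \<open>C\<close>.\<close>

private lemma w_simps:
  defines "w \<equiv> t \<circ>\<^sub>F u \<circ>\<^sub>F under_proj (Pair a c) u"
  shows "functor_from_to K (prod_cat one_cat C) w" "x \<in> Obj K \<Longrightarrow> FO w x = Pair (Nats []) (psnd (pfst x))"
    "k \<in> Hom K x y \<Longrightarrow> FA w k = Pair (Nats []) (psnd (psnd k))"
proof -
  note pr = functor_under_proj[OF fu, of "Pair a c"]
  note up = functor_comp[OF pr fu]
  show w: "functor_from_to K (prod_cat one_cat C) w" unfolding w_def using functor_comp[OF up ft] .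
  show "FO w x = Pair (Nats []) (psnd (pfst x))" if x: "x \<in> Obj K"
  proof -
    obtain a0 fs c' f g where x': "x = Pair (Pair (Pair a0 (encl fs)) c') (Pair f g)" "is_string A a0 fs" "c' \<in> Obj C"
      using x by (rule K_objE)
    have "FO w x = FO t (FO u (pfst x))" unfolding w_def using x by simp
    also have "\<dots> = Pair (Nats []) c'" using uO[OF x'(2,3)] string_obj[OF A x'(2)] x'(1,3) by simp
    finally show ?thesis using x'(1) by simp
  qed
  show "FA w k = Pair (Nats []) (psnd (psnd k))" if k: "k \<in> Hom K x y"
  proof -
    obtain a0 fs c' f g v vs c'' h where *: "k = Pair (Pair x y) (Pair (Pair (Pair a0 (encl fs)) (Nats (length fs # v # vs))) h)"
      "is_string A a0 fs" "sorted (v # vs)" "set (v # vs) \<subseteq> {..length fs}" "h \<in> Hom C c' c''"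
      using k by (rule K_homE)
    have vl: "v \<le> length fs" using *(4) by simp
    have "FA w k = FA t (FA u (psnd k))"
      unfolding w_def using k comp_func_FA[of k "u \<circ>\<^sub>F under_proj (Pair a c) u" x y t] comp_func_FA[of k "under_proj (Pair a c) u" x y u] by (simp del: under_hom)
    also have "FA u (psnd k) = Pair (seg A a0 fs 0 v) h"
      using uA[OF E_hom[OF *(2,3,4) refl] *(5)] *(1) by simp
    also have "FA t \<dots> = Pair (Nats []) h"
      using tA[of "Pair (seg A a0 fs 0 v) h" "Pair a0 c'" "Pair (vert A a0 fs v) c''"] seg_hom[OF A *(2) _ vl, of 0] *(5) by simp
    finally show ?thesis using *(1) by simp
  qed
qed

text \<open>This is the input for \<open>cofinal_ff\<close>. Seen in the parameter alone,
  \<open>T\<close> is constant at \<open>c\<close>, the leg to the identity is the structure arrow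
  \<open>c \<rightarrow> c'\<close>, and the leg to \<open>e\<close> is an identity.\<close>

lemma first_vertex_zigzag:
  defines "w \<equiv> t \<circ>\<^sub>F u \<circ>\<^sub>F under_proj (Pair a c) u"
  shows "\<exists>e T \<sigma> \<tau>. e \<in> Obj K \<and> functor_from_to K K T \<and> ntrans_from_to T (id_func K) \<sigma> \<and>
        ntrans_from_to T (point K e \<circ>\<^sub>F to_one K) \<tau> \<and>
        FO w e = FO t (Pair a c) \<and> FA t (psnd e) = Ident (prod_cat one_cat C) (FO t (Pair a c)) \<and>
        w \<circ>\<^sub>F T = t \<circ>\<^sub>F point (prod_cat A C) (Pair a c) \<circ>\<^sub>F to_one K \<and>
        (\<forall>x\<in>Obj K. FA w (At \<sigma> x) = FA t (psnd x)) \<and> (\<forall>x\<in>Obj K. FA w (At \<tau> x) = Ident (prod_cat one_cat C) (FO w (FO T x)))"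
proof (intro exI conjI)
  note ws = w_simps[folded w_def]
  show "e \<in> Obj K" by (rule e_obj)
  show "functor_from_to K K T" by (rule functor_T)
  show "ntrans_from_to T (id_func K) (over_nt T (id_func K) t\<sigma>)" by (rule nt_\<sigma>)
  show "ntrans_from_to T (point K e \<circ>\<^sub>F to_one K) (over_nt T (point K e \<circ>\<^sub>F to_one K) t\<tau>)" by (rule nt_\<tau>)
  have ac: "Pair a c \<in> Obj (prod_cat A C)" using a c by simp
  have tac: "FO t (Pair a c) = Pair (Nats []) c" using tO[OF ac] by simp
  show "FO w e = FO t (Pair a c)" unfolding tac ws(2)[OF e_obj] by (simp add: e_def)
  have tI: "FA t (Pair (Ident A a) (Ident C c)) = Pair (Nats []) (Ident C c)"
    using tA[of "Pair (Ident A a) (Ident C c)" "Pair a c" "Pair a c"] Ia Ic by simp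
  then show "FA t (psnd e) = Ident (prod_cat one_cat C) (FO t (Pair a c))" unfolding tac using c by (simp add: e_def)
  have FOwT: "FO w (FO T x) = Pair (Nats []) c" if x: "x \<in> Obj K" for x
  proof -
    obtain a0 fs c' f g where x': "x = Pair (Pair (Pair a0 (encl fs)) c') (Pair f g)" using x by (rule K_objE)
    then have "FO F x = Pair (Pair a (encl (f # fs))) c" using FO_F x by blast
    then show ?thesis using ws(2)[OF fun_obj[OF functor_T x]] unfolding FO_T[OF x] by simp
  qed
  note pt = functor_point[OF category_prod[OF A C] ac]
  show "w \<circ>\<^sub>F T = t \<circ>\<^sub>F point (prod_cat A C) (Pair a c) \<circ>\<^sub>F to_one K"
  proof (rule functor_eqI[OF functor_comp[OF functor_T ws(1)] functor_comp[OF functor_comp[OF functor_to_one[OF cK] pt] ft]])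
    fix x assume x: "x \<in> Obj K"
    then show "FO (w \<circ>\<^sub>F T) x = FO (t \<circ>\<^sub>F point (prod_cat A C) (Pair a c) \<circ>\<^sub>F to_one K) x"
      using FOwT[OF x] tac by (simp add: functor_ends[OF functor_T])
  next
    fix k x y assume k: "k \<in> Hom K x y"
    obtain f fs v vs where F: "FA F k = Pair (Pair (Pair a (encl (f # fs))) (Nats (Suc (length fs) # 0 # map Suc (v # vs)))) (Ident C c)"
      using k by (rule FA_F_hom)
    have "FA (w \<circ>\<^sub>F T) k = FA w (FA T k)" using comp_func_FA[of k T x y w] k by (simp add: functor_ends[OF functor_T] del: under_hom)
    also have "\<dots> = Pair (Nats []) (Ident C c)" using ws(3)[OF fun_hom[OF functor_T k]] FA_T[OF k] F by simp
    also have "\<dots> = FA t (FA (point (prod_cat A C) (Pair a c)) (FA (to_one K) k))" using tI to_one_simps(4)[OF k] a c by simp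
    also have "\<dots> = FA (t \<circ>\<^sub>F point (prod_cat A C) (Pair a c) \<circ>\<^sub>F to_one K) k"
      using comp_func_FA[of k "to_one K" x y "point (prod_cat A C) (Pair a c)"] k
        comp_func_FA[of k "point (prod_cat A C) (Pair a c) \<circ>\<^sub>F to_one K" x y t] by (simp del: under_hom)
    finally show "FA (w \<circ>\<^sub>F T) k = FA (t \<circ>\<^sub>F point (prod_cat A C) (Pair a c) \<circ>\<^sub>F to_one K) k" .
  qed
  show "\<forall>x\<in>Obj K. FA w (At (over_nt T (id_func K) t\<sigma>) x) = FA t (psnd x)"
  proof
    fix x assume x: "x \<in> Obj K"
    obtain a0 fs c' f g where x': "x = Pair (Pair (Pair a0 (encl fs)) c') (Pair f g)" "f \<in> Hom A a a0" "g \<in> Hom C c c'"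
      using x by (rule K_objE)
    have "FA w (At (over_nt T (id_func K) t\<sigma>) x) = Pair (Nats []) (psnd (t\<sigma> x))"
      using ws(3)[OF nt_hom[OF nt_\<sigma>, unfolded functor_ends[OF functor_T], OF x]] x by (simp add: functor_ends[OF functor_T])
    then show "FA w (At (over_nt T (id_func K) t\<sigma>) x) = FA t (psnd x)"
      using tA[of "Pair f g" "Pair a c" "Pair a0 c'"] x' by (simp add: t\<sigma>_eq del: upt_Suc)
  qed
  show "\<forall>x\<in>Obj K. FA w (At (over_nt T (point K e \<circ>\<^sub>F to_one K) t\<tau>) x) = Ident (prod_cat one_cat C) (FO w (FO T x))"
  proof
    fix x assume x: "x \<in> Obj K"
    have "FA w (At (over_nt T (point K e \<circ>\<^sub>F to_one K) t\<tau>) x) = Pair (Nats []) (psnd (t\<tau> x))"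
      using ws(3)[OF nt_hom[OF nt_\<tau>, unfolded functor_ends[OF functor_T], OF x]] x by (simp add: functor_ends[OF functor_T])
    then show "FA w (At (over_nt T (point K e \<circ>\<^sub>F to_one K) t\<tau>) x) = Ident (prod_cat one_cat C) (FO w (FO T x))"
      unfolding FOwT[OF x] using c by (simp add: t\<tau>_def)
  qed
qed

end

theorem theorem5p19:
  fixes \<kappa> :: "'a univ rel" and D :: "('a, 'o, 'm) prederiv" and A :: "'a scat"
  assumes "size_bound \<kappa>" and "derivator \<kappa> D" and "small_category \<kappa> A"
  shows "\<exists>s. deriv_morphism \<kappa> (shift D A) (shift D simplex_op) s \<and>
    (\<exists>\<Phi>. iso_modification \<kappa> (shift D A) (shift D one_cat)
       (colim_mor D simplex_op \<circ>\<^sub>D s) (colim_mor D A) \<Phi>) \<and>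
    (\<forall>n. \<exists>P j \<Psi>.
       coproduct_morphism \<kappa> (shift D A) (shift D one_cat) (nerve A n)
         (\<lambda>x. eval_mor D A (fst x)) P j \<and>
       iso_modification \<kappa> (shift D A) (shift D one_cat)
         (eval_mor D simplex_op (Nats [n]) \<circ>\<^sub>D s) P \<Psi>)"
proof -
  interpret derivator_theory \<kappa> D using assms by unfold_locales
  have sA: "small A" and A: "is_category A" using assms(3) by (auto simp: small_category_def)
  have s\<Delta>: "small simplex_op" using small_op[OF small_simplex[OF size]] .
  have s1: "small one_cat" using small_one[OF size] .
  let ?S = "strings A"
  note da = simplices_action[OF A] and S = small_strings[OF size sA]
  have sE: "small (simplices A)" using small_elements[OF da size S s\<Delta>] .
  let ?\<pi> = "first_vertex A" and ?p = "elements_proj simplex_op ?S string_dim (string_act A)"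
  have \<pi>: "sfun (simplices A) A ?\<pi>" using functor_first_vertex[OF A] sE sA by (simp add: small_fun_def)
  have p: "sfun (simplices A) simplex_op ?p" using functor_elements_proj[OF da] sE s\<Delta> by (simp add: small_fun_def)
  define s where "s = lan_mor D ?p \<circ>\<^sub>D pull_mor D ?\<pi>"
  define \<eta> where "\<eta> = (\<lambda>C X. lu (prod_func ?p (id_func C)) (pb (prod_func ?\<pi> (id_func C)) X))"
  have s: "deriv_morphism \<kappa> (shift D A) (shift D simplex_op) s"
    unfolding s_def using comp_dmor_morphism[OF sA sE s\<Delta> pull_mor_morphism[OF \<pi>] lan_mor_morphism[OF p]] .
  have ks: "kan ?\<pi> ?p s \<eta>" unfolding s_def \<eta>_def by (rule kan_lan_pull[OF \<pi> p])
  note tA = sfun_to_one[OF sA] and t\<Delta> = sfun_to_one[OF s\<Delta>]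
  \<comment> \<open>Both routes to the terminal category agree, so both colimits become Kan
    extensions along one functor out of the category of simplices.\<close>
  have tt: "to_one simplex_op \<circ>\<^sub>F ?p = to_one A \<circ>\<^sub>F ?\<pi>"
    by (rule to_one_eq[OF small_funD(1)[OF sfun_comp[OF p t\<Delta>]] small_funD(1)[OF sfun_comp[OF \<pi> tA]]])
  \<comment> \<open>Cofinality of the first vertex functor with parameters in \<open>C\<close>, for
    targets that are constant along \<open>A\<close>.\<close>
  have ff: "\<exists>!h. h \<in> hm (prod_cat A C) X (pb (prod_func (to_one A) (id_func C)) Y) \<and> pa (prod_func ?\<pi> (id_func C)) h = g"
    if C: "small C" and X: "X \<in> ob (prod_cat A C)" and Y: "Y \<in> ob (prod_cat one_cat C)" and
      g: "g \<in> hm (prod_cat (simplices A) C) (pb (prod_func ?\<pi> (id_func C)) X) (pb (prod_func ?\<pi> (id_func C)) (pb (prod_func (to_one A) (id_func C)) Y))"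
    for C X Y g
  proof (rule cofinal_ff[OF sfun_idr[OF \<pi> C] sfun_idr[OF tA C] Y X _ g])
    fix b K w assume b: "b \<in> Obj (prod_cat A C)" and K: "K = under_cat b (prod_func ?\<pi> (id_func C))"
      and w: "w = prod_func (to_one A) (id_func C) \<circ>\<^sub>F prod_func ?\<pi> (id_func C) \<circ>\<^sub>F under_proj b (prod_func ?\<pi> (id_func C))"
    obtain a c where ac: "b = Pair a c" "a \<in> Obj A" "c \<in> Obj C" using b by (rule prod_objE)
    show "\<exists>e T \<sigma> \<tau>. e \<in> Obj K \<and> functor_from_to K K T \<and> ntrans_from_to T (id_func K) \<sigma> \<and>
        ntrans_from_to T (point K e \<circ>\<^sub>F to_one K) \<tau> \<and>
        FO w e = FO (prod_func (to_one A) (id_func C)) b \<and>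
        FA (prod_func (to_one A) (id_func C)) (psnd e) = Ident (prod_cat one_cat C) (FO (prod_func (to_one A) (id_func C)) b) \<and>
        w \<circ>\<^sub>F T = prod_func (to_one A) (id_func C) \<circ>\<^sub>F point (prod_cat A C) b \<circ>\<^sub>F to_one K \<and>
        (\<forall>x\<in>Obj K. FA w (At \<sigma> x) = FA (prod_func (to_one A) (id_func C)) (psnd x)) \<and>
        (\<forall>x\<in>Obj K. FA w (At \<tau> x) = Ident (prod_cat one_cat C) (FO w (FO T x)))"
      unfolding w K ac(1) using first_vertex_zigzag[OF A small_is_category[OF C] ac(2,3)] .
  qed
  \<comment> \<open>The two sides are Kan extensions of the restriction of \<open>X\<close> along
    the same functor; for the right-hand side this is cofinality.\<close>
  have "\<exists>\<Phi>. iso_modification \<kappa> (shift D A) (shift D one_cat) (colim_mor D simplex_op \<circ>\<^sub>D s) (colim_mor D A) \<Phi>"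
    unfolding colim_mor_def
  proof (rule kan_iso_modification[OF \<pi> sfun_comp[OF \<pi> tA]
        comp_dmor_morphism[OF sA s\<Delta> s1 s lan_mor_morphism[OF t\<Delta>]] lan_mor_morphism[OF tA]])
    show "kan ?\<pi> (to_one A \<circ>\<^sub>F ?\<pi>) (lan_mor D (to_one simplex_op) \<circ>\<^sub>D s)
      (\<lambda>C X. pa (prod_func ?p (id_func C)) (lu (prod_func (to_one simplex_op) (id_func C)) (FO (M0 s C) X)) \<cdot>\<^bsub>prod_cat (simplices A) C\<^esub> \<eta> C X)"
      using kan_compose_lan[OF \<pi> p s ks t\<Delta>] unfolding tt .
    show "kan ?\<pi> (to_one A \<circ>\<^sub>F ?\<pi>) (lan_mor D (to_one A)) (\<lambda>C X. pa (prod_func ?\<pi> (id_func C)) (lu (prod_func (to_one A) (id_func C)) X))"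
      by (rule kan_lan_restrict[OF \<pi> tA ff])
  qed
  moreover have "\<exists>P j \<Psi>.
       coproduct_morphism \<kappa> (shift D A) (shift D one_cat) (nerve A n) (\<lambda>x. eval_mor D A (fst x)) P j \<and>
       iso_modification \<kappa> (shift D A) (shift D one_cat) (eval_mor D simplex_op (Nats [n]) \<circ>\<^sub>D s) P \<Psi>" for n
  proof -
    \<comment> \<open>The value of the resolution at \<open>[n]\<close> is itself taken as the
      coproduct, so the isomorphism \<open>\<Psi>\<close> is the identity.\<close>
    let ?P = "eval_mor D simplex_op (Nats [n]) \<circ>\<^sub>D s"
    let ?e = "\<lambda>x. Pair (fst x) (encl (snd x))"
    let ?x = "\<lambda>i. point (simplices A) i"
    \<comment> \<open>The coprojection at a simplex is the unit of the Kan extension evaluated at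
      that simplex. Its source is \<open>X\<close> at the first vertex, because \<open>\<pi>\<close>
      composed with the point is the point of that vertex.\<close>
    define j where "j = (\<lambda>x C. mk_nt (M0 (eval_mor D A (fst x)) C) (M0 ?P C) (\<lambda>X. pa (prod_func (?x (?e x)) (id_func C)) (\<eta> C X)))"
    have n: "Nats [n] \<in> Obj simplex_op" by (simp add: simplex_obj)
    have P: "deriv_morphism \<kappa> (shift D A) (shift D one_cat) ?P"
      unfolding eval_mor_def using comp_dmor_morphism[OF sA s\<Delta> s1 s pull_mor_morphism[OF sfun_point[OF s\<Delta> n]]] .
    have nv: "?e x \<in> ?S" "string_dim (?e x) = Nats [n]" "FO ?\<pi> (?e x) = fst x" if "x \<in> nerve A n" for x
      using that elements_obj[OF da] by (auto simp: nerve_def first_vertex_def)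
    have pt: "sfun one_cat (simplices A) (?x (?e x))" if "x \<in> nerve A n" for x
      using sfun_point[OF sE] nv(1)[OF that] elements_obj[OF da] by simp
    have px: "?p \<circ>\<^sub>F ?x (?e x) = point simplex_op (Nats [n])" "?\<pi> \<circ>\<^sub>F ?x (?e x) = point A (fst x)" if "x \<in> nerve A n" for x
      using functor_comp_point[OF small_funD(1)[OF p]] functor_comp_point[OF small_funD(1)[OF \<pi>]] nv[OF that]
        elements_obj[OF da] elements_proj_simps(3)[OF da] by simp_all
    have jm: "modification \<kappa> (shift D A) (shift D one_cat) (eval_mor D A (fst x)) ?P (j x)" if x: "x \<in> nerve A n" for x
      using kan_restrict_modification[OF \<pi> p pt[OF x] s ks] unfolding px[OF x] j_def eval_mor_def .
    have "is_coproduct (D0 D (prod_cat one_cat C)) (nerve A n) (\<lambda>x. FO (M0 (eval_mor D A (fst x)) C) X) (FO (M0 ?P C) X) (\<lambda>x. At (j x C) X)"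
      if C: "small C" and X: "X \<in> ob (prod_cat A C)" for C X
    proof (rule coproduct_reindex)
      note \<pi>C = sfun_idr[OF \<pi> C] and pC = sfun_idr[OF p C]
      let ?Y = "pb (prod_func ?\<pi> (id_func C)) X"
      have Y: "?Y \<in> ob (prod_cat (simplices A) C)" using pb_ob[OF \<pi>C X] .
      have sX: "FO (M0 s C) X = lo (prod_func ?p (id_func C)) ?Y"
        using X functor_ends[OF star[OF \<pi>C]] by (simp add: s_def comp_dmor_def pull_mor_simps(1)[OF \<pi>])
      have PX: "FO (M0 ?P C) X = pb (prod_func (point simplex_op (Nats [n])) (id_func C)) (lo (prod_func ?p (id_func C)) ?Y)"
        using X sX functor_ends[OF deriv_morphismD(1)[OF s C]]
        by (simp add: comp_dmor_def eval_mor_def pull_mor_simps(1)[OF sfun_point[OF s\<Delta> n]])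
      show "is_coproduct (D0 D (prod_cat one_cat C)) {i \<in> ?S. string_dim i = Nats [n]} (\<lambda>i. pb (prod_func (?x i) (id_func C)) ?Y)
        (FO (M0 ?P C) X) (\<lambda>i. pa (prod_func (?x i) (id_func C)) (lu (prod_func ?p (id_func C)) ?Y))"
        unfolding PX by (rule fibre_coproduct[OF da S s\<Delta> n C Y])
      \<comment> \<open>The fibre of the dimension map over \<open>[n]\<close> consists of the codes
        of the \<open>n\<close>-simplices.\<close>
      show "bij_betw ?e (nerve A n) {i \<in> ?S. string_dim i = Nats [n]}"
        unfolding bij_betw_def inj_on_def by (auto simp: nerve_def image_iff prod_eq_iff elim!: stringE)
      fix x assume x: "x \<in> nerve A n"
      have a: "fst x \<in> Obj A" using fun_obj[OF small_funD(1)[OF \<pi>], of "?e x"] nv[OF x] elements_obj[OF da] by simp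
      show "FO (M0 (eval_mor D A (fst x)) C) X = pb (prod_func (?x (?e x)) (id_func C)) ?Y"
        using pb_comp[OF sfun_idr[OF pt[OF x] C] \<pi>C X] prod_idr_comp[OF C pt[OF x] \<pi>] px(2)[OF x]
        by (simp add: eval_mor_def pull_mor_simps(1)[OF sfun_point[OF sA a]])
      have "X \<in> Obj (Src (M0 (eval_mor D A (fst x)) C))"
        using X functor_ends[OF star[OF sfun_idr[OF sfun_point[OF sA a] C]]] by (simp add: eval_mor_def pull_mor_simps(1)[OF sfun_point[OF sA a]])
      then show "At (j x C) X = pa (prod_func (?x (?e x)) (id_func C)) (lu (prod_func ?p (id_func C)) ?Y)"
        by (simp add: j_def \<eta>_def)
    qed
    then have "coproduct_morphism \<kappa> (shift D A) (shift D one_cat) (nerve A n) (\<lambda>x. eval_mor D A (fst x)) ?P j"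
      unfolding coproduct_morphism_def using P jm by simp
    then show ?thesis using id_iso_modification[OF sA s1 P] by blast
  qed
  ultimately show ?thesis using s by blast
qed

end
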